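(* Let $G$ and $H$ be ample groupoids, let $\Omega\colon G\to H$ be an étale correspondence, let $M$ be a left $G$-module, $N$ a left $H$-module and $f\colon M\to\mathrm{Ind}_\Omega N$ a $G$-module map. Then there is an induced map in homology $$\mathrm H_*(\Omega,f)\colon\mathrm H_*(G;M)\to\mathrm H_*(H;N)$$ such that for any left $G$-acyclic resolution $P_\bullet\to M$, any left $H$-acyclic resolution $Q_\bullet\to N$, and any chain map $\tilde f\colon P_\bullet\to\mathrm{Ind}_\Omega Q_\bullet$ of $G$-modules lifting $f\colon M\to\mathrm{Ind}_\Omega N$, the chain map $$(\delta_\Omega\otimes\mathrm{id})\circ\tilde f_G\colon(P_\bullet)_G\to(\mathrm{Ind}_\Omega Q_\bullet)_G\to(Q_\bullet)_H$$ induces $\mathrm H_*(\Omega,f)$ in homology.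
   Context: LCH means locally compact Hausdorff. An ample groupoid is an étale topological groupoid $G$ whose unit space $G^0$ is LCH and totally disconnected ($G$ itself need not be Hausdorff). Write $r,s$ for range and source, $G^x=r^{-1}(x)$, $G_x=s^{-1}(x)$. A space $X$ is totally disconnected locally LCH if every point has an open neighbourhood which is LCH and totally disconnected. For such $X$, $\mathbb Z[X]$ is the group of functions $X\to\mathbb Z$ spanned by the groups $C_c(U,\mathbb Z)$ for $U\subseteq X$ open Hausdorff (functions extended by $0$ outside $U$). The groupoid ring $\mathbb Z[G]$ has multiplication $(\xi*\eta)(g)=\sum_{h\in G_{r(g)}}\xi(h^{-1})\eta(hg)$; it is locally unital. Left (right) $G$-modules are left (right) $\mathbb Z[G]$-modules $M$ that are non-degenerate: $\mathbb Z[G]M=M$ (resp. $M\mathbb Z[G]=M$). A left $G$-space $X$ has a continuous anchor map $\tau\colon X\to G^0$ and a continuous action $G\times_{s,G^0,\tau}X\to X$ satisfying the usual axioms ($\tau(g\cdot x)=r(g)$, associativity, units act trivially); right $G$-spaces are similar. If $X$ is a totally disconnected locally LCH left $G$-space then $\mathbb Z[X]$ is a left $G$-module via $(\xi\cdot m)(x)=\sum_{g\in G_{\tau(x)}}\xi(g^{-1})m(g\cdot x)$; for a right $G$-space $Z$ with anchor $\pi$, $(m\cdot\xi)(z)=\sum_{g\in G^{\pi(z)}}m(z\cdot g)\xi(g^{-1})$. In particular $\mathbb Z[G^0]$ is a left and a right $G$-module (trivial modules). The coinvariants of a left $G$-module $M$ are $M_G=\mathbb Z[G^0]\otimes_G M$;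 this is a functor $f\mapsto f_G$. The homology is $\mathrm H_n(G;M)=\mathrm{Tor}^G_n(\mathbb Z[G^0],M)$, the $n$th left derived functor of $M\mapsto M_G$ (computed with projective resolutions in the category of left $G$-modules). A left $G$-module $A$ is left $G$-acyclic if $\mathrm H_n(G;A)=0$ for all $n\ge1$. If $Q_\bullet\to M$ is a left $G$-acyclic resolution, then for a projective resolution $P'_\bullet\to M$ the (unique up to homotopy) chain map $P'_\bullet\to Q_\bullet$ over $\mathrm{id}_M$ induces an isomorphism $\mathrm H_n(G;M)\cong\mathrm H_n((Q_\bullet)_G)$; these identifications are used in the claim. An étale correspondence $\Omega\colon G\to H$ of ample groupoids is a topological space $\Omega$ with commuting left $G$-action and right $H$-action, with anchor maps $\rho\colon\Omega\to G^0$ and $\sigma\colon\Omega\to H^0$, such that the right $H$-action is free and proper (equivalently: $\Omega\times_{H^0}H\to\Omega\times_{\Omega/H}\Omega$, $(\omega,h)\mapsto(\omega,\omega\cdot h)$ is a homeomorphism and $\Omega/H$ is Hausdorff) and étale ($\sigma$ is a local homeomorphism). The space $\Omega$ is totally disconnected locally LCH and $\mathbb Z[\Omega]$ is a $G$-$H$-bimodule. The induction functor from left $H$-modules to left $G$-modules is $\mathrm{Ind}_\Omega=\mathbb Z[\Omega]\otimes_H-$ (it is exact). The map $\delta_\Omega\colon\mathbb Z[\Omega]_G=\mathbb Z[G^0]\otimes_G\mathbb Z[\Omega]\to\mathbb Z[H^0]$ is the right $H$-module map with $\delta_\Omega(\eta\otimes\xi)=\sigma_*(\eta\cdot\xi)$,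 where $\eta\cdot\xi$ is the action of $\eta\in\mathbb Z[G^0]\subseteq\mathbb Z[G]$, and $\sigma_*(\xi)(y)=\sum_{\omega\in\sigma^{-1}(y)}\xi(\omega)$. Tensoring over $H$ with an $H$-module $N$ gives $\delta_\Omega\otimes\mathrm{id}\colon(\mathrm{Ind}_\Omega N)_G\to N_H$. *)

theory Defs
  imports "HOL-Analysis.Analysis" "HOL-Algebra.Free_Abelian_Groups"
begin

section \<open>Ample groupoids\<close>

definition local_homeomorphism :: "'a topology \<Rightarrow> 'b topology \<Rightarrow> ('a \<Rightarrow> 'b) \<Rightarrow> bool" where
  "local_homeomorphism X Y f \<longleftrightarrow>
     (\<forall>x \<in> topspace X. \<exists>U. openin X U \<and> x \<in> U \<and> openin Y (f ` U) \<and>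
        homeomorphic_map (subtopology X U) (subtopology Y (f ` U)) f)"

definition totally_disconnected_space :: "'a topology \<Rightarrow> bool" where
  "totally_disconnected_space X \<longleftrightarrow> (\<forall>C. connectedin X C \<longrightarrow> (\<exists>a. C \<subseteq> {a}))"

text \<open>Arrows are the points of the topology; the product \<open>gmul \<Gamma> g h\<close> is meaningful
  when \<open>src \<Gamma> g = rng \<Gamma> h\<close>. Units are identified with the corresponding arrows.\<close>

record 'g groupoid =
  gtop :: "'g topology"
  src :: "'g \<Rightarrow> 'g"
  rng :: "'g \<Rightarrow> 'g"
  gmul :: "'g \<Rightarrow> 'g \<Rightarrow> 'g"
  ginv :: "'g \<Rightarrow> 'g"

abbreviation arrows :: "'g groupoid \<Rightarrow> 'g set" where
  "arrows \<Gamma> \<equiv> topspace (gtop \<Gamma>)"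

definition units :: "'g groupoid \<Rightarrow> 'g set" where
  "units \<Gamma> = src \<Gamma> ` arrows \<Gamma>"

definition unit_space :: "'g groupoid \<Rightarrow> 'g topology" where
  "unit_space \<Gamma> = subtopology (gtop \<Gamma>) (units \<Gamma>)"

locale topological_groupoid =
  fixes \<Gamma> :: "'g groupoid"
  assumes src_closed: "g \<in> arrows \<Gamma> \<Longrightarrow> src \<Gamma> g \<in> arrows \<Gamma>"
    and rng_closed: "g \<in> arrows \<Gamma> \<Longrightarrow> rng \<Gamma> g \<in> arrows \<Gamma>"
    and src_src: "g \<in> arrows \<Gamma> \<Longrightarrow> src \<Gamma> (src \<Gamma> g) = src \<Gamma> g"
    and rng_src: "g \<in> arrows \<Gamma> \<Longrightarrow> rng \<Gamma> (src \<Gamma> g) = src \<Gamma> g"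
    and src_rng: "g \<in> arrows \<Gamma> \<Longrightarrow> src \<Gamma> (rng \<Gamma> g) = rng \<Gamma> g"
    and rng_rng: "g \<in> arrows \<Gamma> \<Longrightarrow> rng \<Gamma> (rng \<Gamma> g) = rng \<Gamma> g"
    and gmul_closed: "\<lbrakk>g \<in> arrows \<Gamma>; h \<in> arrows \<Gamma>; src \<Gamma> g = rng \<Gamma> h\<rbrakk> \<Longrightarrow> gmul \<Gamma> g h \<in> arrows \<Gamma>"
    and src_gmul: "\<lbrakk>g \<in> arrows \<Gamma>; h \<in> arrows \<Gamma>; src \<Gamma> g = rng \<Gamma> h\<rbrakk> \<Longrightarrow> src \<Gamma> (gmul \<Gamma> g h) = src \<Gamma> h"
    and rng_gmul: "\<lbrakk>g \<in> arrows \<Gamma>; h \<in> arrows \<Gamma>; src \<Gamma> g = rng \<Gamma> h\<rbrakk> \<Longrightarrow> rng \<Gamma> (gmul \<Gamma> g h) = rng \<Gamma> g"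
    and gmul_assoc: "\<lbrakk>g \<in> arrows \<Gamma>; h \<in> arrows \<Gamma>; k \<in> arrows \<Gamma>; src \<Gamma> g = rng \<Gamma> h; src \<Gamma> h = rng \<Gamma> k\<rbrakk>
        \<Longrightarrow> gmul \<Gamma> (gmul \<Gamma> g h) k = gmul \<Gamma> g (gmul \<Gamma> h k)"
    and gmul_src: "g \<in> arrows \<Gamma> \<Longrightarrow> gmul \<Gamma> g (src \<Gamma> g) = g"
    and rng_gmul_left: "g \<in> arrows \<Gamma> \<Longrightarrow> gmul \<Gamma> (rng \<Gamma> g) g = g"
    and ginv_closed: "g \<in> arrows \<Gamma> \<Longrightarrow> ginv \<Gamma> g \<in> arrows \<Gamma>"
    and src_ginv: "g \<in> arrows \<Gamma> \<Longrightarrow> src \<Gamma> (ginv \<Gamma> g) = rng \<Gamma> g"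
    and rng_ginv: "g \<in> arrows \<Gamma> \<Longrightarrow> rng \<Gamma> (ginv \<Gamma> g) = src \<Gamma> g"
    and ginv_gmul: "g \<in> arrows \<Gamma> \<Longrightarrow> gmul \<Gamma> (ginv \<Gamma> g) g = src \<Gamma> g"
    and gmul_ginv: "g \<in> arrows \<Gamma> \<Longrightarrow> gmul \<Gamma> g (ginv \<Gamma> g) = rng \<Gamma> g"
    and continuous_src: "continuous_map (gtop \<Gamma>) (gtop \<Gamma>) (src \<Gamma>)"
    and continuous_rng: "continuous_map (gtop \<Gamma>) (gtop \<Gamma>) (rng \<Gamma>)"
    and continuous_ginv: "continuous_map (gtop \<Gamma>) (gtop \<Gamma>) (ginv \<Gamma>)"
    and continuous_gmul: "continuous_map
        (subtopology (prod_topology (gtop \<Gamma>) (gtop \<Gamma>)) {(g, h). src \<Gamma> g = rng \<Gamma> h})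
        (gtop \<Gamma>) (\<lambda>(g, h). gmul \<Gamma> g h)"

locale ample_groupoid = topological_groupoid +
  assumes etale: "local_homeomorphism (gtop \<Gamma>) (unit_space \<Gamma>) (src \<Gamma>)"
    and locally_compact_units: "locally_compact_space (unit_space \<Gamma>)"
    and Hausdorff_units: "Hausdorff_space (unit_space \<Gamma>)"
    and totally_disconnected_units: "totally_disconnected_space (unit_space \<Gamma>)"

section \<open>The groups of functions and the groupoid ring\<close>

text \<open>The support condition uses the closure inside \<open>U\<close>, not inside \<open>X\<close>.\<close>

definition Cc :: "'x topology \<Rightarrow> 'x set \<Rightarrow> ('x \<Rightarrow> int) set" where
  "Cc X U = {f. (\<forall>x. x \<notin> U \<longrightarrow> f x = 0) \<and>
     continuous_map (subtopology X U) (discrete_topology UNIV) f \<and>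
     compactin (subtopology X U) (subtopology X U closure_of {x. f x \<noteq> 0})}"

text \<open>Each \<open>Cc X U\<close> is closed under negation, so finite sums give the generated subgroup.\<close>

definition int_functions :: "'x topology \<Rightarrow> ('x \<Rightarrow> int) set" where
  "int_functions X = {(\<lambda>x. \<Sum>i<k. f i x) | (k::nat) f.
     \<forall>i<k. \<exists>U. openin X U \<and> Hausdorff_space (subtopology X U) \<and> f i \<in> Cc X U}"

text \<open>\<open>sum'\<close> is the sum of a family with finitely many nonzero terms. In the formulas below all but
  finitely many terms vanish when \<open>\<xi>\<close> is in the groupoid ring.\<close>

definition fun_lact :: "'g groupoid \<Rightarrow> 'x topology \<Rightarrow> ('x \<Rightarrow> 'g) \<Rightarrow> ('g \<Rightarrow> 'x \<Rightarrow> 'x)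
    \<Rightarrow> ('g \<Rightarrow> int) \<Rightarrow> ('x \<Rightarrow> int) \<Rightarrow> ('x \<Rightarrow> int)" where
  "fun_lact \<Gamma> X \<tau> a \<xi> m = (\<lambda>x. if x \<in> topspace X
     then sum' (\<lambda>g. \<xi> (ginv \<Gamma> g) * m (a g x)) {g \<in> arrows \<Gamma>. src \<Gamma> g = \<tau> x} else 0)"

definition fun_ract :: "'g groupoid \<Rightarrow> 'x topology \<Rightarrow> ('x \<Rightarrow> 'g) \<Rightarrow> ('x \<Rightarrow> 'g \<Rightarrow> 'x)
    \<Rightarrow> ('g \<Rightarrow> int) \<Rightarrow> ('x \<Rightarrow> int) \<Rightarrow> ('x \<Rightarrow> int)" where
  "fun_ract \<Gamma> X \<pi> a \<xi> m = (\<lambda>x. if x \<in> topspace X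
     then sum' (\<lambda>g. m (a x g) * \<xi> (ginv \<Gamma> g)) {g \<in> arrows \<Gamma>. rng \<Gamma> g = \<pi> x} else 0)"

abbreviation groupoid_ring :: "'g groupoid \<Rightarrow> ('g \<Rightarrow> int) set" where
  "groupoid_ring \<Gamma> \<equiv> int_functions (gtop \<Gamma>)"

definition conv :: "'g groupoid \<Rightarrow> ('g \<Rightarrow> int) \<Rightarrow> ('g \<Rightarrow> int) \<Rightarrow> ('g \<Rightarrow> int)" where
  "conv \<Gamma> \<xi> \<eta> = (\<lambda>g. if g \<in> arrows \<Gamma>
     then sum' (\<lambda>h. \<xi> (ginv \<Gamma> h) * \<eta> (gmul \<Gamma> h g)) {h \<in> arrows \<Gamma>. src \<Gamma> h = rng \<Gamma> g} else 0)"

section \<open>Modules\<close>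

text \<open>Abelian groups are written multiplicatively as in \<^theory>\<open>HOL-Algebra.Free_Abelian_Groups\<close>.
  The same record serves for left and right modules: for a right module,
  \<open>act M \<xi> m\<close> stands for \<open>m \<cdot> \<xi>\<close>.\<close>

record ('g, 'm) gmodule = "'m monoid" +
  act :: "('g \<Rightarrow> int) \<Rightarrow> 'm \<Rightarrow> 'm"

locale left_module = comm_group M for \<Gamma> :: "'g groupoid" and M :: "('g, 'm) gmodule" (structure) +
  assumes act_closed: "\<lbrakk>\<xi> \<in> groupoid_ring \<Gamma>; m \<in> carrier M\<rbrakk> \<Longrightarrow> act M \<xi> m \<in> carrier M"
    and act_add: "\<lbrakk>\<xi> \<in> groupoid_ring \<Gamma>; m \<in> carrier M; n \<in> carrier M\<rbrakk>
        \<Longrightarrow> act M \<xi> (m \<otimes> n) = act M \<xi> m \<otimes> act M \<xi> n"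
    and add_act: "\<lbrakk>\<xi> \<in> groupoid_ring \<Gamma>; \<eta> \<in> groupoid_ring \<Gamma>; m \<in> carrier M\<rbrakk>
        \<Longrightarrow> act M (\<lambda>g. \<xi> g + \<eta> g) m = act M \<xi> m \<otimes> act M \<eta> m"
    and conv_act: "\<lbrakk>\<xi> \<in> groupoid_ring \<Gamma>; \<eta> \<in> groupoid_ring \<Gamma>; m \<in> carrier M\<rbrakk>
        \<Longrightarrow> act M (conv \<Gamma> \<xi> \<eta>) m = act M \<xi> (act M \<eta> m)"
    and nondegenerate: "carrier M =
        generate M {act M \<xi> m | \<xi> m. \<xi> \<in> groupoid_ring \<Gamma> \<and> m \<in> carrier M}"

definition gmodule_hom :: "'g groupoid \<Rightarrow> ('g, 'm) gmodule \<Rightarrow> ('g, 'n) gmodule \<Rightarrow> ('m \<Rightarrow> 'n) \<Rightarrow> bool" where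
  "gmodule_hom \<Gamma> M N f \<longleftrightarrow> f \<in> hom M N \<and>
     (\<forall>\<xi> \<in> groupoid_ring \<Gamma>. \<forall>m \<in> carrier M. f (act M \<xi> m) = act N \<xi> (f m))"

text \<open>The trivial right module on the unit space, for the right action \<open>x \<cdot> g = src g\<close>.\<close>

definition unit_module :: "'g groupoid \<Rightarrow> ('g, 'g \<Rightarrow> int) gmodule" where
  "unit_module \<Gamma> = \<lparr>carrier = int_functions (unit_space \<Gamma>),
     monoid.mult = (\<lambda>m n x. m x + n x), one = (\<lambda>x. 0),
     act = fun_ract \<Gamma> (unit_space \<Gamma>) (\<lambda>x. x) (\<lambda>x g. src \<Gamma> g)\<rparr>"

section \<open>Tensor products over the groupoid ring and coinvariants\<close>

definition tensor_relations :: "'g groupoid \<Rightarrow> ('g, 'a) gmodule \<Rightarrow> ('g, 'b) gmodule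
    \<Rightarrow> ('a \<times> 'b \<Rightarrow>\<^sub>0 int) set" where
  "tensor_relations \<Gamma> A B =
     {frag_of (a \<otimes>\<^bsub>A\<^esub> a', b) - frag_of (a, b) - frag_of (a', b) | a a' b.
        a \<in> carrier A \<and> a' \<in> carrier A \<and> b \<in> carrier B} \<union>
     {frag_of (a, b \<otimes>\<^bsub>B\<^esub> b') - frag_of (a, b) - frag_of (a, b') | a b b'.
        a \<in> carrier A \<and> b \<in> carrier B \<and> b' \<in> carrier B} \<union>
     {frag_of (act A \<xi> a, b) - frag_of (a, act B \<xi> b) | \<xi> a b.
        \<xi> \<in> groupoid_ring \<Gamma> \<and> a \<in> carrier A \<and> b \<in> carrier B}"

definition tensor_kernel :: "'g groupoid \<Rightarrow> ('g, 'a) gmodule \<Rightarrow> ('g, 'b) gmodule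
    \<Rightarrow> ('a \<times> 'b \<Rightarrow>\<^sub>0 int) set" where
  "tensor_kernel \<Gamma> A B =
     generate (free_Abelian_group (carrier A \<times> carrier B)) (tensor_relations \<Gamma> A B)"

text \<open>\<open>A\<close> is read as a right module and \<open>B\<close> as a left module.\<close>

definition tensor :: "'g groupoid \<Rightarrow> ('g, 'a) gmodule \<Rightarrow> ('g, 'b) gmodule
    \<Rightarrow> ('a \<times> 'b \<Rightarrow>\<^sub>0 int) set monoid" where
  "tensor \<Gamma> A B = free_Abelian_group (carrier A \<times> carrier B) Mod tensor_kernel \<Gamma> A B"

definition pure_tensor :: "'g groupoid \<Rightarrow> ('g, 'a) gmodule \<Rightarrow> ('g, 'b) gmodule
    \<Rightarrow> 'a \<Rightarrow> 'b \<Rightarrow> ('a \<times> 'b \<Rightarrow>\<^sub>0 int) set" where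
  "pure_tensor \<Gamma> A B a b =
     tensor_kernel \<Gamma> A B #>\<^bsub>free_Abelian_group (carrier A \<times> carrier B)\<^esub> frag_of (a, b)"

text \<open>The homomorphism from a tensor product to \<open>C\<close> sending \<open>a \<otimes> b\<close> to \<open>\<beta> a b\<close>, for \<open>\<beta>\<close> biadditive and
  balanced.\<close>

definition tensor_lift :: "('c, 'z) monoid_scheme \<Rightarrow> ('a \<Rightarrow> 'b \<Rightarrow> 'c)
    \<Rightarrow> ('a \<times> 'b \<Rightarrow>\<^sub>0 int) set \<Rightarrow> 'c" where
  "tensor_lift C \<beta> X = the_elem ((\<lambda>p. finprod C
     (\<lambda>z. \<beta> (fst z) (snd z) [^]\<^bsub>C\<^esub> Poly_Mapping.lookup p z) (Poly_Mapping.keys p)) ` X)"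

definition coinvariants :: "'g groupoid \<Rightarrow> ('g, 'm) gmodule \<Rightarrow> (('g \<Rightarrow> int) \<times> 'm \<Rightarrow>\<^sub>0 int) set monoid" where
  "coinvariants \<Gamma> M = tensor \<Gamma> (unit_module \<Gamma>) M"

definition coinvariants_map :: "'g groupoid \<Rightarrow> ('g, 'n) gmodule \<Rightarrow> ('m \<Rightarrow> 'n)
    \<Rightarrow> (('g \<Rightarrow> int) \<times> 'm \<Rightarrow>\<^sub>0 int) set \<Rightarrow> (('g \<Rightarrow> int) \<times> 'n \<Rightarrow>\<^sub>0 int) set" where
  "coinvariants_map \<Gamma> N f =
     tensor_lift (coinvariants \<Gamma> N) (\<lambda>\<eta> m. pure_tensor \<Gamma> (unit_module \<Gamma>) N \<eta> (f m))"

section \<open>Resolutions and homology\<close>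

text \<open>The homology of \<open>\<dots> \<rightarrow> C 2 \<rightarrow> C 1 \<rightarrow> C 0 \<rightarrow> 0\<close> with \<open>d n\<close> mapping \<open>C (Suc n)\<close> to \<open>C n\<close>.\<close>

definition cycles :: "(nat \<Rightarrow> 'c monoid) \<Rightarrow> (nat \<Rightarrow> 'c \<Rightarrow> 'c) \<Rightarrow> nat \<Rightarrow> 'c set" where
  "cycles C d n = (case n of 0 \<Rightarrow> carrier (C 0) | Suc k \<Rightarrow> kernel (C (Suc k)) (C k) (d k))"

definition boundaries :: "(nat \<Rightarrow> 'c monoid) \<Rightarrow> (nat \<Rightarrow> 'c \<Rightarrow> 'c) \<Rightarrow> nat \<Rightarrow> 'c set" where
  "boundaries C d n = d n ` carrier (C (Suc n))"

definition complex_homology :: "(nat \<Rightarrow> 'c monoid) \<Rightarrow> (nat \<Rightarrow> 'c \<Rightarrow> 'c) \<Rightarrow> nat \<Rightarrow> 'c set monoid" where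
  "complex_homology C d n = (C n)\<lparr>carrier := cycles C d n\<rparr> Mod boundaries C d n"

text \<open>The map induced in degree \<open>n\<close> by a chain map \<open>\<alpha>\<close> into the complex \<open>(C, d)\<close>.\<close>

definition complex_homology_map :: "(nat \<Rightarrow> 'c monoid) \<Rightarrow> (nat \<Rightarrow> 'c \<Rightarrow> 'c) \<Rightarrow> (nat \<Rightarrow> 'b \<Rightarrow> 'c) \<Rightarrow> nat
    \<Rightarrow> 'b set \<Rightarrow> 'c set" where
  "complex_homology_map C d \<alpha> n X = the_elem ((\<lambda>x. boundaries C d n #>\<^bsub>C n\<^esub> \<alpha> n x) ` X)"

record ('g, 'p, 'm) gcomplex =
  term_at :: "nat \<Rightarrow> ('g, 'p) gmodule"
  bdry :: "nat \<Rightarrow> 'p \<Rightarrow> 'p"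
  aug :: "'p \<Rightarrow> 'm"

definition is_resolution :: "'g groupoid \<Rightarrow> ('g, 'm) gmodule \<Rightarrow> ('g, 'p, 'm) gcomplex \<Rightarrow> bool" where
  "is_resolution \<Gamma> M P \<longleftrightarrow>
     (\<forall>n. left_module \<Gamma> (term_at P n)) \<and>
     (\<forall>n. gmodule_hom \<Gamma> (term_at P (Suc n)) (term_at P n) (bdry P n)) \<and>
     gmodule_hom \<Gamma> (term_at P 0) M (aug P) \<and>
     aug P ` carrier (term_at P 0) = carrier M \<and>
     kernel (term_at P 0) M (aug P) = bdry P 0 ` carrier (term_at P 1) \<and>
     (\<forall>n. kernel (term_at P (Suc n)) (term_at P n) (bdry P n) =
          bdry P (Suc n) ` carrier (term_at P (Suc (Suc n))))"

text \<open>\<open>\<phi>\<close> is a chain map of \<open>\<Gamma>\<close>-modules from \<open>P\<close> to \<open>Q\<close> lying over the map \<open>f\<close> of augmented modules.\<close>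

definition chain_lift :: "'g groupoid \<Rightarrow> ('g, 'p, 'm) gcomplex \<Rightarrow> ('g, 'q, 'n) gcomplex \<Rightarrow> ('m \<Rightarrow> 'n)
    \<Rightarrow> (nat \<Rightarrow> 'p \<Rightarrow> 'q) \<Rightarrow> bool" where
  "chain_lift \<Gamma> P Q f \<phi> \<longleftrightarrow>
     (\<forall>n. gmodule_hom \<Gamma> (term_at P n) (term_at Q n) (\<phi> n)) \<and>
     (\<forall>n. \<forall>x \<in> carrier (term_at P (Suc n)). \<phi> n (bdry P n x) = bdry Q n (\<phi> (Suc n) x)) \<and>
     (\<forall>x \<in> carrier (term_at P 0). aug Q (\<phi> 0 x) = f (aug P x))"

text \<open>Lifting against all surjections \<open>p : B \<rightarrow> C\<close>. The modules \<open>B\<close> and \<open>C\<close> have to range over fixed types,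
  which are large enough to make this projectivity in the whole category: if \<open>u k\<close> are
  indicator functions of compact open sets of units with \<open>u k \<cdot> k = k\<close> for \<open>k \<in> carrier P\<close>, then
  the direct sum of the projective left ideals \<open>\<int>[\<Gamma>] u k\<close>, which is a set of functions
  on \<open>carrier P \<times> arrows \<Gamma>\<close>, surjects onto \<open>P\<close>; this surjection splits by the lifting property for \<open>C = P\<close>.\<close>

definition projective_module :: "'g groupoid \<Rightarrow> ('g, 'p) gmodule \<Rightarrow> bool" where
  "projective_module \<Gamma> P \<longleftrightarrow> left_module \<Gamma> P \<and>
     (\<forall>(B :: ('g, 'p \<times> 'g \<Rightarrow> int) gmodule) (C :: ('g, 'p) gmodule) p f.
        left_module \<Gamma> B \<and> left_module \<Gamma> C \<and>
        gmodule_hom \<Gamma> B C p \<and> p ` carrier B = carrier C \<and> gmodule_hom \<Gamma> P C f \<longrightarrow>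
        (\<exists>h. gmodule_hom \<Gamma> P B h \<and> (\<forall>x \<in> carrier P. p (h x) = f x)))"

text \<open>A type that carries some projective resolution of any module on \<open>'m\<close>. It is infinite, and at
  least as large as \<open>'m\<close> and the groupoid ring (whose elements are finite combinations of
  indicator functions); hence so is the direct sum above, in every degree.\<close>

type_synonym ('g, 'm) res = "('m \<times> 'g set) list"

definition projective_resolution :: "'g groupoid \<Rightarrow> ('g, 'm) gmodule \<Rightarrow> ('g, ('g, 'm) res, 'm) gcomplex" where
  "projective_resolution \<Gamma> M =
     (SOME P. is_resolution \<Gamma> M P \<and> (\<forall>n. projective_module \<Gamma> (term_at P n)))"

abbreviation coinvariants_complex :: "'g groupoid \<Rightarrow> ('g, 'p, 'm) gcomplex
    \<Rightarrow> nat \<Rightarrow> (('g \<Rightarrow> int) \<times> 'p \<Rightarrow>\<^sub>0 int) set monoid" where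
  "coinvariants_complex \<Gamma> P \<equiv> (\<lambda>n. coinvariants \<Gamma> (term_at P n))"

abbreviation coinvariants_bdry :: "'g groupoid \<Rightarrow> ('g, 'p, 'm) gcomplex
    \<Rightarrow> nat \<Rightarrow> (('g \<Rightarrow> int) \<times> 'p \<Rightarrow>\<^sub>0 int) set \<Rightarrow> (('g \<Rightarrow> int) \<times> 'p \<Rightarrow>\<^sub>0 int) set" where
  "coinvariants_bdry \<Gamma> P \<equiv> (\<lambda>n. coinvariants_map \<Gamma> (term_at P n) (bdry P n))"

definition coinvariants_homology :: "'g groupoid \<Rightarrow> ('g, 'p, 'm) gcomplex \<Rightarrow> nat
    \<Rightarrow> (('g \<Rightarrow> int) \<times> 'p \<Rightarrow>\<^sub>0 int) set set monoid" where
  "coinvariants_homology \<Gamma> P n =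
     complex_homology (coinvariants_complex \<Gamma> P) (coinvariants_bdry \<Gamma> P) n"

text \<open>The map in homology induced by a chain map \<open>\<alpha>\<close> into the coinvariants of \<open>Q\<close>.\<close>

definition coinvariants_homology_map :: "'g groupoid \<Rightarrow> ('g, 'q, 'n) gcomplex
    \<Rightarrow> (nat \<Rightarrow> 'b \<Rightarrow> (('g \<Rightarrow> int) \<times> 'q \<Rightarrow>\<^sub>0 int) set) \<Rightarrow> nat
    \<Rightarrow> 'b set \<Rightarrow> (('g \<Rightarrow> int) \<times> 'q \<Rightarrow>\<^sub>0 int) set set" where
  "coinvariants_homology_map \<Gamma> Q \<alpha> n =
     complex_homology_map (coinvariants_complex \<Gamma> Q) (coinvariants_bdry \<Gamma> Q) \<alpha> n"

definition homology :: "'g groupoid \<Rightarrow> ('g, 'm) gmodule \<Rightarrow> nat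
    \<Rightarrow> (('g \<Rightarrow> int) \<times> ('g, 'm) res \<Rightarrow>\<^sub>0 int) set set monoid" where
  "homology \<Gamma> M n = coinvariants_homology \<Gamma> (projective_resolution \<Gamma> M) n"

definition acyclic_module :: "'g groupoid \<Rightarrow> ('g, 'm) gmodule \<Rightarrow> bool" where
  "acyclic_module \<Gamma> A \<longleftrightarrow> left_module \<Gamma> A \<and> (\<forall>n\<ge>1. trivial_group (homology \<Gamma> A n))"

definition is_acyclic_resolution :: "'g groupoid \<Rightarrow> ('g, 'm) gmodule \<Rightarrow> ('g, 'p, 'm) gcomplex \<Rightarrow> bool" where
  "is_acyclic_resolution \<Gamma> M P \<longleftrightarrow> is_resolution \<Gamma> M P \<and> (\<forall>n. acyclic_module \<Gamma> (term_at P n))"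

text \<open>The comparison map from \<open>homology \<Gamma> M n\<close> to the homology of the coinvariants of an
  acyclic resolution \<open>P\<close> of \<open>M\<close>. It does not depend on the chosen chain map, which is unique up to homotopy.\<close>

definition comparison :: "'g groupoid \<Rightarrow> ('g, 'm) gmodule \<Rightarrow> ('g, 'p, 'm) gcomplex \<Rightarrow> nat
    \<Rightarrow> (('g \<Rightarrow> int) \<times> ('g, 'm) res \<Rightarrow>\<^sub>0 int) set set
    \<Rightarrow> (('g \<Rightarrow> int) \<times> 'p \<Rightarrow>\<^sub>0 int) set set" where
  "comparison \<Gamma> M P n =
     (let \<phi> = (SOME \<phi>. chain_lift \<Gamma> (projective_resolution \<Gamma> M) P (\<lambda>x. x) \<phi>)
      in coinvariants_homology_map \<Gamma> P (\<lambda>k. coinvariants_map \<Gamma> (term_at P k) (\<phi> k)) n)"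

section \<open>Etale correspondences\<close>

record ('g, 'h, 'w) correspondence =
  ctop :: "'w topology"
  lanchor :: "'w \<Rightarrow> 'g"
  ranchor :: "'w \<Rightarrow> 'h"
  lmul :: "'g \<Rightarrow> 'w \<Rightarrow> 'w"
  rmul :: "'w \<Rightarrow> 'h \<Rightarrow> 'w"

locale left_space =
  fixes \<Gamma> :: "'g groupoid" and X :: "'x topology" and \<tau> :: "'x \<Rightarrow> 'g" and a :: "'g \<Rightarrow> 'x \<Rightarrow> 'x"
  assumes continuous_anchor: "continuous_map X (unit_space \<Gamma>) \<tau>"
    and continuous_action:
      "continuous_map (subtopology (prod_topology (gtop \<Gamma>) X) {(g, x). src \<Gamma> g = \<tau> x}) X (\<lambda>(g, x). a g x)"
    and anchor_action: "\<lbrakk>g \<in> arrows \<Gamma>; x \<in> topspace X; src \<Gamma> g = \<tau> x\<rbrakk> \<Longrightarrow> \<tau> (a g x) = rng \<Gamma> g"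
    and action_assoc: "\<lbrakk>g \<in> arrows \<Gamma>; h \<in> arrows \<Gamma>; x \<in> topspace X; src \<Gamma> g = rng \<Gamma> h; src \<Gamma> h = \<tau> x\<rbrakk>
        \<Longrightarrow> a (gmul \<Gamma> g h) x = a g (a h x)"
    and action_unit: "x \<in> topspace X \<Longrightarrow> a (\<tau> x) x = x"

locale right_space =
  fixes \<Gamma> :: "'g groupoid" and X :: "'x topology" and \<pi> :: "'x \<Rightarrow> 'g" and a :: "'x \<Rightarrow> 'g \<Rightarrow> 'x"
  assumes continuous_anchor: "continuous_map X (unit_space \<Gamma>) \<pi>"
    and continuous_action:
      "continuous_map (subtopology (prod_topology X (gtop \<Gamma>)) {(x, g). \<pi> x = rng \<Gamma> g}) X (\<lambda>(x, g). a x g)"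
    and anchor_action: "\<lbrakk>x \<in> topspace X; g \<in> arrows \<Gamma>; \<pi> x = rng \<Gamma> g\<rbrakk> \<Longrightarrow> \<pi> (a x g) = src \<Gamma> g"
    and action_assoc: "\<lbrakk>x \<in> topspace X; g \<in> arrows \<Gamma>; h \<in> arrows \<Gamma>; \<pi> x = rng \<Gamma> g; src \<Gamma> g = rng \<Gamma> h\<rbrakk>
        \<Longrightarrow> a x (gmul \<Gamma> g h) = a (a x g) h"
    and action_unit: "x \<in> topspace X \<Longrightarrow> a x (\<pi> x) = x"

text \<open>For a free action, properness says that \<open>(\<omega>, h) \<mapsto> (\<omega>, \<omega> \<cdot> h)\<close> is a homeomorphism onto the
  orbit relation and that this relation is closed, i.e. (the orbit map being open) that the
  orbit space is Hausdorff.\<close>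

locale etale_correspondence =
  left: left_space G "ctop \<Omega>" "lanchor \<Omega>" "lmul \<Omega>" +
  right: right_space H "ctop \<Omega>" "ranchor \<Omega>" "rmul \<Omega>"
  for G :: "'g groupoid" and H :: "'h groupoid" and \<Omega> :: "('g, 'h, 'w) correspondence" +
  assumes ranchor_lmul: "\<lbrakk>g \<in> arrows G; w \<in> topspace (ctop \<Omega>); src G g = lanchor \<Omega> w\<rbrakk>
        \<Longrightarrow> ranchor \<Omega> (lmul \<Omega> g w) = ranchor \<Omega> w"
    and lanchor_rmul: "\<lbrakk>w \<in> topspace (ctop \<Omega>); h \<in> arrows H; ranchor \<Omega> w = rng H h\<rbrakk>
        \<Longrightarrow> lanchor \<Omega> (rmul \<Omega> w h) = lanchor \<Omega> w"
    and commuting: "\<lbrakk>g \<in> arrows G; w \<in> topspace (ctop \<Omega>); h \<in> arrows H;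
          src G g = lanchor \<Omega> w; ranchor \<Omega> w = rng H h\<rbrakk>
        \<Longrightarrow> rmul \<Omega> (lmul \<Omega> g w) h = lmul \<Omega> g (rmul \<Omega> w h)"
    and free: "\<lbrakk>w \<in> topspace (ctop \<Omega>); h \<in> arrows H; ranchor \<Omega> w = rng H h; rmul \<Omega> w h = w\<rbrakk>
        \<Longrightarrow> h = ranchor \<Omega> w"
    and proper: "proper_map
        (subtopology (prod_topology (ctop \<Omega>) (gtop H)) {(w, h). ranchor \<Omega> w = rng H h})
        (prod_topology (ctop \<Omega>) (ctop \<Omega>)) (\<lambda>(w, h). (w, rmul \<Omega> w h))"
    and etale: "local_homeomorphism (ctop \<Omega>) (unit_space H) (ranchor \<Omega>)"

text \<open>The bimodule \<open>\<int>[\<Omega>]\<close>, as a left module over the first groupoid and as a right module over the second.\<close>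

definition corr_lmodule :: "'g groupoid \<Rightarrow> ('g, 'h, 'w) correspondence \<Rightarrow> ('g, 'w \<Rightarrow> int) gmodule" where
  "corr_lmodule G \<Omega> = \<lparr>carrier = int_functions (ctop \<Omega>),
     monoid.mult = (\<lambda>m n x. m x + n x), one = (\<lambda>x. 0),
     act = fun_lact G (ctop \<Omega>) (lanchor \<Omega>) (lmul \<Omega>)\<rparr>"

definition corr_rmodule :: "'h groupoid \<Rightarrow> ('g, 'h, 'w) correspondence \<Rightarrow> ('h, 'w \<Rightarrow> int) gmodule" where
  "corr_rmodule H \<Omega> = \<lparr>carrier = int_functions (ctop \<Omega>),
     monoid.mult = (\<lambda>m n x. m x + n x), one = (\<lambda>x. 0),
     act = fun_ract H (ctop \<Omega>) (ranchor \<Omega>) (rmul \<Omega>)\<rparr>"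

type_synonym ('w, 'n) ind = "(('w \<Rightarrow> int) \<times> 'n \<Rightarrow>\<^sub>0 int) set"

definition Ind :: "'g groupoid \<Rightarrow> 'h groupoid \<Rightarrow> ('g, 'h, 'w) correspondence \<Rightarrow> ('h, 'n) gmodule
    \<Rightarrow> ('g, ('w, 'n) ind) gmodule" where
  "Ind G H \<Omega> N = (let T = tensor H (corr_rmodule H \<Omega>) N in
     \<lparr>carrier = carrier T, monoid.mult = monoid.mult T, one = one T,
      act = (\<lambda>\<xi>. tensor_lift T
        (\<lambda>m n. pure_tensor H (corr_rmodule H \<Omega>) N (act (corr_lmodule G \<Omega>) \<xi> m) n))\<rparr>)"

definition Ind_map :: "'h groupoid \<Rightarrow> ('g, 'h, 'w) correspondence \<Rightarrow> ('h, 'n') gmodule \<Rightarrow> ('n \<Rightarrow> 'n')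
    \<Rightarrow> ('w, 'n) ind \<Rightarrow> ('w, 'n') ind" where
  "Ind_map H \<Omega> N' f = tensor_lift (tensor H (corr_rmodule H \<Omega>) N')
     (\<lambda>m n. pure_tensor H (corr_rmodule H \<Omega>) N' m (f n))"

definition Ind_complex :: "'g groupoid \<Rightarrow> 'h groupoid \<Rightarrow> ('g, 'h, 'w) correspondence \<Rightarrow> ('h, 'n) gmodule
    \<Rightarrow> ('h, 'q, 'n) gcomplex \<Rightarrow> ('g, ('w, 'q) ind, ('w, 'n) ind) gcomplex" where
  "Ind_complex G H \<Omega> N Q = \<lparr>term_at = (\<lambda>n. Ind G H \<Omega> (term_at Q n)),
     bdry = (\<lambda>n. Ind_map H \<Omega> (term_at Q n) (bdry Q n)),
     aug = Ind_map H \<Omega> N (aug Q)\<rparr>"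

definition pushforward :: "'x topology \<Rightarrow> ('x \<Rightarrow> 'y) \<Rightarrow> ('x \<Rightarrow> int) \<Rightarrow> ('y \<Rightarrow> int)" where
  "pushforward X \<sigma> \<xi> = (\<lambda>y. sum' \<xi> {x \<in> topspace X. \<sigma> x = y})"

text \<open>Functions on the unit space are extended by zero to the open set of all arrows, so the
  inclusion of \<open>\<int>[G\<^sup>0]\<close> in \<open>\<int>[G]\<close> is not visible in \<open>\<eta> \<cdot> \<xi>\<close>.\<close>

definition delta :: "'g groupoid \<Rightarrow> 'h groupoid \<Rightarrow> ('g, 'h, 'w) correspondence
    \<Rightarrow> (('g \<Rightarrow> int) \<times> ('w \<Rightarrow> int) \<Rightarrow>\<^sub>0 int) set \<Rightarrow> ('h \<Rightarrow> int)" where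
  "delta G H \<Omega> = tensor_lift (unit_module H)
     (\<lambda>\<eta> \<xi>. pushforward (ctop \<Omega>) (ranchor \<Omega>) (act (corr_lmodule G \<Omega>) \<eta> \<xi>))"

text \<open>\<open>\<delta> \<otimes> id\<close>, sending \<open>\<eta> \<otimes> (\<xi> \<otimes> n)\<close> to \<open>\<delta> (\<eta> \<otimes> \<xi>) \<otimes> n\<close>; the reassociation of the triple tensor
  product is built in.\<close>

definition delta_tensor :: "'g groupoid \<Rightarrow> 'h groupoid \<Rightarrow> ('g, 'h, 'w) correspondence \<Rightarrow> ('h, 'n) gmodule
    \<Rightarrow> (('g \<Rightarrow> int) \<times> ('w, 'n) ind \<Rightarrow>\<^sub>0 int) set \<Rightarrow> (('h \<Rightarrow> int) \<times> 'n \<Rightarrow>\<^sub>0 int) set" where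
  "delta_tensor G H \<Omega> N = tensor_lift (coinvariants H N) (\<lambda>\<eta>. tensor_lift (coinvariants H N)
     (\<lambda>\<xi> n. pure_tensor H (unit_module H) N
        (delta G H \<Omega> (pure_tensor G (unit_module G) (corr_lmodule G \<Omega>) \<eta> \<xi>)) n))"

text \<open>The chain map from the coinvariants of \<open>P\<close> to those of \<open>Q\<close> obtained from a chain map \<open>P \<rightarrow> Ind Q\<close>,
  and the map it induces in homology.\<close>

definition corr_chain_map :: "'g groupoid \<Rightarrow> 'h groupoid \<Rightarrow> ('g, 'h, 'w) correspondence
    \<Rightarrow> ('h, 'q, 'n) gcomplex \<Rightarrow> (nat \<Rightarrow> 'p \<Rightarrow> ('w, 'q) ind)
    \<Rightarrow> nat \<Rightarrow> (('g \<Rightarrow> int) \<times> 'p \<Rightarrow>\<^sub>0 int) set \<Rightarrow> (('h \<Rightarrow> int) \<times> 'q \<Rightarrow>\<^sub>0 int) set" where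
  "corr_chain_map G H \<Omega> Q ft n =
     delta_tensor G H \<Omega> (term_at Q n) \<circ> coinvariants_map G (Ind G H \<Omega> (term_at Q n)) (ft n)"

definition corr_induced :: "'g groupoid \<Rightarrow> 'h groupoid \<Rightarrow> ('g, 'h, 'w) correspondence
    \<Rightarrow> ('h, 'q, 'n) gcomplex \<Rightarrow> (nat \<Rightarrow> 'p \<Rightarrow> ('w, 'q) ind)
    \<Rightarrow> nat \<Rightarrow> (('g \<Rightarrow> int) \<times> 'p \<Rightarrow>\<^sub>0 int) set set \<Rightarrow> (('h \<Rightarrow> int) \<times> 'q \<Rightarrow>\<^sub>0 int) set set" where
  "corr_induced G H \<Omega> Q ft n = coinvariants_homology_map H Q (corr_chain_map G H \<Omega> Q ft) n"

text \<open>The map \<open>H\<^sub>n(\<Omega>, f)\<close>. It is given by a definition, rather than by an existential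
  quantifier, so that one and the same map serves for resolutions on arbitrary types.\<close>

definition homology_map :: "'g groupoid \<Rightarrow> 'h groupoid \<Rightarrow> ('g, 'h, 'w) correspondence
    \<Rightarrow> ('g, 'm) gmodule \<Rightarrow> ('h, 'n) gmodule \<Rightarrow> ('m \<Rightarrow> ('w, 'n) ind) \<Rightarrow> nat
    \<Rightarrow> (('g \<Rightarrow> int) \<times> ('g, 'm) res \<Rightarrow>\<^sub>0 int) set set
    \<Rightarrow> (('h \<Rightarrow> int) \<times> ('h, 'n) res \<Rightarrow>\<^sub>0 int) set set" where
  "homology_map G H \<Omega> M N f n =
     (let P = projective_resolution G M; Q = projective_resolution H N;
          ft = (SOME ft. chain_lift G P (Ind_complex G H \<Omega> N Q) f ft)
      in corr_induced G H \<Omega> Q ft n)"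

end

theory Submission
  imports Defs
begin

text \<open>Choose projective resolutions \<open>P' \<rightarrow> M\<close> and \<open>Q' \<rightarrow> N\<close>, with chain maps \<open>\<phi> : P' \<rightarrow> P\<close> and
  \<open>\<psi> : Q' \<rightarrow> Q\<close> over the identities. A lift \<open>f' : P' \<rightarrow> Ind Q'\<close> of \<open>f\<close> defines \<open>H(\<Omega>, f)\<close>, and
  \<open>Ind \<psi> \<circ> f'\<close> and \<open>ft \<circ> \<phi>\<close> are two lifts \<open>P' \<rightarrow> Ind Q\<close> of the same map \<open>f\<close>. Since \<open>P'\<close> is projective
  and \<open>Ind Q\<close> is exact they are homotopic, so they agree on the homology of coinvariants; the square
  that relates \<open>H(\<Omega>, f)\<close> to \<open>(\<delta> \<otimes> id) \<circ> ft\<^sub>G\<close> then commutes because \<open>\<delta> \<otimes> id\<close> is natural.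

  \<open>Ind\<close> is exact because \<open>\<Omega>\<close> has a base of compact open slices \<open>U\<close>, on which the anchor to \<open>H\<close> is
  injective and which meet every orbit of \<open>H\<close> at most once. A function supported on \<open>U \<cdot> H\<close> is
  \<open>1\<^sub>U \<cdot> \<xi>\<close> for a unique coordinate \<open>\<xi>\<close> in the ideal of the groupoid ring over the image of \<open>U\<close>,
  and these coordinates detect when an element of \<open>\<int>[\<Omega>] \<otimes> N\<close> vanishes.

  For the comparison isomorphism of an acyclic resolution \<open>Q\<close>, the mapping cone of \<open>\<phi> : P' \<rightarrow> Q\<close> is
  a resolution of \<open>Q\<^sub>0\<close> by acyclic modules. Resolutions of acyclic modules by acyclic modules stay exact
  under coinvariants, by splitting them into short exact sequences and applying the horseshoe lemma.\<close>

section \<open>Abelian groups and tensor products\<close>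

text \<open>The arrow spaces and \<Omega> may fail to be Hausdorff, so a function in
  \<open>int_functions\<close> need not be continuous and compact open sets may meet in a set that
  is not compact. Arguments about functions therefore reduce to indicators of compact open Hausdorff
  sets, always cut inside one such set. The ring need not have a unit; idempotents
  \<open>ind K\<close> of compact open sets K of units take its place, and non-degeneracy of a
  module becomes the statement that each finite set of elements is fixed by one of them. Two further
  obstacles come from quantifying over modules. Projectivity is tested on fixed types only; the
  module \<open>cover M\<close>, which lifts against surjections on every type, turns this into the
  full property. Acyclicity refers to one chosen resolution; homotopies of lifts show that any
  projective resolution decides it. In place of a long exact sequence, the horseshoe construction is
  exploited when the quotient C of B by A is acyclic: A is then acyclic if and only if B is, and in
  that case A_G -> B_G is injective. Dimension shifting rests on these facts.\<close>

lemma comm_group_imp_group: "comm_group G \<Longrightarrow> group G"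
  by (simp add: comm_group_def)

lemma hom_inv':
  assumes "h \<in> hom G H" "group G" "group H" "x \<in> carrier G"
  shows "h (inv\<^bsub>G\<^esub> x) = inv\<^bsub>H\<^esub> (h x)"
  using assms by (intro group_hom.hom_inv) (auto simp: group_hom_def group_hom_axioms_def)

lemma comm_group_cong:
  assumes "comm_group G" "carrier G' = carrier G" "monoid.mult G' = monoid.mult G" "one G' = one G"
  shows "comm_group G'"
proof -
  interpret G: comm_group G by fact
  show ?thesis
    by (rule comm_groupI) (use assms G.l_inv_ex in \<open>simp_all add: G.m_ac\<close>)
qed

context comm_group
begin

lemma quotient_eq_iff:
  assumes "subgroup N G" "x \<in> carrier G" "y \<in> carrier G"
  shows "N #> x = N #> y \<longleftrightarrow> x \<otimes> inv y \<in> N"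
  using assms
  by (metis group.rcos_self is_group repr_independence subgroup.rcos_module)

lemma quotient_one_iff:
  assumes "subgroup N G" "x \<in> carrier G"
  shows "N #> x = N \<longleftrightarrow> x \<in> N"
  using assms by (metis coset_join1 coset_join2 is_group subgroup.subset)

lemma quotient_mult:
  assumes "subgroup N G" "x \<in> carrier G" "y \<in> carrier G"
  shows "(N #> x) \<otimes>\<^bsub>G Mod N\<^esub> (N #> y) = N #> (x \<otimes> y)"
  using assms normal.rcos_sum[OF subgroup_imp_normal] by simp

lemma quotient_hom: "subgroup N G \<Longrightarrow> (\<lambda>x. N #> x) \<in> hom G (G Mod N)"
  by (rule homI) (simp_all add: quotient_mult carrier_FactGroup del: mult_FactGroup)

lemma quotient_inv:
  assumes "subgroup N G" "x \<in> carrier G"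
  shows "inv\<^bsub>G Mod N\<^esub> (N #> x) = N #> inv x"
  using hom_inv'[OF quotient_hom[OF assms(1)] is_group] assms
  by (metis comm_group_imp_group abelian_FactGroup)

lemma diff_mult_cancel:
  "\<lbrakk>a \<in> carrier G; b \<in> carrier G; c \<in> carrier G\<rbrakk> \<Longrightarrow> a \<otimes> inv b = c \<longleftrightarrow> a = c \<otimes> b"
  using inv_solve_right' by auto

lemma mult_inv_comm4:
  "\<lbrakk>a \<in> carrier G; b \<in> carrier G; c \<in> carrier G; d \<in> carrier G\<rbrakk>
   \<Longrightarrow> (a \<otimes> b) \<otimes> inv (c \<otimes> d) = (a \<otimes> inv c) \<otimes> (b \<otimes> inv d)"
  by (simp add: inv_mult m_ac)

lemma image_hom_subgroup: "\<lbrakk>h \<in> hom H G; group H\<rbrakk> \<Longrightarrow> subgroup (h ` carrier H) G"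
  using group_hom.img_is_subgroup group_hom.intro group_hom_axioms.intro is_group by blast

end

text \<open>The only property of a right module that the tensor product uses.\<close>

locale right_acted = comm_group A for \<Gamma> :: "'g groupoid" and A :: "('g, 'a) gmodule" (structure) +
  assumes ract_closed: "\<lbrakk>\<xi> \<in> groupoid_ring \<Gamma>; a \<in> carrier A\<rbrakk> \<Longrightarrow> act A \<xi> a \<in> carrier A"

definition balanced :: "'g groupoid \<Rightarrow> ('g, 'a) gmodule \<Rightarrow> ('g, 'b) gmodule \<Rightarrow> ('c, 'z) monoid_scheme
    \<Rightarrow> ('a \<Rightarrow> 'b \<Rightarrow> 'c) \<Rightarrow> bool" where
  "balanced \<Gamma> A B C \<beta> \<longleftrightarrow>
     (\<forall>a \<in> carrier A. \<forall>b \<in> carrier B. \<beta> a b \<in> carrier C) \<and>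
     (\<forall>a \<in> carrier A. \<forall>a' \<in> carrier A. \<forall>b \<in> carrier B. \<beta> (a \<otimes>\<^bsub>A\<^esub> a') b = \<beta> a b \<otimes>\<^bsub>C\<^esub> \<beta> a' b) \<and>
     (\<forall>a \<in> carrier A. \<forall>b \<in> carrier B. \<forall>b' \<in> carrier B. \<beta> a (b \<otimes>\<^bsub>B\<^esub> b') = \<beta> a b \<otimes>\<^bsub>C\<^esub> \<beta> a b') \<and>
     (\<forall>\<xi> \<in> groupoid_ring \<Gamma>. \<forall>a \<in> carrier A. \<forall>b \<in> carrier B. \<beta> (act A \<xi> a) b = \<beta> a (act B \<xi> b))"

lemma balancedI:
  assumes "\<And>a b. \<lbrakk>a \<in> carrier A; b \<in> carrier B\<rbrakk> \<Longrightarrow> \<beta> a b \<in> carrier C"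
    and "\<And>a a' b. \<lbrakk>a \<in> carrier A; a' \<in> carrier A; b \<in> carrier B\<rbrakk> \<Longrightarrow> \<beta> (a \<otimes>\<^bsub>A\<^esub> a') b = \<beta> a b \<otimes>\<^bsub>C\<^esub> \<beta> a' b"
    and "\<And>a b b'. \<lbrakk>a \<in> carrier A; b \<in> carrier B; b' \<in> carrier B\<rbrakk> \<Longrightarrow> \<beta> a (b \<otimes>\<^bsub>B\<^esub> b') = \<beta> a b \<otimes>\<^bsub>C\<^esub> \<beta> a b'"
    and "\<And>\<xi> a b. \<lbrakk>\<xi> \<in> groupoid_ring \<Gamma>; a \<in> carrier A; b \<in> carrier B\<rbrakk> \<Longrightarrow> \<beta> (act A \<xi> a) b = \<beta> a (act B \<xi> b)"
  shows "balanced \<Gamma> A B C \<beta>"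
  unfolding balanced_def using assms by blast

locale tensor_pair = A: right_acted \<Gamma> A + B: left_module \<Gamma> B
  for \<Gamma> :: "'g groupoid" and A :: "('g, 'a) gmodule" and B :: "('g, 'b) gmodule"
begin

abbreviation F where "F \<equiv> free_Abelian_group (carrier A \<times> carrier B)"
abbreviation K where "K \<equiv> tensor_kernel \<Gamma> A B"
abbreviation T where "T \<equiv> tensor \<Gamma> A B"
abbreviation pt where "pt \<equiv> pure_tensor \<Gamma> A B"

sublocale F: comm_group F
  by (rule abelian_free_Abelian_group)

lemma relations_subset: "tensor_relations \<Gamma> A B \<subseteq> carrier F"
proof -
  have *: "x + y \<in> carrier F" "x - y \<in> carrier F" if "x \<in> carrier F" "y \<in> carrier F" for x y
    using that keys_add[of x y] keys_diff[of x y] by auto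
  show ?thesis
    unfolding tensor_relations_def
    by (auto simp del: carrier_free_Abelian_group_iff intro!: * A.ract_closed B.act_closed)
qed

lemma subgroup_kernel: "subgroup K F"
  unfolding tensor_kernel_def using F.generate_is_subgroup[OF relations_subset] .

lemma comm_group_tensor: "comm_group T"
  unfolding tensor_def by (rule F.abelian_FactGroup[OF subgroup_kernel])

sublocale T: comm_group T
  by (rule comm_group_tensor)

lemma pure_closed: "\<lbrakk>a \<in> carrier A; b \<in> carrier B\<rbrakk> \<Longrightarrow> pt a b \<in> carrier T"
  by (auto simp: tensor_def pure_tensor_def carrier_FactGroup)

lemma relation_in_kernel: "x \<in> tensor_relations \<Gamma> A B \<Longrightarrow> x \<in> K"
  unfolding tensor_kernel_def by (rule generate.incl)

lemma coset_eqI: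
  assumes "p \<in> carrier F" "q \<in> carrier F" "p - q \<in> tensor_relations \<Gamma> A B"
  shows "K #>\<^bsub>F\<^esub> p = K #>\<^bsub>F\<^esub> q"
  using F.quotient_eq_iff[OF subgroup_kernel assms(1,2)] relation_in_kernel[OF assms(3)] assms(2)
  by simp

lemma coset_mult:
  assumes "p \<in> carrier F" "q \<in> carrier F"
  shows "(K #>\<^bsub>F\<^esub> p) \<otimes>\<^bsub>T\<^esub> (K #>\<^bsub>F\<^esub> q) = K #>\<^bsub>F\<^esub> (p + q)"
  using F.quotient_mult[OF subgroup_kernel assms] by (simp add: tensor_def)

lemma pure_add_left:
  assumes "a \<in> carrier A" "a' \<in> carrier A" "b \<in> carrier B"
  shows "pt (a \<otimes>\<^bsub>A\<^esub> a') b = pt a b \<otimes>\<^bsub>T\<^esub> pt a' b"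
proof -
  have "frag_of (a \<otimes>\<^bsub>A\<^esub> a', b) - (frag_of (a, b) + frag_of (a', b)) \<in> tensor_relations \<Gamma> A B"
    unfolding tensor_relations_def using assms by (auto simp: diff_diff_eq[symmetric])
  moreover have "frag_of (a, b) + frag_of (a', b) \<in> carrier F"
    using assms F.m_closed[of "frag_of (a, b)" "frag_of (a', b)"] by (metis frag_of_in_free_Abelian_group
      mem_Sigma_iff mult_free_Abelian_group)
  ultimately show ?thesis
    unfolding pure_tensor_def using assms by (subst coset_mult) (simp_all add: coset_eqI)
qed

lemma pure_add_right:
  assumes "a \<in> carrier A" "b \<in> carrier B" "b' \<in> carrier B"
  shows "pt a (b \<otimes>\<^bsub>B\<^esub> b') = pt a b \<otimes>\<^bsub>T\<^esub> pt a b'"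
proof -
  have "frag_of (a, b \<otimes>\<^bsub>B\<^esub> b') - (frag_of (a, b) + frag_of (a, b')) \<in> tensor_relations \<Gamma> A B"
    unfolding tensor_relations_def using assms by (auto simp: diff_diff_eq[symmetric])
  moreover have "frag_of (a, b) + frag_of (a, b') \<in> carrier F"
    using assms F.m_closed[of "frag_of (a, b)" "frag_of (a, b')"] by (metis frag_of_in_free_Abelian_group
      mem_Sigma_iff mult_free_Abelian_group)
  ultimately show ?thesis
    unfolding pure_tensor_def using assms by (subst coset_mult) (simp_all add: coset_eqI)
qed

lemma pure_act:
  assumes "\<xi> \<in> groupoid_ring \<Gamma>" "a \<in> carrier A" "b \<in> carrier B"
  shows "pt (act A \<xi> a) b = pt a (act B \<xi> b)"
proof -
  have "frag_of (act A \<xi> a, b) - frag_of (a, act B \<xi> b) \<in> tensor_relations \<Gamma> A B"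
    unfolding tensor_relations_def using assms by auto
  then show ?thesis
    unfolding pure_tensor_def using assms by (intro coset_eqI) (simp_all add: A.ract_closed B.act_closed)
qed

lemma pure_hom_left: "b \<in> carrier B \<Longrightarrow> (\<lambda>a. pt a b) \<in> hom A T"
  by (rule homI) (auto simp: pure_closed pure_add_left)

lemma pure_hom_right: "a \<in> carrier A \<Longrightarrow> pt a \<in> hom B T"
  by (rule homI) (auto simp: pure_closed pure_add_right)

lemma pure_one_right [simp]: "a \<in> carrier A \<Longrightarrow> pt a \<one>\<^bsub>B\<^esub> = \<one>\<^bsub>T\<^esub>"
  using hom_one[OF pure_hom_right B.is_group T.is_group] .

lemma pure_one_left [simp]: "b \<in> carrier B \<Longrightarrow> pt \<one>\<^bsub>A\<^esub> b = \<one>\<^bsub>T\<^esub>"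
  using hom_one[OF pure_hom_left A.is_group T.is_group] .

lemma pure_inv_left: "\<lbrakk>a \<in> carrier A; b \<in> carrier B\<rbrakk> \<Longrightarrow> pt (inv\<^bsub>A\<^esub> a) b = inv\<^bsub>T\<^esub> pt a b"
  using hom_inv'[OF pure_hom_left A.is_group T.is_group] .

text \<open>The inverse of \<open>pt a b\<close> is again a pure tensor, with the inverse of a in
  place of a, so products of pure tensors reach every element. The proof carries the claim for the
  inverse along, because induction over the free group forms differences.\<close>

lemma tensor_induct [consumes 1, case_names pure mult]:
  assumes X: "X \<in> carrier T"
    and pure: "\<And>a b. \<lbrakk>a \<in> carrier A; b \<in> carrier B\<rbrakk> \<Longrightarrow> P (pt a b)"
    and mult: "\<And>X Y. \<lbrakk>X \<in> carrier T; Y \<in> carrier T; P X; P Y\<rbrakk> \<Longrightarrow> P (X \<otimes>\<^bsub>T\<^esub> Y)"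
  shows "P X"
proof -
  obtain p where p: "Poly_Mapping.keys p \<subseteq> carrier A \<times> carrier B" "X = K #>\<^bsub>F\<^esub> p"
    using X by (auto simp: tensor_def carrier_FactGroup)
  have inT: "K #>\<^bsub>F\<^esub> q \<in> carrier T" if "Poly_Mapping.keys q \<subseteq> carrier A \<times> carrier B" for q
    using that by (auto simp: tensor_def carrier_FactGroup)
  have cinv: "inv\<^bsub>T\<^esub> (K #>\<^bsub>F\<^esub> q) = K #>\<^bsub>F\<^esub> (- q)" if "Poly_Mapping.keys q \<subseteq> carrier A \<times> carrier B" for q
    using F.quotient_inv[OF subgroup_kernel, of q] that by (simp add: tensor_def)
  have diff: "K #>\<^bsub>F\<^esub> (x - y) = (K #>\<^bsub>F\<^esub> x) \<otimes>\<^bsub>T\<^esub> inv\<^bsub>T\<^esub> (K #>\<^bsub>F\<^esub> y)"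
    if "Poly_Mapping.keys x \<subseteq> carrier A \<times> carrier B" "Poly_Mapping.keys y \<subseteq> carrier A \<times> carrier B" for x y
    using that by (simp add: cinv coset_mult)
  have "P (K #>\<^bsub>F\<^esub> p) \<and> P (inv\<^bsub>T\<^esub> (K #>\<^bsub>F\<^esub> p))"
    using p(1)
  proof (rule free_Abelian_group_induct)
    have *: "K #>\<^bsub>F\<^esub> 0 = \<one>\<^bsub>T\<^esub>"
      using F.coset_join2[OF _ subgroup_kernel] subgroup.one_closed[OF subgroup_kernel]
      by (simp add: tensor_def)
    \<comment> \<open>The neutral element is itself a pure tensor, so the base case is an instance
      of \<open>pure\<close>.\<close>
    have "P (pt \<one>\<^bsub>A\<^esub> \<one>\<^bsub>B\<^esub>)"
      by (rule pure) auto
    then show "P (K #>\<^bsub>F\<^esub> 0) \<and> P (inv\<^bsub>T\<^esub> (K #>\<^bsub>F\<^esub> 0))"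
      by (simp add: *)
  next
    fix x y assume xy: "Poly_Mapping.keys x \<subseteq> carrier A \<times> carrier B" "Poly_Mapping.keys y \<subseteq> carrier A \<times> carrier B"
      and P: "P (K #>\<^bsub>F\<^esub> x) \<and> P (inv\<^bsub>T\<^esub> (K #>\<^bsub>F\<^esub> x))" "P (K #>\<^bsub>F\<^esub> y) \<and> P (inv\<^bsub>T\<^esub> (K #>\<^bsub>F\<^esub> y))"
    have c: "K #>\<^bsub>F\<^esub> x \<in> carrier T" "K #>\<^bsub>F\<^esub> y \<in> carrier T"
      using xy inT by auto
    then have "inv\<^bsub>T\<^esub> ((K #>\<^bsub>F\<^esub> x) \<otimes>\<^bsub>T\<^esub> inv\<^bsub>T\<^esub> (K #>\<^bsub>F\<^esub> y)) = inv\<^bsub>T\<^esub> (K #>\<^bsub>F\<^esub> x) \<otimes>\<^bsub>T\<^esub> (K #>\<^bsub>F\<^esub> y)"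
      by (simp add: T.inv_mult)
    with c P show "P (K #>\<^bsub>F\<^esub> (x - y)) \<and> P (inv\<^bsub>T\<^esub> (K #>\<^bsub>F\<^esub> (x - y)))"
      by (simp add: diff[OF xy] mult)
  next
    fix z assume "z \<in> carrier A \<times> carrier B"
    then obtain a b where z: "z = (a, b)" "a \<in> carrier A" "b \<in> carrier B"
      by auto
    then have "P (pt a b)" "P (pt (inv\<^bsub>A\<^esub> a) b)"
      by (auto intro: pure)
    then show "P (K #>\<^bsub>F\<^esub> frag_of z) \<and> P (inv\<^bsub>T\<^esub> (K #>\<^bsub>F\<^esub> frag_of z))"
      using z pure_inv_left[of a b] by (simp add: pure_tensor_def)
  qed
  then show ?thesis
    using p by simp
qed

lemma tensor_hom_eq:
  assumes "f \<in> hom T C" "g \<in> hom T C"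
    and "\<And>a b. \<lbrakk>a \<in> carrier A; b \<in> carrier B\<rbrakk> \<Longrightarrow> f (pt a b) = g (pt a b)"
    and "X \<in> carrier T"
  shows "f X = g X"
  using assms(4) by (induction rule: tensor_induct) (simp_all add: assms hom_mult[OF assms(1)] hom_mult[OF assms(2)])

context
  fixes C :: "('c, 'z) monoid_scheme" and \<beta> :: "'a \<Rightarrow> 'b \<Rightarrow> 'c"
  assumes C: "comm_group C" and \<beta>: "balanced \<Gamma> A B C \<beta>"
begin

interpretation C: comm_group C by (rule C)

text \<open>The universal property. \<open>tensor_lift\<close> takes \<open>the_elem\<close> of an
  image, so the point is that evaluation on the free group is constant on cosets of
  \<open>K\<close>; this holds because a balanced \<beta> makes every relation evaluate to the
  neutral element.\<close>

lemma tensor_lift_hom_pure: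
  "tensor_lift C \<beta> \<in> hom T C \<and>
   (\<forall>a \<in> carrier A. \<forall>b \<in> carrier B. tensor_lift C \<beta> (pt a b) = \<beta> a b)"
proof -
  define ev where "ev = (\<lambda>p :: 'a \<times> 'b \<Rightarrow>\<^sub>0 int. finprod C (\<lambda>z. \<beta> (fst z) (snd z) [^]\<^bsub>C\<^esub> Poly_Mapping.lookup p z) (Poly_Mapping.keys p))"
  have \<beta>c: "\<beta> a b \<in> carrier C" if "a \<in> carrier A" "b \<in> carrier B" for a b
    using \<beta> that unfolding balanced_def by blast
  have cl: "\<beta> (fst z) (snd z) \<in> carrier C" if "z \<in> carrier A \<times> carrier B" for z
    using that by (auto intro: \<beta>c)
  \<comment> \<open>Cancellation may make the keys of a sum smaller than the union of the keys, so
    products are compared over a common larger set, where the extra factors have exponent 0.\<close>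
  have ev_eq: "ev p = finprod C (\<lambda>z. \<beta> (fst z) (snd z) [^]\<^bsub>C\<^esub> Poly_Mapping.lookup p z) S"
    if "finite S" "Poly_Mapping.keys p \<subseteq> S" "S \<subseteq> carrier A \<times> carrier B" for p S
    unfolding ev_def using that
    by (intro C.finprod_mono_neutral_cong_left) (auto simp: in_keys_iff cl intro!: C.int_pow_closed cl)
  have ev_hom: "ev \<in> hom F C"
  proof (rule homI)
    fix p assume p: "p \<in> carrier F"
    show "ev p \<in> carrier C"
      unfolding ev_def using p by (intro C.finprod_closed) (auto intro!: C.int_pow_closed cl)
    fix q assume q: "q \<in> carrier F"
    define S where "S = Poly_Mapping.keys p \<union> Poly_Mapping.keys q"
    have S: "finite S" "S \<subseteq> carrier A \<times> carrier B"
      using p q by (auto simp: S_def)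
    have "Poly_Mapping.keys (p + q) \<subseteq> S"
      unfolding S_def using keys_add[of p q] by auto
    then have "ev (p + q) = finprod C (\<lambda>z. \<beta> (fst z) (snd z) [^]\<^bsub>C\<^esub> Poly_Mapping.lookup (p + q) z) S"
      using ev_eq S by blast
    also have "\<dots> = finprod C (\<lambda>z. \<beta> (fst z) (snd z) [^]\<^bsub>C\<^esub> Poly_Mapping.lookup p z \<otimes>\<^bsub>C\<^esub>
                     \<beta> (fst z) (snd z) [^]\<^bsub>C\<^esub> Poly_Mapping.lookup q z) S"
      using S by (intro C.finprod_cong') (auto simp: lookup_add C.int_pow_mult subset_iff \<beta>c intro!: C.int_pow_closed cl)
    also have "\<dots> = ev p \<otimes>\<^bsub>C\<^esub> ev q"
    proof -
      have "ev p = finprod C (\<lambda>z. \<beta> (fst z) (snd z) [^]\<^bsub>C\<^esub> Poly_Mapping.lookup p z) S"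
           "ev q = finprod C (\<lambda>z. \<beta> (fst z) (snd z) [^]\<^bsub>C\<^esub> Poly_Mapping.lookup q z) S"
        using ev_eq[of S] S by (auto simp: S_def)
      then show ?thesis
        using S by (subst C.finprod_multf) (auto intro!: C.int_pow_closed cl)
    qed
    finally show "ev (p \<otimes>\<^bsub>F\<^esub> q) = ev p \<otimes>\<^bsub>C\<^esub> ev q"
      by simp
  qed
  interpret ev: group_hom F C ev
    using ev_hom by unfold_locales
  have ev_frag: "ev (frag_of (a, b)) = \<beta> a b" if "a \<in> carrier A" "b \<in> carrier B" for a b
    using that \<beta>c[OF that] by (simp add: ev_def)
  have Fc: "frag_of (a, b) \<in> carrier F" if "a \<in> carrier A" "b \<in> carrier B" for a b
    using that by simp
  have ev_diff: "ev (x - y) = ev x \<otimes>\<^bsub>C\<^esub> inv\<^bsub>C\<^esub> ev y" if "x \<in> carrier F" "y \<in> carrier F" for x y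
    using ev.hom_mult[of x "inv\<^bsub>F\<^esub> y"] ev.hom_inv[of y] that by simp
  have diffc: "x - y \<in> carrier F" if "x \<in> carrier F" "y \<in> carrier F" for x y
    using that keys_diff[of x y] by auto
  have "tensor_relations \<Gamma> A B \<subseteq> kernel F C ev"
  proof
    fix x assume x: "x \<in> tensor_relations \<Gamma> A B"
    have "ev x = \<one>\<^bsub>C\<^esub>"
      using x unfolding tensor_relations_def
    proof (elim UnE CollectE exE conjE)
      fix a a' b assume *: "x = frag_of (a \<otimes>\<^bsub>A\<^esub> a', b) - frag_of (a, b) - frag_of (a', b)"
        "a \<in> carrier A" "a' \<in> carrier A" "b \<in> carrier B"
      have "\<beta> (a \<otimes>\<^bsub>A\<^esub> a') b = \<beta> a b \<otimes>\<^bsub>C\<^esub> \<beta> a' b"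
        using \<beta> * unfolding balanced_def by blast
      then show ?thesis
        using * by (simp add: ev_diff diffc Fc ev_frag \<beta>c C.m_ac C.inv_solve_right' del: carrier_free_Abelian_group_iff)
    next
      fix a b b' assume *: "x = frag_of (a, b \<otimes>\<^bsub>B\<^esub> b') - frag_of (a, b) - frag_of (a, b')"
        "a \<in> carrier A" "b \<in> carrier B" "b' \<in> carrier B"
      have "\<beta> a (b \<otimes>\<^bsub>B\<^esub> b') = \<beta> a b \<otimes>\<^bsub>C\<^esub> \<beta> a b'"
        using \<beta> * unfolding balanced_def by blast
      then show ?thesis
        using * by (simp add: ev_diff diffc Fc ev_frag \<beta>c C.m_ac C.inv_solve_right' del: carrier_free_Abelian_group_iff)
    next
      fix \<xi> a b assume *: "x = frag_of (act A \<xi> a, b) - frag_of (a, act B \<xi> b)"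
        "\<xi> \<in> groupoid_ring \<Gamma>" "a \<in> carrier A" "b \<in> carrier B"
      have "\<beta> (act A \<xi> a) b = \<beta> a (act B \<xi> b)"
        using \<beta> * unfolding balanced_def by blast
      then show ?thesis
        using * by (simp add: ev_diff Fc ev_frag \<beta>c A.ract_closed B.act_closed del: carrier_free_Abelian_group_iff)
    qed
    then show "x \<in> kernel F C ev"
      using x relations_subset unfolding kernel_def by blast
  qed
  then have K: "K \<subseteq> kernel F C ev"
    unfolding tensor_kernel_def using F.generate_subgroup_incl ev.subgroup_kernel by blast
  have ev_coset: "ev ` (K #>\<^bsub>F\<^esub> p) = {ev p}" if p: "p \<in> carrier F" for p
  proof -
    have "ev y = ev p" if y: "y \<in> K #>\<^bsub>F\<^esub> p" for y
    proof -
      obtain k where k: "k \<in> K" "y = k \<otimes>\<^bsub>F\<^esub> p"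
        using y unfolding r_coset_def by blast
      then have "k \<in> carrier F" "ev k = \<one>\<^bsub>C\<^esub>"
        using K by (auto simp: kernel_def)
      then show ?thesis
        using k p ev.hom_mult[of k p] ev.hom_closed[OF p] by (simp del: mult_free_Abelian_group)
    qed
    moreover have "p \<in> K #>\<^bsub>F\<^esub> p"
      using F.rcos_self[OF p subgroup_kernel] .
    ultimately show ?thesis
      by blast
  qed
  have tl: "tensor_lift C \<beta> (K #>\<^bsub>F\<^esub> p) = ev p" if "p \<in> carrier F" for p
    unfolding tensor_lift_def ev_def[symmetric] using ev_coset[OF that] by simp
  show ?thesis
  proof (intro conjI ballI)
    show "tensor_lift C \<beta> \<in> hom T C"
    proof (rule homI)
      fix X assume "X \<in> carrier T"
      then obtain p where p: "p \<in> carrier F" "X = K #>\<^bsub>F\<^esub> p"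
        by (auto simp: tensor_def carrier_FactGroup)
      then show "tensor_lift C \<beta> X \<in> carrier C"
        using tl ev.hom_closed by simp
      fix Y assume "Y \<in> carrier T"
      then obtain q where q: "q \<in> carrier F" "Y = K #>\<^bsub>F\<^esub> q"
        by (auto simp: tensor_def carrier_FactGroup)
      have "p \<otimes>\<^bsub>F\<^esub> q \<in> carrier F"
        using p q by blast
      then show "tensor_lift C \<beta> (X \<otimes>\<^bsub>T\<^esub> Y) = tensor_lift C \<beta> X \<otimes>\<^bsub>C\<^esub> tensor_lift C \<beta> Y"
        using p q tl[of "p + q"] tl ev.hom_mult[of p q] coset_mult[of p q] by simp
    qed
    show "tensor_lift C \<beta> (pt a b) = \<beta> a b" if "a \<in> carrier A" "b \<in> carrier B" for a b
      unfolding pure_tensor_def using tl[OF Fc[OF that]] ev_frag[OF that] by simp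
  qed
qed

lemmas tensor_lift_hom = tensor_lift_hom_pure[THEN conjunct1]
  and tensor_lift_pure = tensor_lift_hom_pure[THEN conjunct2, rule_format]

end

end

section \<open>Functoriality and right exactness\<close>

lemma gmodule_hom_hom: "gmodule_hom \<Gamma> M N f \<Longrightarrow> f \<in> hom M N"
  by (simp add: gmodule_hom_def)

lemma gmodule_hom_closed: "\<lbrakk>gmodule_hom \<Gamma> M N f; x \<in> carrier M\<rbrakk> \<Longrightarrow> f x \<in> carrier N"
  by (meson gmodule_hom_hom hom_in_carrier)

lemma gmodule_hom_mult:
  "\<lbrakk>gmodule_hom \<Gamma> M N f; x \<in> carrier M; y \<in> carrier M\<rbrakk> \<Longrightarrow> f (x \<otimes>\<^bsub>M\<^esub> y) = f x \<otimes>\<^bsub>N\<^esub> f y"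
  by (meson gmodule_hom_hom hom_mult)

lemma gmodule_hom_act:
  "\<lbrakk>gmodule_hom \<Gamma> M N f; \<xi> \<in> groupoid_ring \<Gamma>; x \<in> carrier M\<rbrakk> \<Longrightarrow> f (act M \<xi> x) = act N \<xi> (f x)"
  by (simp add: gmodule_hom_def)

lemma gmodule_homI:
  assumes "\<And>x. x \<in> carrier M \<Longrightarrow> f x \<in> carrier N"
    and "\<And>x y. \<lbrakk>x \<in> carrier M; y \<in> carrier M\<rbrakk> \<Longrightarrow> f (x \<otimes>\<^bsub>M\<^esub> y) = f x \<otimes>\<^bsub>N\<^esub> f y"
    and "\<And>\<xi> x. \<lbrakk>\<xi> \<in> groupoid_ring \<Gamma>; x \<in> carrier M\<rbrakk> \<Longrightarrow> f (act M \<xi> x) = act N \<xi> (f x)"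
  shows "gmodule_hom \<Gamma> M N f"
  using assms by (simp add: gmodule_hom_def hom_def)

lemma left_module_group: "left_module \<Gamma> M \<Longrightarrow> group M"
  by (simp add: left_module_def comm_group_def)

lemma left_module_comm_group: "left_module \<Gamma> M \<Longrightarrow> comm_group M"
  by (simp add: left_module_def)

lemma gmodule_hom_one:
  "\<lbrakk>gmodule_hom \<Gamma> M N f; left_module \<Gamma> M; left_module \<Gamma> N\<rbrakk> \<Longrightarrow> f \<one>\<^bsub>M\<^esub> = \<one>\<^bsub>N\<^esub>"
  by (meson gmodule_hom_hom left_module_group hom_one)

lemma gmodule_hom_inv:
  "\<lbrakk>gmodule_hom \<Gamma> M N f; left_module \<Gamma> M; left_module \<Gamma> N; x \<in> carrier M\<rbrakk> \<Longrightarrow> f (inv\<^bsub>M\<^esub> x) = inv\<^bsub>N\<^esub> f x"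
  by (meson gmodule_hom_hom left_module_group hom_inv')

lemma gmodule_hom_group_hom:
  "\<lbrakk>gmodule_hom \<Gamma> M N f; left_module \<Gamma> M; left_module \<Gamma> N\<rbrakk> \<Longrightarrow> group_hom M N f"
  by (simp add: group_hom_def group_hom_axioms_def left_module_group gmodule_hom_hom)

lemma gmodule_hom_cong:
  assumes "gmodule_hom \<Gamma> M N f" "left_module \<Gamma> M" "\<And>x. x \<in> carrier M \<Longrightarrow> g x = f x"
  shows "gmodule_hom \<Gamma> M N g"
proof -
  interpret M: left_module \<Gamma> M by fact
  show ?thesis
    using assms(1,3) by (intro gmodule_homI)
      (auto simp: M.act_closed gmodule_hom_closed gmodule_hom_mult gmodule_hom_act)
qed

lemma gmodule_hom_comp:
  "\<lbrakk>gmodule_hom \<Gamma> M N f; gmodule_hom \<Gamma> N L g\<rbrakk> \<Longrightarrow> gmodule_hom \<Gamma> M L (\<lambda>x. g (f x))"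
  by (intro gmodule_homI) (auto simp: gmodule_hom_closed gmodule_hom_mult gmodule_hom_act)

lemma gmodule_hom_id: "gmodule_hom \<Gamma> M M (\<lambda>x. x)"
  by (intro gmodule_homI) auto

context left_module
begin

lemma act_hom: "\<xi> \<in> groupoid_ring \<Gamma> \<Longrightarrow> act M \<xi> \<in> hom M M"
  by (rule homI) (auto simp: act_closed act_add)

lemma act_one [simp]: "\<xi> \<in> groupoid_ring \<Gamma> \<Longrightarrow> act M \<xi> \<one> = \<one>"
  using hom_one[OF act_hom is_group is_group] .

lemma act_inv: "\<lbrakk>\<xi> \<in> groupoid_ring \<Gamma>; m \<in> carrier M\<rbrakk> \<Longrightarrow> act M \<xi> (inv m) = inv (act M \<xi> m)"
  using hom_inv'[OF act_hom is_group is_group] .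

end

lemma gmodule_hom_times:
  assumes "left_module \<Gamma> N" "gmodule_hom \<Gamma> M N f" "gmodule_hom \<Gamma> M N g"
  shows "gmodule_hom \<Gamma> M N (\<lambda>x. f x \<otimes>\<^bsub>N\<^esub> g x)"
proof -
  interpret N: left_module \<Gamma> N by fact
  show ?thesis
    using assms by (intro gmodule_homI)
      (auto simp: gmodule_hom_closed gmodule_hom_mult gmodule_hom_act N.act_add N.m_ac)
qed

lemma gmodule_hom_inverse:
  assumes "left_module \<Gamma> N" "gmodule_hom \<Gamma> M N f"
  shows "gmodule_hom \<Gamma> M N (\<lambda>x. inv\<^bsub>N\<^esub> f x)"
proof -
  interpret N: left_module \<Gamma> N by fact
  show ?thesis
    using assms by (intro gmodule_homI)
      (auto simp: gmodule_hom_closed gmodule_hom_mult gmodule_hom_act N.act_inv N.inv_mult)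
qed

lemma gmodule_hom_trivial:
  assumes "left_module \<Gamma> N"
  shows "gmodule_hom \<Gamma> M N (\<lambda>x. \<one>\<^bsub>N\<^esub>)"
proof -
  interpret N: left_module \<Gamma> N by fact
  show ?thesis by (intro gmodule_homI) auto
qed

text \<open>One functor covers both coinvariants, with A the trivial module, and induction, with A
  the right module of \<Omega>; the results below serve both.\<close>

definition tensor_map :: "'g groupoid \<Rightarrow> ('g, 'a) gmodule \<Rightarrow> ('g, 'n) gmodule \<Rightarrow> ('m \<Rightarrow> 'n)
    \<Rightarrow> ('a \<times> 'm \<Rightarrow>\<^sub>0 int) set \<Rightarrow> ('a \<times> 'n \<Rightarrow>\<^sub>0 int) set" where
  "tensor_map \<Gamma> A N f = tensor_lift (tensor \<Gamma> A N) (\<lambda>a m. pure_tensor \<Gamma> A N a (f m))"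

lemma coinvariants_map_eq: "coinvariants_map \<Gamma> N f = tensor_map \<Gamma> (unit_module \<Gamma>) N f"
  by (simp add: coinvariants_map_def tensor_map_def coinvariants_def)

lemma Ind_map_eq: "Ind_map H \<Omega> N f = tensor_map H (corr_rmodule H \<Omega>) N f"
  by (simp add: Ind_map_def tensor_map_def)

lemma tensor_pairI: "\<lbrakk>right_acted \<Gamma> A; left_module \<Gamma> B\<rbrakk> \<Longrightarrow> tensor_pair \<Gamma> A B"
  by (simp add: tensor_pair_def)

lemma tensor_map_balanced:
  assumes "right_acted \<Gamma> A" "left_module \<Gamma> M" "left_module \<Gamma> N" "gmodule_hom \<Gamma> M N f"
  shows "balanced \<Gamma> A M (tensor \<Gamma> A N) (\<lambda>a m. pure_tensor \<Gamma> A N a (f m))"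
proof -
  interpret tensor_pair \<Gamma> A N using assms by (simp add: tensor_pairI)
  show ?thesis
    using assms(4) by (intro balancedI)
      (auto simp: pure_closed gmodule_hom_closed gmodule_hom_mult gmodule_hom_act pure_add_left pure_add_right pure_act)
qed

lemma tensor_comm_group: "\<lbrakk>right_acted \<Gamma> A; left_module \<Gamma> B\<rbrakk> \<Longrightarrow> comm_group (tensor \<Gamma> A B)"
  using tensor_pair.comm_group_tensor tensor_pairI by blast

context
  fixes \<Gamma> :: "'g groupoid" and A :: "('g, 'a) gmodule" and M :: "('g, 'm) gmodule" and N :: "('g, 'n) gmodule" and f
  assumes *: "right_acted \<Gamma> A" "left_module \<Gamma> M" "left_module \<Gamma> N" "gmodule_hom \<Gamma> M N f"
begin

interpretation M: tensor_pair \<Gamma> A M using * by (simp add: tensor_pairI)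
interpretation N: tensor_pair \<Gamma> A N using * by (simp add: tensor_pairI)

lemma tensor_map_hom: "tensor_map \<Gamma> A N f \<in> hom (tensor \<Gamma> A M) (tensor \<Gamma> A N)"
  unfolding tensor_map_def
  by (rule M.tensor_lift_hom[OF N.comm_group_tensor tensor_map_balanced[OF *]])

lemma tensor_map_pure:
  "\<lbrakk>a \<in> carrier A; m \<in> carrier M\<rbrakk> \<Longrightarrow> tensor_map \<Gamma> A N f (pure_tensor \<Gamma> A M a m) = pure_tensor \<Gamma> A N a (f m)"
  unfolding tensor_map_def
  by (rule M.tensor_lift_pure[OF N.comm_group_tensor tensor_map_balanced[OF *]])

lemma tensor_map_closed: "X \<in> carrier (tensor \<Gamma> A M) \<Longrightarrow> tensor_map \<Gamma> A N f X \<in> carrier (tensor \<Gamma> A N)"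
  using tensor_map_hom by (rule hom_in_carrier)

lemma tensor_map_mult:
  "\<lbrakk>X \<in> carrier (tensor \<Gamma> A M); Y \<in> carrier (tensor \<Gamma> A M)\<rbrakk> \<Longrightarrow>
   tensor_map \<Gamma> A N f (X \<otimes>\<^bsub>tensor \<Gamma> A M\<^esub> Y) = tensor_map \<Gamma> A N f X \<otimes>\<^bsub>tensor \<Gamma> A N\<^esub> tensor_map \<Gamma> A N f Y"
  using hom_mult[OF tensor_map_hom] .

lemma tensor_map_one: "tensor_map \<Gamma> A N f \<one>\<^bsub>tensor \<Gamma> A M\<^esub> = \<one>\<^bsub>tensor \<Gamma> A N\<^esub>"
  using hom_one[OF tensor_map_hom M.T.is_group N.T.is_group] .

lemma tensor_map_inv:
  "X \<in> carrier (tensor \<Gamma> A M) \<Longrightarrow>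
   tensor_map \<Gamma> A N f (inv\<^bsub>tensor \<Gamma> A M\<^esub> X) = inv\<^bsub>tensor \<Gamma> A N\<^esub> tensor_map \<Gamma> A N f X"
  using hom_inv'[OF tensor_map_hom M.T.is_group N.T.is_group] .

lemma tensor_map_cong:
  assumes "\<And>x. x \<in> carrier M \<Longrightarrow> g x = f x" "X \<in> carrier (tensor \<Gamma> A M)"
  shows "tensor_map \<Gamma> A N g X = tensor_map \<Gamma> A N f X"
proof -
  have g: "gmodule_hom \<Gamma> M N g"
    using gmodule_hom_cong[OF *(4,2)] assms(1) by blast
  have b: "balanced \<Gamma> A M (tensor \<Gamma> A N) (\<lambda>a m. pure_tensor \<Gamma> A N a (g m))"
    using tensor_map_balanced[OF *(1-3) g] .
  show ?thesis
    by (rule M.tensor_hom_eq[OF _ tensor_map_hom _ assms(2)])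
      (use M.tensor_lift_hom[OF N.comm_group_tensor b] M.tensor_lift_pure[OF N.comm_group_tensor b] assms(1)
        in \<open>simp_all add: tensor_map_def[of _ _ _ g] tensor_map_pure\<close>)
qed

lemma tensor_map_trivial:
  assumes "\<And>x. x \<in> carrier M \<Longrightarrow> f x = \<one>\<^bsub>N\<^esub>" "X \<in> carrier (tensor \<Gamma> A M)"
  shows "tensor_map \<Gamma> A N f X = \<one>\<^bsub>tensor \<Gamma> A N\<^esub>"
  using assms(2)
proof (induction rule: M.tensor_induct)
  case (mult X Y)
  then show ?case by (simp add: tensor_map_mult)
qed (simp add: tensor_map_pure assms(1))

lemma tensor_map_surj:
  assumes "f ` carrier M = carrier N"
  shows "tensor_map \<Gamma> A N f ` carrier (tensor \<Gamma> A M) = carrier (tensor \<Gamma> A N)"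
proof
  show "carrier (tensor \<Gamma> A N) \<subseteq> tensor_map \<Gamma> A N f ` carrier (tensor \<Gamma> A M)"
  proof
    fix Y assume "Y \<in> carrier (tensor \<Gamma> A N)"
    then show "Y \<in> tensor_map \<Gamma> A N f ` carrier (tensor \<Gamma> A M)"
    proof (induction rule: N.tensor_induct)
      case (pure a b)
      then obtain m where "m \<in> carrier M" "b = f m"
        using assms by blast
      then show ?case
        using pure tensor_map_pure M.pure_closed by (metis imageI)
    next
      case (mult X Y)
      then obtain x y where "x \<in> carrier M.T" "X = tensor_map \<Gamma> A N f x" "y \<in> carrier M.T" "Y = tensor_map \<Gamma> A N f y"
        by blast
      then show ?case
        using tensor_map_mult M.T.m_closed by (intro image_eqI[of _ _ "x \<otimes>\<^bsub>M.T\<^esub> y"]) simp_all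
    qed
  qed
qed (auto intro: tensor_map_closed)

end

lemma tensor_map_id:
  assumes "right_acted \<Gamma> A" "left_module \<Gamma> M" "X \<in> carrier (tensor \<Gamma> A M)"
    and f: "\<And>x. x \<in> carrier M \<Longrightarrow> f x = x"
  shows "tensor_map \<Gamma> A M f X = X"
proof -
  interpret M: tensor_pair \<Gamma> A M using assms by (simp add: tensor_pairI)
  have fh: "gmodule_hom \<Gamma> M M f"
    using gmodule_hom_cong[OF gmodule_hom_id assms(2)] f by blast
  show ?thesis
    using M.tensor_hom_eq[OF tensor_map_hom[OF assms(1,2,2) fh], of "\<lambda>x. x" X] assms(3) f
    by (simp add: tensor_map_pure[OF assms(1,2,2) fh] hom_def)
qed

lemma tensor_map_comp:
  assumes "right_acted \<Gamma> A" "left_module \<Gamma> M" "left_module \<Gamma> N" "left_module \<Gamma> L"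
    and f: "gmodule_hom \<Gamma> M N f" and g: "gmodule_hom \<Gamma> N L g"
    and h: "\<And>x. x \<in> carrier M \<Longrightarrow> h x = g (f x)" and X: "X \<in> carrier (tensor \<Gamma> A M)"
  shows "tensor_map \<Gamma> A L g (tensor_map \<Gamma> A N f X) = tensor_map \<Gamma> A L h X"
proof -
  interpret M: tensor_pair \<Gamma> A M using assms by (simp add: tensor_pairI)
  have hh: "gmodule_hom \<Gamma> M L h"
    using gmodule_hom_cong[OF gmodule_hom_comp[OF f g] assms(2)] h by blast
  have "(\<lambda>X. tensor_map \<Gamma> A L g (tensor_map \<Gamma> A N f X)) \<in> hom (tensor \<Gamma> A M) (tensor \<Gamma> A L)"
    using hom_compose[OF tensor_map_hom[OF assms(1,2,3) f] tensor_map_hom[OF assms(1,3,4) g]]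
    by (simp add: o_def)
  then show ?thesis
    by (rule M.tensor_hom_eq[OF _ tensor_map_hom[OF assms(1,2,4) hh] _ X])
      (simp add: tensor_map_pure[OF assms(1,2,3) f] tensor_map_pure[OF assms(1,3,4) g]
        tensor_map_pure[OF assms(1,2,4) hh] gmodule_hom_closed[OF f] h)
qed

lemma tensor_map_times:
  assumes "right_acted \<Gamma> A" "left_module \<Gamma> M" "left_module \<Gamma> N"
    and f: "gmodule_hom \<Gamma> M N f" and g: "gmodule_hom \<Gamma> M N g"
    and h: "\<And>x. x \<in> carrier M \<Longrightarrow> h x = f x \<otimes>\<^bsub>N\<^esub> g x" and X: "X \<in> carrier (tensor \<Gamma> A M)"
  shows "tensor_map \<Gamma> A N h X = tensor_map \<Gamma> A N f X \<otimes>\<^bsub>tensor \<Gamma> A N\<^esub> tensor_map \<Gamma> A N g X"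
proof -
  interpret M: tensor_pair \<Gamma> A M using assms by (simp add: tensor_pairI)
  interpret N: tensor_pair \<Gamma> A N using assms by (simp add: tensor_pairI)
  have hh: "gmodule_hom \<Gamma> M N h"
    using gmodule_hom_cong[OF gmodule_hom_times[OF assms(3) f g] assms(2)] h by blast
  note H = tensor_map_hom[OF assms(1-3) f] tensor_map_hom[OF assms(1-3) g] tensor_map_hom[OF assms(1-3) hh]
  note P = tensor_map_pure[OF assms(1-3) f] tensor_map_pure[OF assms(1-3) g] tensor_map_pure[OF assms(1-3) hh]
  have "(\<lambda>X. tensor_map \<Gamma> A N f X \<otimes>\<^bsub>tensor \<Gamma> A N\<^esub> tensor_map \<Gamma> A N g X) \<in> hom (tensor \<Gamma> A M) (tensor \<Gamma> A N)"
    by (rule homI) (simp_all add: hom_in_carrier[OF H(1)] hom_in_carrier[OF H(2)] hom_mult[OF H(1)] hom_mult[OF H(2)] N.T.m_ac)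
  then show ?thesis
    by (rule M.tensor_hom_eq[OF H(3) _ _ X]) (simp add: P h N.pure_add_right gmodule_hom_closed[OF f] gmodule_hom_closed[OF g])
qed

lemma tensor_map_inverse:
  assumes "right_acted \<Gamma> A" "left_module \<Gamma> M" "left_module \<Gamma> N"
    and f: "gmodule_hom \<Gamma> M N f"
    and h: "\<And>x. x \<in> carrier M \<Longrightarrow> h x = inv\<^bsub>N\<^esub> f x" and X: "X \<in> carrier (tensor \<Gamma> A M)"
  shows "tensor_map \<Gamma> A N h X = inv\<^bsub>tensor \<Gamma> A N\<^esub> tensor_map \<Gamma> A N f X"
proof -
  interpret N: tensor_pair \<Gamma> A N using assms by (simp add: tensor_pairI)
  have hh: "gmodule_hom \<Gamma> M N h"
    using gmodule_hom_cong[OF gmodule_hom_inverse[OF assms(3) f] assms(2)] h by blast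
  have "tensor_map \<Gamma> A N (\<lambda>x. \<one>\<^bsub>N\<^esub>) X = tensor_map \<Gamma> A N h X \<otimes>\<^bsub>tensor \<Gamma> A N\<^esub> tensor_map \<Gamma> A N f X"
    by (rule tensor_map_times[OF assms(1-3) hh f _ X]) (simp add: h gmodule_hom_closed[OF f])
  then have "tensor_map \<Gamma> A N h X \<otimes>\<^bsub>tensor \<Gamma> A N\<^esub> tensor_map \<Gamma> A N f X = \<one>\<^bsub>tensor \<Gamma> A N\<^esub>"
    using tensor_map_trivial[OF assms(1-3) gmodule_hom_trivial[OF assms(3)] refl X] by simp
  then show ?thesis
    using N.T.inv_equality[of "tensor_map \<Gamma> A N h X" "tensor_map \<Gamma> A N f X"]
      tensor_map_closed[OF assms(1-3) f X] tensor_map_closed[OF assms(1-3) hh X] by simp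
qed

text \<open>An inverse of the map induced by p is built on the cokernel: the tensor of a and y goes
  to the class of the tensor of a and any preimage of y under p. Two preimages differ by an image of
  f, so modulo the image I the choice is immaterial.\<close>

lemma tensor_right_exact:
  assumes A: "right_acted \<Gamma> A" and M: "left_module \<Gamma> M" and N: "left_module \<Gamma> N" and L: "left_module \<Gamma> L"
    and f: "gmodule_hom \<Gamma> M N f" and p: "gmodule_hom \<Gamma> N L p" and surj: "p ` carrier N = carrier L"
    and ex: "\<And>x. \<lbrakk>x \<in> carrier N; p x = \<one>\<^bsub>L\<^esub>\<rbrakk> \<Longrightarrow> x \<in> f ` carrier M"
    and X: "X \<in> carrier (tensor \<Gamma> A N)" and X1: "tensor_map \<Gamma> A L p X = \<one>\<^bsub>tensor \<Gamma> A L\<^esub>"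
  shows "X \<in> tensor_map \<Gamma> A N f ` carrier (tensor \<Gamma> A M)"
proof -
  interpret TM: tensor_pair \<Gamma> A M using A M by (simp add: tensor_pairI)
  interpret TN: tensor_pair \<Gamma> A N using A N by (simp add: tensor_pairI)
  interpret TL: tensor_pair \<Gamma> A L using A L by (simp add: tensor_pairI)
  define I where "I = tensor_map \<Gamma> A N f ` carrier (tensor \<Gamma> A M)"
  have I: "subgroup I TN.T"
    unfolding I_def using TN.T.image_hom_subgroup[OF tensor_map_hom[OF A M N f] TM.T.is_group] .
  define Q where "Q = TN.T Mod I"
  have Q: "comm_group Q"
    unfolding Q_def using TN.T.abelian_FactGroup[OF I] .
  interpret Q: comm_group Q by (rule Q)
  define cl where "cl = (\<lambda>X. I #>\<^bsub>TN.T\<^esub> X)"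
  have cl: "cl \<in> hom TN.T Q"
    unfolding cl_def Q_def by (rule TN.T.quotient_hom[OF I])
  \<comment> \<open>A section of p as a map of sets. It need not be additive or linear, but
    \<open>eq\<close> below makes it so modulo I.\<close>
  define s where "s = inv_into (carrier N) p"
  have s: "s y \<in> carrier N" "p (s y) = y" if "y \<in> carrier L" for y
    using that unfolding s_def surj[symmetric] by (auto intro: inv_into_into f_inv_into_f)
  have eq: "cl (TN.pt a x) = cl (TN.pt a y)"
    if "a \<in> carrier A" "x \<in> carrier N" "y \<in> carrier N" "p x = p y" for a x y
  proof -
    have "x \<otimes>\<^bsub>N\<^esub> inv\<^bsub>N\<^esub> y \<in> f ` carrier M"
      using that by (intro ex) (simp_all add: gmodule_hom_mult[OF p] gmodule_hom_inv[OF p N L]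
          gmodule_hom_closed[OF p] TL.B.r_inv)
    then obtain z where z: "z \<in> carrier M" "x \<otimes>\<^bsub>N\<^esub> inv\<^bsub>N\<^esub> y = f z"
      by auto
    have "TN.pt a (f z) \<in> I"
      unfolding I_def using tensor_map_pure[OF A M N f that(1) z(1)] TM.pure_closed[OF that(1) z(1)] by (metis imageI)
    moreover have "TN.pt a (f z) = TN.pt a x \<otimes>\<^bsub>TN.T\<^esub> inv\<^bsub>TN.T\<^esub> TN.pt a y"
      unfolding z(2)[symmetric] using that
      by (simp add: TN.pure_add_right hom_inv'[OF TN.pure_hom_right TN.B.is_group TN.T.is_group])
    ultimately show ?thesis
      unfolding cl_def using TN.T.quotient_eq_iff[OF I] that TN.pure_closed by simp
  qed
  have b: "balanced \<Gamma> A L Q (\<lambda>a y. cl (TN.pt a (s y)))"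
  proof (rule balancedI)
    fix a b b' assume *: "a \<in> carrier A" "b \<in> carrier L" "b' \<in> carrier L"
    have "cl (TN.pt a (s (b \<otimes>\<^bsub>L\<^esub> b'))) = cl (TN.pt a (s b \<otimes>\<^bsub>N\<^esub> s b'))"
      using * s by (intro eq) (simp_all add: gmodule_hom_mult[OF p])
    then show "cl (TN.pt a (s (b \<otimes>\<^bsub>L\<^esub> b'))) = cl (TN.pt a (s b)) \<otimes>\<^bsub>Q\<^esub> cl (TN.pt a (s b'))"
      using * s by (simp add: TN.pure_add_right hom_mult[OF cl] TN.pure_closed)
  next
    fix \<xi> a b assume *: "\<xi> \<in> groupoid_ring \<Gamma>" "a \<in> carrier A" "b \<in> carrier L"
    have "cl (TN.pt a (s (act L \<xi> b))) = cl (TN.pt a (act N \<xi> (s b)))"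
      using * s by (intro eq) (simp_all add: gmodule_hom_act[OF p] TL.B.act_closed TN.B.act_closed)
    then show "cl (TN.pt (act A \<xi> a) (s b)) = cl (TN.pt a (s (act L \<xi> b)))"
      using * s by (simp add: TN.pure_act)
  qed (use s in \<open>simp_all add: TN.pure_add_left hom_mult[OF cl] hom_in_carrier[OF cl] TN.pure_closed\<close>)
  let ?\<phi> = "tensor_lift Q (\<lambda>a y. cl (TN.pt a (s y)))"
  have \<phi>: "?\<phi> \<in> hom TL.T Q"
    by (rule TL.tensor_lift_hom[OF Q b])
  \<comment> \<open>The lift undoes p up to I, so an X killed by p has trivial class and therefore
    lies in I.\<close>
  have "(\<lambda>X. ?\<phi> (tensor_map \<Gamma> A L p X)) \<in> hom TN.T Q"
    using hom_compose[OF tensor_map_hom[OF A N L p] \<phi>] by (simp add: o_def)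
  then have "?\<phi> (tensor_map \<Gamma> A L p X) = cl X"
  proof (rule TN.tensor_hom_eq[OF _ cl _ X])
    fix a b assume ab: "a \<in> carrier A" "b \<in> carrier N"
    then have "p b \<in> carrier L"
      by (simp add: gmodule_hom_closed[OF p])
    then show "?\<phi> (tensor_map \<Gamma> A L p (TN.pt a b)) = cl (TN.pt a b)"
      using ab eq[OF ab(1) s(1) ab(2) s(2)]
      by (simp add: tensor_map_pure[OF A N L p] TL.tensor_lift_pure[OF Q b])
  qed
  then have "cl X = \<one>\<^bsub>Q\<^esub>"
    using X1 hom_one[OF \<phi> TL.T.is_group Q.is_group] by simp
  then have "X \<in> I"
    using TN.T.quotient_one_iff[OF I X] by (simp add: Q_def cl_def)
  then show ?thesis
    by (simp add: I_def)
qed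

section \<open>Sums with finite support\<close>

text \<open>\<open>sum'\<close> returns 0 on infinite support, so Fubini asks for finite support of
  the whole family; finiteness of each row and of the set of nonzero rows follows from it.\<close>

lemma sum'_Sigma:
  fixes f :: "'a \<Rightarrow> 'b \<Rightarrow> int"
  assumes fin: "finite {z \<in> Sigma A B. f (fst z) (snd z) \<noteq> 0}"
  shows "sum' (\<lambda>x. sum' (f x) (B x)) A = sum' (\<lambda>z. f (fst z) (snd z)) (Sigma A B)"
proof -
  define S where "S = {z \<in> Sigma A B. f (fst z) (snd z) \<noteq> 0}"
  have finS: "finite S"
    using fin by (simp add: S_def)
  have slice: "finite {y. (x, y) \<in> S}" for x
  proof (rule finite_subset)
    show "{y. (x, y) \<in> S} \<subseteq> snd ` S"
      by force
  qed (use finS in simp)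
  have inner: "sum' (f x) (B x) = sum (f x) {y. (x, y) \<in> S}" if "x \<in> A" for x
  proof -
    have "{y \<in> B x. f x y \<noteq> 0} = {y. (x, y) \<in> S}"
      using that by (auto simp: S_def)
    then show ?thesis
      using slice[of x] by (simp add: sum.G_def)
  qed
  have "sum' (\<lambda>x. sum' (f x) (B x)) A = sum' (\<lambda>x. sum (f x) {y. (x, y) \<in> S}) (fst ` S)"
  proof (rule sum.mono_neutral_cong_right')
    show SA: "fst ` S \<subseteq> A"
      by (auto simp: S_def)
    show "\<forall>i\<in>A - fst ` S. sum' (f i) (B i) = 0"
    proof
      fix i assume i: "i \<in> A - fst ` S"
      then have "{y. (i, y) \<in> S} = {}"
        by (auto simp: image_iff)
      then show "sum' (f i) (B i) = 0"
        using inner[of i] i by simp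
    qed
    show "sum' (f x) (B x) = sum (f x) {y. (x, y) \<in> S}" if "x \<in> fst ` S" for x
      using inner SA that by blast
  qed
  also have "\<dots> = (\<Sum>x\<in>fst ` S. sum (f x) {y. (x, y) \<in> S})"
    using finS by simp
  also have "\<dots> = (\<Sum>z\<in>Sigma (fst ` S) (\<lambda>x. {y. (x, y) \<in> S}). f (fst z) (snd z))"
    using sum.Sigma[of "fst ` S" "\<lambda>x. {y. (x, y) \<in> S}" f] finS slice by (simp add: case_prod_unfold)
  also have "Sigma (fst ` S) (\<lambda>x. {y. (x, y) \<in> S}) = S"
    by force
  finally show ?thesis
    using finS unfolding sum.G_def S_def[symmetric] by simp
qed

lemma sum'_reindex:
  fixes g :: "'b \<Rightarrow> int"
  assumes "bij_betw h A B"
  shows "sum' g B = sum' (\<lambda>x. g (h x)) A"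
proof -
  have *: "bij_betw h {x \<in> A. g (h x) \<noteq> 0} {y \<in> B. g y \<noteq> 0}"
    using assms by (auto simp: bij_betw_def inj_on_def)
  show ?thesis
    using sum.reindex_bij_betw[OF *, of g] bij_betw_finite[OF *] by (simp add: sum.G_def)
qed

lemma sum'_mult_left:
  fixes c :: int
  shows "c * sum' f A = sum' (\<lambda>x. c * f x) A"
  by (cases "c = 0") (auto simp: sum.G_def sum_distrib_left)

lemma sum'_mult_right:
  fixes c :: int
  shows "sum' f A * c = sum' (\<lambda>x. f x * c) A"
  using sum'_mult_left[of c f A] by (simp add: mult.commute)

lemma sum'_uminus:
  fixes f :: "'a \<Rightarrow> int"
  shows "sum' (\<lambda>x. - f x) A = - sum' f A"
  using sum'_mult_left[of "-1" f A] by simp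

lemma sum'_single:
  fixes f :: "'a \<Rightarrow> int"
  assumes "a \<in> A" "\<And>x. \<lbrakk>x \<in> A; x \<noteq> a\<rbrakk> \<Longrightarrow> f x = 0"
  shows "sum' f A = f a"
  using sum.mono_neutral_right'[of "{a}" A f] assms by simp

lemma sum'_zero:
  fixes f :: "'a \<Rightarrow> int"
  assumes "\<And>x. x \<in> A \<Longrightarrow> f x = 0"
  shows "sum' f A = 0"
  using sum.mono_neutral_right'[of "{}" A f] assms by simp

section \<open>Compact open sets\<close>

abbreviation ind :: "'x set \<Rightarrow> 'x \<Rightarrow> int" where
  "ind V \<equiv> (\<lambda>x. of_bool (x \<in> V))"

text \<open>The Hausdorff clause keeps intersections and differences inside V well behaved when X
  itself is not Hausdorff.\<close>

definition compact_open :: "'x topology \<Rightarrow> 'x set \<Rightarrow> bool" where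
  "compact_open X V \<longleftrightarrow> openin X V \<and> compactin X V \<and> Hausdorff_space (subtopology X V)"

lemma compact_open_subset:
  assumes "compact_open X V" "openin X W" "W \<subseteq> V" "closedin (subtopology X V) W"
  shows "compact_open X W"
proof -
  have "compactin (subtopology X V) W"
    using closed_compactin[of "subtopology X V" V W] assms by (simp add: compact_open_def compactin_subtopology)
  moreover have "Hausdorff_space (subtopology X W)"
    using Hausdorff_space_subtopology[of "subtopology X V" W] assms(1,3)
    by (simp add: compact_open_def subtopology_subtopology inf_absorb2)
  ultimately show ?thesis
    using assms(2) by (simp add: compact_open_def compactin_subtopology)
qed

lemma compact_open_closedin:
  assumes "compact_open X V" "compactin X K" "K \<subseteq> V"
  shows "closedin (subtopology X V) K"
  using assms by (intro compactin_imp_closedin) (auto simp: compact_open_def compactin_subtopology)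

text \<open>Compact sets are closed relative to a Hausdorff set, hence the common superset V: in a
  non-Hausdorff space two compact open sets can meet in a set that is not compact.\<close>

lemma compact_open_Int:
  assumes "compact_open X V" "compact_open X K" "compact_open X L" "K \<subseteq> V" "L \<subseteq> V"
  shows "compact_open X (K \<inter> L)"
proof -
  have "closedin (subtopology X V) (K \<inter> L)"
    using assms by (intro closedin_Int compact_open_closedin) (auto simp: compact_open_def)
  then show ?thesis
    using assms by (intro compact_open_subset[OF assms(1)]) (auto simp: compact_open_def)
qed

lemma compact_open_Diff:
  assumes "compact_open X V" "compact_open X K" "compact_open X L" "K \<subseteq> V" "L \<subseteq> V"
  shows "compact_open X (K - L)"
proof -
  have c: "closedin (subtopology X V) K" "closedin (subtopology X V) L"
    using assms by (auto intro: compact_open_closedin simp: compact_open_def)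
  have o: "openin (subtopology X V) K" "openin (subtopology X V) L"
    using assms by (auto simp: openin_open_subtopology compact_open_def)
  have "closedin (subtopology X V) (K - L)" "openin (subtopology X V) (K - L)"
    using c o by (auto intro: closedin_diff openin_diff)
  then show ?thesis
    using assms by (intro compact_open_subset[OF assms(1)]) (auto simp: compact_open_def openin_open_subtopology)
qed

lemma ind_Cc:
  assumes "compact_open X V"
  shows "ind V \<in> Cc X V"
proof -
  have V: "V \<subseteq> topspace X"
    using assms by (auto simp: compact_open_def openin_subset)
  have "continuous_map (subtopology X V) (discrete_topology UNIV) (ind V)"
    by (rule continuous_map_eq[of _ _ "\<lambda>x. 1"]) auto
  moreover have "{x. ind V x \<noteq> 0} = topspace (subtopology X V)"
    using V by auto
  then have "subtopology X V closure_of {x. ind V x \<noteq> 0} = V"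
    using V by (simp only: closure_of_topspace) auto
  ultimately show ?thesis
    using assms by (auto simp: Cc_def compact_open_def compactin_subtopology)
qed

lemma int_functionsI:
  assumes "openin X U" "Hausdorff_space (subtopology X U)" "f \<in> Cc X U"
  shows "f \<in> int_functions X"
  unfolding int_functions_def using assms by (intro CollectI exI[of _ "1::nat"] exI[of _ "\<lambda>_. f"]) auto

lemma ind_int_functions: "compact_open X V \<Longrightarrow> ind V \<in> int_functions X"
  using ind_Cc by (intro int_functionsI) (auto simp: compact_open_def)

lemma int_functions_zero [simp]: "(\<lambda>x. 0) \<in> int_functions X"
  unfolding int_functions_def by (intro CollectI exI[of _ "0::nat"]) auto

lemma int_functions_add:
  assumes "f \<in> int_functions X" "g \<in> int_functions X"
  shows "(\<lambda>x. f x + g x) \<in> int_functions X"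
proof -
  obtain k and F where F: "f = (\<lambda>x. \<Sum>i<(k::nat). F i x)"
    "\<forall>i<k. \<exists>U. openin X U \<and> Hausdorff_space (subtopology X U) \<and> F i \<in> Cc X U"
    using assms(1) unfolding int_functions_def by blast
  obtain l and G where G: "g = (\<lambda>x. \<Sum>i<(l::nat). G i x)"
    "\<forall>i<l. \<exists>U. openin X U \<and> Hausdorff_space (subtopology X U) \<and> G i \<in> Cc X U"
    using assms(2) unfolding int_functions_def by blast
  define E where "E = (\<lambda>i. if i < k then F i else G (i - k))"
  have "(\<Sum>i<k+l. E i x) = (\<Sum>i<k. F i x) + (\<Sum>i<l. G i x)" for x
  proof -
    have "(\<Sum>i<k+l. E i x) = (\<Sum>i<k. E i x) + (\<Sum>i\<in>{k..<k+l}. E i x)"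
      by (metis (no_types, lifting) atLeast0LessThan le_add1 le_add2 sum.atLeastLessThan_concat zero_le)
    also have "(\<Sum>i\<in>{k..<k+l}. E i x) = (\<Sum>i\<in>{0..<l}. E (i + k) x)"
      using sum.shift_bounds_nat_ivl[of "\<lambda>i. E i x" 0 k l] by (simp add: add.commute)
    finally show ?thesis
      by (simp add: E_def atLeast0LessThan)
  qed
  moreover have "\<forall>i<k+l. \<exists>U. openin X U \<and> Hausdorff_space (subtopology X U) \<and> E i \<in> Cc X U"
    using F(2) G(2) unfolding E_def by auto
  ultimately show ?thesis
    unfolding int_functions_def F(1) G(1) by (intro CollectI exI[of _ "k + l"] exI[of _ E]) auto
qed

lemma Cc_outside: "f \<in> Cc X U \<Longrightarrow> x \<notin> U \<Longrightarrow> f x = 0"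
  by (simp add: Cc_def)

lemma int_functions_outside:
  assumes "f \<in> int_functions X" "x \<notin> topspace X"
  shows "f x = 0"
proof -
  obtain k and F where F: "f = (\<lambda>x. \<Sum>i<(k::nat). F i x)"
    "\<forall>i<k. \<exists>U. openin X U \<and> Hausdorff_space (subtopology X U) \<and> F i \<in> Cc X U"
    using assms(1) unfolding int_functions_def by blast
  have "F i x = 0" if "i < k" for i
    using F(2) that assms(2) openin_subset Cc_outside by (metis subsetD)
  then show ?thesis
    by (simp add: F(1))
qed

text \<open>f is locally constant on U, so the level set is clopen in U. As n is not 0, it is a
  closed part of the compact closure of the support, hence compact.\<close>

lemma Cc_level_set:
  assumes "openin X U" "Hausdorff_space (subtopology X U)" "f \<in> Cc X U" "n \<noteq> 0"
  shows "compact_open X {x. f x = n}"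
proof -
  have U: "U \<subseteq> topspace X"
    using assms(1) by (rule openin_subset)
  let ?S = "subtopology X U" and ?V = "{x. f x = n}"
  have f: "continuous_map ?S (discrete_topology UNIV) f"
    and K: "compactin ?S (?S closure_of {x. f x \<noteq> 0})" and out: "\<And>x. x \<notin> U \<Longrightarrow> f x = 0"
    using assms(3) by (auto simp: Cc_def)
  have eq: "?V = {x \<in> topspace ?S. f x \<in> {n}}"
    using U out assms(4) by auto
  have o: "openin ?S ?V" and c: "closedin ?S ?V"
    unfolding eq by (rule openin_continuous_map_preimage[OF f] closedin_continuous_map_preimage[OF f], simp)+
  have "?V \<subseteq> ?S closure_of {x. f x \<noteq> 0}"
  proof -
    have "{x. f x \<noteq> 0} \<subseteq> topspace ?S"
      using U out by auto
    then have "{x. f x \<noteq> 0} \<subseteq> ?S closure_of {x. f x \<noteq> 0}"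
      by (rule closure_of_subset)
    then show ?thesis
      using assms(4) by auto
  qed
  then have "compactin ?S ?V"
    using closed_compactin[OF K _ c] by simp
  moreover have "?V \<subseteq> U"
    using out assms(4) by auto
  ultimately show ?thesis
    using o assms(1,2) Hausdorff_space_subtopology[of ?S ?V]
    by (auto simp: compact_open_def compactin_subtopology openin_open_subtopology subtopology_subtopology inf_absorb2)
qed

text \<open>A member of \<open>Cc X U\<close> has finitely many values, so it is the sum, over its
  nonzero values n, of n times the indicator of the compact open level set at n.\<close>

lemma int_functions_induct [consumes 1, case_names zero add uminus ind]:
  assumes "f \<in> int_functions X"
    and zero: "P (\<lambda>x. 0)"
    and add: "\<And>f g. \<lbrakk>f \<in> int_functions X; g \<in> int_functions X; P f; P g\<rbrakk> \<Longrightarrow> P (\<lambda>x. f x + g x)"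
    and uminus: "\<And>f. \<lbrakk>f \<in> int_functions X; P f\<rbrakk> \<Longrightarrow> P (\<lambda>x. - f x)"
    and ind: "\<And>V. compact_open X V \<Longrightarrow> P (ind V)"
  shows "P f"
proof -
  text \<open>Closure under negation is not available yet, so the induction carries it along.\<close>
  define Q where "Q = (\<lambda>f. f \<in> int_functions X \<and> (\<lambda>x. - f x) \<in> int_functions X \<and> P f)"
  have Q0: "Q (\<lambda>x. 0)"
    using zero by (simp add: Q_def)
  have Qadd: "Q (\<lambda>x. f x + g x)" if "Q f" "Q g" for f g
    using that add int_functions_add[of f X g] int_functions_add[of "\<lambda>x. - f x" X "\<lambda>x. - g x"]
    by (simp add: Q_def)
  have Quminus: "Q (\<lambda>x. - f x)" if "Q f" for f
    using that uminus by (simp add: Q_def)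
  have uminus_Cc: "(\<lambda>x. - f x) \<in> Cc X U" if "f \<in> Cc X U" for f U
  proof -
    have "continuous_map (subtopology X U) (discrete_topology UNIV) (uminus \<circ> f)"
      using that by (intro continuous_map_compose[of _ "discrete_topology UNIV"]) (auto simp: Cc_def)
    then show ?thesis
      using that by (simp add: Cc_def o_def)
  qed
  have Qind: "Q (ind V)" if "compact_open X V" for V
    using that ind ind_int_functions[OF that] int_functionsI[OF _ _ uminus_Cc[OF ind_Cc[OF that]]]
    by (auto simp: Q_def compact_open_def)
  have Qscale: "Q (\<lambda>x. n * f x)" if "Q f" for n :: int and f
  proof (cases n)
    case (nonneg m)
    have "Q (\<lambda>x. int m * f x)" for m
      by (induction m) (use Q0 Qadd[OF that] in \<open>simp_all add: distrib_right\<close>)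
    then show ?thesis using nonneg by simp
  next
    case (neg m)
    have "Q (\<lambda>x. int m * f x)" for m
      by (induction m) (use Q0 Qadd[OF that] in \<open>simp_all add: distrib_right\<close>)
    moreover have "(\<lambda>x. n * f x) = (\<lambda>x. - (int (Suc m) * f x))"
      unfolding neg by (simp add: fun_eq_iff algebra_simps)
    ultimately show ?thesis using Quminus by metis
  qed
  have Qsum: "Q (\<lambda>x. \<Sum>i\<in>I. F i x)" if "finite I" "\<And>i. i \<in> I \<Longrightarrow> Q (F i)" for I :: "'i set" and F
    using that by (induction I rule: finite_induct) (auto simp: Q0 Qadd)
  have QCc: "Q f" if f: "f \<in> Cc X U" "openin X U" "Hausdorff_space (subtopology X U)" for f U
  proof -
    let ?S = "subtopology X U"
    \<comment> \<open>Finite as a part of the image of a compact set in a discrete space; removing 0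
      keeps the level sets inside the support.\<close>
    define N where "N = f ` (?S closure_of {x. f x \<noteq> 0}) - {0}"
    have "compactin (discrete_topology UNIV) (f ` (?S closure_of {x. f x \<noteq> 0}))"
      using f by (intro image_compactin) (auto simp: Cc_def)
    then have N: "finite N"
      by (simp add: N_def compactin_discrete_topology)
    have "{x. f x \<noteq> 0} \<subseteq> ?S closure_of {x. f x \<noteq> 0}"
      using f openin_subset[OF f(2)] by (intro closure_of_subset) (auto simp: Cc_def)
    then have "f x \<in> N" if "f x \<noteq> 0" for x
      using that by (auto simp: N_def)
    then have "f x = (\<Sum>n\<in>N. n * ind {x. f x = n} x)" for x
      using N sum.delta[OF N, of "f x" "\<lambda>n. n"] by (cases "f x = 0")
        (auto simp: N_def of_bool_def if_distrib[of "\<lambda>t. _ * t"] cong: if_cong)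
    then have "f = (\<lambda>x. \<Sum>n\<in>N. n * ind {x. f x = n} x)"
      by blast
    moreover have "Q (\<lambda>x. \<Sum>n\<in>N. n * ind {x. f x = n} x)"
      using N Cc_level_set[OF f(2,3,1)] by (intro Qsum Qscale Qind) (auto simp: N_def)
    ultimately show ?thesis
      by simp
  qed
  obtain k and F where F: "f = (\<lambda>x. \<Sum>i<(k::nat). F i x)"
    "\<forall>i<k. \<exists>U. openin X U \<and> Hausdorff_space (subtopology X U) \<and> F i \<in> Cc X U"
    using assms(1) unfolding int_functions_def by blast
  have "Q f"
    unfolding F(1) using F(2) QCc by (intro Qsum) auto
  then show ?thesis
    by (simp add: Q_def)
qed

lemma int_functions_uminus:
  assumes "f \<in> int_functions X"
  shows "(\<lambda>x. - f x) \<in> int_functions X"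
proof -
  have Cc: "(\<lambda>x. - g x) \<in> Cc X U" if "g \<in> Cc X U" for g U
  proof -
    have "continuous_map (subtopology X U) (discrete_topology UNIV) (uminus \<circ> g)"
      using that by (intro continuous_map_compose[of _ "discrete_topology UNIV"]) (auto simp: Cc_def)
    then show ?thesis
      using that by (simp add: Cc_def o_def)
  qed
  from assms show ?thesis
  proof (induction rule: int_functions_induct)
    case (add f g)
    then show ?case
      using int_functions_add[of "\<lambda>x. - f x" X "\<lambda>x. - g x"] by simp
  next
    case (ind V)
    then show ?case
      using int_functionsI[OF _ _ Cc[OF ind_Cc[OF ind]]] by (auto simp: compact_open_def)
  qed auto
qed

lemma int_functions_diff:
  "\<lbrakk>f \<in> int_functions X; g \<in> int_functions X\<rbrakk> \<Longrightarrow> (\<lambda>x. f x - g x) \<in> int_functions X"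
  using int_functions_add[of f X "\<lambda>x. - g x"] int_functions_uminus[of g X] by simp

text \<open>The second clause, heredity for open subsets, allows a finite cover by good sets to be
  refined to a disjoint one.\<close>

definition has_base :: "'x topology \<Rightarrow> ('x set \<Rightarrow> bool) \<Rightarrow> bool" where
  "has_base X good \<longleftrightarrow> (\<forall>U x. openin X U \<and> x \<in> U \<longrightarrow> (\<exists>K. compact_open X K \<and> good K \<and> x \<in> K \<and> K \<subseteq> U)) \<and>
     (\<forall>K W. good K \<and> openin X W \<and> W \<subseteq> K \<longrightarrow> good W)"

text \<open>A compact V is covered by finitely many good sets, which are then made disjoint:
  differences taken inside the Hausdorff set V remain compact and open, and heredity keeps the
  pieces good.\<close>

lemma int_functions_induct_base [consumes 2, case_names zero add uminus ind]:
  assumes "f \<in> int_functions X" and base: "has_base X good"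
    and zero: "P (\<lambda>x. 0)"
    and add: "\<And>f g. \<lbrakk>f \<in> int_functions X; g \<in> int_functions X; P f; P g\<rbrakk> \<Longrightarrow> P (\<lambda>x. f x + g x)"
    and uminus: "\<And>f. \<lbrakk>f \<in> int_functions X; P f\<rbrakk> \<Longrightarrow> P (\<lambda>x. - f x)"
    and ind: "\<And>V. \<lbrakk>compact_open X V; good V\<rbrakk> \<Longrightarrow> P (ind V)"
  shows "P f"
  using assms(1)
proof (induction rule: int_functions_induct)
  case (ind V)
  define \<K> where "\<K> = {K. compact_open X K \<and> good K \<and> K \<subseteq> V}"
  have "V \<subseteq> \<Union>\<K>"
    using base ind unfolding has_base_def \<K>_def compact_open_def by blast
  then obtain \<F> where \<F>: "finite \<F>" "\<F> \<subseteq> \<K>" "V \<subseteq> \<Union>\<F>"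
    using ind unfolding compact_open_def compactin_def \<K>_def by (metis (no_types, lifting) mem_Collect_eq)
  \<comment> \<open>Generalised from V to its compact open subsets W, since splitting off the part
    of W in K leaves W - K, which is covered by one set less.\<close>
  have "P (ind W)" if "compact_open X W" "W \<subseteq> V" "W \<subseteq> \<Union>\<F>" for W
    using \<F>(1,2) that
  proof (induction \<F> arbitrary: W rule: finite_induct)
    case empty
    then show ?case using zero by simp
  next
    case (insert K \<F>)
    have K: "compact_open X K" "good K" "K \<subseteq> V"
      using insert.prems by (auto simp: \<K>_def)
    have 1: "compact_open X (W \<inter> K)" "compact_open X (W - K)"
      using compact_open_Int[OF ind insert.prems(2) K(1) insert.prems(3) K(3)]
        compact_open_Diff[OF ind insert.prems(2) K(1) insert.prems(3) K(3)] by auto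
    then have "good (W \<inter> K)"
      using base K unfolding has_base_def compact_open_def by blast
    then have "P (ind (W \<inter> K))"
      using assms(6) 1 by blast
    moreover have "P (ind (W - K))"
      using insert 1(2) by (intro insert.IH) auto
    moreover have "ind W = (\<lambda>x. ind (W \<inter> K) x + ind (W - K) x)"
      by auto
    ultimately show ?case
      using add[OF ind_int_functions ind_int_functions] 1 by metis
  qed
  then show ?case
    using ind \<F>(3) by blast
qed (auto intro: assms)

text \<open>In a locally compact Hausdorff space a compact component has arbitrarily small clopen
  neighbourhoods, and here the components are points. A clopen set inside the compact L is
  compact.\<close>

lemma totally_disconnected_has_base:
  assumes "locally_compact_space X" "Hausdorff_space X" "totally_disconnected_space X"
  shows "has_base X (\<lambda>K. True)"
  unfolding has_base_def
proof (intro conjI allI impI; (elim conjE)?)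
  fix U x assume U: "openin X U" "x \<in> U"
  then have xX: "x \<in> topspace X"
    using openin_subset by blast
  obtain N L where NL: "openin X N" "compactin X L" "x \<in> N" "N \<subseteq> L"
    using assms(1) xX unfolding locally_compact_space_def by blast
  have "connected_component_of_set X x = {x}"
  proof -
    obtain a where "connected_component_of_set X x \<subseteq> {a}"
      using assms(3) connectedin_connected_component_of[of X x] unfolding totally_disconnected_space_def by blast
    moreover have "x \<in> connected_component_of_set X x"
      using xX by (simp add: connected_component_of_refl)
    ultimately show ?thesis by blast
  qed
  then have c: "{x} \<in> connected_components_of X"
    using xX unfolding connected_components_of_def by (metis imageI)
  have "openin X (U \<inter> N)" "{x} \<subseteq> U \<inter> N" "compactin X {x}"
    using U NL xX by auto
  from wilder_locally_compact_component_thm[OF assms(1,2) c this(3,1,2)]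
  obtain V W where VW: "openin X V" "openin X W" "disjnt V W" "V \<union> W = topspace X" "{x} \<subseteq> V" "V \<subseteq> U \<inter> N"
    by blast
  have "V = topspace X - W"
    using VW openin_subset[OF VW(1)] by (auto simp: disjnt_def)
  then have "closedin X V"
    using VW by blast
  then have "compactin X V"
    using closed_compactin[OF NL(2)] VW NL by blast
  then show "\<exists>K. compact_open X K \<and> True \<and> x \<in> K \<and> K \<subseteq> U"
    using VW Hausdorff_space_subtopology[OF assms(2)] by (intro exI[of _ V]) (auto simp: compact_open_def)
qed auto

section \<open>Local homeomorphisms\<close>

definition sheet :: "'x topology \<Rightarrow> 'y topology \<Rightarrow> ('x \<Rightarrow> 'y) \<Rightarrow> 'x set \<Rightarrow> bool" where
  "sheet X Y f U \<longleftrightarrow> openin X U \<and> openin Y (f ` U) \<and>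
     homeomorphic_map (subtopology X U) (subtopology Y (f ` U)) f"

lemma local_homeomorphism_sheet:
  "local_homeomorphism X Y f \<Longrightarrow> x \<in> topspace X \<Longrightarrow> \<exists>U. sheet X Y f U \<and> x \<in> U"
  unfolding local_homeomorphism_def sheet_def by blast

lemma sheet_subset:
  assumes "sheet X Y f U" "openin X V" "V \<subseteq> U"
  shows "sheet X Y f V"
proof -
  have h: "homeomorphic_map (subtopology X U) (subtopology Y (f ` U)) f" and U: "openin X U" "openin Y (f ` U)"
    using assms by (auto simp: sheet_def)
  have "openin (subtopology X U) V"
    using assms U by (simp add: openin_open_subtopology)
  then have "openin (subtopology Y (f ` U)) (f ` V)"
    using homeomorphic_imp_open_map[OF h] by (simp add: open_map_def)
  then have 1: "openin Y (f ` V)"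
    using U by (simp add: openin_open_subtopology)
  have "homeomorphic_map (subtopology (subtopology X U) V) (subtopology (subtopology Y (f ` U)) (f ` V)) f"
  proof (rule homeomorphic_map_subtopologies[OF h])
    show "f ` (topspace (subtopology X U) \<inter> V) = topspace (subtopology Y (f ` U)) \<inter> f ` V"
      using assms openin_subset[OF assms(2)] openin_subset[OF U(2)] by auto
  qed
  moreover have "f ` U \<inter> f ` V = f ` V" "U \<inter> V = V"
    using assms(3) by auto
  ultimately show ?thesis
    using 1 assms(2) by (simp add: sheet_def subtopology_subtopology)
qed

lemma sheet_inj_on: "sheet X Y f U \<Longrightarrow> inj_on f U"
  unfolding sheet_def using homeomorphic_imp_injective_map openin_subset
  by (metis topspace_subtopology_subset)

lemma sheet_inverse:
  assumes "sheet X Y f U"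
  obtains g where "continuous_map (subtopology Y (f ` U)) X g" "\<And>x. x \<in> U \<Longrightarrow> g (f x) = x"
    "\<And>y. y \<in> f ` U \<Longrightarrow> g y \<in> U" "\<And>y. y \<in> f ` U \<Longrightarrow> f (g y) = y"
proof -
  have U: "U \<subseteq> topspace X" "f ` U \<subseteq> topspace Y"
    using assms by (auto simp: sheet_def dest: openin_subset)
  obtain g where g: "homeomorphic_maps (subtopology X U) (subtopology Y (f ` U)) f g"
    using assms unfolding sheet_def homeomorphic_map_maps by blast
  then have "continuous_map (subtopology Y (f ` U)) X g" "\<And>x. x \<in> U \<Longrightarrow> g (f x) = x"
    using U by (auto simp: homeomorphic_maps_def continuous_map_in_subtopology)
  then show thesis
    by (intro that[of g]) auto
qed

text \<open>Compact open sets of Y inside the image of a sheet are transported back by the inverse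
  of f there. The result is Hausdorff because f maps it injectively into the Hausdorff space Y, even
  if X is not Hausdorff.\<close>

lemma has_base_local_homeomorphism:
  assumes f: "local_homeomorphism X Y f" and Y: "has_base Y (\<lambda>K. True)" and H: "Hausdorff_space Y"
  shows "has_base X (sheet X Y f)"
  unfolding has_base_def
proof (intro conjI allI impI; (elim conjE)?)
  fix U x assume U: "openin X U" "x \<in> U"
  then obtain V where V: "sheet X Y f V" "x \<in> V"
    using local_homeomorphism_sheet[OF f] openin_subset by blast
  define W where "W = U \<inter> V"
  have W: "sheet X Y f W" "x \<in> W" "W \<subseteq> topspace X"
    using sheet_subset[OF V(1), of W] U V openin_subset[OF U(1)] unfolding W_def sheet_def by auto
  obtain g where g: "continuous_map (subtopology Y (f ` W)) X g" "\<And>x. x \<in> W \<Longrightarrow> g (f x) = x"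
    "\<And>y. y \<in> f ` W \<Longrightarrow> g y \<in> W" "\<And>y. y \<in> f ` W \<Longrightarrow> f (g y) = y"
    using sheet_inverse[OF W(1)] by blast
  have oW: "openin X W" "openin Y (f ` W)"
    using W by (auto simp: sheet_def)
  obtain K where K: "compact_open Y K" "f x \<in> K" "K \<subseteq> f ` W"
    using Y oW W(2) unfolding has_base_def by blast
  have fc: "continuous_map (subtopology X W) Y f"
    using W(1) by (auto simp: sheet_def dest!: homeomorphic_imp_continuous_map intro: continuous_map_into_fulltopology)
  have eq: "g ` K = {x \<in> topspace (subtopology X W). f x \<in> K}"
  proof (intro equalityI subsetI)
    fix x assume "x \<in> {x \<in> topspace (subtopology X W). f x \<in> K}"
    then show "x \<in> g ` K"
      using g(2)[of x] by (intro image_eqI[of _ _ "f x"]) auto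
  next
    fix x assume "x \<in> g ` K"
    then show "x \<in> {x \<in> topspace (subtopology X W). f x \<in> K}"
      using K(3) g(3,4) W(3) by (auto simp: subset_iff)
  qed
  have "openin (subtopology X W) (g ` K)"
    unfolding eq using fc K(1) by (intro openin_continuous_map_preimage) (auto simp: compact_open_def)
  then have o: "openin X (g ` K)" "g ` K \<subseteq> W"
    using oW by (auto simp: openin_open_subtopology)
  have c: "compactin X (g ` K)"
    using K by (intro image_compactin[OF _ g(1)]) (auto simp: compact_open_def compactin_subtopology)
  have "Hausdorff_space (subtopology X (g ` K))"
  proof (rule Hausdorff_space_injective_preimage[OF H])
    show "continuous_map (subtopology X (g ` K)) Y f"
      using fc o(2) by (rule continuous_map_from_subtopology_mono)
    show "inj_on f (topspace (subtopology X (g ` K)))"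
      using sheet_inj_on[OF W(1)] o(2) by (auto intro: inj_on_subset)
  qed
  then have "compact_open X (g ` K)"
    using o c by (simp add: compact_open_def)
  moreover have "x \<in> g ` K"
    using K(2) g(2)[OF W(2)] by (metis imageI)
  ultimately show "\<exists>K. compact_open X K \<and> sheet X Y f K \<and> x \<in> K \<and> K \<subseteq> U"
    using o(2) sheet_subset[OF W(1) o] unfolding W_def by (intro exI[of _ "g ` K"]) auto
qed (use sheet_subset in blast)

text \<open>A sheet meets a fibre of \<sigma> at most once, so the indicator of a sheet has at most
  one nonzero value on it.\<close>

lemma finite_fibres:
  assumes f: "f \<in> int_functions X" and X: "has_base X (sheet X Y \<sigma>)"
  shows "finite {x. \<sigma> x = y \<and> f x \<noteq> 0}"
  using f X
proof (induction rule: int_functions_induct_base)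
  case (add f g)
  from finite_UnI[OF add(3,4)] show ?case
    by (rule rev_finite_subset) auto
next
  case (ind V)
  have "{x. \<sigma> x = y \<and> ind V x \<noteq> 0} = \<sigma> -` {y} \<inter> V"
    by auto
  then show ?case
    using finite_vimage_IntI[OF _ sheet_inj_on[OF ind(2)], of "{y}"] by simp
qed auto

lemma sum'_swap:
  fixes f :: "'a \<Rightarrow> 'b \<Rightarrow> int"
  assumes fin: "finite {z \<in> A \<times> B. f (fst z) (snd z) \<noteq> 0}"
  shows "sum' (\<lambda>x. sum' (f x) B) A = sum' (\<lambda>y. sum' (\<lambda>x. f x y) A) B"
proof -
  have "{z \<in> B \<times> A. f (snd z) (fst z) \<noteq> 0} = prod.swap ` {z \<in> A \<times> B. f (fst z) (snd z) \<noteq> 0}"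
    by (auto simp: image_iff)
  then have fin': "finite {z \<in> B \<times> A. f (snd z) (fst z) \<noteq> 0}"
    using fin by simp
  have "bij_betw prod.swap (B \<times> A) (A \<times> B)"
    by (auto simp: bij_betw_def inj_on_def image_iff)
  from sum'_reindex[OF this, of "\<lambda>z. f (fst z) (snd z)"] show ?thesis
    using sum'_Sigma[OF fin] sum'_Sigma[of B "\<lambda>_. A" "\<lambda>y x. f x y", OF fin'] by simp
qed

section \<open>The groupoid ring and its modules of functions\<close>

context topological_groupoid
begin

lemma ginv_ginv:
  assumes g: "g \<in> arrows \<Gamma>"
  shows "ginv \<Gamma> (ginv \<Gamma> g) = g"
proof -
  let ?k = "ginv \<Gamma> g"
  have k: "?k \<in> arrows \<Gamma>" "ginv \<Gamma> ?k \<in> arrows \<Gamma>" "src \<Gamma> (ginv \<Gamma> ?k) = src \<Gamma> g"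
    using g by (simp_all add: ginv_closed src_ginv rng_ginv)
  have "ginv \<Gamma> ?k = gmul \<Gamma> (ginv \<Gamma> ?k) (gmul \<Gamma> ?k g)"
    using gmul_src[OF k(2)] g k by (simp add: ginv_gmul)
  also have "\<dots> = gmul \<Gamma> (gmul \<Gamma> (ginv \<Gamma> ?k) ?k) g"
    using g k by (intro gmul_assoc[symmetric]) (simp_all add: src_ginv rng_ginv)
  also have "\<dots> = g"
    using g k by (simp add: ginv_gmul src_ginv rng_gmul_left)
  finally show ?thesis .
qed

lemma unitsD: "u \<in> units \<Gamma> \<Longrightarrow> u \<in> arrows \<Gamma>" "u \<in> units \<Gamma> \<Longrightarrow> src \<Gamma> u = u" "u \<in> units \<Gamma> \<Longrightarrow> rng \<Gamma> u = u"
  unfolding units_def using src_closed src_src rng_src by auto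

lemma src_units: "g \<in> arrows \<Gamma> \<Longrightarrow> src \<Gamma> g \<in> units \<Gamma>"
  by (simp add: units_def)

lemma rng_units: "g \<in> arrows \<Gamma> \<Longrightarrow> rng \<Gamma> g \<in> units \<Gamma>"
  unfolding units_def by (metis imageI rng_closed src_rng)

lemma topspace_unit_space: "topspace (unit_space \<Gamma>) = units \<Gamma>"
  unfolding unit_space_def using unitsD(1) by auto

lemma ginv_unit: "u \<in> units \<Gamma> \<Longrightarrow> ginv \<Gamma> u = u"
  using ginv_gmul[of u] gmul_src[OF ginv_closed, of u] unitsD[of u] by (simp add: src_ginv)

lemma ginv_bij: "bij_betw (ginv \<Gamma>) {g \<in> arrows \<Gamma>. src \<Gamma> g = y} {g \<in> arrows \<Gamma>. rng \<Gamma> g = y}"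
  by (rule bij_betw_byWitness[of _ "ginv \<Gamma>"]) (auto simp: ginv_ginv ginv_closed src_ginv rng_ginv)

lemma gmul_ginv_cancel:
  assumes "g \<in> arrows \<Gamma>" "h \<in> arrows \<Gamma>" "src \<Gamma> g = src \<Gamma> h"
  shows "gmul \<Gamma> (gmul \<Gamma> g (ginv \<Gamma> h)) h = g" "gmul \<Gamma> g (ginv \<Gamma> h) \<in> arrows \<Gamma>"
    "src \<Gamma> (gmul \<Gamma> g (ginv \<Gamma> h)) = rng \<Gamma> h" "rng \<Gamma> (gmul \<Gamma> g (ginv \<Gamma> h)) = rng \<Gamma> g"
  using assms by (simp_all add: gmul_assoc ginv_closed rng_ginv src_ginv ginv_gmul gmul_closed src_gmul rng_gmul)
    (metis gmul_src)

lemma gmul_cancel_ginv: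
  assumes "k \<in> arrows \<Gamma>" "h \<in> arrows \<Gamma>" "src \<Gamma> k = rng \<Gamma> h"
  shows "gmul \<Gamma> (gmul \<Gamma> k h) (ginv \<Gamma> h) = k"
  using assms by (simp add: gmul_assoc ginv_closed rng_ginv gmul_ginv) (metis gmul_src)

lemma ginv_gmul_ginv:
  assumes "g \<in> arrows \<Gamma>" "h \<in> arrows \<Gamma>" "src \<Gamma> g = rng \<Gamma> h"
  shows "ginv \<Gamma> (gmul \<Gamma> g h) = gmul \<Gamma> (ginv \<Gamma> h) (ginv \<Gamma> g)"
proof -
  let ?x = "gmul \<Gamma> g h" and ?y = "gmul \<Gamma> (ginv \<Gamma> h) (ginv \<Gamma> g)"
  have c: "?x \<in> arrows \<Gamma>" "?y \<in> arrows \<Gamma>" "src \<Gamma> ?x = src \<Gamma> h" "rng \<Gamma> ?y = src \<Gamma> h"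
    using assms by (simp_all add: gmul_closed ginv_closed src_gmul rng_gmul src_ginv rng_ginv)
  have "gmul \<Gamma> ?x ?y = gmul \<Gamma> g (gmul \<Gamma> h ?y)"
    using assms c by (simp add: gmul_assoc)
  also have "gmul \<Gamma> h ?y = ginv \<Gamma> g"
    using assms by (simp add: ginv_closed src_ginv rng_ginv gmul_ginv flip: gmul_assoc) (metis ginv_closed rng_ginv rng_gmul_left)
  finally have "gmul \<Gamma> ?x ?y = rng \<Gamma> g"
    using assms by (simp add: gmul_ginv)
  then have "gmul \<Gamma> (ginv \<Gamma> ?x) (gmul \<Gamma> ?x ?y) = ginv \<Gamma> ?x"
    using assms c gmul_src[OF ginv_closed[OF c(1)]] by (simp add: src_ginv rng_gmul)
  moreover have "gmul \<Gamma> (ginv \<Gamma> ?x) (gmul \<Gamma> ?x ?y) = ?y"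
    using c rng_gmul_left[OF c(2)] by (simp add: ginv_closed src_ginv ginv_gmul flip: gmul_assoc)
  ultimately show ?thesis by simp
qed

lemma continuous_src_unit: "continuous_map (gtop \<Gamma>) (unit_space \<Gamma>) (src \<Gamma>)"
  unfolding unit_space_def using continuous_src by (auto simp: continuous_map_in_subtopology src_units)

lemma continuous_rng_unit: "continuous_map (gtop \<Gamma>) (unit_space \<Gamma>) (rng \<Gamma>)"
  unfolding unit_space_def using continuous_rng by (auto simp: continuous_map_in_subtopology rng_units)

lemma left_space_arrows: "left_space \<Gamma> (gtop \<Gamma>) (rng \<Gamma>) (gmul \<Gamma>)"
  using continuous_rng_unit continuous_gmul
  by (auto simp: left_space_def rng_gmul gmul_assoc rng_gmul_left)

text \<open>The ring acts on itself as on the left space of arrows; closure, additivity and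
  associativity of convolution thereby become instances of facts on left spaces.\<close>

lemma conv_eq_lact: "conv \<Gamma> = fun_lact \<Gamma> (gtop \<Gamma>) (rng \<Gamma>) (gmul \<Gamma>)"
  by (simp add: conv_def fun_lact_def fun_eq_iff)

end

context ample_groupoid
begin

lemma unit_space_base: "has_base (unit_space \<Gamma>) (\<lambda>K. True)"
  using totally_disconnected_has_base locally_compact_units Hausdorff_units totally_disconnected_units by blast

lemma src_base: "has_base (gtop \<Gamma>) (sheet (gtop \<Gamma>) (unit_space \<Gamma>) (src \<Gamma>))"
  using has_base_local_homeomorphism etale unit_space_base Hausdorff_units by blast

text \<open>\<open>rng\<close> is \<open>src\<close> composed with the homeomorphism
  \<open>ginv\<close>, so preimages of sheets of \<open>src\<close> are sheets of
  \<open>rng\<close>.\<close>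

lemma etale_rng: "local_homeomorphism (gtop \<Gamma>) (unit_space \<Gamma>) (rng \<Gamma>)"
  unfolding local_homeomorphism_def
proof
  fix g assume g: "g \<in> arrows \<Gamma>"
  obtain U where U: "sheet (gtop \<Gamma>) (unit_space \<Gamma>) (src \<Gamma>) U" "ginv \<Gamma> g \<in> U"
    using local_homeomorphism_sheet[OF etale ginv_closed[OF g]] by blast
  have oU: "openin (gtop \<Gamma>) U" "U \<subseteq> arrows \<Gamma>"
    using U openin_subset by (auto simp: sheet_def)
  define V where "V = {h \<in> arrows \<Gamma>. ginv \<Gamma> h \<in> U}"
  have V: "openin (gtop \<Gamma>) V" "g \<in> V"
    using openin_continuous_map_preimage[OF continuous_ginv oU(1)] g U by (auto simp: V_def)
  have rs: "rng \<Gamma> h = (src \<Gamma> \<circ> ginv \<Gamma>) h" if "h \<in> arrows \<Gamma>" for h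
    using that by (simp add: src_ginv)
  have gV: "ginv \<Gamma> ` V = U"
    unfolding V_def using oU(2) by (auto simp: ginv_ginv ginv_closed image_iff subset_iff) (metis ginv_closed ginv_ginv)
  have im: "rng \<Gamma> ` V = src \<Gamma> ` U"
  proof -
    have "rng \<Gamma> ` V = (src \<Gamma> \<circ> ginv \<Gamma>) ` V"
      using rs by (auto simp: V_def intro!: image_cong)
    then show ?thesis
      using gV by (metis image_comp)
  qed
  have "homeomorphic_map (gtop \<Gamma>) (gtop \<Gamma>) (ginv \<Gamma>)"
    using homeomorphic_map_involution continuous_ginv ginv_ginv by blast
  then have "homeomorphic_map (subtopology (gtop \<Gamma>) V) (subtopology (gtop \<Gamma>) U) (ginv \<Gamma>)"
    by (rule homeomorphic_map_subtopologies_alt) (auto simp: V_def)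
  then have "homeomorphic_map (subtopology (gtop \<Gamma>) V) (subtopology (unit_space \<Gamma>) (src \<Gamma> ` U)) (src \<Gamma> \<circ> ginv \<Gamma>)"
    using U by (intro homeomorphic_map_compose) (auto simp: sheet_def)
  then have "homeomorphic_map (subtopology (gtop \<Gamma>) V) (subtopology (unit_space \<Gamma>) (rng \<Gamma> ` V)) (rng \<Gamma>)"
    unfolding im by (rule homeomorphic_map_eq) (simp add: rs)
  then show "\<exists>U. openin (gtop \<Gamma>) U \<and> g \<in> U \<and> openin (unit_space \<Gamma>) (rng \<Gamma> ` U) \<and>
      homeomorphic_map (subtopology (gtop \<Gamma>) U) (subtopology (unit_space \<Gamma>) (rng \<Gamma> ` U)) (rng \<Gamma>)"
    using V U im by (intro exI[of _ V]) (auto simp: sheet_def)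
qed

lemma rng_base: "has_base (gtop \<Gamma>) (sheet (gtop \<Gamma>) (unit_space \<Gamma>) (rng \<Gamma>))"
  using has_base_local_homeomorphism etale_rng unit_space_base Hausdorff_units by blast

text \<open>Near a unit the source map is injective, so \<open>g\<close> and \<open>src g\<close> coincide when both are near it.\<close>

lemma open_units: "openin (gtop \<Gamma>) (units \<Gamma>)"
proof (subst openin_subopen, intro ballI)
  fix u assume u: "u \<in> units \<Gamma>"
  then obtain U where U: "sheet (gtop \<Gamma>) (unit_space \<Gamma>) (src \<Gamma>) U" "u \<in> U"
    using local_homeomorphism_sheet[OF etale] unitsD(1) by blast
  have oU: "openin (gtop \<Gamma>) U" "U \<subseteq> arrows \<Gamma>"
    using U openin_subset by (auto simp: sheet_def)
  define W where "W = {g \<in> U. src \<Gamma> g \<in> U}"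
  have "openin (gtop \<Gamma>) W"
    unfolding W_def using openin_continuous_map_preimage_gen[OF continuous_src oU(1) oU(1)] .
  moreover have "g \<in> units \<Gamma>" if "g \<in> W" for g
    using inj_onD[OF sheet_inj_on[OF U(1)], of "src \<Gamma> g" g] that oU(2) src_src src_units unfolding W_def by force
  moreover have "u \<in> W"
    using U u by (simp add: W_def unitsD)
  ultimately show "\<exists>T. openin (gtop \<Gamma>) T \<and> u \<in> T \<and> T \<subseteq> units \<Gamma>"
    by blast
qed

text \<open>Rests on the units being open; it is the reason why functions on the unit space,
  extended by zero, are elements of the ring.\<close>

lemma compact_open_units:
  "compact_open (unit_space \<Gamma>) K \<longleftrightarrow> compact_open (gtop \<Gamma>) K \<and> K \<subseteq> units \<Gamma>"
proof -
  have "subtopology (unit_space \<Gamma>) K = subtopology (gtop \<Gamma>) K" if "K \<subseteq> units \<Gamma>"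
    unfolding unit_space_def using that by (simp add: subtopology_subtopology inf_absorb2)
  then show ?thesis
    unfolding compact_open_def
    by (auto simp: unit_space_def openin_open_subtopology[OF open_units] compactin_subtopology)
qed

lemma unit_functions_subset: "int_functions (unit_space \<Gamma>) \<subseteq> groupoid_ring \<Gamma>"
proof
  fix f assume "f \<in> int_functions (unit_space \<Gamma>)"
  then show "f \<in> groupoid_ring \<Gamma>"
    by (induction rule: int_functions_induct)
      (auto simp: compact_open_units intro: int_functions_add int_functions_uminus ind_int_functions)
qed

lemma compact_open_units_Un:
  assumes "compact_open (unit_space \<Gamma>) K" "compact_open (unit_space \<Gamma>) L"
  shows "compact_open (unit_space \<Gamma>) (K \<union> L)"
  using assms Hausdorff_space_subtopology[OF Hausdorff_units] by (auto simp: compact_open_def intro: compactin_Un)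

text \<open>Finite unions of compact open sets of units are again compact open, the unit space being
  Hausdorff. This supplies the set K of a local unit.\<close>

lemma compact_units_in_compact_open:
  assumes "compactin (unit_space \<Gamma>) C"
  obtains K where "compact_open (unit_space \<Gamma>) K" "C \<subseteq> K"
proof -
  have "\<exists>K. compact_open (unit_space \<Gamma>) K \<and> x \<in> K" if "x \<in> C" for x
    using unit_space_base compactin_subset_topspace[OF assms] that unfolding has_base_def
    by (metis openin_topspace subsetD)
  then have "C \<subseteq> \<Union>{K. compact_open (unit_space \<Gamma>) K}"
    by blast
  then obtain \<F> where \<F>: "finite \<F>" "\<F> \<subseteq> {K. compact_open (unit_space \<Gamma>) K}" "C \<subseteq> \<Union>\<F>"
    using assms unfolding compactin_def by (metis (no_types, lifting) compact_open_def mem_Collect_eq)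
  have "compact_open (unit_space \<Gamma>) (\<Union>\<F>)"
    using \<F>(1,2)
  proof (induction \<F> rule: finite_induct)
    case empty
    then show ?case by (simp add: compact_open_def Hausdorff_space_subtopology Hausdorff_units)
  qed (auto intro: compact_open_units_Un)
  then show thesis
    using \<F>(3) that by blast
qed

lemma finite_src_fibre: "\<xi> \<in> groupoid_ring \<Gamma> \<Longrightarrow> finite {g. src \<Gamma> g = y \<and> \<xi> g \<noteq> 0}"
  by (rule finite_fibres[OF _ src_base])

lemma finite_rng_fibre: "\<xi> \<in> groupoid_ring \<Gamma> \<Longrightarrow> finite {g. rng \<Gamma> g = y \<and> \<xi> g \<noteq> 0}"
  by (rule finite_fibres[OF _ rng_base])

text \<open>This finiteness makes the \<open>sum'\<close> in \<open>fun_lact\<close> and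
  \<open>conv\<close> a genuine finite sum.\<close>

lemma finite_inverse_fibre:
  assumes "\<xi> \<in> groupoid_ring \<Gamma>"
  shows "finite {g \<in> arrows \<Gamma>. src \<Gamma> g = y \<and> \<xi> (ginv \<Gamma> g) \<noteq> 0}"
proof (rule finite_subset)
  show "{g \<in> arrows \<Gamma>. src \<Gamma> g = y \<and> \<xi> (ginv \<Gamma> g) \<noteq> 0} \<subseteq> ginv \<Gamma> ` {g. rng \<Gamma> g = y \<and> \<xi> g \<noteq> 0}"
  proof
    fix g assume "g \<in> {g \<in> arrows \<Gamma>. src \<Gamma> g = y \<and> \<xi> (ginv \<Gamma> g) \<noteq> 0}"
    then show "g \<in> ginv \<Gamma> ` {g. rng \<Gamma> g = y \<and> \<xi> g \<noteq> 0}"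
      by (intro image_eqI[of _ _ "ginv \<Gamma> g"]) (auto simp: ginv_ginv rng_ginv)
  qed
qed (use finite_rng_fibre[OF assms] in simp)

text \<open>The anti-involution of the groupoid ring; it converts right actions into left
  actions.\<close>

definition ring_inv :: "('a \<Rightarrow> int) \<Rightarrow> 'a \<Rightarrow> int" where
  "ring_inv \<xi> = (\<lambda>g. if g \<in> arrows \<Gamma> then \<xi> (ginv \<Gamma> g) else 0)"

lemma ring_inv_closed:
  assumes "\<xi> \<in> groupoid_ring \<Gamma>"
  shows "ring_inv \<xi> \<in> groupoid_ring \<Gamma>"
  using assms
proof (induction rule: int_functions_induct)
  case zero
  then show ?case by (simp add: ring_inv_def)
next
  case (add f g)
  have "ring_inv (\<lambda>x. f x + g x) = (\<lambda>x. ring_inv f x + ring_inv g x)"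
    by (auto simp: ring_inv_def)
  then show ?case using int_functions_add add by metis
next
  case (uminus f)
  have "ring_inv (\<lambda>x. - f x) = (\<lambda>x. - ring_inv f x)"
    by (auto simp: ring_inv_def)
  then show ?case using int_functions_uminus uminus by metis
next
  case (ind V)
  define W where "W = {g \<in> arrows \<Gamma>. ginv \<Gamma> g \<in> V}"
  have V: "V \<subseteq> arrows \<Gamma>"
    using ind openin_subset by (auto simp: compact_open_def)
  have im: "W = ginv \<Gamma> ` V"
    using V unfolding W_def by (auto simp: ginv_ginv ginv_closed image_iff subset_iff) (metis ginv_ginv)
  have "homeomorphic_map (gtop \<Gamma>) (gtop \<Gamma>) (ginv \<Gamma>)"
    using homeomorphic_map_involution continuous_ginv ginv_ginv by blast
  then have "homeomorphic_map (subtopology (gtop \<Gamma>) W) (subtopology (gtop \<Gamma>) V) (ginv \<Gamma>)"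
    by (rule homeomorphic_map_subtopologies_alt) (auto simp: W_def)
  then have "Hausdorff_space (subtopology (gtop \<Gamma>) W)"
    using ind homeomorphic_Hausdorff_space homeomorphic_map_imp_homeomorphic_space unfolding compact_open_def by blast
  moreover have "openin (gtop \<Gamma>) W"
    unfolding W_def using ind by (intro openin_continuous_map_preimage[OF continuous_ginv]) (simp add: compact_open_def)
  moreover have "compactin (gtop \<Gamma>) W"
    unfolding im using ind by (intro image_compactin[OF _ continuous_ginv]) (simp add: compact_open_def)
  ultimately have "compact_open (gtop \<Gamma>) W"
    by (simp add: compact_open_def)
  moreover have "ring_inv (ind V) = ind W"
    by (auto simp: ring_inv_def W_def)
  ultimately show ?case
    using ind_int_functions by metis
qed

end

section \<open>Modules of functions on left spaces\<close>

locale ample_left_space = ample_groupoid \<Gamma> + left_space \<Gamma> X \<tau> a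
  for \<Gamma> :: "'g groupoid" and X :: "'x topology" and \<tau> a
begin

abbreviation lact where "lact \<equiv> fun_lact \<Gamma> X \<tau> a"

lemma anchor_units: "x \<in> topspace X \<Longrightarrow> \<tau> x \<in> units \<Gamma>"
  using continuous_anchor topspace_unit_space by (auto simp: continuous_map_def)

lemma action_closed: "\<lbrakk>g \<in> arrows \<Gamma>; x \<in> topspace X; src \<Gamma> g = \<tau> x\<rbrakk> \<Longrightarrow> a g x \<in> topspace X"
  using funcset_mem[OF continuous_map_funspace[OF continuous_action], of "(g, x)"] by simp

lemma action_inverse:
  "\<lbrakk>g \<in> arrows \<Gamma>; x \<in> topspace X; src \<Gamma> g = \<tau> x\<rbrakk> \<Longrightarrow> a (ginv \<Gamma> g) (a g x) = x"
  by (metis action_assoc action_unit ginv_closed ginv_gmul src_ginv)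

lemma finite_lact:
  assumes "\<xi> \<in> groupoid_ring \<Gamma>"
  shows "finite {g \<in> {g \<in> arrows \<Gamma>. src \<Gamma> g = y}. \<xi> (ginv \<Gamma> g) * m (a g x) \<noteq> 0}"
  by (rule finite_subset[OF _ finite_inverse_fibre[OF assms, of y]]) auto

lemma lact_add_left:
  assumes "\<xi> \<in> groupoid_ring \<Gamma>" "\<eta> \<in> groupoid_ring \<Gamma>"
  shows "lact (\<lambda>g. \<xi> g + \<eta> g) m = (\<lambda>x. lact \<xi> m x + lact \<eta> m x)"
  using sum.distrib'[OF finite_lact[OF assms(1)] finite_lact[OF assms(2)]]
  by (auto simp: fun_lact_def fun_eq_iff distrib_right)

lemma lact_add_right:
  assumes "\<xi> \<in> groupoid_ring \<Gamma>"
  shows "lact \<xi> (\<lambda>x. m x + n x) = (\<lambda>x. lact \<xi> m x + lact \<xi> n x)"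
  using sum.distrib'[OF finite_lact[OF assms] finite_lact[OF assms]]
  by (auto simp: fun_lact_def fun_eq_iff distrib_left)

lemma lact_uminus: "lact (\<lambda>g. - \<xi> g) m = (\<lambda>x. - lact \<xi> m x)" "lact \<xi> (\<lambda>x. - m x) = (\<lambda>x. - lact \<xi> m x)"
  by (auto simp: fun_lact_def fun_eq_iff sum'_uminus)

lemma lact_zero [simp]: "lact (\<lambda>g. 0) m = (\<lambda>x. 0)" "lact \<xi> (\<lambda>x. 0) = (\<lambda>x. 0)"
  by (auto simp: fun_lact_def fun_eq_iff sum'_zero)

text \<open>For \<open>B\<close> on which the range map is injective, \<open>1\<^sub>B \<cdot> 1\<^sub>V = 1\<^bsub>BV\<^esub>\<close>.\<close>

lemma lact_ind:
  assumes B: "compact_open (gtop \<Gamma>) B" "sheet (gtop \<Gamma>) (unit_space \<Gamma>) (rng \<Gamma>) B" and V: "compact_open X V"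
  shows "lact (ind B) (ind V) \<in> int_functions X"
proof -
  have BV: "B \<subseteq> arrows \<Gamma>" "V \<subseteq> topspace X"
    using B V openin_subset by (auto simp: compact_open_def)
  obtain \<beta> where \<beta>: "continuous_map (subtopology (unit_space \<Gamma>) (rng \<Gamma> ` B)) (gtop \<Gamma>) \<beta>"
    "\<And>b. b \<in> B \<Longrightarrow> \<beta> (rng \<Gamma> b) = b" "\<And>y. y \<in> rng \<Gamma> ` B \<Longrightarrow> \<beta> y \<in> B" "\<And>y. y \<in> rng \<Gamma> ` B \<Longrightarrow> rng \<Gamma> (\<beta> y) = y"
    using sheet_inverse[OF B(2)] by blast
  define D where "D = {x \<in> topspace X. \<tau> x \<in> rng \<Gamma> ` B}"
  have oD: "openin X D"
    unfolding D_def using B(2) by (intro openin_continuous_map_preimage[OF continuous_anchor]) (simp add: sheet_def)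
  \<comment> \<open>For x in D, \<open>\<beta> (\<tau> x)\<close> is the one b in B with range
    \<tau> x. So x lies in the product BV exactly if \<open>\<phi> x\<close>, the translate of x by
    the inverse of b, lies in V.\<close>
  define \<phi> where "\<phi> = (\<lambda>x. a (ginv \<Gamma> (\<beta> (\<tau> x))) x)"
  have b: "\<beta> (\<tau> x) \<in> B" "\<beta> (\<tau> x) \<in> arrows \<Gamma>" "rng \<Gamma> (\<beta> (\<tau> x)) = \<tau> x" if "x \<in> D" for x
    using that \<beta> BV by (auto simp: D_def)
  have c1: "continuous_map (subtopology X D) (subtopology (unit_space \<Gamma>) (rng \<Gamma> ` B)) \<tau>"
    using continuous_anchor by (auto simp: continuous_map_in_subtopology D_def intro: continuous_map_from_subtopology)
  have "continuous_map (subtopology X D) (gtop \<Gamma>) (ginv \<Gamma> \<circ> (\<beta> \<circ> \<tau>))"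
    using c1 \<beta>(1) continuous_ginv by (blast intro: continuous_map_compose)
  then have "continuous_map (subtopology X D) (subtopology (prod_topology (gtop \<Gamma>) X) {(g, x). src \<Gamma> g = \<tau> x})
      (\<lambda>x. (ginv \<Gamma> (\<beta> (\<tau> x)), x))"
    using b by (auto simp: continuous_map_in_subtopology continuous_map_paired o_def src_ginv
        intro: continuous_map_from_subtopology)
  from continuous_map_compose[OF this continuous_action]
  have c\<phi>: "continuous_map (subtopology X D) X \<phi>"
    by (simp add: o_def \<phi>_def)
  define W where "W = {x \<in> D. \<phi> x \<in> V}"
  have W: "W = {x \<in> topspace (subtopology X D). \<phi> x \<in> V}"
    by (auto simp: W_def D_def)
  have "openin (subtopology X D) W"
    unfolding W using V by (intro openin_continuous_map_preimage[OF c\<phi>]) (simp add: compact_open_def)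
  then have oW: "openin X W" "W \<subseteq> D"
    using oD by (simp_all add: openin_open_subtopology)
  \<comment> \<open>Compactness of W: it is the image under the action of the composable pairs P in
    B \<times> V, and P is closed there because the unit space is Hausdorff.\<close>
  let ?Z = "subtopology (prod_topology (gtop \<Gamma>) X) (B \<times> V)"
  define P where "P = {z \<in> topspace ?Z. src \<Gamma> (fst z) = \<tau> (snd z)}"
  have "closedin ?Z P"
    unfolding P_def using continuous_map_compose[OF continuous_map_subtopology_fst continuous_src_unit]
      continuous_map_compose[OF continuous_map_subtopology_snd continuous_anchor]
    by (intro closedin_continuous_maps_eq[OF Hausdorff_units]) (simp_all add: o_def)
  moreover have "compactin ?Z (B \<times> V)"
    using B V by (simp add: compactin_subtopology compactin_Times compact_open_def)
  ultimately have "compactin ?Z P"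
    using closed_compactin[of ?Z "B \<times> V" P] by (auto simp: P_def)
  then have "compactin (subtopology (prod_topology (gtop \<Gamma>) X) {(g, x). src \<Gamma> g = \<tau> x}) P"
    unfolding compactin_subtopology by (auto simp: P_def)
  then have "compactin X ((\<lambda>(g, x). a g x) ` P)"
    by (rule image_compactin[OF _ continuous_action])
  moreover have "(\<lambda>(g, x). a g x) ` P = W"
  proof (intro equalityI subsetI)
    fix x assume "x \<in> (\<lambda>(g, x). a g x) ` P"
    then obtain g v where gv: "g \<in> B" "v \<in> V" "g \<in> arrows \<Gamma>" "v \<in> topspace X" "src \<Gamma> g = \<tau> v" "x = a g v"
      using BV by (auto simp: P_def)
    then have t: "\<tau> x = rng \<Gamma> g"
      by (simp add: anchor_action)
    then have "\<phi> x = v"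
      using gv \<beta>(2)[OF gv(1)] by (simp add: \<phi>_def action_inverse)
    then show "x \<in> W"
      using gv t by (auto simp: W_def D_def action_closed)
  next
    fix x assume x: "x \<in> W"
    then have x': "x \<in> D" "x \<in> topspace X"
      by (auto simp: W_def D_def)
    let ?b = "\<beta> (\<tau> x)"
    have "x = a ?b (\<phi> x)"
      using action_inverse[of "ginv \<Gamma> ?b" x] b[OF x'(1)] x' by (simp add: \<phi>_def ginv_closed ginv_ginv src_ginv)
    moreover have "src \<Gamma> ?b = \<tau> (\<phi> x)"
      using b[OF x'(1)] x' by (simp add: \<phi>_def anchor_action ginv_closed src_ginv rng_ginv)
    then have "(?b, \<phi> x) \<in> P"
      using x b[OF x'(1)] BV by (auto simp: P_def W_def)
    ultimately show "x \<in> (\<lambda>(g, x). a g x) ` P"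
      by (intro image_eqI[of _ _ "(?b, \<phi> x)"]) simp_all
  qed
  ultimately have cW: "compactin X W"
    by simp
  \<comment> \<open>A point x of W is recovered from \<open>\<phi> x\<close> and
    \<open>\<tau> x\<close> as \<open>a (\<beta> (\<tau> x)) (\<phi> x)\<close>, so W maps
    injectively and continuously into the product of the Hausdorff spaces V and units.\<close>
  have hW: "Hausdorff_space (subtopology X W)"
  proof (rule Hausdorff_space_injective_preimage)
    show "Hausdorff_space (prod_topology (subtopology X V) (unit_space \<Gamma>))"
      using V Hausdorff_units by (simp add: Hausdorff_space_prod_topology compact_open_def)
    show "continuous_map (subtopology X W) (prod_topology (subtopology X V) (unit_space \<Gamma>)) (\<lambda>x. (\<phi> x, \<tau> x))"
      using continuous_map_from_subtopology_mono[OF c\<phi> oW(2)] continuous_anchor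
      by (auto simp: continuous_map_paired continuous_map_in_subtopology W_def intro: continuous_map_from_subtopology)
    show "inj_on (\<lambda>x. (\<phi> x, \<tau> x)) (topspace (subtopology X W))"
    proof (rule inj_onI)
      fix x y assume xy: "x \<in> topspace (subtopology X W)" "y \<in> topspace (subtopology X W)" "(\<phi> x, \<tau> x) = (\<phi> y, \<tau> y)"
      have "z = a (\<beta> (\<tau> z)) (\<phi> z)" if "z \<in> D" for z
        using action_inverse[of "ginv \<Gamma> (\<beta> (\<tau> z))" z] b[OF that] that
        by (simp add: \<phi>_def ginv_closed ginv_ginv src_ginv D_def)
      then show "x = y"
        using xy by (metis IntE W_def mem_Collect_eq prod.inject topspace_subtopology)
    qed
  qed
  have "lact (ind B) (ind V) x = ind W x" for x
  proof (cases "x \<in> D")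
    case True
    then have x: "x \<in> topspace X"
      by (simp add: D_def)
    have "lact (ind B) (ind V) x = sum' (\<lambda>g. ind B (ginv \<Gamma> g) * ind V (a g x)) {g \<in> arrows \<Gamma>. src \<Gamma> g = \<tau> x}"
      using x by (simp add: fun_lact_def)
    also have "\<dots> = ind B (ginv \<Gamma> (ginv \<Gamma> (\<beta> (\<tau> x)))) * ind V (a (ginv \<Gamma> (\<beta> (\<tau> x))) x)"
    proof (rule sum'_single)
      fix g assume g: "g \<in> {g \<in> arrows \<Gamma>. src \<Gamma> g = \<tau> x}" "g \<noteq> ginv \<Gamma> (\<beta> (\<tau> x))"
      have "ginv \<Gamma> g \<notin> B"
        using \<beta>(2)[of "ginv \<Gamma> g"] g by (auto simp: rng_ginv ginv_ginv)
      then show "ind B (ginv \<Gamma> g) * ind V (a g x) = 0"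
        by simp
    qed (use b[OF True] in \<open>auto simp: ginv_closed src_ginv\<close>)
    finally show ?thesis
      using b[OF True] True by (simp add: ginv_ginv W_def \<phi>_def)
  next
    case False
    have "lact (ind B) (ind V) x = 0"
    proof (cases "x \<in> topspace X")
      case True
      have "ginv \<Gamma> g \<notin> B" if "g \<in> arrows \<Gamma>" "src \<Gamma> g = \<tau> x" for g
        using False True that rng_ginv[OF that(1)] by (auto simp: D_def image_iff)
      then show ?thesis
        by (auto simp: fun_lact_def intro!: sum'_zero)
    qed (simp add: fun_lact_def)
    then show ?thesis
      using False by (simp add: W_def)
  qed
  then have "lact (ind B) (ind V) = ind W"
    by blast
  moreover have "compact_open X W"
    using oW cW hW by (simp add: compact_open_def)
  ultimately show ?thesis
    using ind_int_functions by metis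
qed

text \<open>By additivity in both arguments it is enough to treat indicators; the first is taken
  over a sheet of \<open>rng\<close> so that \<open>lact_ind\<close> applies.\<close>

lemma lact_closed:
  assumes "\<xi> \<in> groupoid_ring \<Gamma>" "m \<in> int_functions X"
  shows "lact \<xi> m \<in> int_functions X"
  using assms(1) rng_base
proof (induction rule: int_functions_induct_base)
  case (ind B)
  note B = this
  from assms(2) show ?case
  proof (induction rule: int_functions_induct)
    case (add f g)
    then show ?case
      using lact_add_right[OF ind_int_functions[OF B(1)], of f g] by (simp add: int_functions_add)
  next
    case (ind V)
    then show ?case
      using lact_ind B by blast
  qed (simp_all add: lact_uminus int_functions_uminus)
qed (simp_all add: lact_add_left lact_uminus int_functions_add int_functions_uminus)

text \<open>Both sides are the double sum of F over pairs g, h of arrows with source \<tau> x; they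
  differ in the order of summation and in the substitution g = k h.\<close>

lemma lact_conv:
  assumes \<xi>: "\<xi> \<in> groupoid_ring \<Gamma>" and \<eta>: "\<eta> \<in> groupoid_ring \<Gamma>"
  shows "lact (conv \<Gamma> \<xi> \<eta>) m = lact \<xi> (lact \<eta> m)"
proof
  fix x
  show "lact (conv \<Gamma> \<xi> \<eta>) m x = lact \<xi> (lact \<eta> m) x"
  proof (cases "x \<in> topspace X")
    case x: True
    define S where "S = {g \<in> arrows \<Gamma>. src \<Gamma> g = \<tau> x}"
    define F where "F = (\<lambda>g h. \<xi> (ginv \<Gamma> h) * \<eta> (gmul \<Gamma> h (ginv \<Gamma> g)) * m (a g x))"
    have "lact (conv \<Gamma> \<xi> \<eta>) m x = sum' (\<lambda>g. conv \<Gamma> \<xi> \<eta> (ginv \<Gamma> g) * m (a g x)) S"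
      using x by (simp add: fun_lact_def S_def)
    also have "\<dots> = sum' (\<lambda>g. sum' (F g) S) S"
    proof (rule sum.cong'[OF refl])
      fix g assume "g \<in> S"
      then have "conv \<Gamma> \<xi> \<eta> (ginv \<Gamma> g) = sum' (\<lambda>h. \<xi> (ginv \<Gamma> h) * \<eta> (gmul \<Gamma> h (ginv \<Gamma> g))) S"
        by (simp add: conv_def S_def ginv_closed rng_ginv)
      then show "conv \<Gamma> \<xi> \<eta> (ginv \<Gamma> g) * m (a g x) = sum' (F g) S"
        by (simp add: sum'_mult_right F_def)
    qed
    also have "\<dots> = sum' (\<lambda>h. sum' (\<lambda>g. F g h) S) S"
    proof (rule sum'_swap)
      \<comment> \<open>\<xi> admits finitely many h, and for each of them \<eta> admits finitely
        many k = g h^-1.\<close>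
      let ?T = "Sigma {h \<in> arrows \<Gamma>. src \<Gamma> h = \<tau> x \<and> \<xi> (ginv \<Gamma> h) \<noteq> 0}
                  (\<lambda>h. {k \<in> arrows \<Gamma>. src \<Gamma> k = rng \<Gamma> h \<and> \<eta> (ginv \<Gamma> k) \<noteq> 0})"
      have "finite ?T"
        by (intro finite_SigmaI finite_inverse_fibre \<xi> \<eta>)
      moreover have "{z \<in> S \<times> S. F (fst z) (snd z) \<noteq> 0} \<subseteq> (\<lambda>(h, k). (gmul \<Gamma> k h, h)) ` ?T"
      proof
        fix z assume z: "z \<in> {z \<in> S \<times> S. F (fst z) (snd z) \<noteq> 0}"
        obtain g h where gh: "z = (g, h)" "g \<in> arrows \<Gamma>" "h \<in> arrows \<Gamma>" "src \<Gamma> g = \<tau> x" "src \<Gamma> h = \<tau> x"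
          "\<xi> (ginv \<Gamma> h) \<noteq> 0" "\<eta> (gmul \<Gamma> h (ginv \<Gamma> g)) \<noteq> 0"
          using z by (cases z) (auto simp: S_def F_def)
        let ?k = "gmul \<Gamma> g (ginv \<Gamma> h)"
        have "ginv \<Gamma> ?k = gmul \<Gamma> h (ginv \<Gamma> g)"
          using gh by (simp add: ginv_gmul_ginv ginv_closed rng_ginv ginv_ginv)
        then have "(h, ?k) \<in> ?T"
          using gh gmul_ginv_cancel[of g h] by simp
        then show "z \<in> (\<lambda>(h, k). (gmul \<Gamma> k h, h)) ` ?T"
          using gh gmul_ginv_cancel(1)[of g h] by (intro image_eqI[of _ _ "(h, ?k)"]) simp_all
      qed
      ultimately show "finite {z \<in> S \<times> S. F (fst z) (snd z) \<noteq> 0}"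
        using finite_surj by blast
    qed
    also have "\<dots> = sum' (\<lambda>h. \<xi> (ginv \<Gamma> h) * lact \<eta> m (a h x)) S"
    proof (rule sum.cong'[OF refl])
      fix h assume "h \<in> S"
      then have h: "h \<in> arrows \<Gamma>" "src \<Gamma> h = \<tau> x"
        by (simp_all add: S_def)
      have bij: "bij_betw (\<lambda>g. gmul \<Gamma> g (ginv \<Gamma> h)) S {k \<in> arrows \<Gamma>. src \<Gamma> k = rng \<Gamma> h}"
        using h by (intro bij_betw_byWitness[of _ "\<lambda>k. gmul \<Gamma> k h"])
          (auto simp: S_def gmul_ginv_cancel gmul_cancel_ginv gmul_closed src_gmul)
      have "lact \<eta> m (a h x) = sum' (\<lambda>k. \<eta> (ginv \<Gamma> k) * m (a k (a h x))) {k \<in> arrows \<Gamma>. src \<Gamma> k = rng \<Gamma> h}"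
        using h x by (simp add: fun_lact_def action_closed anchor_action)
      also have "\<dots> = sum' (\<lambda>g. \<eta> (ginv \<Gamma> (gmul \<Gamma> g (ginv \<Gamma> h))) * m (a (gmul \<Gamma> g (ginv \<Gamma> h)) (a h x))) S"
        by (rule sum'_reindex[OF bij])
      also have "\<dots> = sum' (\<lambda>g. \<eta> (gmul \<Gamma> h (ginv \<Gamma> g)) * m (a g x)) S"
      proof (rule sum.cong'[OF refl])
        fix g assume "g \<in> S"
        then have g: "g \<in> arrows \<Gamma>" "src \<Gamma> g = \<tau> x"
          by (simp_all add: S_def)
        have "ginv \<Gamma> (gmul \<Gamma> g (ginv \<Gamma> h)) = gmul \<Gamma> h (ginv \<Gamma> g)"
          using g h by (simp add: ginv_gmul_ginv ginv_closed rng_ginv ginv_ginv)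
        moreover have "a (gmul \<Gamma> g (ginv \<Gamma> h)) (a h x) = a g x"
          using g h x gmul_ginv_cancel[of g h] by (simp flip: action_assoc)
        ultimately show "\<eta> (ginv \<Gamma> (gmul \<Gamma> g (ginv \<Gamma> h))) * m (a (gmul \<Gamma> g (ginv \<Gamma> h)) (a h x))
            = \<eta> (gmul \<Gamma> h (ginv \<Gamma> g)) * m (a g x)"
          by simp
      qed
      finally show "sum' (\<lambda>g. F g h) S = \<xi> (ginv \<Gamma> h) * lact \<eta> m (a h x)"
        by (simp add: sum'_mult_left F_def mult.assoc)
    qed
    also have "\<dots> = lact \<xi> (lact \<eta> m) x"
      using x by (simp add: fun_lact_def S_def)
    finally show ?thesis .
  qed (simp add: fun_lact_def)
qed

text \<open>Only the unit at \<tau> x contributes to the sum, as the inverse of any other arrow with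
  that source is not a unit.\<close>

lemma lact_units:
  assumes "\<And>g. g \<notin> units \<Gamma> \<Longrightarrow> \<eta> g = 0"
  shows "lact \<eta> m x = (if x \<in> topspace X then \<eta> (\<tau> x) * m x else 0)"
proof (cases "x \<in> topspace X")
  case True
  have "sum' (\<lambda>g. \<eta> (ginv \<Gamma> g) * m (a g x)) {g \<in> arrows \<Gamma>. src \<Gamma> g = \<tau> x} =
        \<eta> (ginv \<Gamma> (\<tau> x)) * m (a (\<tau> x) x)"
  proof (rule sum'_single)
    fix g assume g: "g \<in> {g \<in> arrows \<Gamma>. src \<Gamma> g = \<tau> x}" "g \<noteq> \<tau> x"
    have "ginv \<Gamma> g \<notin> units \<Gamma>"
      using g ginv_unit[of "ginv \<Gamma> g"] unitsD(2)[of g] by (auto simp: ginv_ginv)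
    then show "\<eta> (ginv \<Gamma> g) * m (a g x) = 0"
      using assms by simp
  qed (use anchor_units[OF True] unitsD in auto)
  then show ?thesis
    using True anchor_units[OF True] by (simp add: fun_lact_def ginv_unit action_unit)
qed (simp add: fun_lact_def)

text \<open>For an indicator, \<tau> maps the compact set V to a compact set of units, and sums take
  unions. Such a K gives a local unit by \<open>lact_local_unit\<close>.\<close>

lemma support_anchor:
  assumes "m \<in> int_functions X"
  obtains K where "compact_open (unit_space \<Gamma>) K" "\<And>x. m x \<noteq> 0 \<Longrightarrow> \<tau> x \<in> K"
proof -
  have "\<exists>K. compact_open (unit_space \<Gamma>) K \<and> (\<forall>x. m x \<noteq> 0 \<longrightarrow> \<tau> x \<in> K)"
    using assms
  proof (induction rule: int_functions_induct)
    case zero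
    then show ?case
      using compact_units_in_compact_open[of "{}"] by auto
  next
    case (add f g)
    then show ?case
      using compact_open_units_Un by (metis (no_types, lifting) UnCI add.right_neutral)
  next
    case (ind V)
    then have "compactin (unit_space \<Gamma>) (\<tau> ` V)"
      using image_compactin continuous_anchor by (metis compact_open_def)
    then show ?case
      using compact_units_in_compact_open by (metis (full_types) imageI of_bool_eq_0_iff subsetD)
  qed auto
  then show thesis
    using that by blast
qed

lemma lact_local_unit:
  assumes "compact_open (unit_space \<Gamma>) K" "m \<in> int_functions X" "\<And>x. m x \<noteq> 0 \<Longrightarrow> \<tau> x \<in> K"
  shows "lact (ind K) m = m"
proof
  fix x
  have "K \<subseteq> units \<Gamma>"
    using assms(1) by (simp add: compact_open_units)
  then have "lact (ind K) m x = (if x \<in> topspace X then ind K (\<tau> x) * m x else 0)"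
    by (intro lact_units) auto
  then show "lact (ind K) m x = m x"
    using assms(3)[of x] int_functions_outside[OF assms(2), of x] by auto
qed

end

section \<open>The convolution ring, its local units, and non-degenerate modules\<close>

context ample_groupoid
begin

lemma ample_left_space_arrows: "ample_left_space \<Gamma> (gtop \<Gamma>) (rng \<Gamma>) (gmul \<Gamma>)"
  using left_space_arrows ample_groupoid_axioms by (simp add: ample_left_space_def)

interpretation arr: ample_left_space \<Gamma> "gtop \<Gamma>" "rng \<Gamma>" "gmul \<Gamma>"
  by (rule ample_left_space_arrows)

lemma conv_closed: "\<lbrakk>\<xi> \<in> groupoid_ring \<Gamma>; \<eta> \<in> groupoid_ring \<Gamma>\<rbrakk> \<Longrightarrow> conv \<Gamma> \<xi> \<eta> \<in> groupoid_ring \<Gamma>"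
  unfolding conv_eq_lact by (rule arr.lact_closed)

lemma conv_add_left:
  "\<lbrakk>\<xi> \<in> groupoid_ring \<Gamma>; \<eta> \<in> groupoid_ring \<Gamma>\<rbrakk> \<Longrightarrow>
   conv \<Gamma> (\<lambda>g. \<xi> g + \<eta> g) \<zeta> = (\<lambda>g. conv \<Gamma> \<xi> \<zeta> g + conv \<Gamma> \<eta> \<zeta> g)"
  unfolding conv_eq_lact by (rule arr.lact_add_left)

lemma conv_add_right:
  "\<xi> \<in> groupoid_ring \<Gamma> \<Longrightarrow> conv \<Gamma> \<xi> (\<lambda>g. \<eta> g + \<zeta> g) = (\<lambda>g. conv \<Gamma> \<xi> \<eta> g + conv \<Gamma> \<xi> \<zeta> g)"
  unfolding conv_eq_lact by (rule arr.lact_add_right)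

lemma conv_uminus: "conv \<Gamma> (\<lambda>g. - \<xi> g) \<eta> = (\<lambda>g. - conv \<Gamma> \<xi> \<eta> g)" "conv \<Gamma> \<xi> (\<lambda>g. - \<eta> g) = (\<lambda>g. - conv \<Gamma> \<xi> \<eta> g)"
  unfolding conv_eq_lact by (rule arr.lact_uminus)+

lemma conv_zero [simp]: "conv \<Gamma> (\<lambda>g. 0) \<eta> = (\<lambda>g. 0)" "conv \<Gamma> \<xi> (\<lambda>g. 0) = (\<lambda>g. 0)"
  unfolding conv_eq_lact by (rule arr.lact_zero)+

lemma conv_assoc:
  "\<lbrakk>\<xi> \<in> groupoid_ring \<Gamma>; \<eta> \<in> groupoid_ring \<Gamma>\<rbrakk> \<Longrightarrow> conv \<Gamma> (conv \<Gamma> \<xi> \<eta>) \<zeta> = conv \<Gamma> \<xi> (conv \<Gamma> \<eta> \<zeta>)"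
  using arr.lact_conv[of \<xi> \<eta> \<zeta>] by (simp flip: conv_eq_lact)

lemma conv_local_unit:
  "\<lbrakk>compact_open (unit_space \<Gamma>) K; \<xi> \<in> groupoid_ring \<Gamma>; \<And>g. \<xi> g \<noteq> 0 \<Longrightarrow> rng \<Gamma> g \<in> K\<rbrakk> \<Longrightarrow> conv \<Gamma> (ind K) \<xi> = \<xi>"
  unfolding conv_eq_lact by (rule arr.lact_local_unit)

lemma unit_in_ring: "compact_open (unit_space \<Gamma>) K \<Longrightarrow> ind K \<in> groupoid_ring \<Gamma>"
  by (simp add: compact_open_units ind_int_functions)

lemma unit_idem: "compact_open (unit_space \<Gamma>) K \<Longrightarrow> conv \<Gamma> (ind K) (ind K) = ind K"
  by (rule conv_local_unit) (auto simp: unit_in_ring compact_open_units unitsD subset_iff)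

text \<open>Non-degeneracy writes an element as a product of terms \<open>act M \<xi> m\<close> and
  their inverses, and such a term is fixed by \<open>ind K\<close> as soon as K contains the ranges
  of the support of \<xi>. The sets for finitely many elements fit into one K.\<close>

lemma left_module_local_unit:
  assumes M: "left_module \<Gamma> M" and F: "finite F" "F \<subseteq> carrier M"
  obtains K where "compact_open (unit_space \<Gamma>) K" "\<And>m. m \<in> F \<Longrightarrow> act M (ind K) m = m"
proof -
  interpret M: left_module \<Gamma> M by fact
  \<comment> \<open>The element is fixed by all K above some L, not merely by L: this form is
    preserved when two elements with different L are multiplied.\<close>
  have "\<exists>L. compact_open (unit_space \<Gamma>) L \<and>
      (\<forall>K. compact_open (unit_space \<Gamma>) K \<and> L \<subseteq> K \<longrightarrow> act M (ind K) m = m)" if "m \<in> carrier M" for m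
  proof -
    have gen: "m \<in> generate M {act M \<xi> m | \<xi> m. \<xi> \<in> groupoid_ring \<Gamma> \<and> m \<in> carrier M}"
      using M.nondegenerate that by simp
    have cl: "x \<in> carrier M" if "x \<in> generate M {act M \<xi> m | \<xi> m. \<xi> \<in> groupoid_ring \<Gamma> \<and> m \<in> carrier M}" for x
      using M.nondegenerate that by simp
    have base: "\<exists>L. compact_open (unit_space \<Gamma>) L \<and>
      (\<forall>K. compact_open (unit_space \<Gamma>) K \<and> L \<subseteq> K \<longrightarrow> act M (ind K) (act M \<xi> m) = act M \<xi> m)"
      if m: "\<xi> \<in> groupoid_ring \<Gamma>" "m \<in> carrier M" for \<xi> m
    proof -
      obtain L where L: "compact_open (unit_space \<Gamma>) L" "\<And>g. \<xi> g \<noteq> 0 \<Longrightarrow> rng \<Gamma> g \<in> L"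
        using arr.support_anchor[OF m(1)] by blast
      have "act M (ind K) (act M \<xi> m) = act M \<xi> m" if "compact_open (unit_space \<Gamma>) K" "L \<subseteq> K" for K
        using conv_local_unit[OF that(1) m(1)] L(2) that M.conv_act[OF unit_in_ring[OF that(1)] m]
        by (metis subsetD)
      then show ?thesis using L by blast
    qed
    from gen show ?thesis
    proof (induction m rule: generate.induct)
      case one
      then show ?case
        using compact_units_in_compact_open[of "{}"] unit_in_ring M.act_one by (metis compactin_empty)
    next
      case (incl h)
      then show ?case using base by blast
    next
      case (inv h)
      then obtain \<xi> m where h: "h = act M \<xi> m" "\<xi> \<in> groupoid_ring \<Gamma>" "m \<in> carrier M"
        by blast
      then have "h \<in> carrier M"
        by (simp add: M.act_closed)
      then show ?case
        using base[OF h(2,3)] unfolding h(1)[symmetric] by (metis M.act_inv unit_in_ring)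
    next
      case (eng x y)
      then obtain L L' where L: "compact_open (unit_space \<Gamma>) L" "compact_open (unit_space \<Gamma>) L'"
        "\<And>K. compact_open (unit_space \<Gamma>) K \<Longrightarrow> L \<subseteq> K \<Longrightarrow> act M (ind K) x = x"
        "\<And>K. compact_open (unit_space \<Gamma>) K \<Longrightarrow> L' \<subseteq> K \<Longrightarrow> act M (ind K) y = y"
        by blast
      have "act M (ind K) (x \<otimes>\<^bsub>M\<^esub> y) = x \<otimes>\<^bsub>M\<^esub> y" if "compact_open (unit_space \<Gamma>) K" "L \<union> L' \<subseteq> K" for K
        using M.act_add[OF unit_in_ring[OF that(1)] cl[OF eng(1)] cl[OF eng(2)]] L that by simp
      then show ?case
        using compact_open_units_Un[OF L(1,2)] by blast
    qed
  qed
  then obtain L where L: "\<And>m. m \<in> carrier M \<Longrightarrow> compact_open (unit_space \<Gamma>) (L m)"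
    "\<And>m K. \<lbrakk>m \<in> carrier M; compact_open (unit_space \<Gamma>) K; L m \<subseteq> K\<rbrakk> \<Longrightarrow> act M (ind K) m = m"
    by metis
  have "compactin (unit_space \<Gamma>) (\<Union>m\<in>F. L m)"
    using F L(1) by (intro compactin_Union) (auto simp: compact_open_def)
  then obtain K where "compact_open (unit_space \<Gamma>) K" "(\<Union>m\<in>F. L m) \<subseteq> K"
    using compact_units_in_compact_open by blast
  then show thesis
    using F L(2) by (intro that[of K]) blast+
qed

text \<open>An element fixed by some ring element already lies in the generating set, which gives
  non-degeneracy. \<open>left_module_unit\<close> is the converse, and so the criterion passes to
  submodules, direct sums and transported structures.\<close>

lemma left_moduleI:
  assumes "comm_group M"
    and "\<And>\<xi> m. \<lbrakk>\<xi> \<in> groupoid_ring \<Gamma>; m \<in> carrier M\<rbrakk> \<Longrightarrow> act M \<xi> m \<in> carrier M"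
    and "\<And>\<xi> m n. \<lbrakk>\<xi> \<in> groupoid_ring \<Gamma>; m \<in> carrier M; n \<in> carrier M\<rbrakk>
        \<Longrightarrow> act M \<xi> (m \<otimes>\<^bsub>M\<^esub> n) = act M \<xi> m \<otimes>\<^bsub>M\<^esub> act M \<xi> n"
    and "\<And>\<xi> \<eta> m. \<lbrakk>\<xi> \<in> groupoid_ring \<Gamma>; \<eta> \<in> groupoid_ring \<Gamma>; m \<in> carrier M\<rbrakk>
        \<Longrightarrow> act M (\<lambda>g. \<xi> g + \<eta> g) m = act M \<xi> m \<otimes>\<^bsub>M\<^esub> act M \<eta> m"
    and "\<And>\<xi> \<eta> m. \<lbrakk>\<xi> \<in> groupoid_ring \<Gamma>; \<eta> \<in> groupoid_ring \<Gamma>; m \<in> carrier M\<rbrakk>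
        \<Longrightarrow> act M (conv \<Gamma> \<xi> \<eta>) m = act M \<xi> (act M \<eta> m)"
    and unit: "\<And>m. m \<in> carrier M \<Longrightarrow> \<exists>\<xi> \<in> groupoid_ring \<Gamma>. act M \<xi> m = m"
  shows "left_module \<Gamma> M"
proof -
  interpret M: comm_group M by fact
  have "carrier M = generate M {act M \<xi> m | \<xi> m. \<xi> \<in> groupoid_ring \<Gamma> \<and> m \<in> carrier M}"
  proof
    show "carrier M \<subseteq> generate M {act M \<xi> m | \<xi> m. \<xi> \<in> groupoid_ring \<Gamma> \<and> m \<in> carrier M}"
    proof
      fix m assume m: "m \<in> carrier M"
      then obtain \<xi> where "\<xi> \<in> groupoid_ring \<Gamma>" "act M \<xi> m = m"
        using unit by blast
      then have "m \<in> {act M \<xi> m | \<xi> m. \<xi> \<in> groupoid_ring \<Gamma> \<and> m \<in> carrier M}"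
        using m by (metis (mono_tags, lifting) mem_Collect_eq)
      then show "m \<in> generate M {act M \<xi> m | \<xi> m. \<xi> \<in> groupoid_ring \<Gamma> \<and> m \<in> carrier M}"
        by (rule generate.incl)
    qed
    show "generate M {act M \<xi> m | \<xi> m. \<xi> \<in> groupoid_ring \<Gamma> \<and> m \<in> carrier M} \<subseteq> carrier M"
      using assms(2) by (intro M.generate_incl) auto
  qed
  then show ?thesis
    using assms by (simp add: left_module_def left_module_axioms_def)
qed

lemma left_module_unit:
  "\<lbrakk>left_module \<Gamma> M; m \<in> carrier M\<rbrakk> \<Longrightarrow> \<exists>\<xi> \<in> groupoid_ring \<Gamma>. act M \<xi> m = m"
  using left_module_local_unit[of M "{m}"] unit_in_ring by (metis empty_subsetI finite.emptyI finite_insert insert_iff insert_subset)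

lemma submodule:
  assumes M: "left_module \<Gamma> M" and N: "subgroup N M"
    and act: "\<And>\<xi> m. \<lbrakk>\<xi> \<in> groupoid_ring \<Gamma>; m \<in> N\<rbrakk> \<Longrightarrow> act M \<xi> m \<in> N"
  shows "left_module \<Gamma> (M\<lparr>carrier := N\<rparr>)"
proof -
  interpret M: left_module \<Gamma> M by fact
  have sub: "N \<subseteq> carrier M"
    using N by (rule subgroup.subset)
  show ?thesis
  proof (rule left_moduleI)
    show "comm_group (M\<lparr>carrier := N\<rparr>)"
      using group.group_comm_groupI[OF subgroup.subgroup_is_group[OF N M.is_group]] sub M.m_comm by auto
    show "\<exists>\<xi>\<in>groupoid_ring \<Gamma>. act (M\<lparr>carrier := N\<rparr>) \<xi> m = m" if "m \<in> carrier (M\<lparr>carrier := N\<rparr>)" for m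
      using left_module_unit[OF M, of m] that sub by auto
  qed (use sub act in \<open>auto simp: M.act_add M.add_act M.conv_act subset_iff\<close>)
qed

lemma kernel_module:
  assumes "left_module \<Gamma> M" "left_module \<Gamma> N" "gmodule_hom \<Gamma> M N f"
  shows "left_module \<Gamma> (M\<lparr>carrier := kernel M N f\<rparr>)"
proof (rule submodule[OF assms(1)])
  interpret M: left_module \<Gamma> M by fact
  interpret N: left_module \<Gamma> N by fact
  show "subgroup (kernel M N f) M"
    using group_hom.subgroup_kernel[OF gmodule_hom_group_hom[OF assms(3,1,2)]] .
  show "act M \<xi> m \<in> kernel M N f" if "\<xi> \<in> groupoid_ring \<Gamma>" "m \<in> kernel M N f" for \<xi> m
    using that by (auto simp: kernel_def M.act_closed gmodule_hom_act[OF assms(3)])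
qed

end

lemma comm_group_functions:
  assumes "carrier M = int_functions X" "monoid.mult M = (\<lambda>m n x. m x + n x)" "one M = (\<lambda>x. 0)"
  shows "comm_group M"
proof (rule comm_groupI)
  show "\<exists>y\<in>carrier M. y \<otimes>\<^bsub>M\<^esub> x = \<one>\<^bsub>M\<^esub>" if "x \<in> carrier M" for x
    using that assms by (intro bexI[of _ "\<lambda>z. - x z"]) (auto simp: int_functions_uminus)
qed (auto simp: assms int_functions_add add_ac)

section \<open>Right spaces as left spaces with the inverted action\<close>

locale ample_right_space = ample_groupoid \<Gamma> + right_space \<Gamma> X \<pi> a
  for \<Gamma> :: "'g groupoid" and X :: "'x topology" and \<pi> a
begin

abbreviation ract where "ract \<equiv> fun_ract \<Gamma> X \<pi> a"

lemma ranchor_units: "x \<in> topspace X \<Longrightarrow> \<pi> x \<in> units \<Gamma>"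
  using continuous_anchor topspace_unit_space by (auto simp: continuous_map_def)

lemma raction_closed: "\<lbrakk>x \<in> topspace X; g \<in> arrows \<Gamma>; \<pi> x = rng \<Gamma> g\<rbrakk> \<Longrightarrow> a x g \<in> topspace X"
  using funcset_mem[OF continuous_map_funspace[OF continuous_action], of "(x, g)"] by simp

lemma opposite_left_space: "left_space \<Gamma> X \<pi> (\<lambda>g x. a x (ginv \<Gamma> g))"
proof
  have "continuous_map (subtopology (prod_topology (gtop \<Gamma>) X) {(g, x). src \<Gamma> g = \<pi> x})
     (subtopology (prod_topology X (gtop \<Gamma>)) {(x, g). \<pi> x = rng \<Gamma> g}) (\<lambda>z. (snd z, ginv \<Gamma> (fst z)))"
    using continuous_map_compose[OF continuous_map_subtopology_fst continuous_ginv]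
    by (auto simp: continuous_map_in_subtopology continuous_map_paired continuous_map_subtopology_snd o_def rng_ginv)
  from continuous_map_compose[OF this continuous_action]
  show "continuous_map (subtopology (prod_topology (gtop \<Gamma>) X) {(g, x). src \<Gamma> g = \<pi> x}) X
     (\<lambda>(g, x). a x (ginv \<Gamma> g))"
    by (simp add: o_def case_prod_unfold)
  show "a x (ginv \<Gamma> (gmul \<Gamma> g h)) = a (a x (ginv \<Gamma> h)) (ginv \<Gamma> g)"
    if "g \<in> arrows \<Gamma>" "h \<in> arrows \<Gamma>" "x \<in> topspace X" "src \<Gamma> g = rng \<Gamma> h" "src \<Gamma> h = \<pi> x" for g h x
    using that by (simp add: ginv_gmul_ginv action_assoc ginv_closed rng_ginv src_ginv)
qed (use continuous_anchor in \<open>simp_all add: anchor_action ginv_closed src_ginv rng_ginv ranchor_units ginv_unit action_unit\<close>)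

lemma opposite_ample_left_space: "ample_left_space \<Gamma> X \<pi> (\<lambda>g x. a x (ginv \<Gamma> g))"
  using opposite_left_space ample_groupoid_axioms by (simp add: ample_left_space_def)

text \<open>Substitution of g^-1 for g in the sum; closure of the functions under right actions is
  thereby inherited from left actions.\<close>

lemma ract_eq_lact: "ract \<xi> m = fun_lact \<Gamma> X \<pi> (\<lambda>g x. a x (ginv \<Gamma> g)) (ring_inv \<xi>) m"
proof
  fix x
  have "sum' (\<lambda>g. m (a x g) * \<xi> (ginv \<Gamma> g)) {g \<in> arrows \<Gamma>. rng \<Gamma> g = \<pi> x} =
        sum' (\<lambda>g. m (a x (ginv \<Gamma> g)) * \<xi> (ginv \<Gamma> (ginv \<Gamma> g))) {g \<in> arrows \<Gamma>. src \<Gamma> g = \<pi> x}"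
    by (rule sum'_reindex[OF ginv_bij])
  also have "\<dots> = sum' (\<lambda>g. ring_inv \<xi> (ginv \<Gamma> g) * m (a x (ginv \<Gamma> g))) {g \<in> arrows \<Gamma>. src \<Gamma> g = \<pi> x}"
    by (rule sum.cong'[OF refl]) (simp add: ring_inv_def ginv_closed)
  finally show "ract \<xi> m x = fun_lact \<Gamma> X \<pi> (\<lambda>g x. a x (ginv \<Gamma> g)) (ring_inv \<xi>) m x"
    by (simp add: fun_ract_def fun_lact_def)
qed

lemma ract_closed: "\<lbrakk>\<xi> \<in> groupoid_ring \<Gamma>; m \<in> int_functions X\<rbrakk> \<Longrightarrow> ract \<xi> m \<in> int_functions X"
  unfolding ract_eq_lact
  using ample_left_space.lact_closed[OF opposite_ample_left_space] ring_inv_closed by blast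

lemma right_acted_functions:
  "right_acted \<Gamma> \<lparr>carrier = int_functions X, monoid.mult = (\<lambda>m n x. m x + n x), one = (\<lambda>x. 0), act = ract\<rparr>"
  by (auto simp: right_acted_def right_acted_axioms_def ract_closed intro!: comm_group_functions)

end

context ample_groupoid
begin

lemma right_space_units: "ample_right_space \<Gamma> (unit_space \<Gamma>) (\<lambda>x. x) (\<lambda>x g. src \<Gamma> g)"
proof -
  have "continuous_map (subtopology (prod_topology (unit_space \<Gamma>) (gtop \<Gamma>)) {(x, g). x = rng \<Gamma> g}) (unit_space \<Gamma>)
     (src \<Gamma> \<circ> snd)"
    by (rule continuous_map_compose[OF continuous_map_subtopology_snd continuous_src_unit])
  then have "right_space \<Gamma> (unit_space \<Gamma>) (\<lambda>x. x) (\<lambda>x g. src \<Gamma> g)"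
    by (simp add: right_space_def o_def case_prod_unfold src_gmul topspace_unit_space unitsD)
  then show ?thesis
    using ample_groupoid_axioms by (simp add: ample_right_space_def)
qed

lemma right_acted_unit_module: "right_acted \<Gamma> (unit_module \<Gamma>)"
  unfolding unit_module_def by (rule ample_right_space.right_acted_functions[OF right_space_units])

end

section \<open>Induced modules\<close>

locale ample_correspondence = G: ample_groupoid G + H: ample_groupoid H + etale_correspondence G H \<Omega>
  for G :: "'g groupoid" and H :: "'h groupoid" and \<Omega> :: "('g, 'h, 'w) correspondence"
begin

sublocale L: ample_left_space G "ctop \<Omega>" "lanchor \<Omega>" "lmul \<Omega>"
  by unfold_locales
sublocale R: ample_right_space H "ctop \<Omega>" "ranchor \<Omega>" "rmul \<Omega>"
  by unfold_locales

lemma right_acted_corr: "right_acted H (corr_rmodule H \<Omega>)"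
  unfolding corr_rmodule_def by (rule R.right_acted_functions)

lemma corr_simps [simp]:
  "carrier (corr_rmodule H \<Omega>) = int_functions (ctop \<Omega>)"
  "carrier (corr_lmodule G \<Omega>) = int_functions (ctop \<Omega>)"
  "monoid.mult (corr_rmodule H \<Omega>) = (\<lambda>m n x. m x + n x)"
  "monoid.mult (corr_lmodule G \<Omega>) = (\<lambda>m n x. m x + n x)"
  "one (corr_rmodule H \<Omega>) = (\<lambda>x. 0)"
  "one (corr_lmodule G \<Omega>) = (\<lambda>x. 0)"
  "act (corr_rmodule H \<Omega>) = R.ract" "act (corr_lmodule G \<Omega>) = L.lact"
  by (simp_all add: corr_rmodule_def corr_lmodule_def)

text \<open>Expanding gives double sums over the same pairs g, h, because the actions commute and
  each anchor is invariant under the other action. The action of G on \<open>Ind\<close> is well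
  defined on tensors for this reason.\<close>

lemma lact_ract:
  assumes \<xi>: "\<xi> \<in> groupoid_ring G" and \<eta>: "\<eta> \<in> groupoid_ring H"
  shows "L.lact \<xi> (R.ract \<eta> m) = R.ract \<eta> (L.lact \<xi> m)"
proof
  fix w
  show "L.lact \<xi> (R.ract \<eta> m) w = R.ract \<eta> (L.lact \<xi> m) w"
  proof (cases "w \<in> topspace (ctop \<Omega>)")
    case w: True
    define S where "S = {g \<in> arrows G. src G g = lanchor \<Omega> w}"
    define T where "T = {h \<in> arrows H. rng H h = ranchor \<Omega> w}"
    define F where "F = (\<lambda>g h. \<xi> (ginv G g) * m (rmul \<Omega> (lmul \<Omega> g w) h) * \<eta> (ginv H h))"
    have 1: "L.lact \<xi> (R.ract \<eta> m) w = sum' (\<lambda>g. sum' (F g) T) S"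
    proof -
      have "\<xi> (ginv G g) * R.ract \<eta> m (lmul \<Omega> g w) = sum' (F g) T" if "g \<in> S" for g
        using that w by (simp add: fun_ract_def S_def T_def F_def L.action_closed ranchor_lmul sum'_mult_left mult.assoc)
      then have "sum' (\<lambda>g. \<xi> (ginv G g) * R.ract \<eta> m (lmul \<Omega> g w)) S = sum' (\<lambda>g. sum' (F g) T) S"
        by (rule sum.cong'[OF refl])
      then show ?thesis
        using w by (simp add: fun_lact_def S_def)
    qed
    have 2: "R.ract \<eta> (L.lact \<xi> m) w = sum' (\<lambda>h. sum' (\<lambda>g. F g h) S) T"
    proof -
      have "L.lact \<xi> m (rmul \<Omega> w h) * \<eta> (ginv H h) = sum' (\<lambda>g. F g h) S" if "h \<in> T" for h
      proof -
        have "L.lact \<xi> m (rmul \<Omega> w h) = sum' (\<lambda>g. \<xi> (ginv G g) * m (rmul \<Omega> (lmul \<Omega> g w) h)) S"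
          using that w unfolding fun_lact_def
          by (auto simp: S_def T_def R.raction_closed lanchor_rmul commuting intro!: sum.cong')
        then show ?thesis
          by (simp add: sum'_mult_right F_def)
      qed
      then have "sum' (\<lambda>h. L.lact \<xi> m (rmul \<Omega> w h) * \<eta> (ginv H h)) T = sum' (\<lambda>h. sum' (\<lambda>g. F g h) S) T"
        by (rule sum.cong'[OF refl])
      then show ?thesis
        using w by (simp add: fun_ract_def T_def)
    qed
    have "finite {z \<in> S \<times> T. F (fst z) (snd z) \<noteq> 0}"
    proof (rule finite_subset)
      show "{z \<in> S \<times> T. F (fst z) (snd z) \<noteq> 0} \<subseteq>
        {g \<in> arrows G. src G g = lanchor \<Omega> w \<and> \<xi> (ginv G g) \<noteq> 0} \<times>
        ginv H ` {h. src H h = ranchor \<Omega> w \<and> \<eta> h \<noteq> 0}"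
      proof
        fix z assume z: "z \<in> {z \<in> S \<times> T. F (fst z) (snd z) \<noteq> 0}"
        then have "snd z \<in> ginv H ` {h. src H h = ranchor \<Omega> w \<and> \<eta> h \<noteq> 0}"
          by (intro image_eqI[of _ _ "ginv H (snd z)"]) (auto simp: T_def F_def H.ginv_ginv H.src_ginv)
        with z show "z \<in> {g \<in> arrows G. src G g = lanchor \<Omega> w \<and> \<xi> (ginv G g) \<noteq> 0} \<times>
          ginv H ` {h. src H h = ranchor \<Omega> w \<and> \<eta> h \<noteq> 0}"
          by (auto simp: S_def F_def mem_Times_iff)
      qed
    qed (use G.finite_inverse_fibre[OF \<xi>] H.finite_src_fibre[OF \<eta>] in simp)
    from sum'_swap[OF this] show ?thesis
      by (simp add: 1 2)
  qed (simp add: fun_lact_def fun_ract_def)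
qed

lemma Ind_simps [simp]:
  "carrier (Ind G H \<Omega> N) = carrier (tensor H (corr_rmodule H \<Omega>) N)"
  "monoid.mult (Ind G H \<Omega> N) = monoid.mult (tensor H (corr_rmodule H \<Omega>) N)"
  "one (Ind G H \<Omega> N) = one (tensor H (corr_rmodule H \<Omega>) N)"
  by (simp_all add: Ind_def Let_def)

lemma Ind_act: "act (Ind G H \<Omega> N) \<xi> = tensor_lift (tensor H (corr_rmodule H \<Omega>) N)
     (\<lambda>m n. pure_tensor H (corr_rmodule H \<Omega>) N (L.lact \<xi> m) n)"
  by (simp add: Ind_def Let_def)

context
  fixes N :: "('h, 'n) gmodule"
  assumes N: "left_module H N"
begin

interpretation N: tensor_pair H "corr_rmodule H \<Omega>" N
  using right_acted_corr N by (rule tensor_pairI)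

lemma Ind_balanced:
  assumes "\<xi> \<in> groupoid_ring G"
  shows "balanced H (corr_rmodule H \<Omega>) N N.T (\<lambda>m n. N.pt (L.lact \<xi> m) n)"
proof (rule balancedI)
  fix a a' b assume "a \<in> carrier (corr_rmodule H \<Omega>)" "a' \<in> carrier (corr_rmodule H \<Omega>)" "b \<in> carrier N"
  then show "N.pt (L.lact \<xi> (a \<otimes>\<^bsub>corr_rmodule H \<Omega>\<^esub> a')) b = N.pt (L.lact \<xi> a) b \<otimes>\<^bsub>N.T\<^esub> N.pt (L.lact \<xi> a') b"
    using N.pure_add_left[of "L.lact \<xi> a" "L.lact \<xi> a'" b] assms by (simp add: L.lact_add_right L.lact_closed)
next
  fix \<eta> a b assume "\<eta> \<in> groupoid_ring H" "a \<in> carrier (corr_rmodule H \<Omega>)" "b \<in> carrier N"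
  then show "N.pt (L.lact \<xi> (act (corr_rmodule H \<Omega>) \<eta> a)) b = N.pt (L.lact \<xi> a) (act N \<eta> b)"
    using N.pure_act[of \<eta> "L.lact \<xi> a" b] assms by (simp add: L.lact_closed lact_ract)
qed (use assms in \<open>simp_all add: N.pure_closed L.lact_closed N.pure_add_right\<close>)

lemma Ind_act_hom: "\<xi> \<in> groupoid_ring G \<Longrightarrow> act (Ind G H \<Omega> N) \<xi> \<in> hom N.T N.T"
  unfolding Ind_act by (rule N.tensor_lift_hom[OF N.comm_group_tensor Ind_balanced])

lemma Ind_act_pure:
  "\<lbrakk>\<xi> \<in> groupoid_ring G; m \<in> int_functions (ctop \<Omega>); n \<in> carrier N\<rbrakk> \<Longrightarrow>
   act (Ind G H \<Omega> N) \<xi> (N.pt m n) = N.pt (L.lact \<xi> m) n"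
  unfolding Ind_act using N.tensor_lift_pure[OF N.comm_group_tensor Ind_balanced] by simp

lemma Ind_module: "left_module G (Ind G H \<Omega> N)"
proof (rule G.left_moduleI)
  show "comm_group (Ind G H \<Omega> N)"
    by (rule comm_group_cong[OF N.comm_group_tensor]) simp_all
  fix \<xi> m assume \<xi>: "\<xi> \<in> groupoid_ring G" and m: "m \<in> carrier (Ind G H \<Omega> N)"
  show "act (Ind G H \<Omega> N) \<xi> m \<in> carrier (Ind G H \<Omega> N)"
    using hom_in_carrier[OF Ind_act_hom[OF \<xi>]] m by simp
  show "act (Ind G H \<Omega> N) \<xi> (m \<otimes>\<^bsub>Ind G H \<Omega> N\<^esub> n) = act (Ind G H \<Omega> N) \<xi> m \<otimes>\<^bsub>Ind G H \<Omega> N\<^esub> act (Ind G H \<Omega> N) \<xi> n"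
    if "n \<in> carrier (Ind G H \<Omega> N)" for n
    using hom_mult[OF Ind_act_hom[OF \<xi>]] m that by simp
  fix \<eta> assume \<eta>: "\<eta> \<in> groupoid_ring G"
  have s: "(\<lambda>g. \<xi> g + \<eta> g) \<in> groupoid_ring G"
    using \<xi> \<eta> by (rule int_functions_add)
  show "act (Ind G H \<Omega> N) (\<lambda>g. \<xi> g + \<eta> g) m = act (Ind G H \<Omega> N) \<xi> m \<otimes>\<^bsub>Ind G H \<Omega> N\<^esub> act (Ind G H \<Omega> N) \<eta> m"
  proof -
    have "(\<lambda>m. act (Ind G H \<Omega> N) \<xi> m \<otimes>\<^bsub>N.T\<^esub> act (Ind G H \<Omega> N) \<eta> m) \<in> hom N.T N.T"
      using Ind_act_hom[OF \<xi>] Ind_act_hom[OF \<eta>]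
      by (intro homI) (auto simp: hom_in_carrier hom_mult N.T.m_ac)
    then have "act (Ind G H \<Omega> N) (\<lambda>g. \<xi> g + \<eta> g) m = act (Ind G H \<Omega> N) \<xi> m \<otimes>\<^bsub>N.T\<^esub> act (Ind G H \<Omega> N) \<eta> m"
    proof (rule N.tensor_hom_eq[OF Ind_act_hom[OF s]])
      fix a b assume ab: "a \<in> carrier (corr_rmodule H \<Omega>)" "b \<in> carrier N"
      then show "act (Ind G H \<Omega> N) (\<lambda>g. \<xi> g + \<eta> g) (N.pt a b) =
        act (Ind G H \<Omega> N) \<xi> (N.pt a b) \<otimes>\<^bsub>N.T\<^esub> act (Ind G H \<Omega> N) \<eta> (N.pt a b)"
        using N.pure_add_left[of "L.lact \<xi> a" "L.lact \<eta> a" b] \<xi> \<eta> s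
        by (simp add: Ind_act_pure L.lact_add_left L.lact_closed)
    qed (use m in simp)
    then show ?thesis by simp
  qed
  show "act (Ind G H \<Omega> N) (conv G \<xi> \<eta>) m = act (Ind G H \<Omega> N) \<xi> (act (Ind G H \<Omega> N) \<eta> m)"
  proof (rule N.tensor_hom_eq[OF Ind_act_hom[OF G.conv_closed[OF \<xi> \<eta>]]])
    show "(\<lambda>m. act (Ind G H \<Omega> N) \<xi> (act (Ind G H \<Omega> N) \<eta> m)) \<in> hom N.T N.T"
      using hom_compose[OF Ind_act_hom[OF \<eta>] Ind_act_hom[OF \<xi>]] by (simp add: o_def)
    fix a b assume "a \<in> carrier (corr_rmodule H \<Omega>)" "b \<in> carrier N"
    then show "act (Ind G H \<Omega> N) (conv G \<xi> \<eta>) (N.pt a b) = act (Ind G H \<Omega> N) \<xi> (act (Ind G H \<Omega> N) \<eta> (N.pt a b))"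
      using \<xi> \<eta> by (simp add: Ind_act_pure G.conv_closed L.lact_conv L.lact_closed)
  qed (use m in simp)
next
  fix m assume "m \<in> carrier (Ind G H \<Omega> N)"
  then have "m \<in> carrier N.T" by simp
  \<comment> \<open>The same strengthening as for local units: all larger K fix m, so that products
    can be handled.\<close>
  then have "\<exists>L. compact_open (unit_space G) L \<and>
      (\<forall>K. compact_open (unit_space G) K \<and> L \<subseteq> K \<longrightarrow> act (Ind G H \<Omega> N) (ind K) m = m)"
  proof (induction rule: N.tensor_induct)
    case (pure a b)
    obtain L where L: "compact_open (unit_space G) L" "\<And>x. a x \<noteq> 0 \<Longrightarrow> lanchor \<Omega> x \<in> L"
      using L.support_anchor pure by auto
    have "act (Ind G H \<Omega> N) (ind K) (N.pt a b) = N.pt a b" if "compact_open (unit_space G) K" "L \<subseteq> K" for K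
    proof -
      have "L.lact (ind K) a = a"
        using that pure L(2) by (intro L.lact_local_unit) auto
      then show ?thesis
        using that pure by (simp add: Ind_act_pure G.unit_in_ring)
    qed
    then show ?case using L by blast
  next
    case (mult X Y)
    obtain L where L: "compact_open (unit_space G) L"
      "\<And>K. compact_open (unit_space G) K \<Longrightarrow> L \<subseteq> K \<Longrightarrow> act (Ind G H \<Omega> N) (ind K) X = X"
      using mult(3) by metis
    obtain L' where L': "compact_open (unit_space G) L'"
      "\<And>K. compact_open (unit_space G) K \<Longrightarrow> L' \<subseteq> K \<Longrightarrow> act (Ind G H \<Omega> N) (ind K) Y = Y"
      using mult(4) by metis
    have "act (Ind G H \<Omega> N) (ind K) (X \<otimes>\<^bsub>N.T\<^esub> Y) = X \<otimes>\<^bsub>N.T\<^esub> Y" if "compact_open (unit_space G) K" "L \<union> L' \<subseteq> K" for K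
      using hom_mult[OF Ind_act_hom[OF G.unit_in_ring[OF that(1)]] mult(1,2)] L(2) L'(2) that by simp
    then show ?case
      using G.compact_open_units_Un[OF L(1) L'(1)] by (intro exI[of _ "L \<union> L'"]) simp
  qed
  then show "\<exists>\<xi>\<in>groupoid_ring G. act (Ind G H \<Omega> N) \<xi> m = m"
    using G.unit_in_ring by blast
qed

end

lemma Ind_map_hom:
  assumes N: "left_module H N" and N': "left_module H N'" and f: "gmodule_hom H N N' f"
  shows "gmodule_hom G (Ind G H \<Omega> N) (Ind G H \<Omega> N') (Ind_map H \<Omega> N' f)"
proof (rule gmodule_homI)
  interpret N: tensor_pair H "corr_rmodule H \<Omega>" N
    using right_acted_corr N by (rule tensor_pairI)
  interpret N': tensor_pair H "corr_rmodule H \<Omega>" N'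
    using right_acted_corr N' by (rule tensor_pairI)
  note h = tensor_map_hom[OF right_acted_corr N N' f]
  note p = tensor_map_pure[OF right_acted_corr N N' f]
  show "Ind_map H \<Omega> N' f x \<in> carrier (Ind G H \<Omega> N')" if "x \<in> carrier (Ind G H \<Omega> N)" for x
    using that hom_in_carrier[OF h] by (simp add: Ind_map_eq)
  show "Ind_map H \<Omega> N' f (x \<otimes>\<^bsub>Ind G H \<Omega> N\<^esub> y) = Ind_map H \<Omega> N' f x \<otimes>\<^bsub>Ind G H \<Omega> N'\<^esub> Ind_map H \<Omega> N' f y"
    if "x \<in> carrier (Ind G H \<Omega> N)" "y \<in> carrier (Ind G H \<Omega> N)" for x y
    using that hom_mult[OF h] by (simp add: Ind_map_eq)
  show "Ind_map H \<Omega> N' f (act (Ind G H \<Omega> N) \<xi> x) = act (Ind G H \<Omega> N') \<xi> (Ind_map H \<Omega> N' f x)"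
    if \<xi>: "\<xi> \<in> groupoid_ring G" and "x \<in> carrier (Ind G H \<Omega> N)" for \<xi> x
    unfolding Ind_map_eq
  proof (rule N.tensor_hom_eq)
    show "(\<lambda>x. tensor_map H (corr_rmodule H \<Omega>) N' f (act (Ind G H \<Omega> N) \<xi> x)) \<in> hom N.T N'.T"
      using hom_compose[OF Ind_act_hom[OF N \<xi>] h] by (simp add: o_def)
    show "(\<lambda>x. act (Ind G H \<Omega> N') \<xi> (tensor_map H (corr_rmodule H \<Omega>) N' f x)) \<in> hom N.T N'.T"
      using hom_compose[OF h Ind_act_hom[OF N' \<xi>]] by (simp add: o_def)
  qed (use that in \<open>simp_all add: p Ind_act_pure[OF N] Ind_act_pure[OF N'] L.lact_closed gmodule_hom_closed[OF f]\<close>)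
qed

end

section \<open>Induction along a correspondence is exact\<close>

text \<open>The explicit inverse \<open>inv_into\<close> can occur in a definition, as it does in
  \<open>coord\<close>.\<close>

lemma sheet_inv_into:
  assumes "sheet X Y f U"
  shows "continuous_map (subtopology Y (f ` U)) X (inv_into U f)"
proof -
  obtain g where g: "continuous_map (subtopology Y (f ` U)) X g" "\<And>x. x \<in> U \<Longrightarrow> g (f x) = x"
    "\<And>y. y \<in> f ` U \<Longrightarrow> g y \<in> U" "\<And>y. y \<in> f ` U \<Longrightarrow> f (g y) = y"
    by (rule sheet_inverse[OF assms]) (rule that)
  show ?thesis
  proof (rule continuous_map_eq[OF g(1)])
    fix y assume "y \<in> topspace (subtopology Y (f ` U))"
    then obtain x where x: "x \<in> U" "y = f x"
      by auto
    then show "g y = inv_into U f y"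
      using g(2)[OF x(1)] inv_into_f_f[OF sheet_inj_on[OF assms] x(1)] by simp
  qed
qed

context ample_correspondence
begin

lemma corr_base: "has_base (ctop \<Omega>) (sheet (ctop \<Omega>) (unit_space H) (ranchor \<Omega>))"
  using has_base_local_homeomorphism etale H.unit_space_base H.Hausdorff_units by blast

text \<open>The second clause says that U meets each orbit of H at most once: if u and u h both lie
  in U, then h is a unit and u h = u.\<close>

definition slice :: "'w set \<Rightarrow> bool" where
  "slice U \<longleftrightarrow> sheet (ctop \<Omega>) (unit_space H) (ranchor \<Omega>) U \<and>
     (\<forall>u \<in> U. \<forall>h \<in> arrows H. ranchor \<Omega> u = rng H h \<and> rmul \<Omega> u h \<in> U \<longrightarrow> h \<in> units H)"

text \<open>The pairs (w, w h) with h not a unit form a closed set, because the units are open and a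
  proper map is closed; by freeness this set avoids (x, x). A small set whose square lies in a box
  around (x, x) avoiding it satisfies the orbit condition.\<close>

lemma slice_base: "has_base (ctop \<Omega>) slice"
  unfolding has_base_def
proof (intro conjI allI impI; (elim conjE)?)
  fix U x assume U: "openin (ctop \<Omega>) U" "x \<in> U"
  then have x: "x \<in> topspace (ctop \<Omega>)"
    using openin_subset by blast
  let ?Z = "subtopology (prod_topology (ctop \<Omega>) (gtop H)) {(w, h). ranchor \<Omega> w = rng H h}"
  let ?p = "\<lambda>(w, h). (w, rmul \<Omega> w h)"
  define C where "C = {z \<in> topspace ?Z. snd z \<in> arrows H - units H}"
  have "closedin (gtop H) (arrows H - units H)"
    using H.open_units by blast
  then have "closedin ?Z C"
    unfolding C_def by (rule closedin_continuous_map_preimage[OF continuous_map_subtopology_snd])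
  then have cl: "closedin (prod_topology (ctop \<Omega>) (ctop \<Omega>)) (?p ` C)"
    using proper by (auto simp: proper_map_def closed_map_def)
  have "(x, x) \<notin> ?p ` C"
  proof
    assume "(x, x) \<in> ?p ` C"
    then obtain h where "h \<in> arrows H" "h \<notin> units H" "ranchor \<Omega> x = rng H h" "rmul \<Omega> x h = x"
      by (auto simp: C_def)
    then show False
      using free[OF x] R.ranchor_units[OF x] by metis
  qed
  then have "(x, x) \<in> topspace (prod_topology (ctop \<Omega>) (ctop \<Omega>)) - ?p ` C"
    using x by simp
  moreover have "openin (prod_topology (ctop \<Omega>) (ctop \<Omega>)) (topspace (prod_topology (ctop \<Omega>) (ctop \<Omega>)) - ?p ` C)"
    using cl by blast
  ultimately have "\<exists>A B. openin (ctop \<Omega>) A \<and> openin (ctop \<Omega>) B \<and> x \<in> A \<and> x \<in> B \<and>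
      A \<times> B \<subseteq> topspace (prod_topology (ctop \<Omega>) (ctop \<Omega>)) - ?p ` C"
    by (simp only: openin_prod_topology_alt)
  then obtain A B where AB: "openin (ctop \<Omega>) A" "openin (ctop \<Omega>) B" "x \<in> A" "x \<in> B"
    "A \<times> B \<subseteq> topspace (prod_topology (ctop \<Omega>) (ctop \<Omega>)) - ?p ` C"
    by (elim exE conjE)
  define V where "V = U \<inter> A \<inter> B"
  have "openin (ctop \<Omega>) V" "x \<in> V"
    using U AB by (auto simp: V_def)
  then obtain K where K: "compact_open (ctop \<Omega>) K" "sheet (ctop \<Omega>) (unit_space H) (ranchor \<Omega>) K" "x \<in> K" "K \<subseteq> V"
    using corr_base unfolding has_base_def by blast
  have "h \<in> units H" if "u \<in> K" "h \<in> arrows H" "ranchor \<Omega> u = rng H h" "rmul \<Omega> u h \<in> K" for u h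
  proof (rule ccontr)
    assume "h \<notin> units H"
    moreover have "u \<in> topspace (ctop \<Omega>)"
      using K(1) that(1) openin_subset unfolding compact_open_def by blast
    ultimately have "(u, h) \<in> C"
      using that by (simp add: C_def)
    then have "(u, rmul \<Omega> u h) \<in> ?p ` C"
      by (metis (no_types, lifting) image_eqI case_prod_conv)
    moreover have "(u, rmul \<Omega> u h) \<in> A \<times> B"
      using that K(4) by (auto simp: V_def)
    ultimately show False
      using AB(5) by blast
  qed
  then have "slice K"
    using K(2) by (simp add: slice_def)
  then show "\<exists>K. compact_open (ctop \<Omega>) K \<and> slice K \<and> x \<in> K \<and> K \<subseteq> U"
    using K by (intro exI[of _ K]) (auto simp: V_def)
next
  fix K W assume K: "slice K" "openin (ctop \<Omega>) W" "W \<subseteq> K"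
  have "sheet (ctop \<Omega>) (unit_space H) (ranchor \<Omega>) W"
    by (rule sheet_subset[OF _ K(2,3)]) (use K(1) in \<open>simp add: slice_def\<close>)
  then show "slice W"
    using K by (auto simp: slice_def subset_iff)
qed

text \<open>The coordinate of a function along a slice \<open>U\<close>: its value at \<open>h\<close> is taken at \<open>u \<cdot> h\<close>, where
  \<open>u\<close> is the point of \<open>U\<close> over the range of \<open>h\<close>.\<close>

definition coord :: "'w set \<Rightarrow> ('w \<Rightarrow> int) \<Rightarrow> 'h \<Rightarrow> int" where
  "coord U \<xi> = (\<lambda>h. if h \<in> arrows H \<and> rng H h \<in> ranchor \<Omega> ` U
     then \<xi> (rmul \<Omega> (inv_into U (ranchor \<Omega>) (rng H h)) h) else 0)"

context
  fixes U assumes cU: "compact_open (ctop \<Omega>) U" and sU: "slice U"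
begin

lemma slice_sheet: "sheet (ctop \<Omega>) (unit_space H) (ranchor \<Omega>) U"
  using sU by (simp add: slice_def)

lemma slice_top: "u \<in> U \<Longrightarrow> u \<in> topspace (ctop \<Omega>)"
  using cU openin_subset by (auto simp: compact_open_def)

lemma slice_point:
  assumes "y \<in> ranchor \<Omega> ` U"
  shows "inv_into U (ranchor \<Omega>) y \<in> U" "ranchor \<Omega> (inv_into U (ranchor \<Omega>) y) = y"
    "inv_into U (ranchor \<Omega>) y \<in> topspace (ctop \<Omega>)"
  using assms slice_top[OF inv_into_into[OF assms]] inv_into_into[OF assms] f_inv_into_f[OF assms] by simp_all

lemma slice_point_eq: "u \<in> U \<Longrightarrow> inv_into U (ranchor \<Omega>) (ranchor \<Omega> u) = u"
  using inv_into_f_f[OF sheet_inj_on[OF slice_sheet]] .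

text \<open>Right translation by h^-1 k carries w h to w k, so the slice condition makes h^-1 k a
  unit.\<close>

lemma slice_orbit_unique:
  assumes "w \<in> topspace (ctop \<Omega>)" "h \<in> arrows H" "k \<in> arrows H" "ranchor \<Omega> w = rng H h" "ranchor \<Omega> w = rng H k"
    "rmul \<Omega> w h \<in> U" "rmul \<Omega> w k \<in> U"
  shows "h = k"
proof -
  let ?l = "gmul H (ginv H h) k"
  have l: "?l \<in> arrows H" "rng H ?l = src H h" "gmul H h ?l = k"
    using assms H.rng_gmul_left[of k]
    by (simp_all add: H.gmul_closed H.ginv_closed H.src_ginv H.rng_gmul H.rng_ginv H.gmul_ginv flip: H.gmul_assoc)
  have "rmul \<Omega> (rmul \<Omega> w h) ?l = rmul \<Omega> w k"
    using right.action_assoc[of w h ?l] assms l by simp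
  then have "?l \<in> units H"
    using sU assms l unfolding slice_def by (metis right.anchor_action)
  then have "?l = src H h"
    using l(2) H.unitsD(3) by metis
  then show ?thesis
    using l(3) H.gmul_src assms(2) by metis
qed

text \<open>The coordinate of an indicator is the indicator of the set D of those h for which u h
  lies in V, u being the point of U over the range of h. Its compactness is where properness
  enters.\<close>

lemma coord_ind:
  assumes V: "compact_open (ctop \<Omega>) V"
  shows "coord U (ind V) \<in> groupoid_ring H"
proof -
  let ?g = "inv_into U (ranchor \<Omega>)"
  define D0 where "D0 = {h \<in> arrows H. rng H h \<in> ranchor \<Omega> ` U}"
  define \<phi> where "\<phi> = (\<lambda>h. rmul \<Omega> (?g (rng H h)) h)"
  define D where "D = {h \<in> D0. \<phi> h \<in> V}"
  have oD0: "openin (gtop H) D0"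
    unfolding D0_def using slice_sheet
    by (intro openin_continuous_map_preimage[OF H.continuous_rng_unit]) (simp add: sheet_def)
  have c1: "continuous_map (subtopology (gtop H) D0) (subtopology (unit_space H) (ranchor \<Omega> ` U)) (rng H)"
    using H.continuous_rng_unit by (auto simp: continuous_map_in_subtopology D0_def intro: continuous_map_from_subtopology)
  from continuous_map_compose[OF c1 sheet_inv_into[OF slice_sheet]]
  have "continuous_map (subtopology (gtop H) D0)
      (subtopology (prod_topology (ctop \<Omega>) (gtop H)) {(w, h). ranchor \<Omega> w = rng H h}) (\<lambda>h. (?g (rng H h), h))"
    by (auto simp: continuous_map_in_subtopology continuous_map_paired o_def D0_def slice_point
        intro: continuous_map_from_subtopology)
  from continuous_map_compose[OF this right.continuous_action]
  have c\<phi>: "continuous_map (subtopology (gtop H) D0) (ctop \<Omega>) \<phi>"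
    by (simp add: o_def \<phi>_def)
  have D: "D = {h \<in> topspace (subtopology (gtop H) D0). \<phi> h \<in> V}"
    by (auto simp: D_def D0_def)
  have "openin (subtopology (gtop H) D0) D"
    unfolding D using V by (intro openin_continuous_map_preimage[OF c\<phi>]) (simp add: compact_open_def)
  then have oD: "openin (gtop H) D" "D \<subseteq> D0"
    using oD0 by (simp_all add: openin_open_subtopology)
  \<comment> \<open>D is the projection to H of the preimage of the compact set U \<times> V under
    the proper map taking (w, h) to (w, w h).\<close>
  let ?Z = "subtopology (prod_topology (ctop \<Omega>) (gtop H)) {(w, h). ranchor \<Omega> w = rng H h}"
  let ?p = "\<lambda>(w, h). (w, rmul \<Omega> w h)"
  have "compactin (prod_topology (ctop \<Omega>) (ctop \<Omega>)) (U \<times> V)"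
    using cU V by (simp add: compactin_Times compact_open_def)
  then have "compactin ?Z {z. z \<in> topspace ?Z \<and> ?p z \<in> U \<times> V}"
    by (rule compactin_proper_map_preimage[OF proper])
  then have "compactin (gtop H) (snd ` {z. z \<in> topspace ?Z \<and> ?p z \<in> U \<times> V})"
    by (rule image_compactin[OF _ continuous_map_subtopology_snd])
  moreover have "snd ` {z. z \<in> topspace ?Z \<and> ?p z \<in> U \<times> V} = D"
  proof (intro equalityI subsetI)
    fix h assume "h \<in> snd ` {z. z \<in> topspace ?Z \<and> ?p z \<in> U \<times> V}"
    then obtain u where u: "u \<in> U" "h \<in> arrows H" "ranchor \<Omega> u = rng H h" "rmul \<Omega> u h \<in> V"
      by auto
    then show "h \<in> D"
      using slice_point_eq[OF u(1)] by (auto simp: D_def D0_def \<phi>_def intro: image_eqI[of _ _ u])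
  next
    fix h assume "h \<in> D"
    then show "h \<in> snd ` {z. z \<in> topspace ?Z \<and> ?p z \<in> U \<times> V}"
      by (intro image_eqI[of _ _ "(?g (rng H h), h)"]) (auto simp: D_def D0_def \<phi>_def slice_point)
  qed
  ultimately have cD: "compactin (gtop H) D"
    by simp
  have "Hausdorff_space (subtopology (gtop H) D)"
  proof (rule Hausdorff_space_injective_preimage)
    show "Hausdorff_space (subtopology (ctop \<Omega>) V)"
      using V by (simp add: compact_open_def)
    show "continuous_map (subtopology (gtop H) D) (subtopology (ctop \<Omega>) V) \<phi>"
      using continuous_map_from_subtopology_mono[OF c\<phi> oD(2)] by (auto simp: continuous_map_in_subtopology D_def)
    \<comment> \<open>If u h = v k = w, then h^-1 and k^-1 both move w into U, hence agree by
      \<open>slice_orbit_unique\<close>.\<close>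
    show "inj_on \<phi> (topspace (subtopology (gtop H) D))"
    proof (rule inj_onI)
      fix h k assume "h \<in> topspace (subtopology (gtop H) D)" "k \<in> topspace (subtopology (gtop H) D)" and eq: "\<phi> h = \<phi> k"
      then have h: "h \<in> arrows H" "rng H h \<in> ranchor \<Omega> ` U" and k: "k \<in> arrows H" "rng H k \<in> ranchor \<Omega> ` U"
        by (auto simp: D_def D0_def)
      let ?u = "?g (rng H h)" and ?v = "?g (rng H k)"
      let ?w = "rmul \<Omega> ?u h"
      note u = slice_point[OF h(2)] and v = slice_point[OF k(2)]
      have w: "?w \<in> topspace (ctop \<Omega>)" "ranchor \<Omega> ?w = src H h"
        using u h by (simp_all add: R.raction_closed right.anchor_action)
      have w': "?w = rmul \<Omega> ?v k"
        using eq by (simp add: \<phi>_def)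
      then have sk: "ranchor \<Omega> ?w = src H k"
        using v k by (simp add: right.anchor_action)
      have "rmul \<Omega> ?w (ginv H h) = ?u"
        using right.action_assoc[of ?u h "ginv H h"] right.action_unit[of ?u] u h
        by (simp add: H.ginv_closed H.rng_ginv H.gmul_ginv)
      moreover have "rmul \<Omega> ?w (ginv H k) = ?v"
        unfolding w' using right.action_assoc[of ?v k "ginv H k"] right.action_unit[of ?v] v k
        by (simp add: H.ginv_closed H.rng_ginv H.gmul_ginv)
      ultimately have "rmul \<Omega> ?w (ginv H h) \<in> U" "rmul \<Omega> ?w (ginv H k) \<in> U"
        using u(1) v(1) by metis+
      moreover have "ranchor \<Omega> ?w = rng H (ginv H h)" "ranchor \<Omega> ?w = rng H (ginv H k)"
        using w(2) sk h(1) k(1) by (metis H.rng_ginv)+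
      ultimately have "ginv H h = ginv H k"
        by (intro slice_orbit_unique[OF w(1) H.ginv_closed[OF h(1)] H.ginv_closed[OF k(1)]])
      then show "h = k"
        using H.ginv_ginv h k by metis
    qed
  qed
  then have "compact_open (gtop H) D"
    using oD cD by (simp add: compact_open_def)
  moreover have "coord U (ind V) = ind D"
    by (rule ext) (auto simp: coord_def D_def D0_def \<phi>_def)
  ultimately show ?thesis
    using ind_int_functions by metis
qed

lemma coord_closed:
  assumes "\<xi> \<in> int_functions (ctop \<Omega>)"
  shows "coord U \<xi> \<in> groupoid_ring H"
  using assms
proof (induction rule: int_functions_induct)
  case zero
  then show ?case by (simp add: coord_def)
next
  case (add f g)
  have "coord U (\<lambda>x. f x + g x) = (\<lambda>h. coord U f h + coord U g h)"
    by (auto simp: coord_def)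
  then show ?case using int_functions_add add by metis
next
  case (uminus f)
  have "coord U (\<lambda>x. - f x) = (\<lambda>h. - coord U f h)"
    by (auto simp: coord_def)
  then show ?case using int_functions_uminus uminus by metis
qed (rule coord_ind)

lemma coord_add: "coord U (\<lambda>w. \<xi> w + \<eta> w) = (\<lambda>h. coord U \<xi> h + coord U \<eta> h)"
  by (auto simp: coord_def)

text \<open>Because u (h k) = (u h) k, \<open>coord U\<close> is a map of right modules from
  functions on \<Omega> to the ring. This is what makes the pairing of \<xi> and n to
  \<open>act N (coord U \<xi>) n\<close> balanced.\<close>

lemma coord_ract: "coord U (R.ract \<eta> \<xi>) = conv H (coord U \<xi>) \<eta>"
proof
  fix h
  show "coord U (R.ract \<eta> \<xi>) h = conv H (coord U \<xi>) \<eta> h"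
  proof (cases "h \<in> arrows H")
    case h: True
    show ?thesis
    proof (cases "rng H h \<in> ranchor \<Omega> ` U")
      case True
      let ?u = "inv_into U (ranchor \<Omega>) (rng H h)"
      let ?w = "rmul \<Omega> ?u h"
      note u = slice_point[OF True]
      have w: "?w \<in> topspace (ctop \<Omega>)" "ranchor \<Omega> ?w = src H h"
        using u h by (simp_all add: R.raction_closed right.anchor_action)
      \<comment> \<open>The substitution l = (h k)^-1 matches the convolution sum, over l with
        source r(h), with the sum of the right action, over k with range s(h).\<close>
      have bij: "bij_betw (\<lambda>k. ginv H (gmul H h k)) {k \<in> arrows H. rng H k = src H h} {l \<in> arrows H. src H l = rng H h}"
      proof (rule bij_betw_byWitness[of _ "\<lambda>l. gmul H (ginv H h) (ginv H l)"])
        show "\<forall>k\<in>{k \<in> arrows H. rng H k = src H h}. gmul H (ginv H h) (ginv H (ginv H (gmul H h k))) = k"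
          using h by (auto simp: H.ginv_ginv H.gmul_closed H.ginv_closed H.src_ginv H.ginv_gmul simp flip: H.gmul_assoc)
            (metis H.rng_gmul_left)
        show "\<forall>l\<in>{l \<in> arrows H. src H l = rng H h}. ginv H (gmul H h (gmul H (ginv H h) (ginv H l))) = l"
        proof
          fix l assume l: "l \<in> {l \<in> arrows H. src H l = rng H h}"
          have "gmul H h (gmul H (ginv H h) (ginv H l)) = ginv H l"
            using h l H.rng_gmul_left[of "ginv H l"]
            by (simp add: H.ginv_closed H.src_ginv H.rng_ginv H.gmul_ginv flip: H.gmul_assoc)
          then show "ginv H (gmul H h (gmul H (ginv H h) (ginv H l))) = l"
            using l by (simp add: H.ginv_ginv)
        qed
      qed (use h in \<open>auto simp: H.gmul_closed H.ginv_closed H.src_ginv H.rng_ginv H.rng_gmul H.src_gmul\<close>)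
      have "conv H (coord U \<xi>) \<eta> h = sum' (\<lambda>l. coord U \<xi> (ginv H l) * \<eta> (gmul H l h)) {l \<in> arrows H. src H l = rng H h}"
        using h by (simp add: conv_def)
      also have "\<dots> = sum' (\<lambda>k. coord U \<xi> (ginv H (ginv H (gmul H h k))) * \<eta> (gmul H (ginv H (gmul H h k)) h))
          {k \<in> arrows H. rng H k = src H h}"
        by (rule sum'_reindex[OF bij])
      also have "\<dots> = sum' (\<lambda>k. \<xi> (rmul \<Omega> ?w k) * \<eta> (ginv H k)) {k \<in> arrows H. rng H k = src H h}"
      proof (rule sum.cong'[OF refl])
        fix k assume "k \<in> {k \<in> arrows H. rng H k = src H h}"
        then have k: "k \<in> arrows H" "rng H k = src H h" by auto
        have hk: "gmul H h k \<in> arrows H" "rng H (gmul H h k) = rng H h"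
          using h k by (simp_all add: H.gmul_closed H.rng_gmul)
        have "coord U \<xi> (ginv H (ginv H (gmul H h k))) = \<xi> (rmul \<Omega> ?w k)"
          using hk True u h k by (simp add: H.ginv_ginv coord_def right.action_assoc)
        moreover have "gmul H (ginv H (gmul H h k)) h = ginv H k"
          using h k H.gmul_src[of "ginv H k"]
          by (simp add: H.ginv_gmul_ginv H.gmul_assoc H.ginv_closed H.src_ginv H.rng_ginv H.ginv_gmul)
        ultimately show "coord U \<xi> (ginv H (ginv H (gmul H h k))) * \<eta> (gmul H (ginv H (gmul H h k)) h) =
            \<xi> (rmul \<Omega> ?w k) * \<eta> (ginv H k)"
          by simp
      qed
      also have "\<dots> = coord U (R.ract \<eta> \<xi>) h"
        using h True w by (simp add: coord_def fun_ract_def)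
      finally show ?thesis by simp
    next
      case False
      then have "coord U \<xi> (ginv H l) = 0" if "l \<in> arrows H" "src H l = rng H h" for l
        using that by (simp add: coord_def H.rng_ginv)
      then show ?thesis
        using False h sum'_zero[of "{l \<in> arrows H. src H l = rng H h}" "\<lambda>l. coord U \<xi> (ginv H l) * \<eta> (gmul H l h)"]
        unfolding conv_def by (simp add: coord_def[of _ "R.ract \<eta> \<xi>"])
    qed
  qed (simp add: coord_def conv_def)
qed

text \<open>Subtracting the component along \<open>U\<close> removes the part of \<open>\<xi>\<close> supported on the orbits through \<open>U\<close>.\<close>

lemma coord_component:
  assumes \<xi>: "\<xi> \<in> int_functions (ctop \<Omega>)"
  shows "\<xi> w - R.ract (coord U \<xi>) (ind U) w \<noteq> 0 \<Longrightarrow> \<xi> w \<noteq> 0 \<and> w \<notin> U"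
proof -
  assume nz: "\<xi> w - R.ract (coord U \<xi>) (ind U) w \<noteq> 0"
  have w: "w \<in> topspace (ctop \<Omega>)"
    using nz int_functions_outside[OF \<xi>, of w] by (cases "w \<in> topspace (ctop \<Omega>)") (simp_all add: fun_ract_def)
  have val: "R.ract (coord U \<xi>) (ind U) w = sum' (\<lambda>h. ind U (rmul \<Omega> w h) * coord U \<xi> (ginv H h)) {h \<in> arrows H. rng H h = ranchor \<Omega> w}"
    using w by (simp add: fun_ract_def)
  \<comment> \<open>Either the orbit of w meets U, and then the one surviving summand reproduces
    \<xi> w, or w lies outside U and the component vanishes at w.\<close>
  show ?thesis
  proof (cases "\<exists>h. h \<in> arrows H \<and> rng H h = ranchor \<Omega> w \<and> rmul \<Omega> w h \<in> U")
    case True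
    then obtain h where h: "h \<in> arrows H" "rng H h = ranchor \<Omega> w" "rmul \<Omega> w h \<in> U"
      by blast
    have "R.ract (coord U \<xi>) (ind U) w = ind U (rmul \<Omega> w h) * coord U \<xi> (ginv H h)"
      unfolding val
    proof (rule sum'_single)
      fix k assume k: "k \<in> {h \<in> arrows H. rng H h = ranchor \<Omega> w}" "k \<noteq> h"
      then have k': "k \<in> arrows H" "ranchor \<Omega> w = rng H k" "k \<noteq> h"
        by simp_all
      have "rmul \<Omega> w k \<notin> U"
        using slice_orbit_unique[OF w h(1) k'(1) h(2)[symmetric] k'(2) h(3)] k'(3) by metis
      then show "ind U (rmul \<Omega> w k) * coord U \<xi> (ginv H k) = 0" by simp
    next
      show "h \<in> {h \<in> arrows H. rng H h = ranchor \<Omega> w}"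
        using h by simp
    qed
    also have "\<dots> = \<xi> w"
    proof -
      have a: "ranchor \<Omega> (rmul \<Omega> w h) = src H h"
        using w h by (simp add: right.anchor_action)
      then have "inv_into U (ranchor \<Omega>) (src H h) = rmul \<Omega> w h"
        using slice_point_eq[OF h(3)] by simp
      moreover have "src H h \<in> ranchor \<Omega> ` U"
        using a h(3) by (metis imageI)
      moreover have "rmul \<Omega> (rmul \<Omega> w h) (ginv H h) = w"
        using right.action_assoc[of w h "ginv H h"] right.action_unit[of w] w h
        by (simp add: H.ginv_closed H.rng_ginv H.gmul_ginv)
      ultimately show ?thesis
        using h by (simp add: coord_def H.ginv_closed H.rng_ginv)
    qed
    finally show ?thesis using nz by simp
  next
    case False
    have "w \<notin> U"
      using False right.action_unit[OF w] R.ranchor_units[OF w] H.unitsD by metis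
    moreover have "R.ract (coord U \<xi>) (ind U) w = 0"
      unfolding val using False by (intro sum'_zero) auto
    ultimately show ?thesis
      using nz by simp
  qed
qed

end

lemma slice_cover:
  assumes "\<xi> \<in> int_functions (ctop \<Omega>)"
  shows "\<exists>\<U>. finite \<U> \<and> (\<forall>U \<in> \<U>. compact_open (ctop \<Omega>) U \<and> slice U) \<and> (\<forall>w. \<xi> w \<noteq> 0 \<longrightarrow> w \<in> \<Union>\<U>)"
  using assms slice_base
proof (induction rule: int_functions_induct_base)
  case zero
  then show ?case by (intro exI[of _ "{}"]) auto
next
  case (add f g)
  obtain \<U> where U: "finite \<U>" "\<forall>U \<in> \<U>. compact_open (ctop \<Omega>) U \<and> slice U" "\<forall>w. f w \<noteq> 0 \<longrightarrow> w \<in> \<Union>\<U>"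
    using add(3) by (elim exE conjE)
  obtain \<V> where V: "finite \<V>" "\<forall>U \<in> \<V>. compact_open (ctop \<Omega>) U \<and> slice U" "\<forall>w. g w \<noteq> 0 \<longrightarrow> w \<in> \<Union>\<V>"
    using add(4) by (elim exE conjE)
  have "w \<in> \<Union>(\<U> \<union> \<V>)" if "f w + g w \<noteq> 0" for w
    using that U(3) V(3) by (cases "f w = 0") auto
  then show ?case
    using U(1,2) V(1,2) by (intro exI[of _ "\<U> \<union> \<V>"]) auto
next
  case (ind V)
  then show ?case by (intro exI[of _ "{V}"]) auto
qed auto

text \<open>An element killed by an injective map has trivial coordinates along all slices, so
  removing its components along slices does not change it; but finitely many removals give zero.\<close>

lemma tensor_corr_injective:
  assumes N: "left_module H N" and N': "left_module H N'" and f: "gmodule_hom H N N' f"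
    and inj: "\<And>x. \<lbrakk>x \<in> carrier N; f x = \<one>\<^bsub>N'\<^esub>\<rbrakk> \<Longrightarrow> x = \<one>\<^bsub>N\<^esub>"
    and X: "X \<in> carrier (tensor H (corr_rmodule H \<Omega>) N)"
    and X1: "tensor_map H (corr_rmodule H \<Omega>) N' f X = \<one>\<^bsub>tensor H (corr_rmodule H \<Omega>) N'\<^esub>"
  shows "X = \<one>\<^bsub>tensor H (corr_rmodule H \<Omega>) N\<^esub>"
proof -
  interpret N: tensor_pair H "corr_rmodule H \<Omega>" N
    using right_acted_corr N by (rule tensor_pairI)
  interpret N': tensor_pair H "corr_rmodule H \<Omega>" N'
    using right_acted_corr N' by (rule tensor_pairI)
  define good where "good = (\<lambda>U. compact_open (ctop \<Omega>) U \<and> slice U)"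
  have bal: "balanced H (corr_rmodule H \<Omega>) L L (\<lambda>\<xi> n. act L (coord U \<xi>) n)" if "left_module H L" "good U" for L :: "('h, 'l) gmodule" and U
  proof -
    interpret L: left_module H L by fact
    show ?thesis
      using that(2) by (intro balancedI)
        (auto simp: good_def coord_closed coord_add coord_ract L.act_closed L.act_add L.add_act L.conv_act)
  qed
  define c where "c = (\<lambda>U. tensor_lift N (\<lambda>\<xi> n. act N (coord U \<xi>) n))"
  have c: "c U \<in> hom N.T N" "\<And>\<xi> n. \<lbrakk>\<xi> \<in> int_functions (ctop \<Omega>); n \<in> carrier N\<rbrakk> \<Longrightarrow> c U (N.pt \<xi> n) = act N (coord U \<xi>) n"
    if "good U" for U
    unfolding c_def using N.tensor_lift_hom[OF N.B.comm_group_axioms bal[OF N that]]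
      N.tensor_lift_pure[OF N.B.comm_group_axioms bal[OF N that]] by simp_all
  define c' where "c' = (\<lambda>U. tensor_lift N' (\<lambda>\<xi> n. act N' (coord U \<xi>) n))"
  have c': "c' U \<in> hom N'.T N'" "\<And>\<xi> n. \<lbrakk>\<xi> \<in> int_functions (ctop \<Omega>); n \<in> carrier N'\<rbrakk> \<Longrightarrow> c' U (N'.pt \<xi> n) = act N' (coord U \<xi>) n"
    if "good U" for U
    unfolding c'_def using N'.tensor_lift_hom[OF N'.B.comm_group_axioms bal[OF N' that]]
      N'.tensor_lift_pure[OF N'.B.comm_group_axioms bal[OF N' that]] by simp_all
  \<comment> \<open>Naturality of the coordinate maps in N; it transfers triviality of coordinates
    from N' to N.\<close>
  have fc: "f (c U Y) = c' U (tensor_map H (corr_rmodule H \<Omega>) N' f Y)" if U: "good U" and Y: "Y \<in> carrier N.T" for U Y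
  proof (rule N.tensor_hom_eq[OF _ _ _ Y])
    show "(\<lambda>Y. f (c U Y)) \<in> hom N.T N'"
      using hom_compose[OF c(1)[OF U] gmodule_hom_hom[OF f]] by (simp add: o_def)
    show "(\<lambda>Y. c' U (tensor_map H (corr_rmodule H \<Omega>) N' f Y)) \<in> hom N.T N'"
      using hom_compose[OF tensor_map_hom[OF right_acted_corr N N' f] c'(1)[OF U]] by (simp add: o_def)
  next
    fix a b assume "a \<in> carrier (corr_rmodule H \<Omega>)" "b \<in> carrier N"
    then show "f (c U (N.pt a b)) = c' U (tensor_map H (corr_rmodule H \<Omega>) N' f (N.pt a b))"
      using U by (simp add: c c' tensor_map_pure[OF right_acted_corr N N' f] gmodule_hom_closed[OF f]
          gmodule_hom_act[OF f] coord_closed good_def)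
  qed
  \<comment> \<open>\<open>D U\<close> subtracts the component along U. On pure tensors it changes
    the function alone, as \<open>d U\<close> below.\<close>
  define D where "D = (\<lambda>U Y. Y \<otimes>\<^bsub>N.T\<^esub> inv\<^bsub>N.T\<^esub> N.pt (ind U) (c U Y))"
  have indU: "ind U \<in> int_functions (ctop \<Omega>)" if "good U" for U
    by (rule ind_int_functions) (use that in \<open>simp add: good_def\<close>)
  have D_hom: "D U \<in> hom N.T N.T" if U: "good U" for U
  proof (rule homI)
    have cl: "N.pt (ind U) (c U Y) \<in> carrier N.T" if "Y \<in> carrier N.T" for Y
      using that U c(1)[OF U] indU[OF U] by (simp add: N.pure_closed hom_in_carrier)
    then show "D U Y \<in> carrier N.T" if "Y \<in> carrier N.T" for Y
      using that by (simp add: D_def)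
    show "D U (Y \<otimes>\<^bsub>N.T\<^esub> Z) = D U Y \<otimes>\<^bsub>N.T\<^esub> D U Z" if "Y \<in> carrier N.T" "Z \<in> carrier N.T" for Y Z
      using that cl hom_mult[OF c(1)[OF U]] N.pure_add_right[of "ind U" "c U Y" "c U Z"] indU[OF U]
        hom_in_carrier[OF c(1)[OF U]] unfolding D_def
      by (simp add: N.T.mult_inv_comm4)
  qed
  define d where "d = (\<lambda>U \<xi> w. \<xi> w - R.ract (coord U \<xi>) (ind U) w)"
  have d: "d U \<xi> \<in> int_functions (ctop \<Omega>)" "D U (N.pt \<xi> n) = N.pt (d U \<xi>) n"
    if U: "good U" and \<xi>: "\<xi> \<in> int_functions (ctop \<Omega>)" and n: "n \<in> carrier N" for U \<xi> n
  proof -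
    have k: "coord U \<xi> \<in> groupoid_ring H"
      using U \<xi> by (simp add: good_def coord_closed)
    have r: "R.ract (coord U \<xi>) (ind U) \<in> int_functions (ctop \<Omega>)"
      using k indU[OF U] by (rule R.ract_closed)
    then show cl: "d U \<xi> \<in> int_functions (ctop \<Omega>)"
      unfolding d_def using \<xi> by (intro int_functions_diff)
    have "N.pt (ind U) (c U (N.pt \<xi> n)) = N.pt (R.ract (coord U \<xi>) (ind U)) n"
      using U \<xi> n N.pure_act[OF k _ n, of "ind U"] indU[OF U] by (simp add: c)
    moreover have "N.pt \<xi> n = N.pt (d U \<xi>) n \<otimes>\<^bsub>N.T\<^esub> N.pt (R.ract (coord U \<xi>) (ind U)) n"
      using N.pure_add_left[of "d U \<xi>" "R.ract (coord U \<xi>) (ind U)" n] cl r n by (simp add: d_def)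
    ultimately show "D U (N.pt \<xi> n) = N.pt (d U \<xi>) n"
      unfolding D_def using cl r n \<xi> by (simp add: N.T.diff_mult_cancel N.pure_closed)
  qed
  \<comment> \<open>The claim is made for every list of good slices containing \<U>, so that the
    families of two factors can be merged into one list. Order and repetition are harmless since
    each \<open>d U\<close> can only shrink the support.\<close>
  have "\<exists>\<U>. finite \<U> \<and> (\<forall>U \<in> \<U>. good U) \<and> (\<forall>Us. (\<forall>U \<in> set Us. good U) \<and> \<U> \<subseteq> set Us \<longrightarrow> fold D Us X = \<one>\<^bsub>N.T\<^esub>)"
    using X
  proof (induction rule: N.tensor_induct)
    case (pure \<xi> n)
    then have \<xi>: "\<xi> \<in> int_functions (ctop \<Omega>)" by simp
    obtain \<U> where \<U>: "finite \<U>" "\<forall>U \<in> \<U>. good U" "\<forall>w. \<xi> w \<noteq> 0 \<longrightarrow> w \<in> \<Union>\<U>"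
      using slice_cover[OF \<xi>] unfolding good_def by blast
    have "fold D Us (N.pt \<xi> n) = N.pt (fold d Us \<xi>) n \<and> fold d Us \<xi> \<in> int_functions (ctop \<Omega>) \<and>
        (\<forall>w. fold d Us \<xi> w \<noteq> 0 \<longrightarrow> \<xi> w \<noteq> 0 \<and> w \<notin> \<Union>(set Us))" if "\<forall>U \<in> set Us. good U" for Us
      using that \<xi>
    proof (induction Us arbitrary: \<xi>)
      case (Cons U Us)
      have 1: "good U" "\<forall>U \<in> set Us. good U"
        using Cons.prems by auto
      have "d U \<xi> w \<noteq> 0 \<Longrightarrow> \<xi> w \<noteq> 0 \<and> w \<notin> U" for w
        unfolding d_def using coord_component Cons.prems(2) 1(1) unfolding good_def by blast
      then show ?case
        using Cons.IH[OF 1(2) d(1)[OF 1(1) Cons.prems(2) pure(2)]] d(2)[OF 1(1) Cons.prems(2) pure(2)] by auto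
    qed auto
    note * = this
    have "fold D Us (N.pt \<xi> n) = \<one>\<^bsub>N.T\<^esub>" if Us: "\<forall>U \<in> set Us. good U" "\<U> \<subseteq> set Us" for Us
    proof -
      have "fold d Us \<xi> w = 0" for w
      proof (rule ccontr)
        assume "fold d Us \<xi> w \<noteq> 0"
        then have "\<xi> w \<noteq> 0" "w \<notin> \<Union>(set Us)"
          using *[OF Us(1)] by auto
        then show False
          using \<U>(3) Us(2) by auto
      qed
      then have "fold d Us \<xi> = (\<lambda>w. 0)" by blast
      then show ?thesis
        using *[OF Us(1)] N.pure_one_left[OF pure(2)] by simp
    qed
    then show ?case using \<U> by blast
  next
    case (mult X Y)
    obtain \<U> where \<U>: "finite \<U>" "\<forall>U \<in> \<U>. good U"
      "\<And>Us. (\<forall>U \<in> set Us. good U) \<and> \<U> \<subseteq> set Us \<Longrightarrow> fold D Us X = \<one>\<^bsub>N.T\<^esub>"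
      using mult(3) by metis
    obtain \<V> where \<V>: "finite \<V>" "\<forall>U \<in> \<V>. good U"
      "\<And>Us. (\<forall>U \<in> set Us. good U) \<and> \<V> \<subseteq> set Us \<Longrightarrow> fold D Us Y = \<one>\<^bsub>N.T\<^esub>"
      using mult(4) by metis
    have "fold D Us (X \<otimes>\<^bsub>N.T\<^esub> Y) = fold D Us X \<otimes>\<^bsub>N.T\<^esub> fold D Us Y" if "\<forall>U \<in> set Us. good U" for Us
      using that mult(1,2)
    proof (induction Us arbitrary: X Y)
      case (Cons U Us)
      then have U: "good U" and Us: "\<forall>U \<in> set Us. good U" by auto
      show ?case
        using Cons.IH[OF Us hom_in_carrier[OF D_hom[OF U] Cons.prems(2)] hom_in_carrier[OF D_hom[OF U] Cons.prems(3)]]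
          hom_mult[OF D_hom[OF U] Cons.prems(2,3)] by simp
    qed simp
    then have "fold D Us (X \<otimes>\<^bsub>N.T\<^esub> Y) = \<one>\<^bsub>N.T\<^esub>" if "\<forall>U \<in> set Us. good U" "\<U> \<union> \<V> \<subseteq> set Us" for Us
      using that \<U>(3)[of Us] \<V>(3)[of Us] by simp
    then show ?case
      using \<U>(1,2) \<V>(1,2) by (intro exI[of _ "\<U> \<union> \<V>"]) auto
  qed
  then obtain \<U> where \<U>: "finite \<U>" "\<forall>U \<in> \<U>. good U"
    "\<And>Us. (\<forall>U \<in> set Us. good U) \<and> \<U> \<subseteq> set Us \<Longrightarrow> fold D Us X = \<one>\<^bsub>N.T\<^esub>"
    by metis
  obtain Us where Us: "set Us = \<U>"
    using finite_list[OF \<U>(1)] by blast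
  \<comment> \<open>f sends the coordinate \<open>c U X\<close> to the coordinate of a trivial
    element, so injectivity of f makes \<open>c U X\<close> trivial.\<close>
  have "D U X = X" if U: "good U" for U
  proof -
    have "f (c U X) = \<one>\<^bsub>N'\<^esub>"
      using fc[OF U X] X1 hom_one[OF c'(1)[OF U] N'.T.is_group N'.B.is_group] by simp
    then have "c U X = \<one>\<^bsub>N\<^esub>"
      using inj hom_in_carrier[OF c(1)[OF U] X] by blast
    then show ?thesis
      unfolding D_def using X indU[OF U] by simp
  qed
  then have "fold D Us X = X" if "\<forall>U \<in> set Us. good U" for Us
    using that by (induction Us) auto
  then show ?thesis
    using \<U>(2,3) Us by auto
qed

end

section \<open>Image modules and exactness of induction\<close>

context ample_groupoid
begin

lemma image_module:
  assumes "left_module \<Gamma> M" "left_module \<Gamma> N" "gmodule_hom \<Gamma> M N f"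
  shows "left_module \<Gamma> (N\<lparr>carrier := f ` carrier M\<rparr>)"
proof (rule submodule[OF assms(2)])
  interpret M: left_module \<Gamma> M by fact
  interpret N: left_module \<Gamma> N by fact
  show "subgroup (f ` carrier M) N"
    using N.image_hom_subgroup[OF gmodule_hom_hom[OF assms(3)] M.is_group] .
  show "act N \<xi> m \<in> f ` carrier M" if "\<xi> \<in> groupoid_ring \<Gamma>" "m \<in> f ` carrier M" for \<xi> m
    using that by (auto simp: M.act_closed gmodule_hom_act[OF assms(3), symmetric])
qed

lemma gmodule_hom_restrict:
  assumes "gmodule_hom \<Gamma> M N f" "f ` carrier M \<subseteq> I"
  shows "gmodule_hom \<Gamma> M (N\<lparr>carrier := I\<rparr>) f"
  using assms by (intro gmodule_homI) (auto simp: gmodule_hom_mult gmodule_hom_act)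

lemma gmodule_hom_inclusion:
  assumes "I \<subseteq> carrier N"
  shows "gmodule_hom \<Gamma> (N\<lparr>carrier := I\<rparr>) N (\<lambda>x. x)"
  using assms by (intro gmodule_homI) auto

end

context ample_correspondence
begin

text \<open>p is factored through its image: right exactness handles the surjection onto the image,
  and preservation of injectivity handles the inclusion of the image into L.\<close>

lemma tensor_corr_exact:
  assumes M: "left_module H M" and N: "left_module H N" and L: "left_module H L"
    and f: "gmodule_hom H M N f" and p: "gmodule_hom H N L p"
    and ex: "\<And>x. \<lbrakk>x \<in> carrier N; p x = \<one>\<^bsub>L\<^esub>\<rbrakk> \<Longrightarrow> x \<in> f ` carrier M"
    and X: "X \<in> carrier (tensor H (corr_rmodule H \<Omega>) N)"
    and X1: "tensor_map H (corr_rmodule H \<Omega>) L p X = \<one>\<^bsub>tensor H (corr_rmodule H \<Omega>) L\<^esub>"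
  shows "X \<in> tensor_map H (corr_rmodule H \<Omega>) N f ` carrier (tensor H (corr_rmodule H \<Omega>) M)"
proof -
  let ?I = "L\<lparr>carrier := p ` carrier N\<rparr>"
  have I: "left_module H ?I"
    using H.image_module[OF N L p] .
  have p': "gmodule_hom H N ?I p"
    by (rule H.gmodule_hom_restrict[OF p]) simp
  have i: "gmodule_hom H ?I L (\<lambda>x. x)"
    by (rule H.gmodule_hom_inclusion) (auto simp: gmodule_hom_closed[OF p])
  note A = right_acted_corr
  have "tensor_map H (corr_rmodule H \<Omega>) L (\<lambda>x. x) (tensor_map H (corr_rmodule H \<Omega>) ?I p X) =
        \<one>\<^bsub>tensor H (corr_rmodule H \<Omega>) L\<^esub>"
    using tensor_map_comp[OF A N I L p' i _ X, of p] X1 by simp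
  then have "tensor_map H (corr_rmodule H \<Omega>) ?I p X = \<one>\<^bsub>tensor H (corr_rmodule H \<Omega>) ?I\<^esub>"
    by (intro tensor_corr_injective[OF I L i _ tensor_map_closed[OF A N I p' X]]) simp_all
  then show ?thesis
    using ex by (intro tensor_right_exact[OF A M N I f p' _ _ X]) simp_all
qed

text \<open>Exactness of induction is used in this form: lifts from projective resolutions into
  \<open>Ind_complex\<close> exist and are unique up to homotopy.\<close>

lemma Ind_resolution:
  assumes N: "left_module H N" and Q: "is_resolution H N Q"
  shows "is_resolution G (Ind G H \<Omega> N) (Ind_complex G H \<Omega> N Q)"
proof -
  note A = right_acted_corr
  have mod: "left_module H (term_at Q n)" for n
    using Q by (simp add: is_resolution_def)
  have d: "gmodule_hom H (term_at Q (Suc n)) (term_at Q n) (bdry Q n)" for n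
    using Q by (simp add: is_resolution_def)
  have a: "gmodule_hom H (term_at Q 0) N (aug Q)" "aug Q ` carrier (term_at Q 0) = carrier N"
    using Q by (simp_all add: is_resolution_def)
  have k0: "kernel (term_at Q 0) N (aug Q) = bdry Q 0 ` carrier (term_at Q (Suc 0))"
    and k: "\<And>n. kernel (term_at Q (Suc n)) (term_at Q n) (bdry Q n) =
          bdry Q (Suc n) ` carrier (term_at Q (Suc (Suc n)))"
    using Q by (simp_all add: is_resolution_def)
  have exact: "kernel (Ind G H \<Omega> B) (Ind G H \<Omega> C) (Ind_map H \<Omega> C p) = Ind_map H \<Omega> B f ` carrier (Ind G H \<Omega> A)"
    if ABC: "left_module H A" "left_module H B" "left_module H C"
      and f: "gmodule_hom H A B f" and p: "gmodule_hom H B C p" and ke: "kernel B C p = f ` carrier A"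
    for A B :: "('h, 'b) gmodule" and C :: "('h, 'c) gmodule" and f p
  proof (intro equalityI subsetI)
    fix X assume "X \<in> kernel (Ind G H \<Omega> B) (Ind G H \<Omega> C) (Ind_map H \<Omega> C p)"
    then show "X \<in> Ind_map H \<Omega> B f ` carrier (Ind G H \<Omega> A)"
      using ke unfolding Ind_map_eq
      by (simp add: kernel_def) (rule tensor_corr_exact[OF ABC f p], auto simp: kernel_def)
  next
    fix X assume "X \<in> Ind_map H \<Omega> B f ` carrier (Ind G H \<Omega> A)"
    then obtain Y where Y: "Y \<in> carrier (tensor H (corr_rmodule H \<Omega>) A)" "X = tensor_map H (corr_rmodule H \<Omega>) B f Y"
      by (auto simp: Ind_map_eq)
    have pf: "p (f x) = \<one>\<^bsub>C\<^esub>" if "x \<in> carrier A" for x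
      using ke that by (auto simp: kernel_def)
    have "tensor_map H (corr_rmodule H \<Omega>) C p X = \<one>\<^bsub>tensor H (corr_rmodule H \<Omega>) C\<^esub>"
      unfolding Y(2) using tensor_map_comp[OF right_acted_corr ABC f p _ Y(1), of "\<lambda>x. \<one>\<^bsub>C\<^esub>"] pf
        tensor_map_trivial[OF right_acted_corr ABC(1,3) gmodule_hom_trivial[OF ABC(3)] refl Y(1)] by simp
    then show "X \<in> kernel (Ind G H \<Omega> B) (Ind G H \<Omega> C) (Ind_map H \<Omega> C p)"
      using tensor_map_closed[OF right_acted_corr ABC(1,2) f Y(1)] Y(2) by (simp add: kernel_def Ind_map_eq)
  qed
  have surj: "Ind_map H \<Omega> N (aug Q) ` carrier (Ind G H \<Omega> (term_at Q 0)) = carrier (Ind G H \<Omega> N)"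
    using tensor_map_surj[OF A mod N a] by (simp add: Ind_map_eq)
  show ?thesis
    unfolding is_resolution_def
    using Ind_module[OF mod] Ind_map_hom[OF mod mod d] Ind_map_hom[OF mod N a(1)] surj
      exact[OF mod mod N d a(1) k0] exact[OF mod mod mod d d k]
    by (simp add: Ind_complex_def)
qed

section \<open>The map on coinvariants\<close>

lemma unit_module_simps [simp]:
  "carrier (unit_module K) = int_functions (unit_space K)"
  "monoid.mult (unit_module K) = (\<lambda>m n x. m x + n x)"
  "one (unit_module K) = (\<lambda>x. 0)"
  "act (unit_module K) = fun_ract K (unit_space K) (\<lambda>x. x) (\<lambda>x g. src K g)"
  by (simp_all add: unit_module_def)

abbreviation push :: "('w \<Rightarrow> int) \<Rightarrow> 'h \<Rightarrow> int" where
  "push \<equiv> pushforward (ctop \<Omega>) (ranchor \<Omega>)"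

lemma finite_push:
  assumes "\<xi> \<in> int_functions (ctop \<Omega>)"
  shows "finite {w \<in> {w \<in> topspace (ctop \<Omega>). ranchor \<Omega> w = y}. \<xi> w \<noteq> 0}"
  by (rule finite_subset[OF _ finite_fibres[OF assms corr_base, of y]]) auto

lemma push_add:
  assumes "\<xi> \<in> int_functions (ctop \<Omega>)" "\<eta> \<in> int_functions (ctop \<Omega>)"
  shows "push (\<lambda>w. \<xi> w + \<eta> w) = (\<lambda>y. push \<xi> y + push \<eta> y)"
  using sum.distrib'[OF finite_push[OF assms(1)] finite_push[OF assms(2)]]
  by (simp add: pushforward_def fun_eq_iff)

text \<open>On a sheet V the anchor is injective, so the pushforward of \<open>ind V\<close> is the
  indicator of the compact open image of V.\<close>

lemma push_closed:
  assumes "\<xi> \<in> int_functions (ctop \<Omega>)"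
  shows "push \<xi> \<in> int_functions (unit_space H)"
  using assms corr_base
proof (induction rule: int_functions_induct_base)
  case zero
  then show ?case by (simp add: pushforward_def sum'_zero)
next
  case (add f g)
  then show ?case by (simp add: push_add int_functions_add)
next
  case (uminus f)
  then show ?case using int_functions_uminus by (simp add: pushforward_def sum'_uminus)
next
  case (ind V)
  have V: "V \<subseteq> topspace (ctop \<Omega>)"
    using ind openin_subset by (auto simp: compact_open_def)
  have "push (ind V) y = ind (ranchor \<Omega> ` V) y" for y
  proof (cases "y \<in> ranchor \<Omega> ` V")
    case True
    then obtain v where v: "v \<in> V" "y = ranchor \<Omega> v" by auto
    have "push (ind V) y = ind V v"
      unfolding pushforward_def
    proof (rule sum'_single)
      show "v \<in> {x \<in> topspace (ctop \<Omega>). ranchor \<Omega> x = y}"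
        using v V by auto
      fix x assume "x \<in> {x \<in> topspace (ctop \<Omega>). ranchor \<Omega> x = y}" "x \<noteq> v"
      then show "ind V x = 0"
        using inj_onD[OF sheet_inj_on[OF ind(2)], of x v] v by auto
    qed
    then show ?thesis using v True by simp
  next
    case False
    then show ?thesis
      by (auto simp: pushforward_def image_iff intro!: sum'_zero)
  qed
  then have eq: "push (ind V) = ind (ranchor \<Omega> ` V)" by (rule ext)
  have "compactin (unit_space H) (ranchor \<Omega> ` V)"
    by (rule image_compactin[OF _ right.continuous_anchor]) (use ind in \<open>simp add: compact_open_def\<close>)
  then have "compact_open (unit_space H) (ranchor \<Omega> ` V)"
    using ind(2) Hausdorff_space_subtopology[OF H.Hausdorff_units] by (simp add: compact_open_def sheet_def)
  then show ?case
    unfolding eq by (rule ind_int_functions)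
qed

text \<open>After the two sums are exchanged, translation by h is a bijection from the fibre over
  r(h) to the fibre over s(h).\<close>

lemma push_ract:
  assumes a: "a \<in> groupoid_ring H" and \<xi>: "\<xi> \<in> int_functions (ctop \<Omega>)"
  shows "push (R.ract a \<xi>) = act (unit_module H) a (push \<xi>)"
proof
  fix y
  define Y where "Y = {w \<in> topspace (ctop \<Omega>). ranchor \<Omega> w = y}"
  show "push (R.ract a \<xi>) y = act (unit_module H) a (push \<xi>) y"
  proof (cases "y \<in> units H")
    case False
    then have "Y = {}"
      using R.ranchor_units by (auto simp: Y_def)
    then have "push (R.ract a \<xi>) y = 0"
      unfolding pushforward_def Y_def[symmetric] by simp
    then show ?thesis
      using False by (simp add: fun_ract_def H.topspace_unit_space)
  next
    case True
    define T where "T = {h \<in> arrows H. rng H h = y}"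
    define F where "F = (\<lambda>w h. \<xi> (rmul \<Omega> w h) * a (ginv H h))"
    have "push (R.ract a \<xi>) y = sum' (R.ract a \<xi>) Y"
      by (simp add: pushforward_def Y_def)
    also have "\<dots> = sum' (\<lambda>w. sum' (F w) T) Y"
    proof (rule sum.cong'[OF refl])
      fix w assume "w \<in> Y"
      then show "R.ract a \<xi> w = sum' (F w) T"
        by (auto simp: fun_ract_def Y_def T_def F_def)
    qed
    also have "\<dots> = sum' (\<lambda>h. sum' (\<lambda>w. F w h) Y) T"
    proof (rule sum'_swap, rule finite_subset)
      let ?S = "Sigma (ginv H ` {h. src H h = y \<and> a h \<noteq> 0}) (\<lambda>h. {w. ranchor \<Omega> w = src H h \<and> \<xi> w \<noteq> 0})"
      show "finite ((\<lambda>(h, v). (rmul \<Omega> v (ginv H h), h)) ` ?S)"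
        by (intro finite_imageI finite_SigmaI H.finite_src_fibre[OF a] finite_fibres[OF \<xi> corr_base])
      show "{z \<in> Y \<times> T. F (fst z) (snd z) \<noteq> 0} \<subseteq> (\<lambda>(h, v). (rmul \<Omega> v (ginv H h), h)) ` ?S"
      proof
        fix z assume "z \<in> {z \<in> Y \<times> T. F (fst z) (snd z) \<noteq> 0}"
        then obtain w h where z: "z = (w, h)" "w \<in> topspace (ctop \<Omega>)" "ranchor \<Omega> w = y" "h \<in> arrows H" "rng H h = y"
          "\<xi> (rmul \<Omega> w h) \<noteq> 0" "a (ginv H h) \<noteq> 0"
          by (cases z) (auto simp: Y_def T_def F_def)
        have "h \<in> ginv H ` {h. src H h = y \<and> a h \<noteq> 0}"
          using z by (intro image_eqI[of _ _ "ginv H h"]) (simp_all add: H.ginv_ginv H.src_ginv)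
        then have "(h, rmul \<Omega> w h) \<in> ?S"
          using z by (simp add: right.anchor_action)
        moreover have "rmul \<Omega> (rmul \<Omega> w h) (ginv H h) = w"
          using right.action_assoc[of w h "ginv H h"] right.action_unit[of w] z
          by (simp add: H.ginv_closed H.rng_ginv H.gmul_ginv)
        ultimately show "z \<in> (\<lambda>(h, v). (rmul \<Omega> v (ginv H h), h)) ` ?S"
          using z(1) by (intro image_eqI[of _ _ "(h, rmul \<Omega> w h)"]) simp_all
      qed
    qed
    also have "\<dots> = sum' (\<lambda>h. push \<xi> (src H h) * a (ginv H h)) T"
    proof (rule sum.cong'[OF refl])
      fix h assume "h \<in> T"
      then have h: "h \<in> arrows H" "rng H h = y" by (auto simp: T_def)
      have bwd: "rmul \<Omega> (rmul \<Omega> w h) (ginv H h) = w" if "w \<in> topspace (ctop \<Omega>)" "ranchor \<Omega> w = y" for w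
        using right.action_assoc[of w h "ginv H h"] right.action_unit[of w] that h
        by (simp add: H.ginv_closed H.rng_ginv H.gmul_ginv)
      have fwd: "rmul \<Omega> (rmul \<Omega> w (ginv H h)) h = w" if "w \<in> topspace (ctop \<Omega>)" "ranchor \<Omega> w = src H h" for w
        using right.action_assoc[of w "ginv H h" h] right.action_unit[of w] that h
        by (simp add: H.ginv_closed H.rng_ginv H.src_ginv H.ginv_gmul)
      have bij: "bij_betw (\<lambda>w. rmul \<Omega> w h) Y {w \<in> topspace (ctop \<Omega>). ranchor \<Omega> w = src H h}"
        by (rule bij_betw_byWitness[of _ "\<lambda>w. rmul \<Omega> w (ginv H h)"])
          (use h bwd fwd in \<open>auto simp: Y_def R.raction_closed right.anchor_action H.ginv_closed H.rng_ginv H.src_ginv\<close>)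
      show "sum' (\<lambda>w. F w h) Y = push \<xi> (src H h) * a (ginv H h)"
        using sum'_reindex[OF bij, of \<xi>] by (simp add: pushforward_def F_def sum'_mult_right)
    qed
    also have "\<dots> = act (unit_module H) a (push \<xi>) y"
      using True by (simp add: fun_ract_def H.topspace_unit_space T_def)
    finally show ?thesis .
  qed
qed

lemma unit_functions_outside:
  assumes "\<eta> \<in> int_functions (unit_space G)" "g \<notin> units G"
  shows "\<eta> g = 0"
  using int_functions_outside[OF assms(1)] assms(2) by (simp add: G.topspace_unit_space)

lemma unit_act_closed:
  "\<lbrakk>a \<in> groupoid_ring G; \<eta> \<in> int_functions (unit_space G)\<rbrakk> \<Longrightarrow> act (unit_module G) a \<eta> \<in> int_functions (unit_space G)"
  using right_acted.ract_closed[OF G.right_acted_unit_module] by simp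

text \<open>The action of G preserves the fibres of the anchor to H. At a point y both sides are
  sums over pairs (w, g) with w in the fibre over y, matched by replacing w with g w. This makes
  \<delta> well defined on coinvariants.\<close>

lemma push_balanced:
  assumes a: "a \<in> groupoid_ring G" and \<eta>: "\<eta> \<in> int_functions (unit_space G)" and \<xi>: "\<xi> \<in> int_functions (ctop \<Omega>)"
  shows "push (L.lact (act (unit_module G) a \<eta>) \<xi>) = push (L.lact \<eta> (L.lact a \<xi>))"
proof
  fix y
  define Y where "Y = {w \<in> topspace (ctop \<Omega>). ranchor \<Omega> w = y}"
  define A where "A = Sigma Y (\<lambda>w. {g \<in> arrows G. rng G g = lanchor \<Omega> w})"
  define B where "B = Sigma Y (\<lambda>w. {g \<in> arrows G. src G g = lanchor \<Omega> w})"
  define F where "F = (\<lambda>w g. \<eta> (src G g) * a (ginv G g) * \<xi> w)"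
  define \<theta> where "\<theta> = (\<lambda>(w, g). (lmul \<Omega> g w, g))"
  have finA: "finite {z \<in> A. F (fst z) (snd z) \<noteq> 0}"
  proof (rule finite_subset)
    let ?S = "Sigma {w. ranchor \<Omega> w = y \<and> \<xi> w \<noteq> 0} (\<lambda>w. ginv G ` {g. src G g = lanchor \<Omega> w \<and> a g \<noteq> 0})"
    show "finite ?S"
      by (intro finite_SigmaI finite_imageI G.finite_src_fibre[OF a] finite_fibres[OF \<xi> corr_base])
    show "{z \<in> A. F (fst z) (snd z) \<noteq> 0} \<subseteq> ?S"
    proof
      fix z assume "z \<in> {z \<in> A. F (fst z) (snd z) \<noteq> 0}"
      then obtain w g where z: "z = (w, g)" "ranchor \<Omega> w = y" "g \<in> arrows G" "rng G g = lanchor \<Omega> w" "\<xi> w \<noteq> 0" "a (ginv G g) \<noteq> 0"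
        by (cases z) (auto simp: A_def Y_def F_def)
      then have "g \<in> ginv G ` {g. src G g = lanchor \<Omega> w \<and> a g \<noteq> 0}"
        by (intro image_eqI[of _ _ "ginv G g"]) (simp_all add: G.ginv_ginv G.src_ginv)
      then show "z \<in> ?S" using z by simp
    qed
  qed
  have bij: "bij_betw \<theta> B A"
  proof (rule bij_betw_byWitness[of _ "\<lambda>(w, g). (lmul \<Omega> (ginv G g) w, g)"])
    show "\<forall>z\<in>B. (\<lambda>(w, g). (lmul \<Omega> (ginv G g) w, g)) (\<theta> z) = z"
      by (auto simp: B_def Y_def \<theta>_def L.action_inverse)
    show "\<forall>z\<in>A. \<theta> ((\<lambda>(w, g). (lmul \<Omega> (ginv G g) w, g)) z) = z"
    proof (clarsimp simp: A_def Y_def \<theta>_def)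
      fix w g assume "w \<in> topspace (ctop \<Omega>)" "g \<in> arrows G" "rng G g = lanchor \<Omega> w"
      then show "lmul \<Omega> g (lmul \<Omega> (ginv G g) w) = w"
        using L.action_inverse[of "ginv G g" w] by (simp add: G.ginv_closed G.ginv_ginv G.src_ginv)
    qed
    show "\<theta> ` B \<subseteq> A"
      by (auto simp: A_def B_def Y_def \<theta>_def L.action_closed left.anchor_action ranchor_lmul)
    show "(\<lambda>(w, g). (lmul \<Omega> (ginv G g) w, g)) ` A \<subseteq> B"
      by (auto simp: A_def B_def Y_def L.action_closed left.anchor_action ranchor_lmul G.ginv_closed G.src_ginv G.rng_ginv)
  qed
  have finB: "finite {z \<in> B. F (lmul \<Omega> (snd z) (fst z)) (snd z) \<noteq> 0}"
  proof (rule finite_imageD)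
    show "inj_on \<theta> {z \<in> B. F (lmul \<Omega> (snd z) (fst z)) (snd z) \<noteq> 0}"
      using bij by (auto simp: bij_betw_def intro: inj_on_subset)
    show "finite (\<theta> ` {z \<in> B. F (lmul \<Omega> (snd z) (fst z)) (snd z) \<noteq> 0})"
    proof (rule finite_subset[OF _ finA])
      show "\<theta> ` {z \<in> B. F (lmul \<Omega> (snd z) (fst z)) (snd z) \<noteq> 0} \<subseteq> {z \<in> A. F (fst z) (snd z) \<noteq> 0}"
        using bij_betw_imp_surj_on[OF bij] by (auto simp: \<theta>_def)
    qed
  qed
  have "push (L.lact (act (unit_module G) a \<eta>) \<xi>) y = sum' (\<lambda>w. sum' (F w) {g \<in> arrows G. rng G g = lanchor \<Omega> w}) Y"
    unfolding pushforward_def Y_def[symmetric]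
  proof (rule sum.cong'[OF refl])
    fix w assume "w \<in> Y"
    then have w: "w \<in> topspace (ctop \<Omega>)" by (simp add: Y_def)
    have "L.lact (act (unit_module G) a \<eta>) \<xi> w = act (unit_module G) a \<eta> (lanchor \<Omega> w) * \<xi> w"
      using L.lact_units[OF unit_functions_outside[OF unit_act_closed[OF a \<eta>]]] w by simp
    then show "L.lact (act (unit_module G) a \<eta>) \<xi> w = sum' (F w) {g \<in> arrows G. rng G g = lanchor \<Omega> w}"
      using L.anchor_units[OF w] by (simp add: fun_ract_def G.topspace_unit_space sum'_mult_right F_def)
  qed
  also have "\<dots> = sum' (\<lambda>z. F (fst z) (snd z)) A"
    unfolding A_def by (rule sum'_Sigma) (use finA in \<open>simp add: A_def\<close>)
  also have "\<dots> = sum' (\<lambda>z. F (lmul \<Omega> (snd z) (fst z)) (snd z)) B"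
    using sum'_reindex[OF bij, of "\<lambda>z. F (fst z) (snd z)"] by (simp add: \<theta>_def case_prod_unfold)
  also have "\<dots> = sum' (\<lambda>w. sum' (\<lambda>g. F (lmul \<Omega> g w) g) {g \<in> arrows G. src G g = lanchor \<Omega> w}) Y"
    unfolding B_def by (rule sum'_Sigma[symmetric, of Y _ "\<lambda>w g. F (lmul \<Omega> g w) g"]) (use finB in \<open>simp add: B_def\<close>)
  also have "\<dots> = push (L.lact \<eta> (L.lact a \<xi>)) y"
    unfolding pushforward_def Y_def[symmetric]
  proof (rule sum.cong'[OF refl])
    fix w assume "w \<in> Y"
    then have w: "w \<in> topspace (ctop \<Omega>)" by (simp add: Y_def)
    have "L.lact \<eta> (L.lact a \<xi>) w = \<eta> (lanchor \<Omega> w) * L.lact a \<xi> w"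
      using L.lact_units[OF unit_functions_outside[OF \<eta>]] w by simp
    also have "\<dots> = sum' (\<lambda>g. \<eta> (lanchor \<Omega> w) * (a (ginv G g) * \<xi> (lmul \<Omega> g w))) {g \<in> arrows G. src G g = lanchor \<Omega> w}"
      using w by (simp add: fun_lact_def sum'_mult_left)
    also have "\<dots> = sum' (\<lambda>g. F (lmul \<Omega> g w) g) {g \<in> arrows G. src G g = lanchor \<Omega> w}"
      by (rule sum.cong'[OF refl]) (simp add: F_def mult.assoc)
    finally show "sum' (\<lambda>g. F (lmul \<Omega> g w) g) {g \<in> arrows G. src G g = lanchor \<Omega> w} = L.lact \<eta> (L.lact a \<xi>) w"
      by simp
  qed
  finally show "push (L.lact (act (unit_module G) a \<eta>) \<xi>) y = push (L.lact \<eta> (L.lact a \<xi>)) y" .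
qed

lemma corr_module: "left_module G (corr_lmodule G \<Omega>)"
proof (rule G.left_moduleI)
  show "comm_group (corr_lmodule G \<Omega>)"
    by (rule comm_group_functions) simp_all
  show "\<exists>\<xi>\<in>groupoid_ring G. act (corr_lmodule G \<Omega>) \<xi> m = m" if m: "m \<in> carrier (corr_lmodule G \<Omega>)" for m
  proof -
    have m': "m \<in> int_functions (ctop \<Omega>)"
      using m by simp
    obtain K where K: "compact_open (unit_space G) K" "\<And>x. m x \<noteq> 0 \<Longrightarrow> lanchor \<Omega> x \<in> K"
      by (rule L.support_anchor[OF m']) (rule that)
    have "L.lact (ind K) m = m"
      by (rule L.lact_local_unit[OF K(1) m' K(2)])
    then show ?thesis
      using G.unit_in_ring[OF K(1)] by auto
  qed
qed (simp_all add: L.lact_closed L.lact_add_left L.lact_add_right L.lact_conv)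

lemma unit_in_ring_G: "\<eta> \<in> int_functions (unit_space G) \<Longrightarrow> \<eta> \<in> groupoid_ring G"
  using G.unit_functions_subset by blast

lemma H_unit_module: "comm_group (unit_module H)"
  using G.right_acted_unit_module H.right_acted_unit_module right_acted.axioms(1) by blast

lemma delta_pure:
  assumes "\<eta> \<in> int_functions (unit_space G)" "\<xi> \<in> int_functions (ctop \<Omega>)"
  shows "delta G H \<Omega> (pure_tensor G (unit_module G) (corr_lmodule G \<Omega>) \<eta> \<xi>) = push (L.lact \<eta> \<xi>)"
proof -
  interpret T: tensor_pair G "unit_module G" "corr_lmodule G \<Omega>"
    using G.right_acted_unit_module corr_module by (rule tensor_pairI)
  have "balanced G (unit_module G) (corr_lmodule G \<Omega>) (unit_module H)
     (\<lambda>\<eta> \<xi>. push (act (corr_lmodule G \<Omega>) \<eta> \<xi>))"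
    by (rule balancedI)
      (simp_all add: push_closed L.lact_closed unit_in_ring_G L.lact_add_left L.lact_add_right push_add
        push_balanced[unfolded unit_module_simps])
  from T.tensor_lift_pure[OF H_unit_module this] assms show ?thesis
    by (simp add: delta_def)
qed

section \<open>The map \<delta> \<otimes> id on coinvariants of induced modules\<close>

context
  fixes N :: "('h, 'n) gmodule"
  assumes N: "left_module H N"
begin

interpretation I: tensor_pair H "corr_rmodule H \<Omega>" N
  using right_acted_corr N by (rule tensor_pairI)
interpretation C: tensor_pair H "unit_module H" N
  using H.right_acted_unit_module N by (rule tensor_pairI)
interpretation D: tensor_pair G "unit_module G" "Ind G H \<Omega> N"
  using G.right_acted_unit_module Ind_module[OF N] by (rule tensor_pairI)

text \<open>The restriction of \<delta> \<otimes> id to tensors with fixed first factor \<eta>.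
  Separating it lets the universal property be applied once for each of the two nested tensor
  products.\<close>

definition inner :: "('g \<Rightarrow> int) \<Rightarrow> (('w \<Rightarrow> int) \<times> 'n \<Rightarrow>\<^sub>0 int) set \<Rightarrow> (('h \<Rightarrow> int) \<times> 'n \<Rightarrow>\<^sub>0 int) set" where
  "inner \<eta> = tensor_lift C.T (\<lambda>\<xi> n. C.pt (delta G H \<Omega> (pure_tensor G (unit_module G) (corr_lmodule G \<Omega>) \<eta> \<xi>)) n)"

lemma inner_balanced:
  assumes \<eta>: "\<eta> \<in> int_functions (unit_space G)"
  shows "balanced H (corr_rmodule H \<Omega>) N C.T
    (\<lambda>\<xi> n. C.pt (delta G H \<Omega> (pure_tensor G (unit_module G) (corr_lmodule G \<Omega>) \<eta> \<xi>)) n)"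
proof (rule balancedI)
  fix a a' b assume *: "a \<in> carrier (corr_rmodule H \<Omega>)" "a' \<in> carrier (corr_rmodule H \<Omega>)" "b \<in> carrier N"
  have c: "push (L.lact \<eta> \<xi>) \<in> carrier (unit_module H)" if "\<xi> \<in> int_functions (ctop \<Omega>)" for \<xi>
    using that \<eta> by (simp add: push_closed L.lact_closed unit_in_ring_G)
  show "C.pt (delta G H \<Omega> (pure_tensor G (unit_module G) (corr_lmodule G \<Omega>) \<eta> (a \<otimes>\<^bsub>corr_rmodule H \<Omega>\<^esub> a'))) b =
    C.pt (delta G H \<Omega> (pure_tensor G (unit_module G) (corr_lmodule G \<Omega>) \<eta> a)) b \<otimes>\<^bsub>C.T\<^esub>
    C.pt (delta G H \<Omega> (pure_tensor G (unit_module G) (corr_lmodule G \<Omega>) \<eta> a')) b"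
    using * \<eta> C.pure_add_left[OF c c, of a a' b]
    by (simp add: delta_pure int_functions_add L.lact_add_right unit_in_ring_G push_add L.lact_closed)
next
  fix \<zeta> a b assume *: "\<zeta> \<in> groupoid_ring H" "a \<in> carrier (corr_rmodule H \<Omega>)" "b \<in> carrier N"
  have a: "a \<in> int_functions (ctop \<Omega>)" using * by simp
  have l: "L.lact \<eta> a \<in> int_functions (ctop \<Omega>)"
    using a \<eta> by (simp add: L.lact_closed unit_in_ring_G)
  then have c: "push (L.lact \<eta> a) \<in> carrier (unit_module H)"
    by (simp add: push_closed)
  have "push (L.lact \<eta> (R.ract \<zeta> a)) = act (unit_module H) \<zeta> (push (L.lact \<eta> a))"
    using lact_ract[OF unit_in_ring_G[OF \<eta>] *(1)] push_ract[OF *(1) l] by simp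
  then show "C.pt (delta G H \<Omega> (pure_tensor G (unit_module G) (corr_lmodule G \<Omega>) \<eta> (act (corr_rmodule H \<Omega>) \<zeta> a))) b =
    C.pt (delta G H \<Omega> (pure_tensor G (unit_module G) (corr_lmodule G \<Omega>) \<eta> a)) (act N \<zeta> b)"
    using C.pure_act[OF *(1) c *(3)] a \<eta> * by (simp add: delta_pure R.ract_closed)
qed (use \<eta> in \<open>simp_all add: delta_pure C.pure_closed C.pure_add_right push_closed L.lact_closed unit_in_ring_G\<close>)

lemma inner_hom: "\<eta> \<in> int_functions (unit_space G) \<Longrightarrow> inner \<eta> \<in> hom I.T C.T"
  unfolding inner_def by (rule I.tensor_lift_hom[OF C.comm_group_tensor inner_balanced])

lemma inner_pure:
  "\<lbrakk>\<eta> \<in> int_functions (unit_space G); \<xi> \<in> int_functions (ctop \<Omega>); n \<in> carrier N\<rbrakk> \<Longrightarrow>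
   inner \<eta> (I.pt \<xi> n) = C.pt (push (L.lact \<eta> \<xi>)) n"
  unfolding inner_def using I.tensor_lift_pure[OF C.comm_group_tensor inner_balanced] by (simp add: delta_pure)

text \<open>Balancedness over G reduces to \<open>push_balanced\<close>, since homomorphisms out of
  the induced module are compared on its pure tensors.\<close>

lemma delta_tensor_balanced: "balanced G (unit_module G) (Ind G H \<Omega> N) C.T inner"
proof (rule balancedI)
  fix \<eta> \<eta>' X assume "\<eta> \<in> carrier (unit_module G)" "\<eta>' \<in> carrier (unit_module G)" "X \<in> carrier (Ind G H \<Omega> N)"
  then have *: "\<eta> \<in> int_functions (unit_space G)" "\<eta>' \<in> int_functions (unit_space G)" "X \<in> carrier I.T"
    by simp_all
  have s: "(\<lambda>x. \<eta> x + \<eta>' x) \<in> int_functions (unit_space G)"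
    using * by (simp add: int_functions_add)
  have "(\<lambda>X. inner \<eta> X \<otimes>\<^bsub>C.T\<^esub> inner \<eta>' X) \<in> hom I.T C.T"
    using inner_hom[OF *(1)] inner_hom[OF *(2)] by (intro homI) (auto simp: hom_in_carrier hom_mult C.T.m_ac)
  then have "inner (\<lambda>x. \<eta> x + \<eta>' x) X = inner \<eta> X \<otimes>\<^bsub>C.T\<^esub> inner \<eta>' X"
  proof (rule I.tensor_hom_eq[OF inner_hom[OF s]])
    fix \<xi> n assume "\<xi> \<in> carrier (corr_rmodule H \<Omega>)" "n \<in> carrier N"
    then show "inner (\<lambda>x. \<eta> x + \<eta>' x) (I.pt \<xi> n) = inner \<eta> (I.pt \<xi> n) \<otimes>\<^bsub>C.T\<^esub> inner \<eta>' (I.pt \<xi> n)"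
      using * s C.pure_add_left[of "push (L.lact \<eta> \<xi>)" "push (L.lact \<eta>' \<xi>)" n]
      by (simp add: inner_pure L.lact_add_left unit_in_ring_G push_add L.lact_closed push_closed)
  qed (use * in simp)
  then show "inner (\<eta> \<otimes>\<^bsub>unit_module G\<^esub> \<eta>') X = inner \<eta> X \<otimes>\<^bsub>C.T\<^esub> inner \<eta>' X"
    by simp
next
  fix a \<eta> X assume *: "a \<in> groupoid_ring G" "\<eta> \<in> carrier (unit_module G)" "X \<in> carrier (Ind G H \<Omega> N)"
  then have \<eta>: "\<eta> \<in> int_functions (unit_space G)" and X: "X \<in> carrier I.T" by simp_all
  have s: "act (unit_module G) a \<eta> \<in> int_functions (unit_space G)"
    using unit_act_closed[OF *(1) \<eta>] .
  show "inner (act (unit_module G) a \<eta>) X = inner \<eta> (act (Ind G H \<Omega> N) a X)"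
  proof (rule I.tensor_hom_eq[OF inner_hom[OF s] _ _ X])
    show "(\<lambda>X. inner \<eta> (act (Ind G H \<Omega> N) a X)) \<in> hom I.T C.T"
      using hom_compose[OF Ind_act_hom[OF N *(1)] inner_hom[OF \<eta>]] by (simp add: o_def)
    fix \<xi> n assume \<xi>: "\<xi> \<in> carrier (corr_rmodule H \<Omega>)" "n \<in> carrier N"
    then show "inner (act (unit_module G) a \<eta>) (I.pt \<xi> n) = inner \<eta> (act (Ind G H \<Omega> N) a (I.pt \<xi> n))"
      using inner_pure[OF s, of \<xi> n] push_balanced[OF *(1) \<eta>, of \<xi>] *(1) \<eta>
      by (simp add: inner_pure Ind_act_pure[OF N] L.lact_closed)
  qed
next
  fix \<eta> X assume "\<eta> \<in> carrier (unit_module G)" "X \<in> carrier (Ind G H \<Omega> N)"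
  then show "inner \<eta> X \<in> carrier C.T"
    using hom_in_carrier[OF inner_hom] by simp
next
  fix \<eta> X Y assume "\<eta> \<in> carrier (unit_module G)" "X \<in> carrier (Ind G H \<Omega> N)" "Y \<in> carrier (Ind G H \<Omega> N)"
  then show "inner \<eta> (X \<otimes>\<^bsub>Ind G H \<Omega> N\<^esub> Y) = inner \<eta> X \<otimes>\<^bsub>C.T\<^esub> inner \<eta> Y"
    using hom_mult[OF inner_hom] by simp
qed

lemma delta_tensor_eq: "delta_tensor G H \<Omega> N = tensor_lift C.T inner"
  unfolding delta_tensor_def coinvariants_def inner_def ..

lemma delta_tensor_hom: "delta_tensor G H \<Omega> N \<in> hom (coinvariants G (Ind G H \<Omega> N)) (coinvariants H N)"
  unfolding delta_tensor_eq coinvariants_def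
  by (rule D.tensor_lift_hom[OF C.comm_group_tensor delta_tensor_balanced])

lemma delta_tensor_pure:
  "\<lbrakk>\<eta> \<in> int_functions (unit_space G); X \<in> carrier (Ind G H \<Omega> N)\<rbrakk> \<Longrightarrow>
   delta_tensor G H \<Omega> N (D.pt \<eta> X) = inner \<eta> X"
  unfolding delta_tensor_eq using D.tensor_lift_pure[OF C.comm_group_tensor delta_tensor_balanced] by simp

end

text \<open>f acts on the last of three tensor factors and \<delta> on the first two, so both sides
  agree on nested pure tensors, and these determine a homomorphism.\<close>

lemma delta_tensor_natural:
  assumes N: "left_module H N" and N': "left_module H N'" and f: "gmodule_hom H N N' f"
    and X: "X \<in> carrier (coinvariants G (Ind G H \<Omega> N))"
  shows "delta_tensor G H \<Omega> N' (coinvariants_map G (Ind G H \<Omega> N') (Ind_map H \<Omega> N' f) X) =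
         coinvariants_map H N' f (delta_tensor G H \<Omega> N X)"
proof -
  interpret I: tensor_pair H "corr_rmodule H \<Omega>" N
    using right_acted_corr N by (rule tensor_pairI)
  interpret D: tensor_pair G "unit_module G" "Ind G H \<Omega> N"
    using G.right_acted_unit_module Ind_module[OF N] by (rule tensor_pairI)
  note AG = G.right_acted_unit_module and AH = H.right_acted_unit_module
  note If = Ind_map_hom[OF N N' f]
  note cG = tensor_map_hom[OF AG Ind_module[OF N] Ind_module[OF N'] If]
  note cH = tensor_map_hom[OF AH N N' f]
  show ?thesis
    unfolding coinvariants_map_eq
  proof (rule D.tensor_hom_eq)
    show "(\<lambda>X. delta_tensor G H \<Omega> N' (tensor_map G (unit_module G) (Ind G H \<Omega> N') (Ind_map H \<Omega> N' f) X)) \<in> hom D.T (coinvariants H N')"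
      using hom_compose[OF cG delta_tensor_hom[OF N', unfolded coinvariants_def]] by (simp add: o_def coinvariants_def)
    show "(\<lambda>X. tensor_map H (unit_module H) N' f (delta_tensor G H \<Omega> N X)) \<in> hom D.T (coinvariants H N')"
      using hom_compose[OF delta_tensor_hom[OF N, unfolded coinvariants_def] cH] by (simp add: o_def coinvariants_def)
    show "X \<in> carrier D.T"
      using X by (simp add: coinvariants_def)
    fix \<eta> Y assume "\<eta> \<in> carrier (unit_module G)" and Y: "Y \<in> carrier (Ind G H \<Omega> N)"
    then have \<eta>: "\<eta> \<in> int_functions (unit_space G)" and Y': "Y \<in> carrier I.T" by simp_all
    have "inner N' \<eta> (Ind_map H \<Omega> N' f Y) = tensor_map H (unit_module H) N' f (inner N \<eta> Y)"
    proof (rule I.tensor_hom_eq[OF _ _ _ Y'])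
      show "(\<lambda>Y. inner N' \<eta> (Ind_map H \<Omega> N' f Y)) \<in> hom I.T (tensor H (unit_module H) N')"
        using hom_compose[OF tensor_map_hom[OF right_acted_corr N N' f] inner_hom[OF N' \<eta>]]
        by (simp add: o_def Ind_map_eq)
      show "(\<lambda>Y. tensor_map H (unit_module H) N' f (inner N \<eta> Y)) \<in> hom I.T (tensor H (unit_module H) N')"
        using hom_compose[OF inner_hom[OF N \<eta>] cH] by (simp add: o_def)
      fix \<xi> n assume "\<xi> \<in> carrier (corr_rmodule H \<Omega>)" "n \<in> carrier N"
      then show "inner N' \<eta> (Ind_map H \<Omega> N' f (I.pt \<xi> n)) = tensor_map H (unit_module H) N' f (inner N \<eta> (I.pt \<xi> n))"
        using \<eta> by (simp add: Ind_map_eq tensor_map_pure[OF right_acted_corr N N' f] inner_pure[OF N] inner_pure[OF N']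
            gmodule_hom_closed[OF f] tensor_map_pure[OF AH N N' f] push_closed L.lact_closed unit_in_ring_G)
    qed
    then show "delta_tensor G H \<Omega> N' (tensor_map G (unit_module G) (Ind G H \<Omega> N') (Ind_map H \<Omega> N' f) (D.pt \<eta> Y)) =
        tensor_map H (unit_module H) N' f (delta_tensor G H \<Omega> N (D.pt \<eta> Y))"
      using \<eta> Y gmodule_hom_closed[OF If Y]
      by (simp add: tensor_map_pure[OF AG Ind_module[OF N] Ind_module[OF N'] If] delta_tensor_pure[OF N] delta_tensor_pure[OF N'])
  qed
qed

end

section \<open>Projective modules\<close>

lemma hom_finprod:
  assumes "comm_group A" "comm_group B" "h \<in> hom A B" "finite S" "\<And>x. x \<in> S \<Longrightarrow> f x \<in> carrier A"
  shows "h (finprod A f S) = finprod B (\<lambda>x. h (f x)) S"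
proof -
  interpret A: comm_group A by fact
  interpret B: comm_group B by fact
  show ?thesis
    using assms(4,5)
  proof (induction S rule: finite_induct)
    case empty
    then show ?case using hom_one[OF assms(3) A.is_group B.is_group] by simp
  next
    case (insert x S)
    then show ?case
      by (subst A.finprod_insert; (subst B.finprod_insert)?)
        (auto simp: hom_in_carrier[OF assms(3)] hom_mult[OF assms(3)] intro!: A.finprod_closed)
  qed
qed

lemma (in left_module) zero_act: "m \<in> carrier M \<Longrightarrow> act M (\<lambda>g. 0) m = \<one>"
  using add_act[of "\<lambda>g. 0" "\<lambda>g. 0" m] act_closed[of "\<lambda>g. 0" m] by simp

definition prod_module :: "('g, 'm) gmodule \<Rightarrow> ('g, 'n) gmodule \<Rightarrow> ('g, 'm \<times> 'n) gmodule" where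
  "prod_module M N = \<lparr>carrier = carrier M \<times> carrier N,
     monoid.mult = (\<lambda>x y. (fst x \<otimes>\<^bsub>M\<^esub> fst y, snd x \<otimes>\<^bsub>N\<^esub> snd y)), one = (\<one>\<^bsub>M\<^esub>, \<one>\<^bsub>N\<^esub>),
     act = (\<lambda>\<xi> x. (act M \<xi> (fst x), act N \<xi> (snd x)))\<rparr>"

lemma prod_module_simps [simp]:
  "carrier (prod_module M N) = carrier M \<times> carrier N"
  "x \<otimes>\<^bsub>prod_module M N\<^esub> y = (fst x \<otimes>\<^bsub>M\<^esub> fst y, snd x \<otimes>\<^bsub>N\<^esub> snd y)"
  "\<one>\<^bsub>prod_module M N\<^esub> = (\<one>\<^bsub>M\<^esub>, \<one>\<^bsub>N\<^esub>)"
  "act (prod_module M N) \<xi> x = (act M \<xi> (fst x), act N \<xi> (snd x))"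
  by (simp_all add: prod_module_def)

text \<open>Transport of structure along an injection; it moves a direct sum of left ideals onto the
  prescribed type of resolutions.\<close>

definition image_structure :: "('a \<Rightarrow> 'b) \<Rightarrow> ('g, 'a) gmodule \<Rightarrow> ('g, 'b) gmodule" where
  "image_structure j M = (let i = inv_into (carrier M) j in \<lparr>carrier = j ` carrier M,
     monoid.mult = (\<lambda>x y. j (i x \<otimes>\<^bsub>M\<^esub> i y)), one = j \<one>\<^bsub>M\<^esub>, act = (\<lambda>\<xi> x. j (act M \<xi> (i x)))\<rparr>)"

section \<open>Direct sums, transported modules and covers by left ideals\<close>

context ample_groupoid
begin

text \<open>For K inside L the product of \<open>ind L\<close> and \<open>ind K\<close> is
  \<open>ind K\<close>. This allows local units of two modules to be merged by taking the
  union.\<close>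

lemma local_unit_mono:
  assumes M: "left_module \<Gamma> M" and K: "compact_open (unit_space \<Gamma>) K" "compact_open (unit_space \<Gamma>) L" "K \<subseteq> L"
    and m: "m \<in> carrier M" "act M (ind K) m = m"
  shows "act M (ind L) m = m"
proof -
  interpret M: left_module \<Gamma> M by fact
  have "conv \<Gamma> (ind L) (ind K) = ind K"
  proof (rule conv_local_unit[OF K(2) unit_in_ring[OF K(1)]])
    fix g assume "ind K g \<noteq> 0"
    then show "rng \<Gamma> g \<in> L"
      using K by (auto simp: compact_open_units unitsD subset_iff)
  qed
  then show ?thesis
    using M.conv_act[OF unit_in_ring[OF K(2)] unit_in_ring[OF K(1)] m(1)] m(2) by simp
qed

lemma prod_left_module:
  assumes M: "left_module \<Gamma> M" and N: "left_module \<Gamma> N"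
  shows "left_module \<Gamma> (prod_module M N)"
proof -
  interpret M: left_module \<Gamma> M by fact
  interpret N: left_module \<Gamma> N by fact
  show ?thesis
  proof (rule left_moduleI)
    show "comm_group (prod_module M N)"
    proof (rule comm_groupI)
      show "\<exists>y\<in>carrier (prod_module M N). y \<otimes>\<^bsub>prod_module M N\<^esub> x = \<one>\<^bsub>prod_module M N\<^esub>"
        if "x \<in> carrier (prod_module M N)" for x
        using that by (intro bexI[of _ "(inv\<^bsub>M\<^esub> fst x, inv\<^bsub>N\<^esub> snd x)"]) auto
    qed (auto simp: M.m_ac N.m_ac)
    show "\<exists>\<xi>\<in>groupoid_ring \<Gamma>. act (prod_module M N) \<xi> m = m" if m: "m \<in> carrier (prod_module M N)" for m
    proof -
      have c: "{fst m} \<subseteq> carrier M" "{snd m} \<subseteq> carrier N"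
        using m by auto
      obtain K where K: "compact_open (unit_space \<Gamma>) K" "\<And>x. x \<in> {fst m} \<Longrightarrow> act M (ind K) x = x"
        by (rule left_module_local_unit[OF M _ c(1)]) (simp, rule that)
      obtain L where L: "compact_open (unit_space \<Gamma>) L" "\<And>x. x \<in> {snd m} \<Longrightarrow> act N (ind L) x = x"
        by (rule left_module_local_unit[OF N _ c(2)]) (simp, rule that)
      have KL: "compact_open (unit_space \<Gamma>) (K \<union> L)"
        using compact_open_units_Un[OF K(1) L(1)] .
      have "act M (ind (K \<union> L)) (fst m) = fst m"
        by (rule local_unit_mono[OF M K(1) KL]) (use c K in auto)
      moreover have "act N (ind (K \<union> L)) (snd m) = snd m"
        by (rule local_unit_mono[OF N L(1) KL]) (use c L in auto)
      ultimately show ?thesis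
        using unit_in_ring[OF KL] by (intro bexI[of _ "ind (K \<union> L)"]) simp_all
    qed
  qed (auto simp: M.act_closed N.act_closed M.act_add N.act_add M.add_act N.add_act M.conv_act N.conv_act)
qed

lemma image_structure_module:
  assumes M: "left_module \<Gamma> M" and j: "inj_on j (carrier M)"
  shows "left_module \<Gamma> (image_structure j M)" "gmodule_hom \<Gamma> M (image_structure j M) j"
    "gmodule_hom \<Gamma> (image_structure j M) M (inv_into (carrier M) j)"
proof -
  interpret M: left_module \<Gamma> M by fact
  have s: "carrier (image_structure j M) = j ` carrier M" "\<one>\<^bsub>image_structure j M\<^esub> = j \<one>\<^bsub>M\<^esub>"
    "\<And>x y. \<lbrakk>x \<in> carrier M; y \<in> carrier M\<rbrakk> \<Longrightarrow> j x \<otimes>\<^bsub>image_structure j M\<^esub> j y = j (x \<otimes>\<^bsub>M\<^esub> y)"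
    "\<And>\<xi> x. x \<in> carrier M \<Longrightarrow> act (image_structure j M) \<xi> (j x) = j (act M \<xi> x)"
    by (simp_all add: image_structure_def Let_def inv_into_f_f[OF j])
  show "left_module \<Gamma> (image_structure j M)"
  proof (rule left_moduleI)
    show "comm_group (image_structure j M)"
    proof (rule comm_groupI)
      show "\<exists>y\<in>carrier (image_structure j M). y \<otimes>\<^bsub>image_structure j M\<^esub> x = \<one>\<^bsub>image_structure j M\<^esub>"
        if x: "x \<in> carrier (image_structure j M)" for x
      proof -
        obtain z where z: "z \<in> carrier M" "x = j z" using x s by auto
        then show ?thesis
          by (intro bexI[of _ "j (inv\<^bsub>M\<^esub> z)"]) (auto simp: s)
      qed
    qed (auto simp: s M.m_ac)
    show "\<exists>\<xi>\<in>groupoid_ring \<Gamma>. act (image_structure j M) \<xi> m = m" if "m \<in> carrier (image_structure j M)" for m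
      using that left_module_unit[OF M] by (auto simp: s) metis
  qed (auto simp: s M.act_closed M.act_add M.add_act M.conv_act)
  show "gmodule_hom \<Gamma> M (image_structure j M) j"
    by (rule gmodule_homI) (auto simp: s)
  show "gmodule_hom \<Gamma> (image_structure j M) M (inv_into (carrier M) j)"
    by (rule gmodule_homI) (auto simp: s inv_into_f_f[OF j] M.act_closed)
qed

text \<open>The direct sum of the left ideals \<open>\<int>[\<Gamma>] e m\<close>, where \<open>e m\<close> is an idempotent fixing \<open>m\<close>.\<close>

definition fixing_unit :: "('a, 'm) gmodule \<Rightarrow> 'm \<Rightarrow> 'a \<Rightarrow> int" where
  "fixing_unit M m = (SOME e. e \<in> groupoid_ring \<Gamma> \<and> conv \<Gamma> e e = e \<and> (m \<in> carrier M \<longrightarrow> act M e m = m))"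

text \<open>The convolution condition says that the component at m lies in the left ideal generated
  by the idempotent at m. These ideals replace free summands: the ring may lack a unit, while an
  idempotent lies in its ideal and generates it.\<close>

definition cover :: "('a, 'm) gmodule \<Rightarrow> ('a, 'm \<times> 'a \<Rightarrow> int) gmodule" where
  "cover M = \<lparr>carrier = {\<phi>. finite {m. \<exists>g. \<phi> (m, g) \<noteq> 0} \<and> {m. \<exists>g. \<phi> (m, g) \<noteq> 0} \<subseteq> carrier M \<and>
       (\<forall>m. (\<lambda>g. \<phi> (m, g)) \<in> groupoid_ring \<Gamma> \<and>
            conv \<Gamma> (\<lambda>g. \<phi> (m, g)) (fixing_unit M m) = (\<lambda>g. \<phi> (m, g)))},
     monoid.mult = (\<lambda>\<phi> \<psi> z. \<phi> z + \<psi> z), one = (\<lambda>z. 0),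
     act = (\<lambda>\<xi> \<phi> z. conv \<Gamma> \<xi> (\<lambda>g. \<phi> (fst z, g)) (snd z))\<rparr>"

context
  fixes M :: "('a, 'm) gmodule"
  assumes M: "left_module \<Gamma> M"
begin

lemma fixing_unit:
  "fixing_unit M m \<in> groupoid_ring \<Gamma>" "conv \<Gamma> (fixing_unit M m) (fixing_unit M m) = fixing_unit M m"
  "m \<in> carrier M \<Longrightarrow> act M (fixing_unit M m) m = m"
proof -
  have "\<exists>e. e \<in> groupoid_ring \<Gamma> \<and> conv \<Gamma> e e = e \<and> (m \<in> carrier M \<longrightarrow> act M e m = m)"
  proof (cases "m \<in> carrier M")
    case True
    then have c: "{m} \<subseteq> carrier M" by simp
    obtain K where K: "compact_open (unit_space \<Gamma>) K" "\<And>x. x \<in> {m} \<Longrightarrow> act M (ind K) x = x"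
      by (rule left_module_local_unit[OF M _ c]) (simp, rule that)
    then show ?thesis
      using unit_in_ring[OF K(1)] unit_idem[OF K(1)] by blast
  next
    case False
    then show ?thesis by (intro exI[of _ "\<lambda>g. 0"]) simp
  qed
  from someI_ex[OF this] show "fixing_unit M m \<in> groupoid_ring \<Gamma>"
    "conv \<Gamma> (fixing_unit M m) (fixing_unit M m) = fixing_unit M m"
    "m \<in> carrier M \<Longrightarrow> act M (fixing_unit M m) m = m"
    unfolding fixing_unit_def by blast+
qed

definition supp :: "('m \<times> 'a \<Rightarrow> int) \<Rightarrow> 'm set" where
  "supp \<phi> = {m. \<exists>g. \<phi> (m, g) \<noteq> 0}"

lemma cover_simps:
  "x \<otimes>\<^bsub>cover M\<^esub> y = (\<lambda>z. x z + y z)" "\<one>\<^bsub>cover M\<^esub> = (\<lambda>z. 0)"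
  "act (cover M) \<xi> x = (\<lambda>z. conv \<Gamma> \<xi> (\<lambda>g. x (fst z, g)) (snd z))"
  by (simp_all add: cover_def)

lemma coverD:
  assumes "\<phi> \<in> carrier (cover M)"
  shows "finite (supp \<phi>)" "supp \<phi> \<subseteq> carrier M" "(\<lambda>g. \<phi> (m, g)) \<in> groupoid_ring \<Gamma>"
    "conv \<Gamma> (\<lambda>g. \<phi> (m, g)) (fixing_unit M m) = (\<lambda>g. \<phi> (m, g))"
  using assms by (simp_all add: cover_def supp_def)

lemma coverI:
  assumes "finite (supp \<phi>)" "supp \<phi> \<subseteq> carrier M" "\<And>m. (\<lambda>g. \<phi> (m, g)) \<in> groupoid_ring \<Gamma>"
    "\<And>m. conv \<Gamma> (\<lambda>g. \<phi> (m, g)) (fixing_unit M m) = (\<lambda>g. \<phi> (m, g))"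
  shows "\<phi> \<in> carrier (cover M)"
  using assms by (simp add: cover_def supp_def)

lemma not_supp: "m \<notin> supp \<phi> \<Longrightarrow> (\<lambda>g. \<phi> (m, g)) = (\<lambda>g. 0)"
  by (auto simp: supp_def)

lemma supp_act: "supp (act (cover M) \<xi> \<phi>) \<subseteq> supp \<phi>"
proof (rule ccontr)
  assume "\<not> supp (act (cover M) \<xi> \<phi>) \<subseteq> supp \<phi>"
  then obtain m g where m: "m \<notin> supp \<phi>" "act (cover M) \<xi> \<phi> (m, g) \<noteq> 0"
    unfolding supp_def[of "act (cover M) \<xi> \<phi>"] by auto
  then show False
    by (simp add: cover_simps not_supp[OF m(1)])
qed

lemma cover_module: "left_module \<Gamma> (cover M)"
proof (rule left_moduleI)
  have add: "(\<lambda>z. x z + y z) \<in> carrier (cover M)" if x: "x \<in> carrier (cover M)" and y: "y \<in> carrier (cover M)" for x y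
  proof -
    have "supp (\<lambda>z. x z + y z) \<subseteq> supp x \<union> supp y"
      by (auto simp: supp_def)
    then show ?thesis
      using coverD[OF x] coverD[OF y]
      by (intro coverI) (auto simp: int_functions_add conv_add_left intro: finite_subset)
  qed
  have uminus: "(\<lambda>z. - x z) \<in> carrier (cover M)" if x: "x \<in> carrier (cover M)" for x
    using coverD[OF x] by (intro coverI) (auto simp: supp_def int_functions_uminus conv_uminus)
  show "comm_group (cover M)"
  proof (rule comm_groupI)
    show "\<one>\<^bsub>cover M\<^esub> \<in> carrier (cover M)"
      by (rule coverI) (simp_all add: cover_simps supp_def)
    show "\<exists>y\<in>carrier (cover M). y \<otimes>\<^bsub>cover M\<^esub> x = \<one>\<^bsub>cover M\<^esub>" if "x \<in> carrier (cover M)" for x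
      using uminus[OF that] by (intro bexI[of _ "\<lambda>z. - x z"]) (simp_all add: cover_simps)
  qed (simp_all add: cover_simps add add_ac)
next
  fix \<xi> \<phi> assume \<xi>: "\<xi> \<in> groupoid_ring \<Gamma>" and \<phi>: "\<phi> \<in> carrier (cover M)"
  from supp_act[of \<xi> \<phi>] show "act (cover M) \<xi> \<phi> \<in> carrier (cover M)"
    using coverD[OF \<phi>] \<xi>
    by (intro coverI) (auto simp: cover_simps conv_closed conv_assoc finite_subset)
  show "act (cover M) \<xi> (\<phi> \<otimes>\<^bsub>cover M\<^esub> \<psi>) = act (cover M) \<xi> \<phi> \<otimes>\<^bsub>cover M\<^esub> act (cover M) \<xi> \<psi>" for \<psi>
    using \<xi> by (simp add: cover_simps conv_add_right)
  fix \<eta> assume \<eta>: "\<eta> \<in> groupoid_ring \<Gamma>"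
  show "act (cover M) (\<lambda>g. \<xi> g + \<eta> g) \<phi> = act (cover M) \<xi> \<phi> \<otimes>\<^bsub>cover M\<^esub> act (cover M) \<eta> \<phi>"
    using \<xi> \<eta> by (simp add: cover_simps conv_add_left)
  show "act (cover M) (conv \<Gamma> \<xi> \<eta>) \<phi> = act (cover M) \<xi> (act (cover M) \<eta> \<phi>)"
    using \<xi> \<eta> by (simp add: cover_simps conv_assoc)
next
  fix \<phi> assume \<phi>: "\<phi> \<in> carrier (cover M)"
  interpret arr: ample_left_space \<Gamma> "gtop \<Gamma>" "rng \<Gamma>" "gmul \<Gamma>"
    by (rule ample_left_space_arrows)
  have "\<exists>L. compact_open (unit_space \<Gamma>) L \<and> (\<forall>g. \<phi> (m, g) \<noteq> 0 \<longrightarrow> rng \<Gamma> g \<in> L)" for m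
  proof -
    obtain L where "compact_open (unit_space \<Gamma>) L" "\<And>g. \<phi> (m, g) \<noteq> 0 \<Longrightarrow> rng \<Gamma> g \<in> L"
      by (rule arr.support_anchor[OF coverD(3)[OF \<phi>, of m]]) (rule that)
    then show ?thesis by blast
  qed
  then obtain L where L: "\<And>m. compact_open (unit_space \<Gamma>) (L m)" "\<And>m g. \<phi> (m, g) \<noteq> 0 \<Longrightarrow> rng \<Gamma> g \<in> L m"
    by metis
  have "compactin (unit_space \<Gamma>) (\<Union>m\<in>supp \<phi>. L m)"
    using L(1) coverD(1)[OF \<phi>] by (intro compactin_Union) (auto simp: compact_open_def)
  then obtain K where K: "compact_open (unit_space \<Gamma>) K" "(\<Union>m\<in>supp \<phi>. L m) \<subseteq> K"
    by (rule compact_units_in_compact_open) (rule that)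
  have "conv \<Gamma> (ind K) (\<lambda>g. \<phi> (m, g)) = (\<lambda>g. \<phi> (m, g))" for m
  proof (rule conv_local_unit[OF K(1) coverD(3)[OF \<phi>]])
    fix g assume g: "\<phi> (m, g) \<noteq> 0"
    then have "m \<in> supp \<phi>" by (auto simp: supp_def)
    then show "rng \<Gamma> g \<in> K" using L(2)[OF g] K(2) by blast
  qed
  then have "act (cover M) (ind K) \<phi> = \<phi>"
    by (simp add: cover_simps)
  then show "\<exists>\<xi>\<in>groupoid_ring \<Gamma>. act (cover M) \<xi> \<phi> = \<phi>"
    using unit_in_ring[OF K(1)] by blast
qed

definition generator :: "'m \<Rightarrow> 'm \<times> 'a \<Rightarrow> int" where
  "generator m = (\<lambda>z. if fst z = m then fixing_unit M m (snd z) else 0)"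

lemma generator_section: "(\<lambda>g. generator m (k, g)) = (if k = m then fixing_unit M m else (\<lambda>g. 0))"
  by (auto simp: generator_def)

lemma generator_closed: "m \<in> carrier M \<Longrightarrow> generator m \<in> carrier (cover M)"
proof (rule coverI)
  have s: "supp (generator m) \<subseteq> {m}"
    by (auto simp: supp_def generator_def split: if_splits)
  then show "finite (supp (generator m))" by (rule finite_subset) simp
  show "supp (generator m) \<subseteq> carrier M" if "m \<in> carrier M"
    using s that by blast
qed (simp_all add: generator_section fixing_unit)

text \<open>The sum of the components of \<phi> applied to the elements b m. On
  \<open>generator m\<close> the value is the idempotent applied to b m, hence b m itself when the
  idempotent fixes it.\<close>

definition evaluate :: "('a, 'b) gmodule \<Rightarrow> ('m \<Rightarrow> 'b) \<Rightarrow> ('m \<times> 'a \<Rightarrow> int) \<Rightarrow> 'b" where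
  "evaluate B b \<phi> = finprod B (\<lambda>m. act B (\<lambda>g. \<phi> (m, g)) (b m)) (supp \<phi>)"

context
  fixes B :: "('a, 'b) gmodule" and b
  assumes B: "left_module \<Gamma> B" and b: "\<And>m. m \<in> carrier M \<Longrightarrow> b m \<in> carrier B"
begin

interpretation B: left_module \<Gamma> B by (rule B)

lemma evaluate_eq:
  assumes "\<phi> \<in> carrier (cover M)" "finite S" "supp \<phi> \<subseteq> S" "S \<subseteq> carrier M"
  shows "evaluate B b \<phi> = finprod B (\<lambda>m. act B (\<lambda>g. \<phi> (m, g)) (b m)) S"
  unfolding evaluate_def
proof (rule B.finprod_mono_neutral_cong_left[OF assms(2,3)])
  show "act B (\<lambda>g. \<phi> (i, g)) (b i) = \<one>\<^bsub>B\<^esub>" if "i \<in> S - supp \<phi>" for i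
    using that not_supp[of i \<phi>] b assms(4) by (auto simp: B.zero_act)
  show "(\<lambda>m. act B (\<lambda>g. \<phi> (m, g)) (b m)) \<in> S \<rightarrow> carrier B"
    using assms(4) coverD(3)[OF assms(1)] b by (auto intro!: B.act_closed)
qed simp

lemma evaluate_hom: "gmodule_hom \<Gamma> (cover M) B (evaluate B b)"
proof (rule gmodule_homI)
  interpret C: left_module \<Gamma> "cover M" by (rule cover_module)
  have cl: "act B (\<lambda>g. \<phi> (m, g)) (b m) \<in> carrier B" if "\<phi> \<in> carrier (cover M)" "m \<in> carrier M" for \<phi> m
    using coverD(3)[OF that(1)] b that(2) by (intro B.act_closed)
  fix \<phi> assume \<phi>: "\<phi> \<in> carrier (cover M)"
  show "evaluate B b \<phi> \<in> carrier B"
    unfolding evaluate_def using cl[OF \<phi>] coverD(2)[OF \<phi>] by (intro B.finprod_closed) auto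
  show "evaluate B b (\<phi> \<otimes>\<^bsub>cover M\<^esub> \<psi>) = evaluate B b \<phi> \<otimes>\<^bsub>B\<^esub> evaluate B b \<psi>" if \<psi>: "\<psi> \<in> carrier (cover M)" for \<psi>
  proof -
    define S where "S = supp \<phi> \<union> supp \<psi>"
    have S: "finite S" "S \<subseteq> carrier M" "supp \<phi> \<subseteq> S" "supp \<psi> \<subseteq> S" "supp (\<lambda>z. \<phi> z + \<psi> z) \<subseteq> S"
      using coverD(1,2)[OF \<phi>] coverD(1,2)[OF \<psi>] by (auto simp: S_def supp_def)
    have sum: "(\<lambda>z. \<phi> z + \<psi> z) \<in> carrier (cover M)"
      using C.m_closed[OF \<phi> \<psi>] by (simp add: cover_simps)
    have "evaluate B b (\<lambda>z. \<phi> z + \<psi> z) = finprod B (\<lambda>m. act B (\<lambda>g. \<phi> (m, g) + \<psi> (m, g)) (b m)) S"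
      using evaluate_eq[OF sum S(1,5,2)] .
    also have "\<dots> = finprod B (\<lambda>m. act B (\<lambda>g. \<phi> (m, g)) (b m) \<otimes>\<^bsub>B\<^esub> act B (\<lambda>g. \<psi> (m, g)) (b m)) S"
      using S(2) cl[OF \<phi>] cl[OF \<psi>] coverD(3)[OF \<phi>] coverD(3)[OF \<psi>] b
      by (intro B.finprod_cong') (auto simp: B.add_act subset_iff)
    also have "\<dots> = evaluate B b \<phi> \<otimes>\<^bsub>B\<^esub> evaluate B b \<psi>"
      using S(2) cl[OF \<phi>] cl[OF \<psi>] unfolding evaluate_eq[OF \<phi> S(1,3,2)] evaluate_eq[OF \<psi> S(1,4,2)]
      by (intro B.finprod_multf) auto
    finally show ?thesis by (simp add: cover_simps)
  qed
  show "evaluate B b (act (cover M) \<xi> \<phi>) = act B \<xi> (evaluate B b \<phi>)" if \<xi>: "\<xi> \<in> groupoid_ring \<Gamma>" for \<xi>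
  proof -
    have "evaluate B b (act (cover M) \<xi> \<phi>) = finprod B (\<lambda>m. act B (\<lambda>g. act (cover M) \<xi> \<phi> (m, g)) (b m)) (supp \<phi>)"
      using evaluate_eq[OF C.act_closed[OF \<xi> \<phi>] coverD(1)[OF \<phi>] supp_act coverD(2)[OF \<phi>]] .
    also have "\<dots> = finprod B (\<lambda>m. act B \<xi> (act B (\<lambda>g. \<phi> (m, g)) (b m))) (supp \<phi>)"
      using coverD(2)[OF \<phi>] coverD(3)[OF \<phi>] \<xi> b cl[OF \<phi>]
      by (intro B.finprod_cong') (auto simp: cover_simps B.conv_act B.act_closed subset_iff)
    also have "\<dots> = act B \<xi> (evaluate B b \<phi>)"
      unfolding evaluate_def using coverD(1,2)[OF \<phi>] cl[OF \<phi>]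
      by (intro hom_finprod[symmetric, OF B.comm_group_axioms B.comm_group_axioms B.act_hom[OF \<xi>]]) auto
    finally show ?thesis .
  qed
qed

end

text \<open>Right multiplication by the idempotent at m fixes the component of \<phi> at m, so
  \<phi> is the sum of its components applied to the generators. A homomorphism on the cover is
  therefore determined by its values there.\<close>

lemma evaluate_generator:
  assumes \<phi>: "\<phi> \<in> carrier (cover M)"
  shows "evaluate (cover M) generator \<phi> = \<phi>"
proof -
  interpret C: left_module \<Gamma> "cover M" by (rule cover_module)
  have act: "act (cover M) (\<lambda>g. \<phi> (m, g)) (generator m) = (\<lambda>z. if fst z = m then \<phi> z else 0)" for m
  proof
    fix z
    show "act (cover M) (\<lambda>g. \<phi> (m, g)) (generator m) z = (if fst z = m then \<phi> z else 0)"
      using coverD(4)[OF \<phi>, of m] by (cases z) (auto simp: cover_simps generator_section fun_eq_iff)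
  qed
  have cl: "(\<lambda>z. if fst z = m then \<phi> z else 0) \<in> carrier (cover M)" if "m \<in> carrier M" for m
    unfolding act[symmetric] using coverD(3)[OF \<phi>] generator_closed[OF that] by (intro C.act_closed)
  have "finprod (cover M) (\<lambda>m z. if fst z = m then \<phi> z else 0) S = (\<lambda>z. if fst z \<in> S then \<phi> z else 0)"
    if "finite S" "S \<subseteq> carrier M" for S
    using that
  proof (induction S rule: finite_induct)
    case (insert m S)
    then show ?case
      using cl by (subst C.finprod_insert) (auto simp: cover_simps subset_iff)
  qed (simp add: cover_simps)
  from this[OF coverD(1,2)[OF \<phi>]]
  have "evaluate (cover M) generator \<phi> = (\<lambda>z. if fst z \<in> supp \<phi> then \<phi> z else 0)"
    by (simp add: evaluate_def act)
  also have "\<dots> = \<phi>"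
    by (auto simp: supp_def)
  finally show ?thesis .
qed

lemma hom_evaluate:
  assumes B: "left_module \<Gamma> B" and h: "gmodule_hom \<Gamma> (cover M) B h" and \<phi>: "\<phi> \<in> carrier (cover M)"
  shows "h \<phi> = evaluate B (\<lambda>m. h (generator m)) \<phi>"
proof -
  interpret C: left_module \<Gamma> "cover M" by (rule cover_module)
  have "h \<phi> = h (evaluate (cover M) generator \<phi>)"
    using evaluate_generator[OF \<phi>] by simp
  also have "\<dots> = finprod B (\<lambda>m. h (act (cover M) (\<lambda>g. \<phi> (m, g)) (generator m))) (supp \<phi>)"
    unfolding evaluate_def using coverD(1,2)[OF \<phi>] coverD(3)[OF \<phi>]
    by (intro hom_finprod[OF C.comm_group_axioms left_module_comm_group[OF B] gmodule_hom_hom[OF h]])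
      (auto intro!: C.act_closed generator_closed)
  also have "\<dots> = evaluate B (\<lambda>m. h (generator m)) \<phi>"
    unfolding evaluate_def
  proof (rule comm_monoid.finprod_cong')
    show "comm_monoid B"
      using left_module_comm_group[OF B] by (simp add: comm_group_def)
    interpret B: left_module \<Gamma> B by fact
    show "(\<lambda>m. act B (\<lambda>g. \<phi> (m, g)) (h (generator m))) \<in> supp \<phi> \<rightarrow> carrier B"
      using coverD(2,3)[OF \<phi>] by (auto intro!: B.act_closed gmodule_hom_closed[OF h] generator_closed)
    show "h (act (cover M) (\<lambda>g. \<phi> (m, g)) (generator m)) = act B (\<lambda>g. \<phi> (m, g)) (h (generator m))"
      if "m \<in> supp \<phi>" for m
      using that coverD(2)[OF \<phi>] coverD(3)[OF \<phi>] by (intro gmodule_hom_act[OF h] generator_closed) auto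
  qed simp
  finally show ?thesis .
qed

definition cover_map :: "('m \<times> 'a \<Rightarrow> int) \<Rightarrow> 'm" where
  "cover_map = evaluate M (\<lambda>m. m)"

lemma cover_map_hom: "gmodule_hom \<Gamma> (cover M) M cover_map"
  unfolding cover_map_def by (rule evaluate_hom[OF M])

lemma evaluate_at_generator:
  assumes B: "left_module \<Gamma> B" and b: "\<And>m. m \<in> carrier M \<Longrightarrow> b m \<in> carrier B" and m: "m \<in> carrier M"
  shows "evaluate B b (generator m) = act B (fixing_unit M m) (b m)"
proof -
  interpret B: left_module \<Gamma> B by fact
  have s: "supp (generator m) \<subseteq> {m}"
    by (auto simp: supp_def generator_def split: if_splits)
  have "evaluate B b (generator m) = finprod B (\<lambda>k. act B (\<lambda>g. generator m (k, g)) (b k)) {m}"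
    by (rule evaluate_eq[OF B b generator_closed[OF m] _ s]) (use m in auto)
  also have "\<dots> = act B (fixing_unit M m) (b m)"
    using m fixing_unit(1)[of m] b[OF m] by (simp add: generator_section B.act_closed)
  finally show ?thesis .
qed

lemma cover_map_surj: "cover_map ` carrier (cover M) = carrier M"
proof
  show "carrier M \<subseteq> cover_map ` carrier (cover M)"
  proof
    fix m assume m: "m \<in> carrier M"
    have "cover_map (generator m) = m"
      unfolding cover_map_def using evaluate_at_generator[OF M _ m, of "\<lambda>m. m"] fixing_unit(3)[OF m] by simp
    then show "m \<in> cover_map ` carrier (cover M)"
      using generator_closed[OF m] by (metis imageI)
  qed
qed (auto intro: gmodule_hom_closed[OF cover_map_hom])

text \<open>Preimages b m of the values of h at the generators define the lift. As b m need not be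
  fixed by the idempotent e at m, the values are compared after applying p, through e h(g) = h(e g)
  = h(g) for the generator g. The types of B and C are arbitrary, in contrast to
  \<open>projective_module\<close>.\<close>

lemma cover_lift:
  assumes B: "left_module \<Gamma> B" and C: "left_module \<Gamma> C" and p: "gmodule_hom \<Gamma> B C p"
    and surj: "p ` carrier B = carrier C" and h: "gmodule_hom \<Gamma> (cover M) C h"
  shows "\<exists>k. gmodule_hom \<Gamma> (cover M) B k \<and> (\<forall>x \<in> carrier (cover M). p (k x) = h x)"
proof -
  interpret B: left_module \<Gamma> B by fact
  interpret F: left_module \<Gamma> "cover M" by (rule cover_module)
  define s where "s = inv_into (carrier B) p"
  have s: "s y \<in> carrier B" "p (s y) = y" if "y \<in> carrier C" for y
    using that unfolding s_def surj[symmetric] by (auto intro: inv_into_into f_inv_into_f)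
  have hc: "h (generator m) \<in> carrier C" if "m \<in> carrier M" for m
    using that by (intro gmodule_hom_closed[OF h] generator_closed)
  define b where "b = (\<lambda>m. s (h (generator m)))"
  have b: "b m \<in> carrier B" "p (b m) = h (generator m)" if "m \<in> carrier M" for m
    using s[OF hc[OF that]] by (simp_all add: b_def)
  have k: "gmodule_hom \<Gamma> (cover M) B (evaluate B b)"
    by (rule evaluate_hom[OF B b(1)])
  have pk: "gmodule_hom \<Gamma> (cover M) C (\<lambda>x. p (evaluate B b x))"
    by (rule gmodule_hom_comp[OF k p])
  have gen: "p (evaluate B b (generator m)) = h (generator m)" if m: "m \<in> carrier M" for m
  proof -
    have "p (evaluate B b (generator m)) = act C (fixing_unit M m) (p (b m))"
      using evaluate_at_generator[OF B b(1) m] gmodule_hom_act[OF p fixing_unit(1) b(1)[OF m]] by simp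
    also have "\<dots> = h (act (cover M) (fixing_unit M m) (generator m))"
      using gmodule_hom_act[OF h fixing_unit(1) generator_closed[OF m]] b(2)[OF m] by simp
    also have "act (cover M) (fixing_unit M m) (generator m) = generator m"
      by (auto simp: cover_simps generator_section fixing_unit(2) generator_def)
    finally show ?thesis .
  qed
  have "p (evaluate B b x) = h x" if x: "x \<in> carrier (cover M)" for x
  proof -
    interpret C: left_module \<Gamma> C by fact
    have "evaluate C (\<lambda>m. p (evaluate B b (generator m))) x = evaluate C (\<lambda>m. h (generator m)) x"
      unfolding evaluate_def[of C] using coverD(2,3)[OF x] gen hc
      by (intro C.finprod_cong') (auto simp: subset_iff intro!: C.act_closed)
    then show ?thesis
      using hom_evaluate[OF C pk x] hom_evaluate[OF C h x] by simp
  qed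
  then show ?thesis
    using k by blast
qed

end

text \<open>The defining property is applied once, with B = \<open>cover P\<close> and C = P, and
  makes P a retract of its cover. Lifts on arbitrary types then come from \<open>cover_lift\<close>,
  composed with the section s.\<close>

lemma projective_lift:
  assumes P: "projective_module \<Gamma> P" and B: "left_module \<Gamma> B" and C: "left_module \<Gamma> C" and p: "gmodule_hom \<Gamma> B C p"
    and surj: "p ` carrier B = carrier C" and f: "gmodule_hom \<Gamma> P C f"
  shows "\<exists>h. gmodule_hom \<Gamma> P B h \<and> (\<forall>x \<in> carrier P. p (h x) = f x)"
proof -
  have PM: "left_module \<Gamma> P"
    using P by (simp add: projective_module_def)
  obtain s where s: "gmodule_hom \<Gamma> P (cover P) s" "\<forall>x \<in> carrier P. cover_map P (s x) = x"
    using P cover_module[OF PM] PM cover_map_hom[OF PM] cover_map_surj[OF PM] gmodule_hom_id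
    unfolding projective_module_def by metis
  have fe: "gmodule_hom \<Gamma> (cover P) C (\<lambda>x. f (cover_map P x))"
    by (rule gmodule_hom_comp[OF cover_map_hom[OF PM] f])
  obtain k where k: "gmodule_hom \<Gamma> (cover P) B k" "\<forall>x \<in> carrier (cover P). p (k x) = f (cover_map P x)"
    using cover_lift[OF PM B C p surj fe] by (elim exE conjE)
  have "gmodule_hom \<Gamma> P B (\<lambda>x. k (s x))"
    by (rule gmodule_hom_comp[OF s(1) k(1)])
  moreover have "p (k (s x)) = f x" if "x \<in> carrier P" for x
    using k(2) s(2) gmodule_hom_closed[OF s(1) that] that by simp
  ultimately show ?thesis
    by (intro exI[of _ "\<lambda>x. k (s x)"]) simp
qed

lemma projective_left_module: "projective_module \<Gamma> P \<Longrightarrow> left_module \<Gamma> P"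
  by (simp add: projective_module_def)

text \<open>The summands are lifted separately. Their lifting problems live on the types belonging
  to the product, which is why \<open>projective_lift\<close> is used instead of the
  definition.\<close>

lemma projective_prod:
  assumes P: "projective_module \<Gamma> P" and R: "projective_module \<Gamma> R"
  shows "projective_module \<Gamma> (prod_module P R)"
  unfolding projective_module_def
proof (intro conjI allI impI; (elim conjE)?)
  note PM = projective_left_module[OF P] and RM = projective_left_module[OF R]
  interpret P: left_module \<Gamma> P by (rule PM)
  interpret R: left_module \<Gamma> R by (rule RM)
  show "left_module \<Gamma> (prod_module P R)"
    by (rule prod_left_module[OF PM RM])
  fix B :: "('a, ('b \<times> 'c) \<times> 'a \<Rightarrow> int) gmodule" and C :: "('a, 'b \<times> 'c) gmodule" and p f
  assume B: "left_module \<Gamma> B" and C: "left_module \<Gamma> C" and p: "gmodule_hom \<Gamma> B C p" "p ` carrier B = carrier C"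
    and f: "gmodule_hom \<Gamma> (prod_module P R) C f"
  interpret B: left_module \<Gamma> B by fact
  have 1: "gmodule_hom \<Gamma> P (prod_module P R) (\<lambda>x. (x, \<one>\<^bsub>R\<^esub>))"
    and 2: "gmodule_hom \<Gamma> R (prod_module P R) (\<lambda>x. (\<one>\<^bsub>P\<^esub>, x))"
    by (rule gmodule_homI; simp)+
  obtain h where h: "gmodule_hom \<Gamma> P B h" "\<forall>x \<in> carrier P. p (h x) = f (x, \<one>\<^bsub>R\<^esub>)"
    using projective_lift[OF P B C p gmodule_hom_comp[OF 1 f]] by (elim exE conjE)
  obtain k where k: "gmodule_hom \<Gamma> R B k" "\<forall>x \<in> carrier R. p (k x) = f (\<one>\<^bsub>P\<^esub>, x)"
    using projective_lift[OF R B C p gmodule_hom_comp[OF 2 f]] by (elim exE conjE)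
  have fst: "gmodule_hom \<Gamma> (prod_module P R) P fst" and snd: "gmodule_hom \<Gamma> (prod_module P R) R snd"
    by (rule gmodule_homI; auto)+
  have "gmodule_hom \<Gamma> (prod_module P R) B (\<lambda>z. h (fst z) \<otimes>\<^bsub>B\<^esub> k (snd z))"
    by (rule gmodule_hom_times[OF B gmodule_hom_comp[OF fst h(1)] gmodule_hom_comp[OF snd k(1)]])
  moreover have "p (h (fst z) \<otimes>\<^bsub>B\<^esub> k (snd z)) = f z" if z: "z \<in> carrier (prod_module P R)" for z
  proof -
    have "f ((fst z, \<one>\<^bsub>R\<^esub>) \<otimes>\<^bsub>prod_module P R\<^esub> (\<one>\<^bsub>P\<^esub>, snd z)) = f (fst z, \<one>\<^bsub>R\<^esub>) \<otimes>\<^bsub>C\<^esub> f (\<one>\<^bsub>P\<^esub>, snd z)"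
      using z by (intro gmodule_hom_mult[OF f]) auto
    moreover have "p (h (fst z) \<otimes>\<^bsub>B\<^esub> k (snd z)) = f (fst z, \<one>\<^bsub>R\<^esub>) \<otimes>\<^bsub>C\<^esub> f (\<one>\<^bsub>P\<^esub>, snd z)"
      using z h(2) k(2) by (auto simp: gmodule_hom_mult[OF p(1)] gmodule_hom_closed[OF h(1)] gmodule_hom_closed[OF k(1)])
    ultimately show ?thesis
      using z by (cases z) simp
  qed
  ultimately show "\<exists>h. gmodule_hom \<Gamma> (prod_module P R) B h \<and> (\<forall>x\<in>carrier (prod_module P R). p (h x) = f x)"
    by (intro exI[of _ "\<lambda>z. h (fst z) \<otimes>\<^bsub>B\<^esub> k (snd z)"]) simp
qed

lemma projective_image_cover:
  assumes M: "left_module \<Gamma> M" and j: "inj_on j (carrier (cover M))"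
  shows "projective_module \<Gamma> (image_structure j (cover M))"
  unfolding projective_module_def
proof (intro conjI allI impI; (elim conjE)?)
  note E = image_structure_module[OF cover_module[OF M] j]
  show "left_module \<Gamma> (image_structure j (cover M))" by (rule E)
  fix B :: "('a, 'c \<times> 'a \<Rightarrow> int) gmodule" and C :: "('a, 'c) gmodule" and p f
  assume B: "left_module \<Gamma> B" and C: "left_module \<Gamma> C" and p: "gmodule_hom \<Gamma> B C p" "p ` carrier B = carrier C"
    and f: "gmodule_hom \<Gamma> (image_structure j (cover M)) C f"
  obtain k where k: "gmodule_hom \<Gamma> (cover M) B k" "\<forall>x \<in> carrier (cover M). p (k x) = f (j x)"
    using cover_lift[OF M B C p gmodule_hom_comp[OF E(2) f]] by (elim exE conjE)
  let ?i = "inv_into (carrier (cover M)) j"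
  have "p (k (?i x)) = f x" if "x \<in> carrier (image_structure j (cover M))" for x
  proof -
    have "x \<in> j ` carrier (cover M)"
      using that by (simp add: image_structure_def Let_def)
    then show ?thesis
      using k(2) f_inv_into_f[of x j] inv_into_into[of x j] by simp
  qed
  then show "\<exists>h. gmodule_hom \<Gamma> (image_structure j (cover M)) B h \<and> (\<forall>x\<in>carrier (image_structure j (cover M)). p (h x) = f x)"
    using gmodule_hom_comp[OF E(3) k(1)] by (intro exI[of _ "\<lambda>x. k (?i x)"]) simp
qed

end

section \<open>Existence of projective resolutions\<close>

lemma lists_injection:
  assumes "infinite (UNIV :: 'b set)"
  shows "\<exists>f :: 'b list \<Rightarrow> 'b. inj f"
proof -
  have "|lists (UNIV :: 'b set)| \<le>o |UNIV :: 'b set|"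
    using card_of_lists_infinite[OF assms] ordIso_imp_ordLeq by blast
  then show ?thesis
    unfolding card_of_ordLeq[symmetric] by auto
qed

text \<open>The type of lists is infinite, hence as large as the type of lists over itself, and so
  absorbs the codes of a further cover. This keeps all terms of a resolution on one type.\<close>

lemma res_injection:
  "\<exists>f :: (('m \<times> 'g set) list \<times> int \<times> 'g set) list \<Rightarrow> ('m \<times> 'g set) list. inj f"
proof -
  have "infinite (UNIV :: ('m \<times> 'g set) list set)"
    by (rule infinite_UNIV_listI)
  then obtain f :: "('m \<times> 'g set) list list \<Rightarrow> ('m \<times> 'g set) list" where f: "inj f"
    using lists_injection by blast
  obtain c :: "int \<Rightarrow> nat" where c: "inj c"
    using inj_to_nat by blast
  \<comment> \<open>A triple becomes a list of three words; the integer, coded as a natural number,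
    is the length of the second.\<close>
  define e where "e = (\<lambda>(w, i, S). f [w, replicate (c i) (undefined, {}), [(undefined :: 'm, S :: 'g set)]])"
  have "inj e"
  proof (rule injI)
    fix x y :: "('m \<times> 'g set) list \<times> int \<times> 'g set" assume "e x = e y"
    moreover obtain w i S where x: "x = (w, i, S)" by (cases x)
    moreover obtain w' i' S' where y: "y = (w', i', S')" by (cases y)
    ultimately have "[w, replicate (c i) (undefined, {}), [(undefined, S)]] =
        [w', replicate (c i') (undefined, {}), [(undefined, S')]]"
      using f unfolding e_def by (auto dest: injD)
    then have "w = w'" "replicate (c i) (undefined :: 'm, {} :: 'g set) = replicate (c i') (undefined, {})" "S = S'"
      by auto
    moreover from this(2) have "c i = c i'"
      by (metis length_replicate)
    ultimately show "x = y"
      using c x y by (simp add: inj_eq)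
  qed
  then have "inj (\<lambda>l. f (map e l))"
    using inj_compose[OF f list.inj_map] by (simp add: o_def)
  then show ?thesis by blast
qed

lemma res_injection':
  "\<exists>f :: ('m \<times> int \<times> 'g set) list \<Rightarrow> ('m \<times> 'g set) list. inj f"
proof -
  obtain f :: "(('m \<times> 'g set) list \<times> int \<times> 'g set) list \<Rightarrow> ('m \<times> 'g set) list" where f: "inj f"
    using res_injection by blast
  define e where "e = (\<lambda>(m, i, S). ([(m :: 'm, {} :: 'g set)], i :: int, S :: 'g set))"
  have "inj e"
    by (auto simp: inj_def e_def)
  then have "inj (\<lambda>l. f (map e l))"
    using inj_compose[OF f list.inj_map] by (simp add: o_def)
  then show ?thesis by blast
qed

section \<open>Codes for elements of covers, and the construction of the resolution\<close>

context ample_groupoid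
begin

lemma ring_element_list:
  assumes "\<xi> \<in> groupoid_ring \<Gamma>"
  shows "\<exists>l :: (int \<times> 'a set) list. \<forall>g. \<xi> g = sum_list (map (\<lambda>(n, V). n * of_bool (g \<in> V)) l)"
  using assms
proof (induction rule: int_functions_induct)
  case zero
  then show ?case by (intro exI[of _ "[]"]) simp
next
  case (add f g)
  then obtain l k where "\<forall>x. f x = sum_list (map (\<lambda>(n, V). n * of_bool (x \<in> V)) l)"
    "\<forall>x. g x = sum_list (map (\<lambda>(n, V). n * of_bool (x \<in> V)) k)" by (elim exE)
  then show ?case by (intro exI[of _ "l @ k"]) simp
next
  case (uminus f)
  then obtain l where l: "\<forall>x. f x = sum_list (map (\<lambda>(n, V). n * of_bool (x \<in> V)) l)" by (elim exE)
  have "- sum_list (map (\<lambda>(n, V). n * of_bool (x \<in> V)) l) =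
      sum_list (map (\<lambda>(n, V). n * of_bool (x \<in> V)) (map (\<lambda>(n, V). (- n, V)) l))" for x :: 'a and l :: "(int \<times> 'a set) list"
    by (induction l) auto
  then show ?case using l by (intro exI[of _ "map (\<lambda>(n, V). (- n, V)) l"]) simp
next
  case (ind V)
  show ?case by (intro exI[of _ "[(1, V)]"]) simp
qed

text \<open>An element of the cover is a finite sum of terms n times the indicator of V placed at m,
  hence is decoded from a list of triples (m, n, V). Choosing one code for each element is injective
  because decoding recovers the element.\<close>

lemma cover_injection:
  fixes enc :: "('m \<times> int \<times> 'a set) list \<Rightarrow> 'b"
  assumes M: "left_module \<Gamma> (M :: ('a, 'm) gmodule)" and enc: "inj enc"
  shows "\<exists>j :: ('m \<times> 'a \<Rightarrow> int) \<Rightarrow> 'b. inj_on j (carrier (cover M))"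
proof -
  define dec where "dec = (\<lambda>(l :: ('m \<times> int \<times> 'a set) list) z.
     sum_list (map (\<lambda>(k, n, V). if k = fst z then n * of_bool (snd z \<in> V) else 0) l))"
  have dec_append: "dec (l @ k) z = dec l z + dec k z" for l k z
    by (simp add: dec_def)
  have dec_map: "dec (map (Pair m) l) (k, g) =
      (if k = m then sum_list (map (\<lambda>(n, V). n * of_bool (g \<in> V)) l) else 0)" for l m k g
    unfolding dec_def by (induction l) auto
  have ex: "\<exists>l. \<phi> = dec l" if \<phi>: "\<phi> \<in> carrier (cover M)" for \<phi>
  proof -
    have "\<exists>l. \<forall>m g. dec l (m, g) = (if m \<in> S then \<phi> (m, g) else 0)" if "finite S" for S
      using that
    proof (induction S rule: finite_induct)
      case empty
      then show ?case by (intro exI[of _ "[]"]) (simp add: dec_def)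
    next
      case (insert k S)
      then obtain l where l: "\<forall>m g. dec l (m, g) = (if m \<in> S then \<phi> (m, g) else 0)" by (elim exE)
      obtain r where r: "\<forall>g. \<phi> (k, g) = sum_list (map (\<lambda>(n, V). n * of_bool (g \<in> V)) r)"
        using ring_element_list[OF coverD(3)[OF M \<phi>, of k]] by (elim exE)
      show ?case
        by (intro exI[of _ "l @ map (Pair k) r"]) (use insert(2) l r in \<open>simp add: dec_append dec_map\<close>)
    qed
    then obtain l where l: "\<forall>m g. dec l (m, g) = (if m \<in> supp \<phi> then \<phi> (m, g) else 0)"
      using coverD(1)[OF M \<phi>] by metis
    have "\<phi> z = dec l z" for z
      using l by (cases z) (auto simp: supp_def[OF M])
    then show ?thesis by blast
  qed
  define pick where "pick = (\<lambda>\<phi>. SOME l. \<phi> = dec l)"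
  have "dec (pick \<phi>) = \<phi>" if "\<phi> \<in> carrier (cover M)" for \<phi>
    using someI_ex[OF ex[OF that]] by (simp add: pick_def)
  then have "inj_on pick (carrier (cover M))"
    by (metis inj_onI)
  then have "inj_on (\<lambda>\<phi>. enc (pick \<phi>)) (carrier (cover M))"
    using enc by (auto simp: inj_on_def)
  then show ?thesis by blast
qed

lemma projective_onto:
  fixes enc :: "('m \<times> int \<times> 'a set) list \<Rightarrow> 'b"
  assumes M: "left_module \<Gamma> (M :: ('a, 'm) gmodule)" and enc: "inj enc"
  shows "\<exists>(Y :: ('a, 'b) gmodule) d. projective_module \<Gamma> Y \<and> gmodule_hom \<Gamma> Y M d \<and> d ` carrier Y = carrier M"
proof -
  obtain j :: "('m \<times> 'a \<Rightarrow> int) \<Rightarrow> 'b" where j: "inj_on j (carrier (cover M))"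
    using cover_injection[OF M enc] by blast
  note E = image_structure_module[OF cover_module[OF M] j]
  let ?Y = "image_structure j (cover M)" and ?i = "inv_into (carrier (cover M)) j"
  have "(\<lambda>x. cover_map M (?i x)) ` carrier ?Y = cover_map M ` carrier (cover M)"
    using inv_into_f_f[OF j] by (force simp: image_structure_def Let_def image_iff)
  then have "(\<lambda>x. cover_map M (?i x)) ` carrier ?Y = carrier M"
    using cover_map_surj[OF M] by simp
  then show ?thesis
    using projective_image_cover[OF M j] gmodule_hom_comp[OF E(3) cover_map_hom[OF M]] by blast
qed

lemma projective_resolution_exists:
  assumes M: "left_module \<Gamma> (M :: ('a, 'm) gmodule)"
  shows "\<exists>P :: ('a, ('a, 'm) res, 'm) gcomplex. is_resolution \<Gamma> M P \<and> (\<forall>n. projective_module \<Gamma> (term_at P n))"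
proof -
  obtain e0 :: "('m \<times> int \<times> 'a set) list \<Rightarrow> ('a, 'm) res" where e0: "inj e0"
    using res_injection' by blast
  obtain e1 :: "(('a, 'm) res \<times> int \<times> 'a set) list \<Rightarrow> ('a, 'm) res" where e1: "inj e1"
    using res_injection by blast
  obtain X0 :: "('a, ('a, 'm) res) gmodule" and a where X0: "projective_module \<Gamma> X0" "gmodule_hom \<Gamma> X0 M a" "a ` carrier X0 = carrier M"
    using projective_onto[OF M e0] by blast
  \<comment> \<open>The next term maps onto the kernel of the last differential and is coded by e1
    on the same type again.\<close>
  have step: "\<exists>(Y :: ('a, ('a, 'm) res) gmodule) d. projective_module \<Gamma> Y \<and> gmodule_hom \<Gamma> Y X d \<and> d ` carrier Y = kernel X Z f"
    if X: "projective_module \<Gamma> X" and Z: "left_module \<Gamma> Z" and f: "gmodule_hom \<Gamma> X Z f"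
    for X :: "('a, ('a, 'm) res) gmodule" and Z :: "('a, 'z) gmodule" and f
  proof -
    let ?K = "X\<lparr>carrier := kernel X Z f\<rparr>"
    have K: "left_module \<Gamma> ?K"
      by (rule kernel_module[OF projective_left_module[OF X] Z f])
    obtain Y :: "('a, ('a, 'm) res) gmodule" and d where Y: "projective_module \<Gamma> Y" "gmodule_hom \<Gamma> Y ?K d" "d ` carrier Y = carrier ?K"
      using projective_onto[OF K e1] by blast
    have "gmodule_hom \<Gamma> Y X (\<lambda>x. d x)"
      by (rule gmodule_hom_comp[OF Y(2) gmodule_hom_inclusion]) (auto simp: kernel_def)
    then show ?thesis
      using Y by auto
  qed
  \<comment> \<open>A state of the recursion is (target, source, differential). The relation B makes
    the old source the new target and the old kernel the image of the new differential; the clause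
    for n = 0 ties the first differential to the augmentation.\<close>
  define A where "A = (\<lambda>n::nat. \<lambda>s :: ('a, ('a, 'm) res) gmodule \<times> ('a, ('a, 'm) res) gmodule \<times> (('a, 'm) res \<Rightarrow> ('a, 'm) res).
     projective_module \<Gamma> (fst s) \<and> projective_module \<Gamma> (fst (snd s)) \<and> gmodule_hom \<Gamma> (fst (snd s)) (fst s) (snd (snd s)) \<and>
     (n = 0 \<longrightarrow> fst s = X0 \<and> snd (snd s) ` carrier (fst (snd s)) = kernel X0 M a))"
  define B where "B = (\<lambda>n::nat. \<lambda>(s :: ('a, ('a, 'm) res) gmodule \<times> ('a, ('a, 'm) res) gmodule \<times> (('a, 'm) res \<Rightarrow> ('a, 'm) res))
      (t :: ('a, ('a, 'm) res) gmodule \<times> ('a, ('a, 'm) res) gmodule \<times> (('a, 'm) res \<Rightarrow> ('a, 'm) res)).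
     fst t = fst (snd s) \<and> snd (snd t) ` carrier (fst (snd t)) = kernel (fst (snd s)) (fst s) (snd (snd s)))"
  obtain S where S: "\<And>n. A n (S n)" "\<And>n. B n (S n) (S (Suc n))"
  proof -
    have "\<exists>S. \<forall>n. A n (S n) \<and> B n (S n) (S (Suc n))"
    proof (rule dependent_nat_choice)
      obtain Y :: "('a, ('a, 'm) res) gmodule" and d where "projective_module \<Gamma> Y" "gmodule_hom \<Gamma> Y X0 d" "d ` carrier Y = kernel X0 M a"
        using step[OF X0(1) M X0(2)] by (elim exE conjE)
      then show "\<exists>s. A 0 s"
        using X0(1) by (intro exI[of _ "(X0, Y, d)"]) (simp add: A_def)
      fix s n assume s: "A n s"
      then have s': "projective_module \<Gamma> (fst (snd s))" "left_module \<Gamma> (fst s)" "gmodule_hom \<Gamma> (fst (snd s)) (fst s) (snd (snd s))"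
        by (simp_all add: A_def projective_left_module)
      obtain Y :: "('a, ('a, 'm) res) gmodule" and d where "projective_module \<Gamma> Y" "gmodule_hom \<Gamma> Y (fst (snd s)) d"
        "d ` carrier Y = kernel (fst (snd s)) (fst s) (snd (snd s))"
        using step[OF s'] by (elim exE conjE)
      then show "\<exists>t. A (Suc n) t \<and> B n s t"
        using s by (intro exI[of _ "(fst (snd s), Y, d)"]) (simp add: A_def B_def)
    qed
    then show thesis using that by blast
  qed
  define P where "P = \<lparr>term_at = (\<lambda>n. fst (S n)), bdry = (\<lambda>n. snd (snd (S n))), aug = a\<rparr>"
  have next_term: "fst (S (Suc n)) = fst (snd (S n))" for n
    using S(2)[of n] by (simp add: B_def)
  have 0: "fst (S 0) = X0" "snd (snd (S 0)) ` carrier (fst (snd (S 0))) = kernel X0 M a"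
    using S(1)[of 0] by (simp_all add: A_def)
  have "is_resolution \<Gamma> M P"
    unfolding is_resolution_def
  proof (intro conjI allI)
    show "left_module \<Gamma> (term_at P n)" for n
      using S(1)[of n] by (simp add: P_def A_def projective_left_module)
    show "gmodule_hom \<Gamma> (term_at P (Suc n)) (term_at P n) (bdry P n)" for n
      using S(1)[of n] by (simp add: P_def A_def next_term)
    show "kernel (term_at P (Suc n)) (term_at P n) (bdry P n) = bdry P (Suc n) ` carrier (term_at P (Suc (Suc n)))" for n
      using S(2)[of n] by (simp add: P_def B_def next_term)
    show "kernel (term_at P 0) M (aug P) = bdry P 0 ` carrier (term_at P 1)"
      using 0 by (simp add: P_def next_term)
  qed (use X0 0 in \<open>simp_all add: P_def\<close>)
  moreover have "projective_module \<Gamma> (term_at P n)" for n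
    using S(1)[of n] by (simp add: P_def A_def)
  ultimately show ?thesis by blast
qed

lemma projective_resolution:
  assumes "left_module \<Gamma> M"
  shows "is_resolution \<Gamma> M (projective_resolution \<Gamma> M)" "projective_module \<Gamma> (term_at (projective_resolution \<Gamma> M) n)"
  using someI_ex[OF projective_resolution_exists[OF assms]] unfolding projective_resolution_def by blast+

section \<open>Chain maps and homotopies\<close>

text \<open>Lifting against the surjection of A onto its image; exactness enters the constructions
  of lifts and homotopies in this way.\<close>

lemma projective_factor:
  assumes P: "projective_module \<Gamma> P" and A: "left_module \<Gamma> A" and B: "left_module \<Gamma> B" and d: "gmodule_hom \<Gamma> A B d"
    and h: "gmodule_hom \<Gamma> P B h" and im: "\<And>x. x \<in> carrier P \<Longrightarrow> h x \<in> d ` carrier A"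
  shows "\<exists>k. gmodule_hom \<Gamma> P A k \<and> (\<forall>x \<in> carrier P. d (k x) = h x)"
proof -
  have "gmodule_hom \<Gamma> P (B\<lparr>carrier := d ` carrier A\<rparr>) h"
    by (rule gmodule_hom_restrict[OF h]) (use im in auto)
  then show ?thesis
    by (intro projective_lift[OF P A image_module[OF A B d] gmodule_hom_restrict[OF d]]) auto
qed

lemma resolutionD:
  assumes "is_resolution \<Gamma> M P"
  shows "left_module \<Gamma> (term_at P n)" "gmodule_hom \<Gamma> (term_at P (Suc n)) (term_at P n) (bdry P n)"
    "gmodule_hom \<Gamma> (term_at P 0) M (aug P)" "aug P ` carrier (term_at P 0) = carrier M"
    "\<lbrakk>x \<in> carrier (term_at P 0); aug P x = \<one>\<^bsub>M\<^esub>\<rbrakk> \<Longrightarrow> x \<in> bdry P 0 ` carrier (term_at P (Suc 0))"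
    "\<lbrakk>x \<in> carrier (term_at P (Suc n)); bdry P n x = \<one>\<^bsub>term_at P n\<^esub>\<rbrakk> \<Longrightarrow> x \<in> bdry P (Suc n) ` carrier (term_at P (Suc (Suc n)))"
    "x \<in> carrier (term_at P (Suc 0)) \<Longrightarrow> aug P (bdry P 0 x) = \<one>\<^bsub>M\<^esub>"
    "x \<in> carrier (term_at P (Suc (Suc n))) \<Longrightarrow> bdry P n (bdry P (Suc n) x) = \<one>\<^bsub>term_at P n\<^esub>"
proof -
  note R = assms[unfolded is_resolution_def]
  show "left_module \<Gamma> (term_at P n)" "gmodule_hom \<Gamma> (term_at P (Suc n)) (term_at P n) (bdry P n)"
    "gmodule_hom \<Gamma> (term_at P 0) M (aug P)" "aug P ` carrier (term_at P 0) = carrier M"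
    using R by auto
  have k0: "kernel (term_at P 0) M (aug P) = bdry P 0 ` carrier (term_at P (Suc 0))"
    and k: "kernel (term_at P (Suc n)) (term_at P n) (bdry P n) = bdry P (Suc n) ` carrier (term_at P (Suc (Suc n)))"
    using R by auto
  show "\<lbrakk>x \<in> carrier (term_at P 0); aug P x = \<one>\<^bsub>M\<^esub>\<rbrakk> \<Longrightarrow> x \<in> bdry P 0 ` carrier (term_at P (Suc 0))"
    "x \<in> carrier (term_at P (Suc 0)) \<Longrightarrow> aug P (bdry P 0 x) = \<one>\<^bsub>M\<^esub>"
    using k0 by (auto simp: kernel_def)
  show "\<lbrakk>x \<in> carrier (term_at P (Suc n)); bdry P n x = \<one>\<^bsub>term_at P n\<^esub>\<rbrakk> \<Longrightarrow> x \<in> bdry P (Suc n) ` carrier (term_at P (Suc (Suc n)))"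
    "x \<in> carrier (term_at P (Suc (Suc n))) \<Longrightarrow> bdry P n (bdry P (Suc n) x) = \<one>\<^bsub>term_at P n\<^esub>"
    using k by (auto simp: kernel_def)
qed

lemma chain_liftD:
  assumes "chain_lift \<Gamma> P Q f \<phi>"
  shows "gmodule_hom \<Gamma> (term_at P n) (term_at Q n) (\<phi> n)"
    "x \<in> carrier (term_at P (Suc n)) \<Longrightarrow> \<phi> n (bdry P n x) = bdry Q n (\<phi> (Suc n) x)"
    "x \<in> carrier (term_at P 0) \<Longrightarrow> aug Q (\<phi> 0 x) = f (aug P x)"
  using assms by (auto simp: chain_lift_def)

lemma chain_lift_exists:
  assumes P: "is_resolution \<Gamma> M P" "\<And>n. projective_module \<Gamma> (term_at P n)" and Q: "is_resolution \<Gamma> N Q"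
    and M: "left_module \<Gamma> M" and N: "left_module \<Gamma> N" and f: "gmodule_hom \<Gamma> M N f"
  shows "\<exists>\<phi>. chain_lift \<Gamma> P Q f \<phi>"
proof -
  note p = resolutionD[OF P(1)] and q = resolutionD[OF Q]
  \<comment> \<open>The second clause is what the choice of the next component requires: the
    composite of the differential with \<phi> must land in the image of the differential of
    Q.\<close>
  define A where "A = (\<lambda>n \<phi>. gmodule_hom \<Gamma> (term_at P n) (term_at Q n) \<phi> \<and>
     (\<forall>x \<in> carrier (term_at P (Suc n)). \<phi> (bdry P n x) \<in> bdry Q n ` carrier (term_at Q (Suc n))) \<and>
     (n = 0 \<longrightarrow> (\<forall>x \<in> carrier (term_at P 0). aug Q (\<phi> x) = f (aug P x))))"
  define B where "B = (\<lambda>n \<phi> \<psi>. \<forall>x \<in> carrier (term_at P (Suc n)). \<phi> (bdry P n x) = bdry Q n (\<psi> x))"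
  have "\<exists>\<phi>. \<forall>n. A n (\<phi> n) \<and> B n (\<phi> n) (\<phi> (Suc n))"
  proof (rule dependent_nat_choice)
    obtain \<phi> where \<phi>: "gmodule_hom \<Gamma> (term_at P 0) (term_at Q 0) \<phi>" "\<forall>x \<in> carrier (term_at P 0). aug Q (\<phi> x) = f (aug P x)"
      using projective_lift[OF P(2) q(1) N q(3,4) gmodule_hom_comp[OF p(3) f]] by (elim exE conjE)
    have "\<phi> (bdry P 0 x) \<in> bdry Q 0 ` carrier (term_at Q (Suc 0))" if x: "x \<in> carrier (term_at P (Suc 0))" for x
    proof (rule q(5))
      have d: "bdry P 0 x \<in> carrier (term_at P 0)"
        using gmodule_hom_closed[OF p(2) x] .
      then show "\<phi> (bdry P 0 x) \<in> carrier (term_at Q 0)"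
        by (rule gmodule_hom_closed[OF \<phi>(1)])
      show "aug Q (\<phi> (bdry P 0 x)) = \<one>\<^bsub>N\<^esub>"
        using \<phi>(2) d p(7)[OF x] gmodule_hom_one[OF f M N] by simp
    qed
    then show "\<exists>\<phi>. A 0 \<phi>"
      using \<phi> by (intro exI[of _ \<phi>]) (simp add: A_def)
    fix \<phi> n assume "A n \<phi>"
    then have \<phi>: "gmodule_hom \<Gamma> (term_at P n) (term_at Q n) \<phi>"
      "\<And>x. x \<in> carrier (term_at P (Suc n)) \<Longrightarrow> \<phi> (bdry P n x) \<in> bdry Q n ` carrier (term_at Q (Suc n))"
      by (simp_all add: A_def)
    have "\<exists>\<psi>. gmodule_hom \<Gamma> (term_at P (Suc n)) (term_at Q (Suc n)) \<psi> \<and>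
        (\<forall>x \<in> carrier (term_at P (Suc n)). bdry Q n (\<psi> x) = \<phi> (bdry P n x))"
      by (rule projective_factor[OF P(2) q(1) q(1) q(2) gmodule_hom_comp[OF p(2) \<phi>(1)] \<phi>(2)])
    then obtain \<psi> where \<psi>: "gmodule_hom \<Gamma> (term_at P (Suc n)) (term_at Q (Suc n)) \<psi>"
      "\<forall>x \<in> carrier (term_at P (Suc n)). bdry Q n (\<psi> x) = \<phi> (bdry P n x)"
      by (elim exE conjE)
    have "\<psi> (bdry P (Suc n) x) \<in> bdry Q (Suc n) ` carrier (term_at Q (Suc (Suc n)))" if x: "x \<in> carrier (term_at P (Suc (Suc n)))" for x
    proof (rule q(6))
      have d: "bdry P (Suc n) x \<in> carrier (term_at P (Suc n))"
        using gmodule_hom_closed[OF p(2) x] .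
      then show "\<psi> (bdry P (Suc n) x) \<in> carrier (term_at Q (Suc n))"
        by (rule gmodule_hom_closed[OF \<psi>(1)])
      show "bdry Q n (\<psi> (bdry P (Suc n) x)) = \<one>\<^bsub>term_at Q n\<^esub>"
        using \<psi>(2) d p(8)[OF x] gmodule_hom_one[OF \<phi>(1) p(1) q(1)] by simp
    qed
    then show "\<exists>\<psi>. A (Suc n) \<psi> \<and> B n \<phi> \<psi>"
      using \<psi> by (intro exI[of _ \<psi>]) (simp add: A_def B_def)
  qed
  then obtain \<phi> where "\<forall>n. A n (\<phi> n) \<and> B n (\<phi> n) (\<phi> (Suc n))"
    by (elim exE)
  then show ?thesis
    by (intro exI[of _ \<phi>]) (simp add: chain_lift_def A_def B_def)
qed

text \<open>In additive notation, once s is known in degree n, the difference of \<theta> and s d in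
  degree n + 1 is a cycle, hence a boundary by exactness of Q; projectivity of P turns this into the
  next component of s.\<close>

lemma homotopy_exists:
  assumes P: "is_resolution \<Gamma> M P" "\<And>n. projective_module \<Gamma> (term_at P n)" and Q: "is_resolution \<Gamma> N Q"
    and \<theta>: "\<And>n. gmodule_hom \<Gamma> (term_at P n) (term_at Q n) (\<theta> n)"
    and chain: "\<And>n x. x \<in> carrier (term_at P (Suc n)) \<Longrightarrow> \<theta> n (bdry P n x) = bdry Q n (\<theta> (Suc n) x)"
    and aug: "\<And>x. x \<in> carrier (term_at P 0) \<Longrightarrow> aug Q (\<theta> 0 x) = \<one>\<^bsub>N\<^esub>"
  obtains s where "\<And>n. gmodule_hom \<Gamma> (term_at P n) (term_at Q (Suc n)) (s n)"
    "\<And>x. x \<in> carrier (term_at P 0) \<Longrightarrow> \<theta> 0 x = bdry Q 0 (s 0 x)"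
    "\<And>n x. x \<in> carrier (term_at P (Suc n)) \<Longrightarrow>
       \<theta> (Suc n) x = bdry Q (Suc n) (s (Suc n) x) \<otimes>\<^bsub>term_at Q (Suc n)\<^esub> s n (bdry P n x)"
proof -
  note p = resolutionD[OF P(1)] and q = resolutionD[OF Q]
  \<comment> \<open>The clause d s d = \<theta> d makes the next difference a cycle; it is the
    homotopy identity restricted to boundaries, where the earlier term s d vanishes.\<close>
  define A where "A = (\<lambda>n s. gmodule_hom \<Gamma> (term_at P n) (term_at Q (Suc n)) s \<and>
     (\<forall>x \<in> carrier (term_at P (Suc n)). bdry Q n (s (bdry P n x)) = \<theta> n (bdry P n x)) \<and>
     (n = 0 \<longrightarrow> (\<forall>x \<in> carrier (term_at P 0). \<theta> 0 x = bdry Q 0 (s x))))"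
  define B where "B = (\<lambda>n s t. \<forall>x \<in> carrier (term_at P (Suc n)).
     \<theta> (Suc n) x = bdry Q (Suc n) (t x) \<otimes>\<^bsub>term_at Q (Suc n)\<^esub> s (bdry P n x))"
  have "\<exists>s. \<forall>n. A n (s n) \<and> B n (s n) (s (Suc n))"
  proof (rule dependent_nat_choice)
    have "\<theta> 0 x \<in> bdry Q 0 ` carrier (term_at Q (Suc 0))" if "x \<in> carrier (term_at P 0)" for x
      using that by (intro q(5) gmodule_hom_closed[OF \<theta>] aug)
    then obtain s where s: "gmodule_hom \<Gamma> (term_at P 0) (term_at Q (Suc 0)) s" "\<forall>x \<in> carrier (term_at P 0). bdry Q 0 (s x) = \<theta> 0 x"
      using projective_factor[OF P(2) q(1) q(1) q(2) \<theta>] by metis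
    then show "\<exists>s. A 0 s"
      using gmodule_hom_closed[OF p(2)] by (intro exI[of _ s]) (simp add: A_def)
    fix s n assume "A n s"
    then have s: "gmodule_hom \<Gamma> (term_at P n) (term_at Q (Suc n)) s"
      "\<And>x. x \<in> carrier (term_at P (Suc n)) \<Longrightarrow> bdry Q n (s (bdry P n x)) = \<theta> n (bdry P n x)"
      by (simp_all add: A_def)
    interpret Qn: left_module \<Gamma> "term_at Q (Suc n)" by (rule q(1))
    interpret Qp: left_module \<Gamma> "term_at Q n" by (rule q(1))
    let ?h = "\<lambda>x. \<theta> (Suc n) x \<otimes>\<^bsub>term_at Q (Suc n)\<^esub> inv\<^bsub>term_at Q (Suc n)\<^esub> s (bdry P n x)"
    have sd: "gmodule_hom \<Gamma> (term_at P (Suc n)) (term_at Q (Suc n)) (\<lambda>x. s (bdry P n x))"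
      by (rule gmodule_hom_comp[OF p(2) s(1)])
    have h: "gmodule_hom \<Gamma> (term_at P (Suc n)) (term_at Q (Suc n)) ?h"
      by (rule gmodule_hom_times[OF q(1) \<theta> gmodule_hom_inverse[OF q(1) sd]])
    have "?h x \<in> bdry Q (Suc n) ` carrier (term_at Q (Suc (Suc n)))" if x: "x \<in> carrier (term_at P (Suc n))" for x
    proof (rule q(6))
      show "?h x \<in> carrier (term_at Q (Suc n))"
        by (rule gmodule_hom_closed[OF h x])
      have "bdry Q n (?h x) = bdry Q n (\<theta> (Suc n) x) \<otimes>\<^bsub>term_at Q n\<^esub> inv\<^bsub>term_at Q n\<^esub> bdry Q n (s (bdry P n x))"
        using gmodule_hom_closed[OF \<theta> x] gmodule_hom_closed[OF sd x]
        by (simp add: gmodule_hom_mult[OF q(2)] gmodule_hom_inv[OF q(2) q(1) q(1)])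
      also have "\<dots> = \<one>\<^bsub>term_at Q n\<^esub>"
        using gmodule_hom_closed[OF q(2) gmodule_hom_closed[OF \<theta> x]] by (simp add: s(2)[OF x] chain[OF x])
      finally show "bdry Q n (?h x) = \<one>\<^bsub>term_at Q n\<^esub>" .
    qed
    then have "\<exists>t. gmodule_hom \<Gamma> (term_at P (Suc n)) (term_at Q (Suc (Suc n))) t \<and>
        (\<forall>x \<in> carrier (term_at P (Suc n)). bdry Q (Suc n) (t x) = ?h x)"
      by (rule projective_factor[OF P(2) q(1) q(1) q(2) h])
    then obtain t where t: "gmodule_hom \<Gamma> (term_at P (Suc n)) (term_at Q (Suc (Suc n))) t"
      "\<forall>x \<in> carrier (term_at P (Suc n)). bdry Q (Suc n) (t x) = ?h x"
      by (elim exE conjE)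
    have "bdry Q (Suc n) (t (bdry P (Suc n) x)) = \<theta> (Suc n) (bdry P (Suc n) x)" if x: "x \<in> carrier (term_at P (Suc (Suc n)))" for x
    proof -
      have d: "bdry P (Suc n) x \<in> carrier (term_at P (Suc n))"
        using gmodule_hom_closed[OF p(2) x] .
      then show ?thesis
        using t(2) p(8)[OF x] gmodule_hom_one[OF s(1) p(1) q(1)] gmodule_hom_closed[OF \<theta> d] by simp
    qed
    moreover have "\<theta> (Suc n) x = bdry Q (Suc n) (t x) \<otimes>\<^bsub>term_at Q (Suc n)\<^esub> s (bdry P n x)" if x: "x \<in> carrier (term_at P (Suc n))" for x
      using t(2) x gmodule_hom_closed[OF \<theta> x] gmodule_hom_closed[OF sd x] by (simp add: Qn.m_assoc)
    ultimately show "\<exists>t. A (Suc n) t \<and> B n s t"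
      using t by (intro exI[of _ t]) (simp add: A_def B_def)
  qed
  then obtain s where s: "\<forall>n. A n (s n) \<and> B n (s n) (s (Suc n))"
    by (elim exE)
  show thesis
    by (rule that[of s]) (use s in \<open>simp_all add: A_def B_def\<close>)
qed

end

section \<open>Acyclic modules\<close>

context ample_groupoid
begin

abbreviation T :: "('a, 'm) gmodule \<Rightarrow> (('a \<Rightarrow> int) \<times> 'm \<Rightarrow>\<^sub>0 int) set monoid" where
  "T \<equiv> coinvariants \<Gamma>"
abbreviation cm :: "('a, 'n) gmodule \<Rightarrow> ('m \<Rightarrow> 'n) \<Rightarrow>
    (('a \<Rightarrow> int) \<times> 'm \<Rightarrow>\<^sub>0 int) set \<Rightarrow> (('a \<Rightarrow> int) \<times> 'n \<Rightarrow>\<^sub>0 int) set" where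
  "cm \<equiv> coinvariants_map \<Gamma>"

lemmas cm_comm_group = tensor_comm_group[OF right_acted_unit_module, folded coinvariants_def]
lemmas cm_hom = tensor_map_hom[OF right_acted_unit_module, folded coinvariants_def coinvariants_map_eq]
lemmas cm_closed = tensor_map_closed[OF right_acted_unit_module, folded coinvariants_def coinvariants_map_eq]
lemmas cm_mult = tensor_map_mult[OF right_acted_unit_module, folded coinvariants_def coinvariants_map_eq]
lemmas cm_one = tensor_map_one[OF right_acted_unit_module, folded coinvariants_def coinvariants_map_eq]
lemmas cm_inv = tensor_map_inv[OF right_acted_unit_module, folded coinvariants_def coinvariants_map_eq]
lemmas cm_cong = tensor_map_cong[OF right_acted_unit_module, folded coinvariants_def coinvariants_map_eq]
lemmas cm_trivial = tensor_map_trivial[OF right_acted_unit_module, folded coinvariants_def coinvariants_map_eq]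
lemmas cm_surj = tensor_map_surj[OF right_acted_unit_module, folded coinvariants_def coinvariants_map_eq]
lemmas cm_id = tensor_map_id[OF right_acted_unit_module, folded coinvariants_def coinvariants_map_eq]
lemmas cm_comp = tensor_map_comp[OF right_acted_unit_module, folded coinvariants_def coinvariants_map_eq]
lemmas cm_times = tensor_map_times[OF right_acted_unit_module, folded coinvariants_def coinvariants_map_eq]
lemmas cm_inverse = tensor_map_inverse[OF right_acted_unit_module, folded coinvariants_def coinvariants_map_eq]
lemmas cm_right_exact = tensor_right_exact[OF right_acted_unit_module, folded coinvariants_def coinvariants_map_eq]

lemma cm_comp_one:
  assumes "left_module \<Gamma> M" "left_module \<Gamma> N" "left_module \<Gamma> L" "gmodule_hom \<Gamma> M N f" "gmodule_hom \<Gamma> N L g"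
    and "\<And>x. x \<in> carrier M \<Longrightarrow> g (f x) = \<one>\<^bsub>L\<^esub>" "X \<in> carrier (T M)"
  shows "cm L g (cm N f X) = \<one>\<^bsub>T L\<^esub>"
  using cm_comp[OF assms(1-5) _ assms(7), of "\<lambda>x. \<one>\<^bsub>L\<^esub>"] assms(6)
    cm_trivial[OF assms(1,3) gmodule_hom_trivial[OF assms(3)] refl assms(7)] by simp

lemma cm_square:
  assumes M: "left_module \<Gamma> M" and N: "left_module \<Gamma> N" and N': "left_module \<Gamma> N'" and L: "left_module \<Gamma> L"
    and f: "gmodule_hom \<Gamma> M N f" and g: "gmodule_hom \<Gamma> N L g" and f': "gmodule_hom \<Gamma> M N' f'" and g': "gmodule_hom \<Gamma> N' L g'"
    and eq: "\<And>x. x \<in> carrier M \<Longrightarrow> g (f x) = g' (f' x)" and X: "X \<in> carrier (T M)"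
  shows "cm L g (cm N f X) = cm L g' (cm N' f' X)"
  using cm_comp[OF M N L f g refl X] cm_comp[OF M N' L f' g' _ X, of "\<lambda>x. g (f x)"] eq by simp

text \<open>The index starts at degree 1: in degree 0 the homology of a resolution is the group of
  coinvariants of the augmented module, which is nonzero in general.\<close>

definition coinv_exact :: "('a, 'p, 'm) gcomplex \<Rightarrow> bool" where
  "coinv_exact P \<longleftrightarrow> (\<forall>n. \<forall>z \<in> carrier (T (term_at P (Suc n))). cm (term_at P n) (bdry P n) z = \<one>\<^bsub>T (term_at P n)\<^esub> \<longrightarrow>
     z \<in> cm (term_at P (Suc n)) (bdry P (Suc n)) ` carrier (T (term_at P (Suc (Suc n)))))"

lemma coinv_exactD:
  "\<lbrakk>coinv_exact P; z \<in> carrier (T (term_at P (Suc n))); cm (term_at P n) (bdry P n) z = \<one>\<^bsub>T (term_at P n)\<^esub>\<rbrakk> \<Longrightarrow>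
   z \<in> cm (term_at P (Suc n)) (bdry P (Suc n)) ` carrier (T (term_at P (Suc (Suc n))))"
  unfolding coinv_exact_def by blast

lemma resolution_coinv_complex:
  assumes "is_resolution \<Gamma> M P" "z \<in> carrier (T (term_at P (Suc (Suc n))))"
  shows "cm (term_at P n) (bdry P n) (cm (term_at P (Suc n)) (bdry P (Suc n)) z) = \<one>\<^bsub>T (term_at P n)\<^esub>"
  by (rule cm_comp_one[OF resolutionD(1)[OF assms(1)] resolutionD(1)[OF assms(1)] resolutionD(1)[OF assms(1)]
      resolutionD(2)[OF assms(1)] resolutionD(2)[OF assms(1)] resolutionD(8)[OF assms(1)] assms(2)])

text \<open>Two lifts of the same map are homotopic, so they differ by boundaries on cycles.\<close>

lemma lifts_agree_on_cycles:
  assumes P: "is_resolution \<Gamma> M P" "\<And>n. projective_module \<Gamma> (term_at P n)" and Q: "is_resolution \<Gamma> N Q"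
    and N: "left_module \<Gamma> N" and \<phi>: "chain_lift \<Gamma> P Q f \<phi>" and \<psi>: "chain_lift \<Gamma> P Q f \<psi>" and f: "gmodule_hom \<Gamma> M N f"
    and z: "z \<in> carrier (T (term_at P n))"
    and cyc: "\<And>k. n = Suc k \<Longrightarrow> cm (term_at P k) (bdry P k) z = \<one>\<^bsub>T (term_at P k)\<^esub>"
  obtains y where "y \<in> carrier (T (term_at Q (Suc n)))"
    "cm (term_at Q n) (\<phi> n) z = cm (term_at Q n) (\<psi> n) z \<otimes>\<^bsub>T (term_at Q n)\<^esub> cm (term_at Q n) (bdry Q n) y"
proof -
  note p = resolutionD[OF P(1)] and q = resolutionD[OF Q]
  note \<phi>' = chain_liftD[OF \<phi>] and \<psi>' = chain_liftD[OF \<psi>]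
  define \<theta> where "\<theta> = (\<lambda>n x. \<phi> n x \<otimes>\<^bsub>term_at Q n\<^esub> inv\<^bsub>term_at Q n\<^esub> \<psi> n x)"
  have \<theta>h: "gmodule_hom \<Gamma> (term_at P n) (term_at Q n) (\<theta> n)" for n
    unfolding \<theta>_def by (rule gmodule_hom_times[OF q(1) \<phi>'(1) gmodule_hom_inverse[OF q(1) \<psi>'(1)]])
  have \<theta>c: "\<theta> n (bdry P n x) = bdry Q n (\<theta> (Suc n) x)" if x: "x \<in> carrier (term_at P (Suc n))" for n x
  proof -
    interpret Q: left_module \<Gamma> "term_at Q (Suc n)" by (rule q(1))
    show ?thesis
      using gmodule_hom_closed[OF \<phi>'(1) x] gmodule_hom_closed[OF \<psi>'(1) x] x
      by (simp add: \<theta>_def \<phi>'(2) \<psi>'(2) gmodule_hom_mult[OF q(2)] gmodule_hom_inv[OF q(2) q(1) q(1)])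
  qed
  have \<theta>a: "aug Q (\<theta> 0 x) = \<one>\<^bsub>N\<^esub>" if x: "x \<in> carrier (term_at P 0)" for x
  proof -
    interpret Q: left_module \<Gamma> "term_at Q 0" by (rule q(1))
    interpret N: left_module \<Gamma> N by (rule N)
    show ?thesis
      using gmodule_hom_closed[OF \<phi>'(1) x] gmodule_hom_closed[OF \<psi>'(1) x] x gmodule_hom_closed[OF f gmodule_hom_closed[OF p(3) x]]
      by (simp add: \<theta>_def \<phi>'(3) \<psi>'(3) gmodule_hom_mult[OF q(3)] gmodule_hom_inv[OF q(3) q(1) N])
  qed
  obtain s where s: "\<And>n. gmodule_hom \<Gamma> (term_at P n) (term_at Q (Suc n)) (s n)"
    "\<And>x. x \<in> carrier (term_at P 0) \<Longrightarrow> \<theta> 0 x = bdry Q 0 (s 0 x)"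
    "\<And>n x. x \<in> carrier (term_at P (Suc n)) \<Longrightarrow>
       \<theta> (Suc n) x = bdry Q (Suc n) (s (Suc n) x) \<otimes>\<^bsub>term_at Q (Suc n)\<^esub> s n (bdry P n x)"
    by (rule homotopy_exists[OF P Q \<theta>h \<theta>c \<theta>a]) (assumption | rule that)+
  have dc: "cm (term_at Q n) (\<lambda>x. bdry Q n (s n x)) z = cm (term_at Q n) (bdry Q n) (cm (term_at Q (Suc n)) (s n) z)"
    by (rule cm_comp[OF p(1) q(1) q(1) s(1) q(2) refl z, symmetric])
  have y: "cm (term_at Q (Suc n)) (s n) z \<in> carrier (T (term_at Q (Suc n)))"
    by (rule cm_closed[OF p(1) q(1) s(1) z])
  have dh: "gmodule_hom \<Gamma> (term_at P n) (term_at Q n) (\<lambda>x. bdry Q n (s n x))"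
    by (rule gmodule_hom_comp[OF s(1) q(2)])
  interpret TQ: comm_group "T (term_at Q n)" by (rule cm_comm_group[OF q(1)])
  have dy: "cm (term_at Q n) (bdry Q n) (cm (term_at Q (Suc n)) (s n) z) \<in> carrier (T (term_at Q n))"
    by (rule cm_closed[OF q(1) q(1) q(2) y])
  have \<theta>z: "cm (term_at Q n) (\<theta> n) z = cm (term_at Q n) (bdry Q n) (cm (term_at Q (Suc n)) (s n) z)"
  proof (cases n)
    case 0
    have "cm (term_at Q n) (\<theta> n) z = cm (term_at Q n) (\<lambda>x. bdry Q n (s n x)) z"
      by (rule cm_cong[OF p(1) q(1) dh _ z]) (simp add: 0 s(2))
    then show ?thesis
      using dc by simp
  next
    case (Suc k)
    have sd: "gmodule_hom \<Gamma> (term_at P n) (term_at Q n) (\<lambda>x. s k (bdry P k x))"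
      unfolding Suc by (rule gmodule_hom_comp[OF p(2) s(1)])
    \<comment> \<open>Of the homotopy d s + s d only the first summand survives on a cycle.\<close>
    have "cm (term_at Q n) (\<theta> n) z = cm (term_at Q n) (\<lambda>x. bdry Q n (s n x)) z \<otimes>\<^bsub>T (term_at Q n)\<^esub> cm (term_at Q n) (\<lambda>x. s k (bdry P k x)) z"
      by (rule cm_times[OF p(1) q(1) dh sd _ z]) (simp add: Suc s(3))
    moreover have "cm (term_at Q n) (\<lambda>x. s k (bdry P k x)) z = cm (term_at Q n) (s k) (cm (term_at P k) (bdry P k) z)"
      using cm_comp[OF p(1) p(1) q(1) p(2) s(1) refl, of z k] z by (simp add: Suc)
    then have "cm (term_at Q n) (\<lambda>x. s k (bdry P k x)) z = \<one>\<^bsub>T (term_at Q n)\<^esub>"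
      using cyc[OF Suc] cm_one[OF p(1) q(1) s(1), of k] by (simp add: Suc)
    ultimately show ?thesis
      using dc dy by simp
  qed
  have "cm (term_at Q n) (\<phi> n) z = cm (term_at Q n) (\<psi> n) z \<otimes>\<^bsub>T (term_at Q n)\<^esub> cm (term_at Q n) (\<theta> n) z"
  proof (rule cm_times[OF p(1) q(1) \<psi>'(1) \<theta>h _ z])
    fix x assume x: "x \<in> carrier (term_at P n)"
    interpret Qn: left_module \<Gamma> "term_at Q n" by (rule q(1))
    have "\<phi> n x \<in> carrier (term_at Q n)" "\<psi> n x \<in> carrier (term_at Q n)"
      using gmodule_hom_closed[OF \<phi>'(1) x] gmodule_hom_closed[OF \<psi>'(1) x] by auto
    then show "\<phi> n x = \<psi> n x \<otimes>\<^bsub>term_at Q n\<^esub> \<theta> n x"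
      by (simp add: \<theta>_def Qn.m_ac Qn.m_lcomm[of "\<psi> n x"])
  qed
  then show thesis
    using that[OF y] \<theta>z by simp
qed

text \<open>On Q both the identity and the composite of \<phi> and \<psi> lift the identity of M, so
  a cycle z differs by a boundary from its image under the composite, while \<phi> z is a boundary
  by exactness for P. This frees \<open>acyclic_module\<close> from the resolution chosen in its
  definition.\<close>

lemma coinv_exact_transfer:
  assumes M: "left_module \<Gamma> M"
    and P: "is_resolution \<Gamma> M P" "\<And>n. projective_module \<Gamma> (term_at P n)"
    and Q: "is_resolution \<Gamma> M Q" "\<And>n. projective_module \<Gamma> (term_at Q n)"
    and ex: "coinv_exact P"
  shows "coinv_exact Q"
  unfolding coinv_exact_def
proof (intro allI ballI impI)
  note p = resolutionD[OF P(1)] and q = resolutionD[OF Q(1)]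
  obtain \<phi> where \<phi>: "chain_lift \<Gamma> Q P (\<lambda>x. x) \<phi>"
    using chain_lift_exists[OF Q P(1) M M gmodule_hom_id] by blast
  obtain \<psi> where \<psi>: "chain_lift \<Gamma> P Q (\<lambda>x. x) \<psi>"
    using chain_lift_exists[OF P Q(1) M M gmodule_hom_id] by blast
  note \<phi>' = chain_liftD[OF \<phi>] and \<psi>' = chain_liftD[OF \<psi>]
  have 1: "chain_lift \<Gamma> Q Q (\<lambda>x. x) (\<lambda>n x. x)"
    by (simp add: chain_lift_def gmodule_hom_id)
  have 2: "chain_lift \<Gamma> Q Q (\<lambda>x. x) (\<lambda>n x. \<psi> n (\<phi> n x))"
    unfolding chain_lift_def
  proof (intro conjI allI ballI)
    fix n x assume x: "x \<in> carrier (term_at Q (Suc n))"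
    show "\<psi> n (\<phi> n (bdry Q n x)) = bdry Q n (\<psi> (Suc n) (\<phi> (Suc n) x))"
      using \<psi>'(2)[OF gmodule_hom_closed[OF \<phi>'(1) x]] \<phi>'(2)[OF x] by simp
  next
    fix x assume x: "x \<in> carrier (term_at Q 0)"
    show "aug Q (\<psi> 0 (\<phi> 0 x)) = aug Q x"
      using \<psi>'(3)[OF gmodule_hom_closed[OF \<phi>'(1) x]] \<phi>'(3)[OF x] by simp
  qed (rule gmodule_hom_comp[OF \<phi>'(1) \<psi>'(1)])
  fix n z assume z: "z \<in> carrier (T (term_at Q (Suc n)))" and dz: "cm (term_at Q n) (bdry Q n) z = \<one>\<^bsub>T (term_at Q n)\<^esub>"
  let ?N = "Suc n"
  interpret TQ: comm_group "T (term_at Q ?N)" by (rule cm_comm_group[OF q(1)])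
  obtain w where w: "w \<in> carrier (T (term_at Q (Suc ?N)))"
    "cm (term_at Q ?N) (\<lambda>x. x) z = cm (term_at Q ?N) (\<lambda>x. \<psi> ?N (\<phi> ?N x)) z \<otimes>\<^bsub>T (term_at Q ?N)\<^esub> cm (term_at Q ?N) (bdry Q ?N) w"
    by (rule lifts_agree_on_cycles[OF Q Q(1) M 1 2 gmodule_hom_id z]) (use dz in simp, rule that)
  let ?v = "cm (term_at P ?N) (\<phi> ?N) z"
  have v: "?v \<in> carrier (T (term_at P ?N))"
    by (rule cm_closed[OF q(1) p(1) \<phi>'(1) z])
  have "cm (term_at P n) (bdry P n) ?v = cm (term_at P n) (\<phi> n) (cm (term_at Q n) (bdry Q n) z)"
    by (rule cm_square[OF q(1) p(1) q(1) p(1) \<phi>'(1) p(2) q(2) \<phi>'(1) _ z]) (simp add: \<phi>'(2))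
  then have "cm (term_at P n) (bdry P n) ?v = \<one>\<^bsub>T (term_at P n)\<^esub>"
    using dz cm_one[OF q(1) p(1) \<phi>'(1)] by simp
  then obtain u where u: "u \<in> carrier (T (term_at P (Suc ?N)))" "?v = cm (term_at P ?N) (bdry P ?N) u"
    using coinv_exactD[OF ex v] by blast
  have "cm (term_at Q ?N) (\<lambda>x. \<psi> ?N (\<phi> ?N x)) z = cm (term_at Q ?N) (\<psi> ?N) ?v"
    by (rule cm_comp[OF q(1) p(1) q(1) \<phi>'(1) \<psi>'(1) refl z, symmetric])
  also have "\<dots> = cm (term_at Q ?N) (bdry Q ?N) (cm (term_at Q (Suc ?N)) (\<psi> (Suc ?N)) u)"
    unfolding u(2) by (rule cm_square[OF p(1) p(1) q(1) q(1) p(2) \<psi>'(1) \<psi>'(1) q(2) _ u(1)]) (simp add: \<psi>'(2))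
  finally have "z = cm (term_at Q ?N) (bdry Q ?N) (cm (term_at Q (Suc ?N)) (\<psi> (Suc ?N)) u) \<otimes>\<^bsub>T (term_at Q ?N)\<^esub> cm (term_at Q ?N) (bdry Q ?N) w"
    using w(2) cm_id[OF q(1) z] by simp
  also have "\<dots> = cm (term_at Q ?N) (bdry Q ?N) (cm (term_at Q (Suc ?N)) (\<psi> (Suc ?N)) u \<otimes>\<^bsub>T (term_at Q (Suc ?N))\<^esub> w)"
    using cm_mult[OF q(1) q(1) q(2) cm_closed[OF p(1) q(1) \<psi>'(1) u(1)] w(1)] by simp
  finally show "z \<in> cm (term_at Q ?N) (bdry Q ?N) ` carrier (T (term_at Q (Suc ?N)))"
    using comm_group_imp_group[OF cm_comm_group[OF q(1), of "Suc ?N"]] cm_closed[OF p(1) q(1) \<psi>'(1) u(1)] w(1)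
    by (metis group.is_monoid image_eqI monoid.m_closed)
qed

subsection \<open>The horseshoe lemma\<close>

text \<open>In additive notation the differential on the sum of R and P is (d r + \<theta> q, d q),
  and the augmentation is i (aug r) + t q with t a lift of the augmentation of P through p.
  Composites vanish if d \<theta> = - \<theta> d and, at the bottom, i aug \<theta> = - t d. Such a
  \<theta> is obtained in one stroke as a chain map.\<close>

lemma horseshoe:
  assumes A: "left_module \<Gamma> A" and B: "left_module \<Gamma> B" and C: "left_module \<Gamma> C"
    and i: "gmodule_hom \<Gamma> A B i" "inj_on i (carrier A)" and p: "gmodule_hom \<Gamma> B C p" "p ` carrier B = carrier C"
    and ex: "kernel B C p = i ` carrier A"
    and R: "is_resolution \<Gamma> A R" "\<And>n. projective_module \<Gamma> (term_at R n)"
    and P: "is_resolution \<Gamma> C P" "\<And>n. projective_module \<Gamma> (term_at P n)"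
  obtains S where "is_resolution \<Gamma> B S" "\<And>n. projective_module \<Gamma> (term_at S n)"
    "\<And>n. term_at S n = prod_module (term_at R n) (term_at P n)"
    "\<And>n r. r \<in> carrier (term_at R (Suc n)) \<Longrightarrow> bdry S n (r, \<one>\<^bsub>term_at P (Suc n)\<^esub>) = (bdry R n r, \<one>\<^bsub>term_at P n\<^esub>)"
    "\<And>n z. z \<in> carrier (term_at S (Suc n)) \<Longrightarrow> snd (bdry S n z) = bdry P n (snd z)"
    "\<And>r. r \<in> carrier (term_at R 0) \<Longrightarrow> aug S (r, \<one>\<^bsub>term_at P 0\<^esub>) = i (aug R r)"
proof -
  interpret A: left_module \<Gamma> A by (rule A)
  interpret B: left_module \<Gamma> B by (rule B)
  interpret C: left_module \<Gamma> C by (rule C)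
  note rr = resolutionD[OF R(1)] and pp = resolutionD[OF P(1)]
  obtain t where t: "gmodule_hom \<Gamma> (term_at P 0) B t" "\<forall>x \<in> carrier (term_at P 0). p (t x) = aug P x"
    using projective_lift[OF P(2) B C p pp(3)] by (elim exE conjE)
  have pi: "p (i a) = \<one>\<^bsub>C\<^esub>" if "a \<in> carrier A" for a
    using ex that by (auto simp: kernel_def)
  have kp: "b \<in> i ` carrier A" if "b \<in> carrier B" "p b = \<one>\<^bsub>C\<^esub>" for b
    using ex that by (auto simp: kernel_def)
  \<comment> \<open>P1 is P shifted by one degree, a resolution of the boundaries K in degree 0. R1
    is R with negated differentials, so that a chain map from P1 to R1 anticommutes with the
    original ones.\<close>
  define K where "K = (term_at P 0)\<lparr>carrier := bdry P 0 ` carrier (term_at P (Suc 0))\<rparr>"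
  have K: "left_module \<Gamma> K"
    unfolding K_def by (rule image_module[OF pp(1) pp(1) pp(2)])
  define P1 where "P1 = \<lparr>term_at = (\<lambda>n. term_at P (Suc n)), bdry = (\<lambda>n. bdry P (Suc n)), aug = bdry P 0\<rparr>"
  have P1: "is_resolution \<Gamma> K P1"
    unfolding is_resolution_def
  proof (intro conjI allI)
    show "gmodule_hom \<Gamma> (term_at P1 0) K (aug P1)"
      unfolding P1_def K_def by (simp add: gmodule_hom_restrict[OF pp(2)])
    show "kernel (term_at P1 0) K (aug P1) = bdry P1 0 ` carrier (term_at P1 1)"
      using P(1) unfolding is_resolution_def by (simp add: P1_def K_def kernel_def)
    show "kernel (term_at P1 (Suc n)) (term_at P1 n) (bdry P1 n) = bdry P1 (Suc n) ` carrier (term_at P1 (Suc (Suc n)))" for n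
      using P(1) unfolding is_resolution_def by (simp add: P1_def)
  qed (use pp in \<open>simp_all add: P1_def K_def\<close>)
  define R1 where "R1 = \<lparr>term_at = term_at R, bdry = (\<lambda>n x. inv\<^bsub>term_at R n\<^esub> bdry R n x), aug = aug R\<rparr>"
  have R1: "is_resolution \<Gamma> A R1"
  proof -
    have im: "(\<lambda>x. inv\<^bsub>term_at R n\<^esub> bdry R n x) ` carrier (term_at R (Suc n)) = bdry R n ` carrier (term_at R (Suc n))" for n
    proof -
      interpret X: left_module \<Gamma> "term_at R (Suc n)" by (rule rr(1))
      have "inv\<^bsub>term_at R n\<^esub> bdry R n x = bdry R n (inv\<^bsub>term_at R (Suc n)\<^esub> x)" if "x \<in> carrier (term_at R (Suc n))" for x
        using gmodule_hom_inv[OF rr(2) rr(1) rr(1) that] by simp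
      then show ?thesis
        by (auto simp: image_iff) (metis X.inv_closed X.inv_inv)+
    qed
    have ke: "kernel (term_at R (Suc n)) (term_at R n) (\<lambda>x. inv\<^bsub>term_at R n\<^esub> bdry R n x) = kernel (term_at R (Suc n)) (term_at R n) (bdry R n)" for n
    proof -
      interpret X: left_module \<Gamma> "term_at R n" by (rule rr(1))
      show ?thesis
        using gmodule_hom_closed[OF rr(2), of _ n] by (auto simp: kernel_def)
    qed
    show ?thesis
      using R(1) gmodule_hom_inverse[OF rr(1) rr(2)] unfolding is_resolution_def by (simp add: R1_def im ke)
  qed
  \<comment> \<open>On K the composite of t and p vanishes, so - t factors through i; this gives the
    map from K to A that \<theta> lifts.\<close>
  define f where "f = (\<lambda>k. inv_into (carrier A) i (inv\<^bsub>B\<^esub> t k))"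
  have tk: "k \<in> carrier (term_at P 0)" "inv\<^bsub>B\<^esub> t k \<in> i ` carrier A" if k: "k \<in> carrier K" for k
  proof -
    obtain x where x: "x \<in> carrier (term_at P (Suc 0))" "k = bdry P 0 x"
      using k by (auto simp: K_def)
    then show k': "k \<in> carrier (term_at P 0)"
      using gmodule_hom_closed[OF pp(2)] by simp
    show "inv\<^bsub>B\<^esub> t k \<in> i ` carrier A"
    proof (rule kp)
      show "inv\<^bsub>B\<^esub> t k \<in> carrier B"
        using gmodule_hom_closed[OF t(1) k'] by simp
      show "p (inv\<^bsub>B\<^esub> t k) = \<one>\<^bsub>C\<^esub>"
        using gmodule_hom_inv[OF p(1) B C gmodule_hom_closed[OF t(1) k']] t(2) k' pp(7)[OF x(1)] x(2) by simp
    qed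
  qed
  have fA: "f k \<in> carrier A" "i (f k) = inv\<^bsub>B\<^esub> t k" if "k \<in> carrier K" for k
    using tk(2)[OF that] by (simp_all add: f_def inv_into_into f_inv_into_f)
  have f: "gmodule_hom \<Gamma> K A f"
  proof (rule gmodule_homI)
    show "f x \<in> carrier A" if "x \<in> carrier K" for x
      using fA that by blast
    interpret K: left_module \<Gamma> K by (rule K)
    show "f (x \<otimes>\<^bsub>K\<^esub> y) = f x \<otimes>\<^bsub>A\<^esub> f y" if x: "x \<in> carrier K" and y: "y \<in> carrier K" for x y
    proof (rule inj_onD[OF i(2)])
      have "i (f (x \<otimes>\<^bsub>K\<^esub> y)) = inv\<^bsub>B\<^esub> (t x \<otimes>\<^bsub>B\<^esub> t y)"
        using fA(2)[OF K.m_closed[OF x y]] gmodule_hom_mult[OF t(1) tk(1)[OF x] tk(1)[OF y]] by (simp add: K_def)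
      also have "\<dots> = i (f x \<otimes>\<^bsub>A\<^esub> f y)"
        using fA x y gmodule_hom_mult[OF i(1)] gmodule_hom_closed[OF t(1) tk(1)[OF x]] gmodule_hom_closed[OF t(1) tk(1)[OF y]]
        by (simp add: B.inv_mult)
      finally show "i (f (x \<otimes>\<^bsub>K\<^esub> y)) = i (f x \<otimes>\<^bsub>A\<^esub> f y)" .
    qed (use fA x y K.m_closed in auto)
    show "f (act K \<xi> x) = act A \<xi> (f x)" if \<xi>: "\<xi> \<in> groupoid_ring \<Gamma>" and x: "x \<in> carrier K" for \<xi> x
    proof (rule inj_onD[OF i(2)])
      have "i (f (act K \<xi> x)) = inv\<^bsub>B\<^esub> (act B \<xi> (t x))"
        using fA(2)[OF K.act_closed[OF \<xi> x]] gmodule_hom_act[OF t(1) \<xi> tk(1)[OF x]] by (simp add: K_def)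
      also have "\<dots> = i (act A \<xi> (f x))"
        using fA x \<xi> gmodule_hom_act[OF i(1) \<xi>] gmodule_hom_closed[OF t(1) tk(1)[OF x]] by (simp add: B.act_inv)
      finally show "i (f (act K \<xi> x)) = i (act A \<xi> (f x))" .
    qed (use fA x \<xi> K.act_closed A.act_closed in auto)
  qed
  have P1p: "projective_module \<Gamma> (term_at P1 n)" for n
    by (simp add: P1_def P(2))
  obtain \<theta> where \<theta>: "chain_lift \<Gamma> P1 R1 f \<theta>"
    using chain_lift_exists[OF P1 P1p R1 K A f] by blast
  have \<theta>h: "gmodule_hom \<Gamma> (term_at P (Suc n)) (term_at R n) (\<theta> n)" for n
    using chain_liftD(1)[OF \<theta>, of n] by (simp add: P1_def R1_def)
  have \<theta>d: "\<theta> n (bdry P (Suc n) x) = inv\<^bsub>term_at R n\<^esub> bdry R n (\<theta> (Suc n) x)" if "x \<in> carrier (term_at P (Suc (Suc n)))" for n x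
    using chain_liftD(2)[OF \<theta>, of x n] that by (simp add: P1_def R1_def)
  have \<theta>0: "i (aug R (\<theta> 0 x)) = inv\<^bsub>B\<^esub> t (bdry P 0 x)" if x: "x \<in> carrier (term_at P (Suc 0))" for x
  proof -
    have "bdry P 0 x \<in> carrier K"
      using x by (simp add: K_def)
    then show ?thesis
      using chain_liftD(3)[OF \<theta>, of x] x fA(2) by (simp add: P1_def R1_def)
  qed
  define S where "S = \<lparr>term_at = (\<lambda>n. prod_module (term_at R n) (term_at P n)),
     bdry = (\<lambda>n z. (bdry R n (fst z) \<otimes>\<^bsub>term_at R n\<^esub> \<theta> n (snd z), bdry P n (snd z))),
     aug = (\<lambda>z. i (aug R (fst z)) \<otimes>\<^bsub>B\<^esub> t (snd z))\<rparr>"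
  have fst: "gmodule_hom \<Gamma> (prod_module X Y) X fst" and snd: "gmodule_hom \<Gamma> (prod_module X Y) Y snd"
    for X :: "('a, 'x) gmodule" and Y :: "('a, 'y) gmodule"
    by (rule gmodule_homI; auto)+
  have S: "is_resolution \<Gamma> B S"
    unfolding is_resolution_def
  proof (intro conjI allI)
    show "left_module \<Gamma> (term_at S n)" for n
      by (simp add: S_def prod_left_module[OF rr(1) pp(1)])
    show "gmodule_hom \<Gamma> (term_at S (Suc n)) (term_at S n) (bdry S n)" for n
    proof -
      have 1: "gmodule_hom \<Gamma> (term_at S (Suc n)) (term_at R n) (\<lambda>z. bdry R n (fst z) \<otimes>\<^bsub>term_at R n\<^esub> \<theta> n (snd z))"
        by (simp add: S_def) (rule gmodule_hom_times[OF rr(1) gmodule_hom_comp[OF fst rr(2)] gmodule_hom_comp[OF snd \<theta>h]])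
      have 2: "gmodule_hom \<Gamma> (term_at S (Suc n)) (term_at P n) (\<lambda>z. bdry P n (snd z))"
        by (simp add: S_def) (rule gmodule_hom_comp[OF snd pp(2)])
      show ?thesis
        using gmodule_hom_closed[OF 1] gmodule_hom_closed[OF 2] gmodule_hom_mult[OF 1] gmodule_hom_mult[OF 2]
          gmodule_hom_act[OF 1] gmodule_hom_act[OF 2]
        by (intro gmodule_homI) (simp_all add: S_def)
    qed
    have aS: "aug S = (\<lambda>z. i (aug R (fst z)) \<otimes>\<^bsub>B\<^esub> t (snd z))" and S0: "term_at S 0 = prod_module (term_at R 0) (term_at P 0)"
      by (simp_all add: S_def)
    show "gmodule_hom \<Gamma> (term_at S 0) B (aug S)"
      unfolding aS S0
      by (rule gmodule_hom_times[OF B gmodule_hom_comp[OF gmodule_hom_comp[OF fst rr(3)] i(1)] gmodule_hom_comp[OF snd t(1)]])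
    have ic: "i (aug R x) \<in> carrier B" if "x \<in> carrier (term_at R 0)" for x
      using that by (intro gmodule_hom_closed[OF i(1)] gmodule_hom_closed[OF rr(3)])
    have tc: "t x \<in> carrier B" if "x \<in> carrier (term_at P 0)" for x
      by (rule gmodule_hom_closed[OF t(1) that])
    show "aug S ` carrier (term_at S 0) = carrier B"
    proof (intro equalityI subsetI)
      fix b assume b: "b \<in> carrier B"
      then have "p b \<in> aug P ` carrier (term_at P 0)"
        using pp(4) gmodule_hom_closed[OF p(1)] by blast
      then obtain q where q: "q \<in> carrier (term_at P 0)" "p b = aug P q" by blast
      have "b \<otimes>\<^bsub>B\<^esub> inv\<^bsub>B\<^esub> t q \<in> i ` carrier A"
        using b q tc t(2) gmodule_hom_closed[OF pp(3)]
        by (intro kp) (simp_all add: gmodule_hom_mult[OF p(1)] gmodule_hom_inv[OF p(1) B C])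
      then obtain a where a: "a \<in> carrier A" "b \<otimes>\<^bsub>B\<^esub> inv\<^bsub>B\<^esub> t q = i a" by blast
      then obtain r where r: "r \<in> carrier (term_at R 0)" "a = aug R r"
        using rr(4) by blast
      have "b = i (aug R r) \<otimes>\<^bsub>B\<^esub> t q"
        using a b tc[OF q(1)] r ic B.diff_mult_cancel[of b "t q" "i (aug R r)"] by simp
      then show "b \<in> aug S ` carrier (term_at S 0)"
        unfolding aS S0 using r q by (intro image_eqI[of _ _ "(r, q)"]) simp_all
    next
      fix b assume "b \<in> aug S ` carrier (term_at S 0)"
      then show "b \<in> carrier B"
        unfolding aS S0 using ic tc by auto
    qed
    interpret R0: left_module \<Gamma> "term_at R 0" by (rule rr(1))
    show "kernel (term_at S 0) B (aug S) = bdry S 0 ` carrier (term_at S 1)"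
    proof (intro equalityI subsetI)
      fix z assume "z \<in> kernel (term_at S 0) B (aug S)"
      then obtain r q where z: "z = (r, q)" "r \<in> carrier (term_at R 0)" "q \<in> carrier (term_at P 0)" "i (aug R r) \<otimes>\<^bsub>B\<^esub> t q = \<one>\<^bsub>B\<^esub>"
        by (cases z) (auto simp: kernel_def aS S0)
      have "p (i (aug R r) \<otimes>\<^bsub>B\<^esub> t q) = aug P q"
        using z(2,3) ic tc t(2) pi gmodule_hom_closed[OF rr(3)] gmodule_hom_closed[OF pp(3)] by (simp add: gmodule_hom_mult[OF p(1)])
      then have "aug P q = \<one>\<^bsub>C\<^esub>"
        using z(4) gmodule_hom_one[OF p(1) B C] by simp
      then obtain q' where q': "q' \<in> carrier (term_at P (Suc 0))" "q = bdry P 0 q'"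
        using pp(5)[OF z(3)] by blast
      have th: "\<theta> 0 q' \<in> carrier (term_at R 0)"
        by (rule gmodule_hom_closed[OF \<theta>h q'(1)])
      have "i (aug R r) = i (aug R (\<theta> 0 q'))"
        unfolding \<theta>0[OF q'(1)] q'(2)[symmetric] using z ic tc by (metis B.inv_equality B.m_comm B.inv_inv B.inv_closed)
      then have "aug R r = aug R (\<theta> 0 q')"
        using inj_onD[OF i(2)] gmodule_hom_closed[OF rr(3)] z(2) th by blast
      then have "aug R (r \<otimes>\<^bsub>term_at R 0\<^esub> inv\<^bsub>term_at R 0\<^esub> \<theta> 0 q') = \<one>\<^bsub>A\<^esub>"
        using z(2) th gmodule_hom_closed[OF rr(3)] by (simp add: gmodule_hom_mult[OF rr(3)] gmodule_hom_inv[OF rr(3) rr(1) A])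
      then obtain r' where r': "r' \<in> carrier (term_at R (Suc 0))" "r \<otimes>\<^bsub>term_at R 0\<^esub> inv\<^bsub>term_at R 0\<^esub> \<theta> 0 q' = bdry R 0 r'"
        using rr(5)[of "r \<otimes>\<^bsub>term_at R 0\<^esub> inv\<^bsub>term_at R 0\<^esub> \<theta> 0 q'"] z(2) th by auto
      have "r = bdry R 0 r' \<otimes>\<^bsub>term_at R 0\<^esub> \<theta> 0 q'"
        by (rule iffD1[OF R0.diff_mult_cancel[OF z(2) th gmodule_hom_closed[OF rr(2) r'(1)]] r'(2)])
      then show "z \<in> bdry S 0 ` carrier (term_at S 1)"
        using z(1) q' r' by (intro image_eqI[of _ _ "(r', q')"]) (simp_all add: S_def)
    next
      fix z assume "z \<in> bdry S 0 ` carrier (term_at S 1)"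
      then obtain r q where z: "r \<in> carrier (term_at R (Suc 0))" "q \<in> carrier (term_at P (Suc 0))"
        "z = (bdry R 0 r \<otimes>\<^bsub>term_at R 0\<^esub> \<theta> 0 q, bdry P 0 q)"
        by (auto simp: S_def)
      have c: "bdry R 0 r \<in> carrier (term_at R 0)" "\<theta> 0 q \<in> carrier (term_at R 0)" "bdry P 0 q \<in> carrier (term_at P 0)"
        using z gmodule_hom_closed[OF rr(2)] gmodule_hom_closed[OF \<theta>h] gmodule_hom_closed[OF pp(2)] by auto
      then have "i (aug R (bdry R 0 r \<otimes>\<^bsub>term_at R 0\<^esub> \<theta> 0 q)) = inv\<^bsub>B\<^esub> t (bdry P 0 q)"
        using gmodule_hom_closed[OF rr(3)] rr(7)[OF z(1)] \<theta>0[OF z(2)] by (simp add: gmodule_hom_mult[OF rr(3)])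
      then show "z \<in> kernel (term_at S 0) B (aug S)"
        using c tc z(3) by (simp add: kernel_def aS S0)
    qed
    show "kernel (term_at S (Suc n)) (term_at S n) (bdry S n) = bdry S (Suc n) ` carrier (term_at S (Suc (Suc n)))" for n
    proof (intro equalityI subsetI)
      interpret Rn: left_module \<Gamma> "term_at R n" by (rule rr(1))
      interpret Rs: left_module \<Gamma> "term_at R (Suc n)" by (rule rr(1))
      fix z assume "z \<in> kernel (term_at S (Suc n)) (term_at S n) (bdry S n)"
      then obtain r q where z: "z = (r, q)" "r \<in> carrier (term_at R (Suc n))" "q \<in> carrier (term_at P (Suc n))"
        "bdry R n r \<otimes>\<^bsub>term_at R n\<^esub> \<theta> n q = \<one>\<^bsub>term_at R n\<^esub>" "bdry P n q = \<one>\<^bsub>term_at P n\<^esub>"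
        by (cases z) (auto simp: kernel_def S_def)
      obtain q' where q': "q' \<in> carrier (term_at P (Suc (Suc n)))" "q = bdry P (Suc n) q'"
        using pp(6)[OF z(3,5)] by blast
      have th: "\<theta> (Suc n) q' \<in> carrier (term_at R (Suc n))"
        by (rule gmodule_hom_closed[OF \<theta>h q'(1)])
      have c: "bdry R n r \<in> carrier (term_at R n)" "bdry R n (\<theta> (Suc n) q') \<in> carrier (term_at R n)"
        using gmodule_hom_closed[OF rr(2)] z(2) th by auto
      have "bdry R n r \<otimes>\<^bsub>term_at R n\<^esub> inv\<^bsub>term_at R n\<^esub> bdry R n (\<theta> (Suc n) q') = \<one>\<^bsub>term_at R n\<^esub>"
        using z(4) unfolding q'(2) \<theta>d[OF q'(1)] .
      then have "bdry R n (r \<otimes>\<^bsub>term_at R (Suc n)\<^esub> inv\<^bsub>term_at R (Suc n)\<^esub> \<theta> (Suc n) q') = \<one>\<^bsub>term_at R n\<^esub>"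
        using z(2) th by (simp add: gmodule_hom_mult[OF rr(2)] gmodule_hom_inv[OF rr(2) rr(1) rr(1)])
      then obtain r' where r': "r' \<in> carrier (term_at R (Suc (Suc n)))"
        "r \<otimes>\<^bsub>term_at R (Suc n)\<^esub> inv\<^bsub>term_at R (Suc n)\<^esub> \<theta> (Suc n) q' = bdry R (Suc n) r'"
        using rr(6)[of "r \<otimes>\<^bsub>term_at R (Suc n)\<^esub> inv\<^bsub>term_at R (Suc n)\<^esub> \<theta> (Suc n) q'" n] z(2) th by auto
      have "r = bdry R (Suc n) r' \<otimes>\<^bsub>term_at R (Suc n)\<^esub> \<theta> (Suc n) q'"
        by (rule iffD1[OF Rs.diff_mult_cancel[OF z(2) th gmodule_hom_closed[OF rr(2) r'(1)]] r'(2)])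
      then show "z \<in> bdry S (Suc n) ` carrier (term_at S (Suc (Suc n)))"
        using z(1) q' r' by (intro image_eqI[of _ _ "(r', q')"]) (simp_all add: S_def)
    next
      interpret Rn: left_module \<Gamma> "term_at R n" by (rule rr(1))
      interpret Rs: left_module \<Gamma> "term_at R (Suc n)" by (rule rr(1))
      interpret Ps: left_module \<Gamma> "term_at P (Suc n)" by (rule pp(1))
      fix z assume "z \<in> bdry S (Suc n) ` carrier (term_at S (Suc (Suc n)))"
      then obtain r q where z: "r \<in> carrier (term_at R (Suc (Suc n)))" "q \<in> carrier (term_at P (Suc (Suc n)))"
        "z = (bdry R (Suc n) r \<otimes>\<^bsub>term_at R (Suc n)\<^esub> \<theta> (Suc n) q, bdry P (Suc n) q)"
        by (auto simp: S_def)
      have c: "bdry R (Suc n) r \<in> carrier (term_at R (Suc n))" "\<theta> (Suc n) q \<in> carrier (term_at R (Suc n))"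
        "bdry P (Suc n) q \<in> carrier (term_at P (Suc n))" "bdry R n (\<theta> (Suc n) q) \<in> carrier (term_at R n)"
        using z gmodule_hom_closed[OF rr(2)] gmodule_hom_closed[OF \<theta>h] gmodule_hom_closed[OF pp(2)] by auto
      then have "bdry R n (bdry R (Suc n) r \<otimes>\<^bsub>term_at R (Suc n)\<^esub> \<theta> (Suc n) q) = bdry R n (\<theta> (Suc n) q)"
        using rr(8)[OF z(1)] by (simp add: gmodule_hom_mult[OF rr(2)])
      then show "z \<in> kernel (term_at S (Suc n)) (term_at S n) (bdry S n)"
        using c z(3) \<theta>d[OF z(2)] pp(8)[OF z(2)] by (simp add: kernel_def S_def)
    qed
  qed
  show thesis
  proof (rule that[OF S])
    show "projective_module \<Gamma> (term_at S n)" for n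
      by (simp add: S_def projective_prod[OF R(2) P(2)])
    show "bdry S n (r, \<one>\<^bsub>term_at P (Suc n)\<^esub>) = (bdry R n r, \<one>\<^bsub>term_at P n\<^esub>)" if "r \<in> carrier (term_at R (Suc n))" for n r
    proof -
      interpret Rn: left_module \<Gamma> "term_at R n" by (rule rr(1))
      show ?thesis
        using gmodule_hom_closed[OF rr(2) that] gmodule_hom_one[OF \<theta>h pp(1) rr(1), of n] gmodule_hom_one[OF pp(2) pp(1) pp(1), of n]
        by (simp add: S_def)
    qed
    show "aug S (r, \<one>\<^bsub>term_at P 0\<^esub>) = i (aug R r)" if "r \<in> carrier (term_at R 0)" for r
      using gmodule_hom_closed[OF i(1) gmodule_hom_closed[OF rr(3) that]] gmodule_hom_one[OF t(1) pp(1) B] by (simp add: S_def)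
  qed (simp_all add: S_def)
qed

end

context ample_groupoid
begin

text \<open>The last conclusions are parts of the long exact homology sequence when C is acyclic.
  Each term of S splits as a direct sum, hence so do its coinvariants, and the claims are diagram
  chases with these splittings.\<close>

lemma horseshoe_coinv:
  assumes A: "left_module \<Gamma> A" and B: "left_module \<Gamma> B" and C: "left_module \<Gamma> C"
    and i: "gmodule_hom \<Gamma> A B i" "inj_on i (carrier A)" and p: "gmodule_hom \<Gamma> B C p" "p ` carrier B = carrier C"
    and ex: "kernel B C p = i ` carrier A"
    and R: "is_resolution \<Gamma> A R" "\<And>n. projective_module \<Gamma> (term_at R n)"
    and P: "is_resolution \<Gamma> C P" "\<And>n. projective_module \<Gamma> (term_at P n)" and exP: "coinv_exact P"
  obtains S where "is_resolution \<Gamma> B S" "\<And>n. projective_module \<Gamma> (term_at S n)"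
    "\<And>n. term_at S n = prod_module (term_at R n) (term_at P n)"
    "coinv_exact R \<Longrightarrow> coinv_exact S" "coinv_exact S \<Longrightarrow> coinv_exact R"
    "\<And>a. \<lbrakk>coinv_exact S; a \<in> carrier (T A); cm B i a = \<one>\<^bsub>T B\<^esub>\<rbrakk> \<Longrightarrow> a = \<one>\<^bsub>T A\<^esub>"
proof -
  obtain S where S: "is_resolution \<Gamma> B S" "\<And>n. projective_module \<Gamma> (term_at S n)"
    and Sp: "\<And>n. term_at S n = prod_module (term_at R n) (term_at P n)"
    and Sd: "\<And>n r. r \<in> carrier (term_at R (Suc n)) \<Longrightarrow> bdry S n (r, \<one>\<^bsub>term_at P (Suc n)\<^esub>) = (bdry R n r, \<one>\<^bsub>term_at P n\<^esub>)"
    and Ss: "\<And>n z. z \<in> carrier (term_at S (Suc n)) \<Longrightarrow> snd (bdry S n z) = bdry P n (snd z)"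
    and Sa: "\<And>r. r \<in> carrier (term_at R 0) \<Longrightarrow> aug S (r, \<one>\<^bsub>term_at P 0\<^esub>) = i (aug R r)"
    by (rule horseshoe[OF A B C i p ex R P]) (assumption | rule that)+
  note rr = resolutionD[OF R(1)] and pp = resolutionD[OF P(1)] and ss = resolutionD[OF S(1)]
  let ?i = "\<lambda>n r. (r, \<one>\<^bsub>term_at P n\<^esub>)" and ?k = "\<lambda>n q. (\<one>\<^bsub>term_at R n\<^esub>, q)"
  have ih: "gmodule_hom \<Gamma> (term_at R n) (term_at S n) (?i n)" and kh: "gmodule_hom \<Gamma> (term_at P n) (term_at S n) (?k n)"
    and fh: "gmodule_hom \<Gamma> (term_at S n) (term_at R n) fst" and sh: "gmodule_hom \<Gamma> (term_at S n) (term_at P n) snd" for n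
  proof -
    interpret r: left_module \<Gamma> "term_at R n" by (rule rr(1))
    interpret p: left_module \<Gamma> "term_at P n" by (rule pp(1))
    show "gmodule_hom \<Gamma> (term_at R n) (term_at S n) (?i n)" "gmodule_hom \<Gamma> (term_at P n) (term_at S n) (?k n)"
      "gmodule_hom \<Gamma> (term_at S n) (term_at R n) fst" "gmodule_hom \<Gamma> (term_at S n) (term_at P n) snd"
      unfolding Sp by (rule gmodule_homI; auto)+
  qed
  let ?I = "\<lambda>n. cm (term_at S n) (?i n)" and ?K = "\<lambda>n. cm (term_at S n) (?k n)"
  let ?F = "\<lambda>n. cm (term_at R n) fst" and ?P = "\<lambda>n. cm (term_at P n) snd"
  let ?dS = "\<lambda>n. cm (term_at S n) (bdry S n)" and ?dR = "\<lambda>n. cm (term_at R n) (bdry R n)" and ?dP = "\<lambda>n. cm (term_at P n) (bdry P n)"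
  note Ic = cm_closed[OF rr(1) ss(1) ih] and Kc = cm_closed[OF pp(1) ss(1) kh] and Fc = cm_closed[OF ss(1) rr(1) fh]
    and Pc = cm_closed[OF ss(1) pp(1) sh] and dSc = cm_closed[OF ss(1) ss(1) ss(2)] and dRc = cm_closed[OF rr(1) rr(1) rr(2)]
    and dPc = cm_closed[OF pp(1) pp(1) pp(2)]
  have gS: "comm_group (T (term_at S n))" and gP: "comm_group (T (term_at P n))" and gR: "comm_group (T (term_at R n))" for n
    by (rule cm_comm_group[OF ss(1)] cm_comm_group[OF pp(1)] cm_comm_group[OF rr(1)])+
  have FI: "?F n (?I n x) = x" if "x \<in> carrier (T (term_at R n))" for n x
    using cm_comp[OF rr(1) ss(1) rr(1) ih fh _ that, of "\<lambda>x. x"] cm_id[OF rr(1) that] by simp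
  have PI: "?P n (?I n x) = \<one>\<^bsub>T (term_at P n)\<^esub>" if "x \<in> carrier (T (term_at R n))" for n x
    by (rule cm_comp_one[OF rr(1) ss(1) pp(1) ih sh _ that]) simp
  have PK: "?P n (?K n x) = x" if "x \<in> carrier (T (term_at P n))" for n x
    using cm_comp[OF pp(1) ss(1) pp(1) kh sh _ that, of "\<lambda>x. x"] cm_id[OF pp(1) that] by simp
  have dI: "?dS n (?I (Suc n) x) = ?I n (?dR n x)" if "x \<in> carrier (T (term_at R (Suc n)))" for n x
    by (rule cm_square[OF rr(1) ss(1) rr(1) ss(1) ih ss(2) rr(2) ih _ that]) (simp add: Sd)
  have Pd: "?P n (?dS n x) = ?dP n (?P (Suc n) x)" if "x \<in> carrier (T (term_at S (Suc n)))" for n x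
    by (rule cm_square[OF ss(1) ss(1) pp(1) pp(1) ss(2) sh sh pp(2) _ that]) (simp add: Ss)
  \<comment> \<open>The coinvariants of a product are not literally a product, so the splitting is
    expressed through the injections \<open>?I\<close>, \<open>?K\<close> and the projections
    \<open>?F\<close>, \<open>?P\<close>.\<close>
  have dec: "x = ?I n (?F n x) \<otimes>\<^bsub>T (term_at S n)\<^esub> ?K n (?P n x)" if x: "x \<in> carrier (T (term_at S n))" for n x
  proof -
    interpret r: left_module \<Gamma> "term_at R n" by (rule rr(1))
    interpret p: left_module \<Gamma> "term_at P n" by (rule pp(1))
    have "cm (term_at S n) (\<lambda>z. z) x = cm (term_at S n) (\<lambda>z. ?i n (fst z)) x \<otimes>\<^bsub>T (term_at S n)\<^esub> cm (term_at S n) (\<lambda>z. ?k n (snd z)) x"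
      by (rule cm_times[OF ss(1) ss(1) gmodule_hom_comp[OF fh ih] gmodule_hom_comp[OF sh kh] _ x]) (auto simp: Sp)
    then show ?thesis
      using cm_id[OF ss(1) x] cm_comp[OF ss(1) rr(1) ss(1) fh ih refl x] cm_comp[OF ss(1) pp(1) ss(1) sh kh refl x] by simp
  qed
  have dd: "?dS n (?dS (Suc n) x) = \<one>\<^bsub>T (term_at S n)\<^esub>" if "x \<in> carrier (T (term_at S (Suc (Suc n))))" for n x
    by (rule resolution_coinv_complex[OF S(1) that])
  text \<open>An element over a boundary of \<open>P\<close> differs by a boundary from an element coming from \<open>R\<close>.\<close>
  have adjust: "\<exists>r \<in> carrier (T (term_at R n)). x = ?I n r \<otimes>\<^bsub>T (term_at S n)\<^esub> ?dS n (?K (Suc n) y)"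
    if x: "x \<in> carrier (T (term_at S n))" and y: "y \<in> carrier (T (term_at P (Suc n)))" and xy: "?P n x = ?dP n y" for n x y
  proof -
    interpret gS: comm_group "T (term_at S n)" by (rule gS)
    interpret gP: comm_group "T (term_at P n)" by (rule gP)
    have ky: "?dS n (?K (Suc n) y) \<in> carrier (T (term_at S n))"
      using dSc[OF Kc[OF y]] .
    let ?x = "x \<otimes>\<^bsub>T (term_at S n)\<^esub> inv\<^bsub>T (term_at S n)\<^esub> ?dS n (?K (Suc n) y)"
    have x': "?x \<in> carrier (T (term_at S n))"
      using x ky by simp
    have "?P n ?x = ?P n x \<otimes>\<^bsub>T (term_at P n)\<^esub> inv\<^bsub>T (term_at P n)\<^esub> ?P n (?dS n (?K (Suc n) y))"
      using x ky by (simp add: cm_mult[OF ss(1) pp(1) sh] cm_inv[OF ss(1) pp(1) sh])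
    also have "\<dots> = \<one>\<^bsub>T (term_at P n)\<^esub>"
      using xy Pd[OF Kc[OF y]] PK[OF y] dPc[OF y] by simp
    finally have Px: "?P n ?x = \<one>\<^bsub>T (term_at P n)\<^esub>" .
    have "?I n (?F n ?x) \<otimes>\<^bsub>T (term_at S n)\<^esub> ?K n (?P n ?x) = ?I n (?F n ?x)"
      unfolding Px cm_one[OF pp(1) ss(1) kh] by (rule gS.r_one[OF Ic[OF Fc[OF x']]])
    with dec[OF x'] have "?x = ?I n (?F n ?x)"
      by (rule trans)
    then have "x = ?I n (?F n ?x) \<otimes>\<^bsub>T (term_at S n)\<^esub> ?dS n (?K (Suc n) y)"
      by (rule iffD1[OF gS.diff_mult_cancel[OF x ky Ic[OF Fc[OF x']]]])
    then show ?thesis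
      using Fc[OF x'] by blast
  qed
  have Iinj: "r = r'" if "r \<in> carrier (T (term_at R n))" "r' \<in> carrier (T (term_at R n))" "?I n r = ?I n r'" for n r r'
    using FI that by metis
  \<comment> \<open>The correction by a boundary disappears under the differential, leaving only the
    part from R.\<close>
  have dadj: "?dS n (?I (Suc n) r \<otimes>\<^bsub>T (term_at S (Suc n))\<^esub> ?dS (Suc n) (?K (Suc (Suc n)) y)) = ?I n (?dR n r)"
    if r: "r \<in> carrier (T (term_at R (Suc n)))" and y: "y \<in> carrier (T (term_at P (Suc (Suc n))))" for n r y
  proof -
    interpret gS: comm_group "T (term_at S n)" by (rule gS)
    show ?thesis
      using r y by (simp add: cm_mult[OF ss(1) ss(1) ss(2) Ic[OF r] dSc[OF Kc[OF y]]] dI dd[OF Kc[OF y]] Ic[OF dRc[OF r]])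
  qed
  show thesis
  proof (rule that[OF S Sp])
    assume exR: "coinv_exact R"
    show "coinv_exact S"
      unfolding coinv_exact_def
    proof (intro allI ballI impI)
      fix n x assume x: "x \<in> carrier (T (term_at S (Suc n)))" and dx: "?dS n x = \<one>\<^bsub>T (term_at S n)\<^esub>"
      have "?dP n (?P (Suc n) x) = \<one>\<^bsub>T (term_at P n)\<^esub>"
        using Pd[OF x] dx cm_one[OF ss(1) pp(1) sh] by simp
      then obtain y where y: "y \<in> carrier (T (term_at P (Suc (Suc n))))" "?P (Suc n) x = ?dP (Suc n) y"
        using coinv_exactD[OF exP Pc[OF x]] by blast
      obtain r where r: "r \<in> carrier (T (term_at R (Suc n)))"
        "x = ?I (Suc n) r \<otimes>\<^bsub>T (term_at S (Suc n))\<^esub> ?dS (Suc n) (?K (Suc (Suc n)) y)"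
        using adjust[OF x y] by blast
      have "?I n (?dR n r) = \<one>\<^bsub>T (term_at S n)\<^esub>"
        using dx dadj[OF r(1) y(1)] unfolding r(2) by simp
      then have "?dR n r = \<one>\<^bsub>T (term_at R n)\<^esub>"
        using FI[OF dRc[OF r(1)]] cm_one[OF ss(1) rr(1) fh, of n] by metis
      then obtain w where w: "w \<in> carrier (T (term_at R (Suc (Suc n))))" "r = ?dR (Suc n) w"
        using coinv_exactD[OF exR r(1)] by blast
      interpret gS: comm_group "T (term_at S (Suc (Suc n)))" by (rule gS)
      have "x = ?dS (Suc n) (?I (Suc (Suc n)) w \<otimes>\<^bsub>T (term_at S (Suc (Suc n)))\<^esub> ?K (Suc (Suc n)) y)"
        using r(2) w dI[OF w(1)] cm_mult[OF ss(1) ss(1) ss(2) Ic[OF w(1)] Kc[OF y(1)]] by simp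
      then show "x \<in> ?dS (Suc n) ` carrier (T (term_at S (Suc (Suc n))))"
        using Ic[OF w(1)] Kc[OF y(1)] by blast
    qed
  next
    assume exS: "coinv_exact S"
    show "coinv_exact R"
      unfolding coinv_exact_def
    proof (intro allI ballI impI)
      fix n z assume z: "z \<in> carrier (T (term_at R (Suc n)))" and dz: "?dR n z = \<one>\<^bsub>T (term_at R n)\<^esub>"
      have "?dS n (?I (Suc n) z) = \<one>\<^bsub>T (term_at S n)\<^esub>"
        using dI[OF z] dz cm_one[OF rr(1) ss(1) ih] by simp
      then obtain x where x: "x \<in> carrier (T (term_at S (Suc (Suc n))))" "?I (Suc n) z = ?dS (Suc n) x"
        using coinv_exactD[OF exS Ic[OF z]] by blast
      \<comment> \<open>x need not come from R, but its P-part is a cycle since z comes from R.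
        Exactness for P makes that part a boundary, and \<open>adjust\<close> then moves x into R
        modulo a boundary.\<close>
      have "?dP (Suc n) (?P (Suc (Suc n)) x) = \<one>\<^bsub>T (term_at P (Suc n))\<^esub>"
        using Pd[OF x(1)] PI[OF z] x(2) by simp
      then obtain y where y: "y \<in> carrier (T (term_at P (Suc (Suc (Suc n)))))" "?P (Suc (Suc n)) x = ?dP (Suc (Suc n)) y"
        using coinv_exactD[OF exP Pc[OF x(1)]] by blast
      obtain r where r: "r \<in> carrier (T (term_at R (Suc (Suc n))))"
        "x = ?I (Suc (Suc n)) r \<otimes>\<^bsub>T (term_at S (Suc (Suc n)))\<^esub> ?dS (Suc (Suc n)) (?K (Suc (Suc (Suc n))) y)"
        using adjust[OF x(1) y] by blast
      have "?I (Suc n) z = ?I (Suc n) (?dR (Suc n) r)"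
        using x(2) dadj[OF r(1) y(1)] r(2) by simp
      then have "z = ?dR (Suc n) r"
        by (rule Iinj[OF z dRc[OF r(1)]])
      then show "z \<in> ?dR (Suc n) ` carrier (T (term_at R (Suc (Suc n))))"
        using r(1) by blast
    qed
  next
    fix a assume exS: "coinv_exact S" and a: "a \<in> carrier (T A)" and ia: "cm B i a = \<one>\<^bsub>T B\<^esub>"
    have "a \<in> cm A (aug R) ` carrier (T (term_at R 0))"
      using cm_surj[OF rr(1) A rr(3,4)] a by simp
    then obtain r0 where r0: "r0 \<in> carrier (T (term_at R 0))" "a = cm A (aug R) r0" by blast
    have "cm B (aug S) (?I 0 r0) = cm B i (cm A (aug R) r0)"
      by (rule cm_square[OF rr(1) ss(1) A B ih ss(3) rr(3) i(1) _ r0(1)]) (simp add: Sa)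
    then have "cm B (aug S) (?I 0 r0) = \<one>\<^bsub>T B\<^esub>"
      using r0(2) ia by simp
    \<comment> \<open>In degree 0 right exactness of coinvariants takes over from
      \<open>coinv_exact\<close>.\<close>
    then have "?I 0 r0 \<in> ?dS 0 ` carrier (T (term_at S (Suc 0)))"
      by (intro cm_right_exact[OF ss(1) ss(1) B ss(2) ss(3,4) _ Ic[OF r0(1)]] ss(5))
    then obtain x where x: "x \<in> carrier (T (term_at S (Suc 0)))" "?I 0 r0 = ?dS 0 x" by blast
    have "?dP 0 (?P (Suc 0) x) = \<one>\<^bsub>T (term_at P 0)\<^esub>"
      using Pd[OF x(1)] PI[OF r0(1)] x(2) by simp
    then obtain y where y: "y \<in> carrier (T (term_at P (Suc (Suc 0))))" "?P (Suc 0) x = ?dP (Suc 0) y"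
      using coinv_exactD[OF exP Pc[OF x(1)]] by blast
    obtain r where r: "r \<in> carrier (T (term_at R (Suc 0)))"
      "x = ?I (Suc 0) r \<otimes>\<^bsub>T (term_at S (Suc 0))\<^esub> ?dS (Suc 0) (?K (Suc (Suc 0)) y)"
      using adjust[OF x(1) y] by blast
    have "?I 0 r0 = ?I 0 (?dR 0 r)"
      using x(2) dadj[OF r(1) y(1)] r(2) by simp
    then have "r0 = ?dR 0 r"
      by (rule Iinj[OF r0(1) dRc[OF r(1)]])
    then show "a = \<one>\<^bsub>T A\<^esub>"
      using r0(2) cm_comp_one[OF rr(1) rr(1) A rr(2,3) rr(7) r(1)] by simp
  qed
qed

end

section \<open>Homology of complexes of abelian groups\<close>

definition chain_complex :: "(nat \<Rightarrow> 'c monoid) \<Rightarrow> (nat \<Rightarrow> 'c \<Rightarrow> 'c) \<Rightarrow> bool" where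
  "chain_complex C d \<longleftrightarrow> (\<forall>n. comm_group (C n)) \<and> (\<forall>n. d n \<in> hom (C (Suc n)) (C n)) \<and>
     (\<forall>n. \<forall>x \<in> carrier (C (Suc (Suc n))). d n (d (Suc n) x) = \<one>\<^bsub>C n\<^esub>)"

text \<open>A description uniform in the degree: for n = 0 the second condition is void.\<close>

lemma cycles_iff:
  "z \<in> cycles C d n \<longleftrightarrow> z \<in> carrier (C n) \<and> (\<forall>k. n = Suc k \<longrightarrow> d k z = \<one>\<^bsub>C k\<^esub>)"
  by (cases n) (auto simp: cycles_def kernel_def)

context
  fixes C :: "nat \<Rightarrow> 'c monoid" and d
  assumes cc: "chain_complex C d"
begin

lemma chain_complexD: "comm_group (C n)" "d n \<in> hom (C (Suc n)) (C n)"
  "x \<in> carrier (C (Suc (Suc n))) \<Longrightarrow> d n (d (Suc n) x) = \<one>\<^bsub>C n\<^esub>"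
  using cc by (auto simp: chain_complex_def)

lemma subgroup_cycles: "subgroup (cycles C d n) (C n)"
proof (cases n)
  case 0
  then show ?thesis
    using group.subgroup_self[OF comm_group_imp_group[OF chain_complexD(1)]] by (simp add: cycles_def)
next
  case (Suc k)
  have "group_hom (C (Suc k)) (C k) (d k)"
    using chain_complexD by (simp add: group_hom_def group_hom_axioms_def comm_group_imp_group)
  then show ?thesis
    using group_hom.subgroup_kernel Suc by (simp add: cycles_def)
qed

lemma subgroup_boundaries: "subgroup (boundaries C d n) (C n)"
  unfolding boundaries_def
  by (rule comm_group.image_hom_subgroup[OF chain_complexD(1,2) comm_group_imp_group[OF chain_complexD(1)]])

lemma boundaries_cycles: "boundaries C d n \<subseteq> cycles C d n"
  unfolding boundaries_def using chain_complexD(3) hom_in_carrier[OF chain_complexD(2)] by (auto simp: cycles_iff)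

lemma cycles_group: "comm_group ((C n)\<lparr>carrier := cycles C d n\<rparr>)"
proof -
  interpret C: comm_group "C n" by (rule chain_complexD)
  show ?thesis
    using group.group_comm_groupI[OF subgroup.subgroup_is_group[OF subgroup_cycles C.is_group]]
      subgroup.subset[OF subgroup_cycles] C.m_comm by (auto simp: subset_iff)
qed

lemma boundaries_subgroup_cycles: "subgroup (boundaries C d n) ((C n)\<lparr>carrier := cycles C d n\<rparr>)"
  using group.subgroup_incl[OF comm_group_imp_group[OF chain_complexD(1)] subgroup_boundaries subgroup_cycles boundaries_cycles] .

abbreviation cls :: "nat \<Rightarrow> 'c \<Rightarrow> 'c set" where
  "cls n z \<equiv> boundaries C d n #>\<^bsub>C n\<^esub> z"

lemma carrier_homology: "carrier (complex_homology C d n) = cls n ` cycles C d n"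
  by (simp add: complex_homology_def carrier_FactGroup)

lemma one_homology: "\<one>\<^bsub>complex_homology C d n\<^esub> = boundaries C d n"
  by (simp add: complex_homology_def)

lemma mult_homology:
  "\<lbrakk>z \<in> cycles C d n; z' \<in> cycles C d n\<rbrakk> \<Longrightarrow> cls n z \<otimes>\<^bsub>complex_homology C d n\<^esub> cls n z' = cls n (z \<otimes>\<^bsub>C n\<^esub> z')"
  using comm_group.quotient_mult[OF cycles_group boundaries_subgroup_cycles, of z n z']
  by (simp add: complex_homology_def)

lemma group_homology: "comm_group (complex_homology C d n)"
  unfolding complex_homology_def by (rule comm_group.abelian_FactGroup[OF cycles_group boundaries_subgroup_cycles])

lemma cycles_carrier: "z \<in> cycles C d n \<Longrightarrow> z \<in> carrier (C n)"
  by (simp add: cycles_iff)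

lemma cls_eqI:
  assumes "z \<in> carrier (C n)" "y \<in> carrier (C (Suc n))" "z' = z \<otimes>\<^bsub>C n\<^esub> d n y"
  shows "cls n z' = cls n z"
proof -
  interpret C: comm_group "C n" by (rule chain_complexD)
  have dy: "d n y \<in> carrier (C n)"
    using hom_in_carrier[OF chain_complexD(2) assms(2)] .
  have "z' \<otimes>\<^bsub>C n\<^esub> inv\<^bsub>C n\<^esub> z = d n y"
    using assms(1,3) dy C.m_comm[of z "d n y"] C.diff_mult_cancel[of "z'" z "d n y"] by simp
  then show ?thesis
    using C.quotient_eq_iff[OF subgroup_boundaries, of z' z] assms dy by (auto simp: boundaries_def)
qed

lemma cls_eq_iff:
  assumes "z \<in> carrier (C n)" "z' \<in> carrier (C n)"
  shows "cls n z = cls n z' \<longleftrightarrow> z \<otimes>\<^bsub>C n\<^esub> inv\<^bsub>C n\<^esub> z' \<in> boundaries C d n"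
  by (rule comm_group.quotient_eq_iff[OF chain_complexD(1) subgroup_boundaries assms])

lemma trivial_homology_iff:
  "trivial_group (complex_homology C d n) \<longleftrightarrow> cycles C d n \<subseteq> boundaries C d n"
proof -
  interpret Hn: comm_group "complex_homology C d n" by (rule group_homology)
  interpret C: comm_group "C n" by (rule chain_complexD)
  have one: "boundaries C d n \<in> carrier (complex_homology C d n)"
    using Hn.one_closed by (simp add: one_homology)
  have "cls n z = boundaries C d n \<longleftrightarrow> z \<in> boundaries C d n" if "z \<in> cycles C d n" for z
    by (rule C.quotient_one_iff[OF subgroup_boundaries cycles_carrier[OF that]])
  then show ?thesis
    using one Hn.is_group by (auto simp: trivial_group_def carrier_homology one_homology)
qed

end

context
  fixes C :: "nat \<Rightarrow> 'c monoid" and d and C' :: "nat \<Rightarrow> 'e monoid" and d' and \<alpha> :: "nat \<Rightarrow> 'c \<Rightarrow> 'e"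
  assumes cc: "chain_complex C d" and cc': "chain_complex C' d'"
    and \<alpha>: "\<And>n. \<alpha> n \<in> hom (C n) (C' n)"
    and comm: "\<And>n x. x \<in> carrier (C (Suc n)) \<Longrightarrow> \<alpha> n (d n x) = d' n (\<alpha> (Suc n) x)"
begin

lemma chain_map_cycles:
  assumes "z \<in> cycles C d n"
  shows "\<alpha> n z \<in> cycles C' d' n"
proof -
  have "d' k (\<alpha> n z) = \<one>\<^bsub>C' k\<^esub>" if "n = Suc k" for k
    using assms that comm[of z k] hom_one[OF \<alpha>[of k]] chain_complexD(1)[OF cc] chain_complexD(1)[OF cc']
    by (simp add: cycles_iff comm_group_imp_group)
  then show ?thesis
    using assms hom_in_carrier[OF \<alpha>] by (simp add: cycles_iff)
qed

text \<open>Boundaries go to boundaries, so all elements of the coset have the same class and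
  \<open>the_elem\<close> in \<open>complex_homology_map\<close> is taken of a singleton.\<close>

lemma homology_map_class:
  assumes z: "z \<in> carrier (C n)"
  shows "complex_homology_map C' d' \<alpha> n (boundaries C d n #>\<^bsub>C n\<^esub> z) = boundaries C' d' n #>\<^bsub>C' n\<^esub> \<alpha> n z"
proof -
  interpret C: comm_group "C n" by (rule chain_complexD[OF cc])
  interpret C': comm_group "C' n" by (rule chain_complexD[OF cc'])
  have "boundaries C' d' n #>\<^bsub>C' n\<^esub> \<alpha> n x = boundaries C' d' n #>\<^bsub>C' n\<^esub> \<alpha> n z"
    if x: "x \<in> boundaries C d n #>\<^bsub>C n\<^esub> z" for x
  proof -
    obtain y where y: "y \<in> carrier (C (Suc n))" "x = d n y \<otimes>\<^bsub>C n\<^esub> z"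
      using x by (auto simp: r_coset_def boundaries_def)
    have dy: "d n y \<in> carrier (C n)"
      using hom_in_carrier[OF chain_complexD(2)[OF cc] y(1)] .
    have "\<alpha> n x = \<alpha> n z \<otimes>\<^bsub>C' n\<^esub> d' n (\<alpha> (Suc n) y)"
      using y dy z hom_mult[OF \<alpha> dy z] comm[OF y(1)] hom_in_carrier[OF \<alpha>] C'.m_comm by metis
    then show ?thesis
      by (rule cls_eqI[OF cc' hom_in_carrier[OF \<alpha> z] hom_in_carrier[OF \<alpha> y(1)]])
  qed
  moreover have "z \<in> boundaries C d n #>\<^bsub>C n\<^esub> z"
    by (rule C.rcos_self[OF z subgroup_boundaries[OF cc]])
  ultimately have "(\<lambda>x. boundaries C' d' n #>\<^bsub>C' n\<^esub> \<alpha> n x) ` (boundaries C d n #>\<^bsub>C n\<^esub> z) = {boundaries C' d' n #>\<^bsub>C' n\<^esub> \<alpha> n z}"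
    by blast
  then show ?thesis
    by (simp add: complex_homology_map_def)
qed

lemma homology_map_hom:
  "complex_homology_map C' d' \<alpha> n \<in> hom (complex_homology C d n) (complex_homology C' d' n)"
proof (rule homI)
  fix X assume "X \<in> carrier (complex_homology C d n)"
  then obtain z where z: "z \<in> cycles C d n" "X = boundaries C d n #>\<^bsub>C n\<^esub> z"
    by (auto simp: carrier_homology[OF cc])
  note zc = cycles_carrier[OF cc z(1)]
  show "complex_homology_map C' d' \<alpha> n X \<in> carrier (complex_homology C' d' n)"
    using z homology_map_class[OF zc] chain_map_cycles[OF z(1)] by (simp add: carrier_homology[OF cc'])
  fix Y assume "Y \<in> carrier (complex_homology C d n)"
  then obtain w where w: "w \<in> cycles C d n" "Y = boundaries C d n #>\<^bsub>C n\<^esub> w"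
    by (auto simp: carrier_homology[OF cc])
  note wc = cycles_carrier[OF cc w(1)]
  interpret C: comm_group "C n" by (rule chain_complexD[OF cc])
  have "complex_homology_map C' d' \<alpha> n (X \<otimes>\<^bsub>complex_homology C d n\<^esub> Y) = boundaries C' d' n #>\<^bsub>C' n\<^esub> (\<alpha> n z \<otimes>\<^bsub>C' n\<^esub> \<alpha> n w)"
    using mult_homology[OF cc z(1) w(1)] homology_map_class[OF C.m_closed[OF zc wc]] hom_mult[OF \<alpha> zc wc] z w by simp
  then show "complex_homology_map C' d' \<alpha> n (X \<otimes>\<^bsub>complex_homology C d n\<^esub> Y) =
      complex_homology_map C' d' \<alpha> n X \<otimes>\<^bsub>complex_homology C' d' n\<^esub> complex_homology_map C' d' \<alpha> n Y"
    using mult_homology[OF cc' chain_map_cycles[OF z(1)] chain_map_cycles[OF w(1)]] homology_map_class[OF zc] homology_map_class[OF wc] z w by simp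
qed

lemma homology_map_iso:
  assumes inj: "\<And>z. \<lbrakk>z \<in> cycles C d n; \<alpha> n z \<in> boundaries C' d' n\<rbrakk> \<Longrightarrow> z \<in> boundaries C d n"
    and surj: "\<And>y. y \<in> cycles C' d' n \<Longrightarrow> \<exists>z \<in> cycles C d n. \<exists>w \<in> carrier (C' (Suc n)). y = \<alpha> n z \<otimes>\<^bsub>C' n\<^esub> d' n w"
  shows "complex_homology_map C' d' \<alpha> n \<in> iso (complex_homology C d n) (complex_homology C' d' n)"
proof -
  interpret C: comm_group "C n" by (rule chain_complexD[OF cc])
  interpret C': comm_group "C' n" by (rule chain_complexD[OF cc'])
  have "bij_betw (complex_homology_map C' d' \<alpha> n) (carrier (complex_homology C d n)) (carrier (complex_homology C' d' n))"
    unfolding bij_betw_def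
  proof
    show "inj_on (complex_homology_map C' d' \<alpha> n) (carrier (complex_homology C d n))"
    proof (rule inj_onI)
      fix X Y assume XY: "X \<in> carrier (complex_homology C d n)" "Y \<in> carrier (complex_homology C d n)"
        "complex_homology_map C' d' \<alpha> n X = complex_homology_map C' d' \<alpha> n Y"
      obtain z where z: "z \<in> cycles C d n" "X = boundaries C d n #>\<^bsub>C n\<^esub> z"
        using XY(1) by (auto simp: carrier_homology[OF cc])
      obtain w where w: "w \<in> cycles C d n" "Y = boundaries C d n #>\<^bsub>C n\<^esub> w"
        using XY(2) by (auto simp: carrier_homology[OF cc])
      note zc = cycles_carrier[OF cc z(1)] and wc = cycles_carrier[OF cc w(1)]
      have "\<alpha> n z \<otimes>\<^bsub>C' n\<^esub> inv\<^bsub>C' n\<^esub> \<alpha> n w \<in> boundaries C' d' n"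
        using XY(3) z w homology_map_class[OF zc] homology_map_class[OF wc]
          cls_eq_iff[OF cc' hom_in_carrier[OF \<alpha> zc] hom_in_carrier[OF \<alpha> wc]] by simp
      then have "\<alpha> n (z \<otimes>\<^bsub>C n\<^esub> inv\<^bsub>C n\<^esub> w) \<in> boundaries C' d' n"
        using zc wc by (simp add: hom_mult[OF \<alpha>] hom_inv'[OF \<alpha> C.is_group C'.is_group])
      moreover have "z \<otimes>\<^bsub>C n\<^esub> inv\<^bsub>C n\<^esub> w \<in> cycles C d n"
        using z(1) w(1) subgroup_cycles[OF cc] by (meson subgroup.m_closed subgroup.m_inv_closed)
      ultimately show "X = Y"
        using inj cls_eq_iff[OF cc zc wc] z w by blast
    qed
    show "complex_homology_map C' d' \<alpha> n ` carrier (complex_homology C d n) = carrier (complex_homology C' d' n)"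
    proof (intro equalityI subsetI)
      fix Y assume "Y \<in> carrier (complex_homology C' d' n)"
      then obtain y where y: "y \<in> cycles C' d' n" "Y = boundaries C' d' n #>\<^bsub>C' n\<^esub> y"
        by (auto simp: carrier_homology[OF cc'])
      obtain z w where zw: "z \<in> cycles C d n" "w \<in> carrier (C' (Suc n))" "y = \<alpha> n z \<otimes>\<^bsub>C' n\<^esub> d' n w"
        using surj[OF y(1)] by blast
      note zc = cycles_carrier[OF cc zw(1)]
      have "Y = complex_homology_map C' d' \<alpha> n (boundaries C d n #>\<^bsub>C n\<^esub> z)"
        using cls_eqI[OF cc' hom_in_carrier[OF \<alpha> zc] zw(2,3)] y(2) homology_map_class[OF zc] by simp
      then show "Y \<in> complex_homology_map C' d' \<alpha> n ` carrier (complex_homology C d n)"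
        using zw(1) by (auto simp: carrier_homology[OF cc])
    qed (use hom_in_carrier[OF homology_map_hom] in auto)
  qed
  then show ?thesis
    using homology_map_hom by (simp add: iso_def)
qed

end

section \<open>Acyclicity, extensions and resolutions by acyclic modules\<close>

context ample_groupoid
begin

lemma coinvariants_chain_complex:
  assumes "is_resolution \<Gamma> M P"
  shows "chain_complex (coinvariants_complex \<Gamma> P) (coinvariants_bdry \<Gamma> P)"
  unfolding chain_complex_def
  using cm_comm_group[OF resolutionD(1)[OF assms]] resolution_coinv_complex[OF assms]
    cm_hom[OF resolutionD(1)[OF assms] resolutionD(1)[OF assms] resolutionD(2)[OF assms]] by blast

lemma acyclic_module_iff:
  "acyclic_module \<Gamma> A \<longleftrightarrow> left_module \<Gamma> A \<and> coinv_exact (projective_resolution \<Gamma> A)"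
proof (cases "left_module \<Gamma> A")
  case True
  let ?P = "projective_resolution \<Gamma> A"
  note cc = coinvariants_chain_complex[OF projective_resolution(1)[OF True]]
  have "trivial_group (homology \<Gamma> A (Suc n)) \<longleftrightarrow>
      cycles (coinvariants_complex \<Gamma> ?P) (coinvariants_bdry \<Gamma> ?P) (Suc n) \<subseteq> boundaries (coinvariants_complex \<Gamma> ?P) (coinvariants_bdry \<Gamma> ?P) (Suc n)" for n
    unfolding homology_def coinvariants_homology_def by (rule trivial_homology_iff[OF cc])
  moreover have "(\<forall>n\<ge>1. trivial_group (homology \<Gamma> A n)) \<longleftrightarrow> (\<forall>n. trivial_group (homology \<Gamma> A (Suc n)))"
    by (metis One_nat_def Suc_le_D le_add1 plus_1_eq_Suc)
  ultimately show ?thesis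
    using True by (auto simp: acyclic_module_def coinv_exact_def cycles_iff subset_iff boundaries_def)
qed (simp add: acyclic_module_def)

lemma acyclic_module_iff_resolution:
  assumes A: "left_module \<Gamma> A" and P: "is_resolution \<Gamma> A P" "\<And>n. projective_module \<Gamma> (term_at P n)"
  shows "acyclic_module \<Gamma> A \<longleftrightarrow> coinv_exact P"
  using coinv_exact_transfer[OF A P projective_resolution[OF A]] coinv_exact_transfer[OF A projective_resolution[OF A] P] A
  by (auto simp: acyclic_module_iff)

text \<open>\<open>horseshoe_coinv\<close> for the chosen resolutions of A and C; independence of
  the resolution turns exactness for S into acyclicity of B.\<close>

lemma acyclic_extension:
  assumes A: "left_module \<Gamma> A" and B: "left_module \<Gamma> B" and C: "acyclic_module \<Gamma> C"
    and i: "gmodule_hom \<Gamma> A B i" "inj_on i (carrier A)" and p: "gmodule_hom \<Gamma> B C p" "p ` carrier B = carrier C"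
    and ex: "kernel B C p = i ` carrier A"
  shows "acyclic_module \<Gamma> A \<Longrightarrow> acyclic_module \<Gamma> B" "acyclic_module \<Gamma> B \<Longrightarrow> acyclic_module \<Gamma> A"
    "\<lbrakk>acyclic_module \<Gamma> B; a \<in> carrier (T A); cm B i a = \<one>\<^bsub>T B\<^esub>\<rbrakk> \<Longrightarrow> a = \<one>\<^bsub>T A\<^esub>"
proof -
  have CM: "left_module \<Gamma> C" and exP: "coinv_exact (projective_resolution \<Gamma> C)"
    using C by (simp_all add: acyclic_module_iff)
  obtain S where S: "is_resolution \<Gamma> B S" "\<And>n. projective_module \<Gamma> (term_at S n)"
    "\<And>n. term_at S n = prod_module (term_at (projective_resolution \<Gamma> A) n) (term_at (projective_resolution \<Gamma> C) n)"
    "coinv_exact (projective_resolution \<Gamma> A) \<Longrightarrow> coinv_exact S" "coinv_exact S \<Longrightarrow> coinv_exact (projective_resolution \<Gamma> A)"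
    "\<And>a. \<lbrakk>coinv_exact S; a \<in> carrier (T A); cm B i a = \<one>\<^bsub>T B\<^esub>\<rbrakk> \<Longrightarrow> a = \<one>\<^bsub>T A\<^esub>"
    by (rule horseshoe_coinv[OF A B CM i p ex projective_resolution[OF A] projective_resolution[OF CM] exP]) (assumption | rule that)+
  note iB = acyclic_module_iff_resolution[OF B S(1,2)]
  show "acyclic_module \<Gamma> A \<Longrightarrow> acyclic_module \<Gamma> B" "acyclic_module \<Gamma> B \<Longrightarrow> acyclic_module \<Gamma> A"
    "\<lbrakk>acyclic_module \<Gamma> B; a \<in> carrier (T A); cm B i a = \<one>\<^bsub>T B\<^esub>\<rbrakk> \<Longrightarrow> a = \<one>\<^bsub>T A\<^esub>"
    using S(4-6) A unfolding iB by (auto simp: acyclic_module_iff)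
qed

lemma acyclic_prod:
  assumes A: "acyclic_module \<Gamma> A" and C: "acyclic_module \<Gamma> C"
  shows "acyclic_module \<Gamma> (prod_module A C)"
proof -
  have M: "left_module \<Gamma> A" "left_module \<Gamma> C"
    using A C by (simp_all add: acyclic_module_iff)
  interpret A: left_module \<Gamma> A by (rule M)
  interpret C: left_module \<Gamma> C by (rule M)
  have "gmodule_hom \<Gamma> A (prod_module A C) (\<lambda>x. (x, \<one>\<^bsub>C\<^esub>))" "gmodule_hom \<Gamma> (prod_module A C) C snd"
    by (rule gmodule_homI; auto)+
  moreover have "inj_on (\<lambda>x. (x, \<one>\<^bsub>C\<^esub>)) (carrier A)"
    by (auto simp: inj_on_def)
  moreover have "snd ` carrier (prod_module A C) = carrier C"
    using A.one_closed by force
  moreover have "kernel (prod_module A C) C snd = (\<lambda>x. (x, \<one>\<^bsub>C\<^esub>)) ` carrier A"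
    by (auto simp: kernel_def)
  ultimately show ?thesis
    using acyclic_extension(1)[OF M(1) prod_left_module[OF M] C] A by blast
qed

text \<open>P is its own projective resolution of length 0.\<close>

lemma projective_acyclic:
  assumes P: "projective_module \<Gamma> P"
  shows "acyclic_module \<Gamma> P"
proof -
  have PM: "left_module \<Gamma> P"
    by (rule projective_left_module[OF P])
  interpret P: left_module \<Gamma> P by (rule PM)
  \<comment> \<open>The zero module, placed on the type of P because all terms of a complex share
    one type.\<close>
  define Z where "Z = P\<lparr>carrier := {\<one>\<^bsub>P\<^esub>}\<rparr>"
  have Z: "left_module \<Gamma> Z"
    unfolding Z_def by (rule submodule[OF PM P.triv_subgroup]) simp
  have Zp: "projective_module \<Gamma> Z"
    unfolding projective_module_def
  proof (intro conjI allI impI; (elim conjE)?)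
    fix B :: "('a, 'b \<times> 'a \<Rightarrow> int) gmodule" and C :: "('a, 'b) gmodule" and p f
    assume B: "left_module \<Gamma> B" and C: "left_module \<Gamma> C" and p: "gmodule_hom \<Gamma> B C p" and f: "gmodule_hom \<Gamma> Z C f"
    have "p \<one>\<^bsub>B\<^esub> = f x" if "x \<in> carrier Z" for x
      using that gmodule_hom_one[OF p B C] gmodule_hom_one[OF f Z C] by (simp add: Z_def)
    then show "\<exists>h. gmodule_hom \<Gamma> Z B h \<and> (\<forall>x\<in>carrier Z. p (h x) = f x)"
      using gmodule_hom_trivial[OF B] by blast
  qed (rule Z)
  define Q where "Q = \<lparr>term_at = (\<lambda>n::nat. if n = 0 then P else Z), bdry = (\<lambda>n x. x), aug = (\<lambda>x. x)\<rparr>"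
  have iZ: "gmodule_hom \<Gamma> Z P (\<lambda>x. x)"
    by (rule gmodule_homI) (auto simp: Z_def)
  have Q: "is_resolution \<Gamma> P Q"
    unfolding is_resolution_def
    by (auto simp: Q_def PM Z iZ gmodule_hom_id kernel_def, auto simp: Z_def)
  have "coinv_exact Q"
    unfolding coinv_exact_def
  proof (intro allI ballI impI)
    fix n z assume "z \<in> carrier (T (term_at Q (Suc n)))"
    then have z: "z \<in> carrier (T Z)" by (simp add: Q_def)
    have "cm Z (\<lambda>x. x) z = \<one>\<^bsub>T Z\<^esub>"
      by (rule cm_trivial[OF Z Z gmodule_hom_id _ z]) (simp add: Z_def)
    then have "z = cm (term_at Q (Suc n)) (bdry Q (Suc n)) z"
      using cm_id[OF Z z, of "\<lambda>x. x"] by (simp add: Q_def)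
    then show "z \<in> cm (term_at Q (Suc n)) (bdry Q (Suc n)) ` carrier (T (term_at Q (Suc (Suc n))))"
      using z by (intro image_eqI[of _ _ z]) (simp_all add: Q_def)
  qed
  then show ?thesis
    using acyclic_module_iff_resolution[OF PM Q] P Zp by (simp add: Q_def)
qed

text \<open>Dimension shifting: with Z_n the boundaries in degree n, the sequences 0 -> Z_0 -> Q_0
  -> M -> 0 and 0 -> Z_(n+1) -> Q_(n+1) -> Z_n -> 0 make the Z_n acyclic one after the other, so the
  coinvariants of Z_n inject into those of Q_n. A cycle in the coinvariants of Q_(n+1) therefore
  dies already in those of Z_n, and right exactness finishes.\<close>

lemma acyclic_resolution_exact:
  assumes M: "acyclic_module \<Gamma> M" and Q: "is_acyclic_resolution \<Gamma> M Q"
  shows "coinv_exact Q"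
proof -
  have MM: "left_module \<Gamma> M"
    using M by (simp add: acyclic_module_def)
  have res: "is_resolution \<Gamma> M Q" and ac: "\<And>n. acyclic_module \<Gamma> (term_at Q n)"
    using Q by (simp_all add: is_acyclic_resolution_def)
  note q = resolutionD[OF res]
  define Z where "Z = (\<lambda>n. (term_at Q n)\<lparr>carrier := bdry Q n ` carrier (term_at Q (Suc n))\<rparr>)"
  have Zm: "left_module \<Gamma> (Z n)" for n
    unfolding Z_def by (rule image_module[OF q(1,1,2)])
  have Zi: "gmodule_hom \<Gamma> (Z n) (term_at Q n) (\<lambda>x. x)" for n
    unfolding Z_def by (rule gmodule_hom_inclusion) (auto intro: gmodule_hom_closed[OF q(2)])
  have Zd: "gmodule_hom \<Gamma> (term_at Q (Suc n)) (Z n) (bdry Q n)" "bdry Q n ` carrier (term_at Q (Suc n)) = carrier (Z n)" for n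
    unfolding Z_def by (rule gmodule_hom_restrict[OF q(2)]) simp_all
  have ke: "kernel (term_at Q (Suc n)) (Z n) (bdry Q n) = (\<lambda>x. x) ` carrier (Z (Suc n))" for n
    using res unfolding is_resolution_def by (simp add: Z_def kernel_def)
  have ke0: "kernel (term_at Q 0) M (aug Q) = (\<lambda>x. x) ` carrier (Z 0)"
    using res unfolding is_resolution_def by (simp add: Z_def)
  have Zac: "acyclic_module \<Gamma> (Z n)" for n
  proof (induction n)
    case 0
    show ?case
      by (rule acyclic_extension(2)[OF Zm q(1) M Zi _ q(3,4) ke0 ac]) simp
  next
    case (Suc n)
    show ?case
      by (rule acyclic_extension(2)[OF Zm q(1) Suc Zi _ Zd ke ac]) simp
  qed
  have Zinj: "a = \<one>\<^bsub>T (Z n)\<^esub>" if "a \<in> carrier (T (Z n))" "cm (term_at Q n) (\<lambda>x. x) a = \<one>\<^bsub>T (term_at Q n)\<^esub>" for n a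
  proof (cases n)
    case 0
    show ?thesis
      unfolding 0 by (rule acyclic_extension(3)[OF Zm q(1) M Zi _ q(3,4) ke0 ac]) (use that 0 in simp_all)
  next
    case (Suc k)
    show ?thesis
      unfolding Suc by (rule acyclic_extension(3)[OF Zm q(1) Zac Zi _ Zd ke ac]) (use that Suc in simp_all)
  qed
  show ?thesis
    unfolding coinv_exact_def
  proof (intro allI ballI impI)
    fix n z assume z: "z \<in> carrier (T (term_at Q (Suc n)))" and dz: "cm (term_at Q n) (bdry Q n) z = \<one>\<^bsub>T (term_at Q n)\<^esub>"
    have "cm (term_at Q n) (\<lambda>x. x) (cm (Z n) (bdry Q n) z) = \<one>\<^bsub>T (term_at Q n)\<^esub>"
      using cm_comp[OF q(1) Zm q(1) Zd(1) Zi refl z] dz by simp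
    then have 1: "cm (Z n) (bdry Q n) z = \<one>\<^bsub>T (Z n)\<^esub>"
      by (rule Zinj[OF cm_closed[OF q(1) Zm Zd(1) z]])
    show "z \<in> cm (term_at Q (Suc n)) (bdry Q (Suc n)) ` carrier (T (term_at Q (Suc (Suc n))))"
    proof (rule cm_right_exact[OF q(1) q(1) Zm q(2) Zd _ z 1])
      fix x assume "x \<in> carrier (term_at Q (Suc n))" "bdry Q n x = \<one>\<^bsub>Z n\<^esub>"
      then show "x \<in> bdry Q (Suc n) ` carrier (term_at Q (Suc (Suc n)))"
        using q(6) by (simp add: Z_def)
    qed
  qed
qed

end

section \<open>Comparison with acyclic resolutions\<close>

text \<open>The mapping cone of \<open>\<phi>\<close>, truncated: its term \<open>Q\<^sub>0\<close> is not \<open>term_at\<close> \<open>0\<close> but the augmented module.\<close>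

definition cone :: "('g, 'p, 'm) gcomplex \<Rightarrow> ('g, 'q, 'm) gcomplex \<Rightarrow> (nat \<Rightarrow> 'p \<Rightarrow> 'q) \<Rightarrow> ('g, 'q \<times> 'p, 'q) gcomplex" where
  "cone P Q \<phi> = \<lparr>term_at = (\<lambda>n. prod_module (term_at Q (Suc n)) (term_at P n)),
     bdry = (\<lambda>n z. (bdry Q (Suc n) (fst z) \<otimes>\<^bsub>term_at Q (Suc n)\<^esub> \<phi> (Suc n) (snd z), inv\<^bsub>term_at P n\<^esub> bdry P n (snd z))),
     aug = (\<lambda>z. bdry Q 0 (fst z) \<otimes>\<^bsub>term_at Q 0\<^esub> \<phi> 0 (snd z))\<rparr>"

lemma cone_simps [simp]:
  "term_at (cone P Q \<phi>) n = prod_module (term_at Q (Suc n)) (term_at P n)"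
  "bdry (cone P Q \<phi>) n z =
     (bdry Q (Suc n) (fst z) \<otimes>\<^bsub>term_at Q (Suc n)\<^esub> \<phi> (Suc n) (snd z), inv\<^bsub>term_at P n\<^esub> bdry P n (snd z))"
  "aug (cone P Q \<phi>) z = bdry Q 0 (fst z) \<otimes>\<^bsub>term_at Q 0\<^esub> \<phi> 0 (snd z)"
  by (simp_all add: cone_def)

context ample_groupoid
begin

context
  fixes M :: "('a, 'm) gmodule" and P :: "('a, 'p, 'm) gcomplex" and Q :: "('a, 'q, 'm) gcomplex" and \<phi>
  assumes M: "left_module \<Gamma> M" and P: "is_resolution \<Gamma> M P" and Q: "is_resolution \<Gamma> M Q"
    and \<phi>: "chain_lift \<Gamma> P Q (\<lambda>x. x) \<phi>"
begin

interpretation M: left_module \<Gamma> M by (rule M)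
interpretation P: left_module \<Gamma> "term_at P n" for n by (rule resolutionD(1)[OF P])
interpretation Q: left_module \<Gamma> "term_at Q n" for n by (rule resolutionD(1)[OF Q])

lemmas resP = resolutionD[OF P]
lemmas resQ = resolutionD[OF Q]
lemmas lift = chain_liftD[OF \<phi>]
lemmas hom_rules =
  gmodule_hom_closed[OF resP(2)] gmodule_hom_mult[OF resP(2)] gmodule_hom_inv[OF resP(2,1,1)]
  gmodule_hom_closed[OF resQ(2)] gmodule_hom_mult[OF resQ(2)] gmodule_hom_inv[OF resQ(2,1,1)]
  gmodule_hom_closed[OF resP(3)] gmodule_hom_mult[OF resP(3)] gmodule_hom_inv[OF resP(3,1) M]
  gmodule_hom_closed[OF resQ(3)] gmodule_hom_mult[OF resQ(3)] gmodule_hom_inv[OF resQ(3,1) M]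
  gmodule_hom_closed[OF lift(1)] gmodule_hom_mult[OF lift(1)] gmodule_hom_inv[OF lift(1) resP(1) resQ(1)]

text \<open>With y = - d w, the difference x - \<phi> w is a cycle of Q and so a boundary d u; the
  pair (u, w) is then mapped to (x, y). Exactness at the bottom and above it differ in the reason
  why y is a boundary.\<close>

lemma cone_cycle:
  assumes x: "x \<in> carrier (term_at Q (Suc n))" and y: "y \<in> bdry P n ` carrier (term_at P (Suc n))"
    and eq: "bdry Q n x \<otimes>\<^bsub>term_at Q n\<^esub> \<phi> n y = \<one>\<^bsub>term_at Q n\<^esub>"
  shows "(x, y) \<in> bdry (cone P Q \<phi>) n ` carrier (term_at (cone P Q \<phi>) (Suc n))"
proof -
  note [simp] = hom_rules
  obtain v where v: "v \<in> carrier (term_at P (Suc n))" "y = bdry P n v"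
    using y by (elim imageE)
  define w where "w = inv\<^bsub>term_at P (Suc n)\<^esub> v"
  have w: "w \<in> carrier (term_at P (Suc n))" "y = inv\<^bsub>term_at P n\<^esub> bdry P n w"
    using v by (simp_all add: w_def)
  have "bdry Q n (x \<otimes>\<^bsub>term_at Q (Suc n)\<^esub> inv\<^bsub>term_at Q (Suc n)\<^esub> \<phi> (Suc n) w) = \<one>\<^bsub>term_at Q n\<^esub>"
    using eq w x by (simp add: lift(2))
  then obtain u where u: "u \<in> carrier (term_at Q (Suc (Suc n)))"
    and "x \<otimes>\<^bsub>term_at Q (Suc n)\<^esub> inv\<^bsub>term_at Q (Suc n)\<^esub> \<phi> (Suc n) w = bdry Q (Suc n) u"
    using resQ(6)[of "x \<otimes>\<^bsub>term_at Q (Suc n)\<^esub> inv\<^bsub>term_at Q (Suc n)\<^esub> \<phi> (Suc n) w" n] x w by auto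
  then have "x = bdry Q (Suc n) u \<otimes>\<^bsub>term_at Q (Suc n)\<^esub> \<phi> (Suc n) w"
    using Q.diff_mult_cancel[of x "Suc n" "\<phi> (Suc n) w" "bdry Q (Suc n) u"] x w(1) by simp
  then show ?thesis
    using u w by (intro image_eqI[of _ _ "(u, w)"]) simp_all
qed

text \<open>x has the same augmentation as \<phi> y for some y, so the difference of x and \<phi> y
  is a boundary.\<close>

lemma cone_aug_image:
  assumes x: "x \<in> carrier (term_at Q 0)"
  shows "x \<in> aug (cone P Q \<phi>) ` carrier (term_at (cone P Q \<phi>) 0)"
proof -
  note [simp] = hom_rules
  have "aug Q x \<in> aug P ` carrier (term_at P 0)"
    using x by (simp add: resP(4))
  then obtain y where y: "y \<in> carrier (term_at P 0)" "aug Q x = aug P y"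
    by (elim imageE)
  have "aug Q (x \<otimes>\<^bsub>term_at Q 0\<^esub> inv\<^bsub>term_at Q 0\<^esub> \<phi> 0 y) = \<one>\<^bsub>M\<^esub>"
    using x y by (simp add: lift(3))
  then obtain u where u: "u \<in> carrier (term_at Q (Suc 0))"
    and "x \<otimes>\<^bsub>term_at Q 0\<^esub> inv\<^bsub>term_at Q 0\<^esub> \<phi> 0 y = bdry Q 0 u"
    using resQ(5)[of "x \<otimes>\<^bsub>term_at Q 0\<^esub> inv\<^bsub>term_at Q 0\<^esub> \<phi> 0 y"] x y by auto
  then have "x = bdry Q 0 u \<otimes>\<^bsub>term_at Q 0\<^esub> \<phi> 0 y"
    using Q.diff_mult_cancel[of x 0 "\<phi> 0 y" "bdry Q 0 u"] x y(1) by simp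
  then show ?thesis
    using u y by (intro image_eqI[of _ _ "(u, y)"]) simp_all
qed

lemma cone_fst_snd:
  "gmodule_hom \<Gamma> (term_at (cone P Q \<phi>) n) (term_at Q (Suc n)) fst"
  "gmodule_hom \<Gamma> (term_at (cone P Q \<phi>) n) (term_at P n) snd"
  "gmodule_hom \<Gamma> (term_at Q (Suc n)) (term_at (cone P Q \<phi>) n) (\<lambda>x. (x, \<one>\<^bsub>term_at P n\<^esub>))"
  "gmodule_hom \<Gamma> (term_at P n) (term_at (cone P Q \<phi>) n) (\<lambda>y. (\<one>\<^bsub>term_at Q (Suc n)\<^esub>, y))"
  by (rule gmodule_homI; auto)+

lemma cone_module: "left_module \<Gamma> (term_at (cone P Q \<phi>) n)"
  by (simp add: prod_left_module[OF resQ(1) resP(1)])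

lemma cone_bdry_hom: "gmodule_hom \<Gamma> (term_at (cone P Q \<phi>) (Suc n)) (term_at (cone P Q \<phi>) n) (bdry (cone P Q \<phi>) n)"
proof -
  have 1: "gmodule_hom \<Gamma> (term_at (cone P Q \<phi>) (Suc n)) (term_at Q (Suc n))
      (\<lambda>z. bdry Q (Suc n) (fst z) \<otimes>\<^bsub>term_at Q (Suc n)\<^esub> \<phi> (Suc n) (snd z))"
    by (rule gmodule_hom_times[OF resQ(1) gmodule_hom_comp[OF cone_fst_snd(1) resQ(2)] gmodule_hom_comp[OF cone_fst_snd(2) lift(1)]])
  have 2: "gmodule_hom \<Gamma> (term_at (cone P Q \<phi>) (Suc n)) (term_at P n) (\<lambda>z. inv\<^bsub>term_at P n\<^esub> bdry P n (snd z))"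
    by (rule gmodule_hom_inverse[OF resP(1) gmodule_hom_comp[OF cone_fst_snd(2) resP(2)]])
  show ?thesis
    using 1 2 by (simp add: gmodule_hom_def hom_def Pi_iff)
qed

lemma cone_aug_hom: "gmodule_hom \<Gamma> (term_at (cone P Q \<phi>) 0) (term_at Q 0) (aug (cone P Q \<phi>))"
proof -
  have "gmodule_hom \<Gamma> (term_at (cone P Q \<phi>) 0) (term_at Q 0) (\<lambda>z. bdry Q 0 (fst z) \<otimes>\<^bsub>term_at Q 0\<^esub> \<phi> 0 (snd z))"
    by (rule gmodule_hom_times[OF resQ(1) gmodule_hom_comp[OF cone_fst_snd(1) resQ(2)] gmodule_hom_comp[OF cone_fst_snd(2) lift(1)]])
  then show ?thesis
    by (simp add: cone_def)
qed

lemma cone_cycle_cond: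
  assumes u: "u \<in> carrier (term_at Q (Suc (Suc n)))" and w: "w \<in> carrier (term_at P (Suc n))"
  shows "bdry Q n (bdry Q (Suc n) u \<otimes>\<^bsub>term_at Q (Suc n)\<^esub> \<phi> (Suc n) w) \<otimes>\<^bsub>term_at Q n\<^esub> \<phi> n (inv\<^bsub>term_at P n\<^esub> bdry P n w) = \<one>\<^bsub>term_at Q n\<^esub>"
  using u w by (simp add: resQ(8) lift(2) hom_rules)

text \<open>\<phi> lies over the identity of M, hence is a quasi-isomorphism and its cone is exact;
  taking the last term Q_0 as the augmented module turns the exact cone into a resolution.\<close>

lemma cone_resolution: "is_resolution \<Gamma> (term_at Q 0) (cone P Q \<phi>)"
  unfolding is_resolution_def
proof (intro conjI allI)
  show "left_module \<Gamma> (term_at (cone P Q \<phi>) n)" for n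
    by (rule cone_module)
  show "gmodule_hom \<Gamma> (term_at (cone P Q \<phi>) (Suc n)) (term_at (cone P Q \<phi>) n) (bdry (cone P Q \<phi>) n)" for n
    by (rule cone_bdry_hom)
  show "gmodule_hom \<Gamma> (term_at (cone P Q \<phi>) 0) (term_at Q 0) (aug (cone P Q \<phi>))"
    by (rule cone_aug_hom)
  show "aug (cone P Q \<phi>) ` carrier (term_at (cone P Q \<phi>) 0) = carrier (term_at Q 0)"
    using cone_aug_image gmodule_hom_closed[OF cone_aug_hom] by blast
  have "z \<in> bdry (cone P Q \<phi>) 0 ` carrier (term_at (cone P Q \<phi>) (Suc 0))"
    if z: "z \<in> kernel (term_at (cone P Q \<phi>) 0) (term_at Q 0) (aug (cone P Q \<phi>))" for z
  proof -
    obtain x y where xy: "z = (x, y)" "x \<in> carrier (term_at Q (Suc 0))" "y \<in> carrier (term_at P 0)"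
      and eq: "bdry Q 0 x \<otimes>\<^bsub>term_at Q 0\<^esub> \<phi> 0 y = \<one>\<^bsub>term_at Q 0\<^esub>"
      using z by (auto simp: kernel_def)
    \<comment> \<open>Since \<phi> lies over the identity, \<phi> y has the same augmentation as y,
      while boundaries have trivial augmentation.\<close>
    have "aug Q (bdry Q 0 x \<otimes>\<^bsub>term_at Q 0\<^esub> \<phi> 0 y) = \<one>\<^bsub>M\<^esub>"
      unfolding eq by (rule gmodule_hom_one[OF resQ(3,1) M])
    then have "aug P y = \<one>\<^bsub>M\<^esub>"
      using xy by (simp add: resQ(7) lift(3) hom_rules)
    then show ?thesis
      unfolding xy(1) by (intro cone_cycle[OF xy(2) resP(5)[OF xy(3)] eq])
  qed
  moreover have "bdry (cone P Q \<phi>) 0 z \<in> kernel (term_at (cone P Q \<phi>) 0) (term_at Q 0) (aug (cone P Q \<phi>))"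
    if "z \<in> carrier (term_at (cone P Q \<phi>) (Suc 0))" for z
    using that cone_cycle_cond[of "fst z" 0 "snd z"] gmodule_hom_closed[OF cone_bdry_hom that]
    by (auto simp: kernel_def)
  ultimately show "kernel (term_at (cone P Q \<phi>) 0) (term_at Q 0) (aug (cone P Q \<phi>)) = bdry (cone P Q \<phi>) 0 ` carrier (term_at (cone P Q \<phi>) 1)"
    unfolding One_nat_def by blast
  fix n
  have "z \<in> bdry (cone P Q \<phi>) (Suc n) ` carrier (term_at (cone P Q \<phi>) (Suc (Suc n)))"
    if z: "z \<in> kernel (term_at (cone P Q \<phi>) (Suc n)) (term_at (cone P Q \<phi>) n) (bdry (cone P Q \<phi>) n)" for z
  proof -
    obtain x y where xy: "z = (x, y)" "x \<in> carrier (term_at Q (Suc (Suc n)))" "y \<in> carrier (term_at P (Suc n))"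
      and eq: "bdry Q (Suc n) x \<otimes>\<^bsub>term_at Q (Suc n)\<^esub> \<phi> (Suc n) y = \<one>\<^bsub>term_at Q (Suc n)\<^esub>"
      and eq': "inv\<^bsub>term_at P n\<^esub> bdry P n y = \<one>\<^bsub>term_at P n\<^esub>"
      using z by (auto simp: kernel_def)
    have "bdry P n y = \<one>\<^bsub>term_at P n\<^esub>"
      using eq' xy(3) P.inv_eq_1_iff[of "bdry P n y" n] by (simp add: hom_rules)
    then show ?thesis
      unfolding xy(1) by (intro cone_cycle[OF xy(2) resP(6)[OF xy(3)] eq])
  qed
  moreover have "bdry (cone P Q \<phi>) (Suc n) z \<in> kernel (term_at (cone P Q \<phi>) (Suc n)) (term_at (cone P Q \<phi>) n) (bdry (cone P Q \<phi>) n)"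
    if z: "z \<in> carrier (term_at (cone P Q \<phi>) (Suc (Suc n)))" for z
  proof -
    have "bdry P n (inv\<^bsub>term_at P (Suc n)\<^esub> bdry P (Suc n) (snd z)) = \<one>\<^bsub>term_at P n\<^esub>"
      using z by (auto simp: resP(8) hom_rules)
    then show ?thesis
      using z cone_cycle_cond[of "fst z" "Suc n" "snd z"] gmodule_hom_closed[OF cone_bdry_hom z]
      by (auto simp: kernel_def)
  qed
  ultimately show "kernel (term_at (cone P Q \<phi>) (Suc n)) (term_at (cone P Q \<phi>) n) (bdry (cone P Q \<phi>) n) =
      bdry (cone P Q \<phi>) (Suc n) ` carrier (term_at (cone P Q \<phi>) (Suc (Suc n)))"
    by blast
qed

text \<open>(y, z) is a cycle in the coinvariants of the cone, an acyclic resolution of the acyclic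
  module Q_0, and so is the boundary of some (v, w). With z a cycle whose image is a boundary this
  yields injectivity of the comparison map, and with z trivial its surjectivity in positive
  degrees.\<close>

lemma coinv_cone_cycle:
  assumes ac: "\<And>n. acyclic_module \<Gamma> (term_at P n)" "\<And>n. acyclic_module \<Gamma> (term_at Q n)"
    and z: "z \<in> carrier (T (term_at P n))" and cyc: "\<And>k. n = Suc k \<Longrightarrow> cm (term_at P k) (bdry P k) z = \<one>\<^bsub>T (term_at P k)\<^esub>"
    and y: "y \<in> carrier (T (term_at Q (Suc n)))"
    and eq: "cm (term_at Q n) (bdry Q n) y \<otimes>\<^bsub>T (term_at Q n)\<^esub> cm (term_at Q n) (\<phi> n) z = \<one>\<^bsub>T (term_at Q n)\<^esub>"
  obtains w v where "w \<in> carrier (T (term_at P (Suc n)))" "v \<in> carrier (T (term_at Q (Suc (Suc n))))"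
    "z = inv\<^bsub>T (term_at P n)\<^esub> cm (term_at P n) (bdry P n) w"
    "y = cm (term_at Q (Suc n)) (bdry Q (Suc n)) v \<otimes>\<^bsub>T (term_at Q (Suc n))\<^esub> cm (term_at Q (Suc n)) (\<phi> (Suc n)) w"
proof -
  let ?C = "cone P Q \<phi>"
  let ?i = "\<lambda>n x. (x, \<one>\<^bsub>term_at P n\<^esub>)" and ?k = "\<lambda>n y. (\<one>\<^bsub>term_at Q (Suc n)\<^esub>, y)"
  have gP: "comm_group (T (term_at P n))" and gQ: "comm_group (T (term_at Q n))" and gC: "comm_group (T (term_at ?C n))" for n
    by (rule cm_comm_group[OF resP(1)] cm_comm_group[OF resQ(1)] cm_comm_group[OF cone_module])+
  interpret TP: comm_group "T (term_at P j)" for j by (rule gP)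
  interpret TQ: comm_group "T (term_at Q j)" for j by (rule gQ)
  interpret TC: comm_group "T (term_at ?C j)" for j by (rule gC)
  note mC = cone_module and dC = cone_bdry_hom and fh = cone_fst_snd(1) and sh = cone_fst_snd(2)
    and ih = cone_fst_snd(3) and kh = cone_fst_snd(4)
  \<comment> \<open>The images of y and z in the coinvariants of the cone; their product stands for
    the pair (y, z).\<close>
  define I K where "I = cm (term_at ?C n) (?i n) y" and "K = cm (term_at ?C n) (?k n) z"
  have IK1: "I \<in> carrier (T (term_at ?C n))"
    unfolding I_def by (rule cm_closed[OF resQ(1) mC ih y])
  have IK2: "K \<in> carrier (T (term_at ?C n))"
    unfolding K_def by (rule cm_closed[OF resP(1) mC kh z])
  note IK = IK1 IK2
  let ?X = "I \<otimes>\<^bsub>T (term_at ?C n)\<^esub> K"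
  have X: "?X \<in> carrier (T (term_at ?C n))"
    by (rule TC.m_closed[OF IK])
  have "?X \<in> cm (term_at ?C n) (bdry ?C n) ` carrier (T (term_at ?C (Suc n)))"
  proof (cases n)
    \<comment> \<open>In degree 0 the map out of the cone is the augmentation, and right exactness
      suffices; in higher degrees exactness comes from acyclicity.\<close>
    case 0
    note X0 = X[unfolded 0] and IK0 = IK[unfolded 0]
    have "cm (term_at Q 0) (aug ?C) I = cm (term_at Q 0) (bdry Q 0) y"
      unfolding I_def 0 using y gmodule_hom_one[OF lift(1) resP(1) resQ(1)]
      by (intro cm_comp[OF resQ(1) mC resQ(1) ih cone_aug_hom]) (simp_all add: 0 hom_rules)
    moreover have "cm (term_at Q 0) (aug ?C) K = cm (term_at Q 0) (\<phi> 0) z"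
      unfolding K_def 0 using z gmodule_hom_one[OF resQ(2,1,1)]
      by (intro cm_comp[OF resP(1) mC resQ(1) kh cone_aug_hom]) (simp_all add: 0 hom_rules)
    ultimately have "cm (term_at Q 0) (aug ?C) (I \<otimes>\<^bsub>T (term_at ?C 0)\<^esub> K) = \<one>\<^bsub>T (term_at Q 0)\<^esub>"
      using cm_mult[OF mC resQ(1) cone_aug_hom IK0] eq by (simp add: 0)
    then show ?thesis
      unfolding 0
      by (intro cm_right_exact[OF mC mC resQ(1) dC cone_aug_hom resolutionD(4)[OF cone_resolution] resolutionD(5)[OF cone_resolution] X0])
  next
    case (Suc k)
    note XS = X[unfolded Suc] and IKS = IK[unfolded Suc]
    have 1: "cm (term_at ?C k) (bdry ?C k) I = cm (term_at ?C k) (?i k) (cm (term_at Q (Suc k)) (bdry Q (Suc k)) y)"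
      unfolding I_def Suc
    proof (rule cm_square[OF resQ(1) mC resQ(1) mC ih dC resQ(2) ih _ y[unfolded Suc]])
      fix x assume "x \<in> carrier (term_at Q (Suc (Suc k)))"
      then show "bdry ?C k (x, \<one>\<^bsub>term_at P (Suc k)\<^esub>) = (bdry Q (Suc k) x, \<one>\<^bsub>term_at P k\<^esub>)"
        using gmodule_hom_one[OF lift(1) resP(1) resQ(1)] gmodule_hom_one[OF resP(2,1,1)] by (simp add: hom_rules)
    qed
    have kI: "gmodule_hom \<Gamma> (term_at P k) (term_at ?C k) (\<lambda>x. ?k k (inv\<^bsub>term_at P k\<^esub> x))"
      by (rule gmodule_hom_comp[OF gmodule_hom_inverse[OF resP(1) gmodule_hom_id] kh])
    have "cm (term_at ?C k) (bdry ?C k) K = cm (term_at ?C k) (\<lambda>y. bdry ?C k (?k (Suc k) y)) z"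
      unfolding K_def Suc by (rule cm_comp[OF resP(1) mC mC kh dC refl z[unfolded Suc]])
    also have "\<dots> = cm (term_at ?C k) (\<lambda>y. ?i k (\<phi> (Suc k) y)) z \<otimes>\<^bsub>T (term_at ?C k)\<^esub>
        cm (term_at ?C k) (\<lambda>y. ?k k (inv\<^bsub>term_at P k\<^esub> bdry P k y)) z"
    proof (rule cm_times[OF resP(1) mC gmodule_hom_comp[OF lift(1) ih] gmodule_hom_comp[OF resP(2) kI] _ z[unfolded Suc]])
      fix x assume "x \<in> carrier (term_at P (Suc k))"
      then show "bdry ?C k (\<one>\<^bsub>term_at Q (Suc (Suc k))\<^esub>, x) = ?i k (\<phi> (Suc k) x) \<otimes>\<^bsub>term_at ?C k\<^esub> ?k k (inv\<^bsub>term_at P k\<^esub> bdry P k x)"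
        using gmodule_hom_one[OF resQ(2,1,1)] by (simp add: hom_rules)
    qed
    also have "cm (term_at ?C k) (\<lambda>y. ?i k (\<phi> (Suc k) y)) z = cm (term_at ?C k) (?i k) (cm (term_at Q (Suc k)) (\<phi> (Suc k)) z)"
      by (rule cm_comp[OF resP(1) resQ(1) mC lift(1) ih refl z[unfolded Suc], symmetric])
    also have "cm (term_at ?C k) (\<lambda>y. ?k k (inv\<^bsub>term_at P k\<^esub> bdry P k y)) z =
        cm (term_at ?C k) (\<lambda>x. ?k k (inv\<^bsub>term_at P k\<^esub> x)) (cm (term_at P k) (bdry P k) z)"
      by (rule cm_comp[OF resP(1) resP(1) mC resP(2) kI refl z[unfolded Suc], symmetric])
    also have "\<dots> = \<one>\<^bsub>T (term_at ?C k)\<^esub>"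
      using cyc[OF Suc] cm_one[OF resP(1) mC kI] by simp
    finally have 2: "cm (term_at ?C k) (bdry ?C k) K = cm (term_at ?C k) (?i k) (cm (term_at Q (Suc k)) (\<phi> (Suc k)) z)"
      unfolding TC.r_one[OF cm_closed[OF resQ(1) mC ih cm_closed[OF resP(1) resQ(1) lift(1) z[unfolded Suc]]]] .
    have "cm (term_at ?C k) (bdry ?C k) (I \<otimes>\<^bsub>T (term_at ?C (Suc k))\<^esub> K) = \<one>\<^bsub>T (term_at ?C k)\<^esub>"
      unfolding cm_mult[OF mC mC dC IKS] 1 2
      using cm_mult[OF resQ(1) mC ih cm_closed[OF resQ(1,1,2) y[unfolded Suc]] cm_closed[OF resP(1) resQ(1) lift(1) z[unfolded Suc]], symmetric]
        eq[unfolded Suc] cm_one[OF resQ(1) mC ih] by (simp del: cone_simps)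
    moreover have "coinv_exact ?C"
    proof (rule acyclic_resolution_exact[OF ac(2)])
      show "is_acyclic_resolution \<Gamma> (term_at Q 0) ?C"
        unfolding is_acyclic_resolution_def using cone_resolution ac by (simp add: acyclic_prod)
    qed
    ultimately show ?thesis
      unfolding Suc by (intro coinv_exactD[OF _ XS])
  qed
  then obtain V where V: "V \<in> carrier (T (term_at ?C (Suc n)))" "?X = cm (term_at ?C n) (bdry ?C n) V"
    by (elim imageE)
  \<comment> \<open>Projecting the boundary equation to the two summands of the cone gives the two
    identities; the inverse in the first stems from the negated differential of P in the
    cone.\<close>
  define w v where "w = cm (term_at P (Suc n)) snd V" and "v = cm (term_at Q (Suc (Suc n))) fst V"
  note w = cm_closed[OF mC resP(1) sh V(1), folded w_def] and v = cm_closed[OF mC resQ(1) fh V(1), folded v_def]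
  have "cm (term_at P n) snd ?X = cm (term_at P n) snd I \<otimes>\<^bsub>T (term_at P n)\<^esub> cm (term_at P n) snd K"
    by (rule cm_mult[OF mC resP(1) sh IK])
  moreover have "cm (term_at P n) snd I = \<one>\<^bsub>T (term_at P n)\<^esub>"
    unfolding I_def by (rule cm_comp_one[OF resQ(1) mC resP(1) ih sh _ y]) simp
  moreover have "cm (term_at P n) snd K = z"
    unfolding K_def using cm_comp[OF resP(1) mC resP(1) kh sh _ z, of "\<lambda>x. x"] cm_id[OF resP(1) z] by simp
  moreover have "cm (term_at P n) snd ?X = inv\<^bsub>T (term_at P n)\<^esub> cm (term_at P n) (bdry P n) w"
  proof -
    have "cm (term_at P n) snd ?X = cm (term_at P n) (\<lambda>c. inv\<^bsub>term_at P n\<^esub> bdry P n (snd c)) V"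
      unfolding V(2) by (rule cm_comp[OF mC mC resP(1) dC sh _ V(1)]) simp
    also have "\<dots> = inv\<^bsub>T (term_at P n)\<^esub> cm (term_at P n) (\<lambda>c. bdry P n (snd c)) V"
      by (rule cm_inverse[OF mC resP(1) gmodule_hom_comp[OF sh resP(2)] refl V(1)])
    also have "cm (term_at P n) (\<lambda>c. bdry P n (snd c)) V = cm (term_at P n) (bdry P n) w"
      unfolding w_def by (rule cm_comp[OF mC resP(1) resP(1) sh resP(2) refl V(1), symmetric])
    finally show ?thesis .
  qed
  ultimately have zw: "z = inv\<^bsub>T (term_at P n)\<^esub> cm (term_at P n) (bdry P n) w"
    using z by simp
  have "cm (term_at Q (Suc n)) fst ?X = cm (term_at Q (Suc n)) fst I \<otimes>\<^bsub>T (term_at Q (Suc n))\<^esub> cm (term_at Q (Suc n)) fst K"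
    by (rule cm_mult[OF mC resQ(1) fh IK])
  moreover have "cm (term_at Q (Suc n)) fst K = \<one>\<^bsub>T (term_at Q (Suc n))\<^esub>"
    unfolding K_def by (rule cm_comp_one[OF resP(1) mC resQ(1) kh fh _ z]) simp
  moreover have "cm (term_at Q (Suc n)) fst I = y"
    unfolding I_def using cm_comp[OF resQ(1) mC resQ(1) ih fh _ y, of "\<lambda>x. x"] cm_id[OF resQ(1) y] by simp
  moreover have "cm (term_at Q (Suc n)) fst ?X = cm (term_at Q (Suc n)) (bdry Q (Suc n)) v \<otimes>\<^bsub>T (term_at Q (Suc n))\<^esub> cm (term_at Q (Suc n)) (\<phi> (Suc n)) w"
  proof -
    have "cm (term_at Q (Suc n)) fst ?X =
        cm (term_at Q (Suc n)) (\<lambda>c. bdry Q (Suc n) (fst c) \<otimes>\<^bsub>term_at Q (Suc n)\<^esub> \<phi> (Suc n) (snd c)) V"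
      unfolding V(2) by (rule cm_comp[OF mC mC resQ(1) dC fh _ V(1)]) simp
    also have "\<dots> = cm (term_at Q (Suc n)) (\<lambda>c. bdry Q (Suc n) (fst c)) V \<otimes>\<^bsub>T (term_at Q (Suc n))\<^esub>
        cm (term_at Q (Suc n)) (\<lambda>c. \<phi> (Suc n) (snd c)) V"
      by (rule cm_times[OF mC resQ(1) gmodule_hom_comp[OF fh resQ(2)] gmodule_hom_comp[OF sh lift(1)] refl V(1)])
    also have "cm (term_at Q (Suc n)) (\<lambda>c. bdry Q (Suc n) (fst c)) V = cm (term_at Q (Suc n)) (bdry Q (Suc n)) v"
      unfolding v_def by (rule cm_comp[OF mC resQ(1) resQ(1) fh resQ(2) refl V(1), symmetric])
    also have "cm (term_at Q (Suc n)) (\<lambda>c. \<phi> (Suc n) (snd c)) V = cm (term_at Q (Suc n)) (\<phi> (Suc n)) w"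
      unfolding w_def by (rule cm_comp[OF mC resP(1) resQ(1) sh lift(1) refl V(1), symmetric])
    finally show ?thesis .
  qed
  ultimately have "y = cm (term_at Q (Suc n)) (bdry Q (Suc n)) v \<otimes>\<^bsub>T (term_at Q (Suc n))\<^esub> cm (term_at Q (Suc n)) (\<phi> (Suc n)) w"
    using y by simp
  with w v zw show thesis
    by (rule that)
qed

end

lemma cycle_coinvD:
  assumes "z \<in> cycles (coinvariants_complex \<Gamma> P) (coinvariants_bdry \<Gamma> P) n"
  shows "z \<in> carrier (T (term_at P n))" "n = Suc k \<Longrightarrow> cm (term_at P k) (bdry P k) z = \<one>\<^bsub>T (term_at P k)\<^esub>"
  using assms by (simp_all add: cycles_iff)

theorem comparison_iso:
  assumes M: "left_module \<Gamma> M" and Q: "is_acyclic_resolution \<Gamma> M Q"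
  shows "comparison \<Gamma> M Q n \<in> iso (homology \<Gamma> M n) (coinvariants_homology \<Gamma> Q n)"
proof -
  define P where "P = projective_resolution \<Gamma> M"
  define \<phi> where "\<phi> = (SOME \<phi>. chain_lift \<Gamma> P Q (\<lambda>x. x) \<phi>)"
  have P: "is_resolution \<Gamma> M P" and Pp: "projective_module \<Gamma> (term_at P n)" for n
    unfolding P_def by (rule projective_resolution[OF M])+
  have R: "is_resolution \<Gamma> M Q" and Qac: "acyclic_module \<Gamma> (term_at Q n)" for n
    using Q by (simp_all add: is_acyclic_resolution_def)
  note Pac = projective_acyclic[OF Pp]
  note p = resolutionD[OF P] and q = resolutionD[OF R]
  have \<phi>: "chain_lift \<Gamma> P Q (\<lambda>x. x) \<phi>"
    unfolding \<phi>_def by (rule someI_ex[OF chain_lift_exists[OF P Pp R M M gmodule_hom_id]])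
  note l = chain_liftD[OF \<phi>]
  let ?\<alpha> = "\<lambda>k. cm (term_at Q k) (\<phi> k)"
  have "complex_homology_map (coinvariants_complex \<Gamma> Q) (coinvariants_bdry \<Gamma> Q) ?\<alpha> n \<in>
      iso (complex_homology (coinvariants_complex \<Gamma> P) (coinvariants_bdry \<Gamma> P) n)
        (complex_homology (coinvariants_complex \<Gamma> Q) (coinvariants_bdry \<Gamma> Q) n)"
  proof (rule homology_map_iso[OF coinvariants_chain_complex[OF P] coinvariants_chain_complex[OF R]])
    show "?\<alpha> k \<in> hom (T (term_at P k)) (T (term_at Q k))" for k
      by (rule cm_hom[OF p(1) q(1) l(1)])
    show "?\<alpha> k (cm (term_at P k) (bdry P k) x) = cm (term_at Q k) (bdry Q k) (?\<alpha> (Suc k) x)"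
      if x: "x \<in> carrier (T (term_at P (Suc k)))" for k x
      by (rule cm_square[OF p(1,1) q(1,1) p(2) l(1,1) q(2) l(2) x])
    interpret TP: comm_group "T (term_at P j)" for j by (rule cm_comm_group[OF p(1)])
    interpret TQ: comm_group "T (term_at Q j)" for j by (rule cm_comm_group[OF q(1)])
    fix z
    assume z: "z \<in> cycles (coinvariants_complex \<Gamma> P) (coinvariants_bdry \<Gamma> P) n"
      and b: "?\<alpha> n z \<in> boundaries (coinvariants_complex \<Gamma> Q) (coinvariants_bdry \<Gamma> Q) n"
    note zc = cycle_coinvD[OF z]
    obtain u where u: "u \<in> carrier (T (term_at Q (Suc n)))" "?\<alpha> n z = cm (term_at Q n) (bdry Q n) u"
      using b unfolding boundaries_def by (elim imageE)
    \<comment> \<open>\<open>coinv_cone_cycle\<close> asks, additively, for d y + \<phi> z = 0, so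
      the inverse of u is supplied as y.\<close>
    have iu: "inv\<^bsub>T (term_at Q (Suc n))\<^esub> u \<in> carrier (T (term_at Q (Suc n)))"
      by (rule TQ.inv_closed[OF u(1)])
    have "cm (term_at Q n) (bdry Q n) (inv\<^bsub>T (term_at Q (Suc n))\<^esub> u) \<otimes>\<^bsub>T (term_at Q n)\<^esub> ?\<alpha> n z = \<one>\<^bsub>T (term_at Q n)\<^esub>"
      unfolding u(2) cm_inv[OF q(1,1,2) u(1)] by (rule TQ.l_inv[OF cm_closed[OF q(1,1,2) u(1)]])
    then obtain w where w: "w \<in> carrier (T (term_at P (Suc n)))"
      and zw: "z = inv\<^bsub>T (term_at P n)\<^esub> cm (term_at P n) (bdry P n) w"
      using coinv_cone_cycle[OF M P R \<phi> Pac Qac zc iu] by blast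
    have "z = cm (term_at P n) (bdry P n) (inv\<^bsub>T (term_at P (Suc n))\<^esub> w)"
      unfolding zw by (rule cm_inv[OF p(1,1,2) w, symmetric])
    then show "z \<in> boundaries (coinvariants_complex \<Gamma> P) (coinvariants_bdry \<Gamma> P) n"
      unfolding boundaries_def by (rule image_eqI[OF _ TP.inv_closed[OF w]])
  next
    interpret TP: comm_group "T (term_at P j)" for j by (rule cm_comm_group[OF p(1)])
    interpret TQ: comm_group "T (term_at Q j)" for j by (rule cm_comm_group[OF q(1)])
    fix y assume "y \<in> cycles (coinvariants_complex \<Gamma> Q) (coinvariants_bdry \<Gamma> Q) n"
    note y = cycle_coinvD[OF this]
    show "\<exists>z \<in> cycles (coinvariants_complex \<Gamma> P) (coinvariants_bdry \<Gamma> P) n. \<exists>w \<in> carrier (T (term_at Q (Suc n))).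
        y = ?\<alpha> n z \<otimes>\<^bsub>T (term_at Q n)\<^esub> cm (term_at Q n) (bdry Q n) w"
    proof (cases n)
      \<comment> \<open>In degree 0 the surjective augmentation of the cone expresses y as an image
        under \<phi> times a boundary.\<close>
      case 0
      let ?C = "cone P Q \<phi>"
      note C = resolutionD[OF cone_resolution[OF M P R \<phi>]]
      note fs = cone_fst_snd[OF M P R \<phi>]
      have "y \<in> cm (term_at Q 0) (aug ?C) ` carrier (T (term_at ?C 0))"
        using y(1) cm_surj[OF C(1) q(1) C(3,4)] by (simp add: 0)
      then obtain V where V: "V \<in> carrier (T (term_at ?C 0))" "y = cm (term_at Q 0) (aug ?C) V"
        by (elim imageE)
      have "y = cm (term_at Q 0) (\<lambda>c. \<phi> 0 (snd c)) V \<otimes>\<^bsub>T (term_at Q 0)\<^esub> cm (term_at Q 0) (\<lambda>c. bdry Q 0 (fst c)) V"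
        unfolding V(2)
      proof (rule cm_times[OF C(1) q(1) gmodule_hom_comp[OF fs(2) l(1)] gmodule_hom_comp[OF fs(1) q(2)] _ V(1)])
        interpret q0: left_module \<Gamma> "term_at Q 0" by (rule q(1))
        fix c assume "c \<in> carrier (term_at ?C 0)"
        then show "aug ?C c = \<phi> 0 (snd c) \<otimes>\<^bsub>term_at Q 0\<^esub> bdry Q 0 (fst c)"
          using q0.m_comm[OF gmodule_hom_closed[OF q(2), of "fst c"] gmodule_hom_closed[OF l(1), of "snd c"]] by auto
      qed
      then have "y = ?\<alpha> 0 (cm (term_at P 0) snd V) \<otimes>\<^bsub>T (term_at Q 0)\<^esub> cm (term_at Q 0) (bdry Q 0) (cm (term_at Q (Suc 0)) fst V)"
        using cm_comp[OF C(1) p(1) q(1) fs(2) l(1) refl V(1)] cm_comp[OF C(1) q(1) q(1) fs(1) q(2) refl V(1)] by simp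
      then show ?thesis
        unfolding 0 using cm_closed[OF C(1) p(1) fs(2) V(1)] cm_closed[OF C(1) q(1) fs(1) V(1)]
        by (intro bexI[of _ "cm (term_at P 0) snd V"] bexI[of _ "cm (term_at Q (Suc 0)) fst V"]) (simp_all only: cycles_iff, simp_all)
    next
      case (Suc k)
      note yS = y(1)[unfolded Suc] and one = TP.one_closed[of k]
      \<comment> \<open>Here y has degree k + 1 and is paired with the trivial element in degree k;
        the w obtained has trivial boundary and is the required cycle.\<close>
      have "cm (term_at Q k) (bdry Q k) y \<otimes>\<^bsub>T (term_at Q k)\<^esub> ?\<alpha> k \<one>\<^bsub>T (term_at P k)\<^esub> = \<one>\<^bsub>T (term_at Q k)\<^esub>"
        using y(2)[OF Suc] cm_one[OF p(1) q(1) l(1)] by simp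
      moreover have "cm (term_at P j) (bdry P j) \<one>\<^bsub>T (term_at P k)\<^esub> = \<one>\<^bsub>T (term_at P j)\<^esub>" if "k = Suc j" for j
        unfolding that by (rule cm_one[OF p(1,1,2)])
      ultimately obtain w v where w: "w \<in> carrier (T (term_at P (Suc k)))" and v: "v \<in> carrier (T (term_at Q (Suc (Suc k))))"
        and w1: "\<one>\<^bsub>T (term_at P k)\<^esub> = inv\<^bsub>T (term_at P k)\<^esub> cm (term_at P k) (bdry P k) w"
        and yv: "y = cm (term_at Q (Suc k)) (bdry Q (Suc k)) v \<otimes>\<^bsub>T (term_at Q (Suc k))\<^esub> ?\<alpha> (Suc k) w"
        using coinv_cone_cycle[OF M P R \<phi> Pac Qac one _ yS] by blast
      have "cm (term_at P k) (bdry P k) w = \<one>\<^bsub>T (term_at P k)\<^esub>"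
        using w1 TP.inv_eq_1_iff[OF cm_closed[OF p(1,1,2) w]] by simp
      then have "w \<in> cycles (coinvariants_complex \<Gamma> P) (coinvariants_bdry \<Gamma> P) (Suc k)"
        using w by (simp add: cycles_iff)
      moreover have "y = ?\<alpha> (Suc k) w \<otimes>\<^bsub>T (term_at Q (Suc k))\<^esub> cm (term_at Q (Suc k)) (bdry Q (Suc k)) v"
        using TQ.m_comm[OF cm_closed[OF q(1,1,2) v] cm_closed[OF p(1) q(1) l(1) w]] yv by simp
      ultimately show ?thesis
        unfolding Suc using v by (intro bexI)
    qed
  qed
  then show ?thesis
    unfolding comparison_def homology_def coinvariants_homology_def coinvariants_homology_map_def Let_def
      P_def[symmetric] \<phi>_def[symmetric] .
qed

end

section \<open>The induced map in homology\<close>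

context ample_correspondence
begin

lemma Ind_map_square:
  assumes M: "left_module H M" and N: "left_module H N" and N': "left_module H N'" and L: "left_module H L"
    and f: "gmodule_hom H M N f" and g: "gmodule_hom H N L g" and f': "gmodule_hom H M N' f'" and g': "gmodule_hom H N' L g'"
    and eq: "\<And>x. x \<in> carrier M \<Longrightarrow> g (f x) = g' (f' x)" and X: "X \<in> carrier (Ind G H \<Omega> M)"
  shows "Ind_map H \<Omega> L g (Ind_map H \<Omega> N f X) = Ind_map H \<Omega> L g' (Ind_map H \<Omega> N' f' X)"
proof -
  have X': "X \<in> carrier (tensor H (corr_rmodule H \<Omega>) M)"
    using X by (simp add: Ind_simps)
  show ?thesis
    using tensor_map_comp[OF right_acted_corr M N L f g refl X'] tensor_map_comp[OF right_acted_corr M N' L f' g' eq X']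
    by (simp add: Ind_map_eq)
qed

text \<open>Compatibility with the boundaries combines the square for ft with naturality of \<delta>
  \<otimes> id along the boundary of Q.\<close>

lemma corr_chain_map:
  assumes P: "is_resolution G M P" and N: "left_module H N" and Q: "is_resolution H N Q"
    and ft: "chain_lift G P (Ind_complex G H \<Omega> N Q) f ft"
  shows "corr_chain_map G H \<Omega> Q ft n \<in> hom (coinvariants G (term_at P n)) (coinvariants H (term_at Q n))"
    and "X \<in> carrier (coinvariants G (term_at P (Suc n))) \<Longrightarrow>
      corr_chain_map G H \<Omega> Q ft n (coinvariants_bdry G P n X) = coinvariants_bdry H Q n (corr_chain_map G H \<Omega> Q ft (Suc n) X)"
proof -
  note p = G.resolutionD[OF P] and q = H.resolutionD[OF Q]
  note I = Ind_module[OF q(1)]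
  have ft': "gmodule_hom G (term_at P n) (Ind G H \<Omega> (term_at Q n)) (ft n)" for n
    using G.chain_liftD(1)[OF ft] by (simp add: Ind_complex_def)
  show "corr_chain_map G H \<Omega> Q ft n \<in> hom (coinvariants G (term_at P n)) (coinvariants H (term_at Q n))"
    unfolding corr_chain_map_def using G.cm_hom[OF p(1) I ft'] delta_tensor_hom[OF q(1)]
    by (rule Group.hom_compose)
  assume X: "X \<in> carrier (coinvariants G (term_at P (Suc n)))"
  have "G.cm (Ind G H \<Omega> (term_at Q n)) (ft n) (coinvariants_bdry G P n X) =
      G.cm (Ind G H \<Omega> (term_at Q n)) (Ind_map H \<Omega> (term_at Q n) (bdry Q n)) (G.cm (Ind G H \<Omega> (term_at Q (Suc n))) (ft (Suc n)) X)"
    using G.chain_liftD(2)[OF ft]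
    by (intro G.cm_square[OF p(1,1) I I p(2) ft' ft' Ind_map_hom[OF q(1,1,2)] _ X]) (simp add: Ind_complex_def)
  then show "corr_chain_map G H \<Omega> Q ft n (coinvariants_bdry G P n X) = coinvariants_bdry H Q n (corr_chain_map G H \<Omega> Q ft (Suc n) X)"
    unfolding corr_chain_map_def comp_apply
    using delta_tensor_natural[OF q(1,1,2) G.cm_closed[OF p(1) I ft' X]] by simp
qed

lemma chain_lift_Ind_map:
  assumes P: "is_resolution G M P" and N: "left_module H N" and R: "is_resolution H N R" and Q: "is_resolution H N Q"
    and ft: "chain_lift G P (Ind_complex G H \<Omega> N R) f ft" and \<psi>: "chain_lift H R Q (\<lambda>x. x) \<psi>"
  shows "chain_lift G P (Ind_complex G H \<Omega> N Q) f (\<lambda>n x. Ind_map H \<Omega> (term_at Q n) (\<psi> n) (ft n x))"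
proof -
  note p = G.resolutionD[OF P] and q = H.resolutionD[OF Q] and r = H.resolutionD[OF R]
  note l = H.chain_liftD[OF \<psi>]
  have ft1: "gmodule_hom G (term_at P n) (Ind G H \<Omega> (term_at R n)) (ft n)" for n
    using G.chain_liftD(1)[OF ft] by (simp add: Ind_complex_def)
  have ft2: "ft n (bdry P n x) = Ind_map H \<Omega> (term_at R n) (bdry R n) (ft (Suc n) x)" if "x \<in> carrier (term_at P (Suc n))" for n x
    using G.chain_liftD(2)[OF ft that] by (simp add: Ind_complex_def)
  have ft3: "Ind_map H \<Omega> N (aug R) (ft 0 x) = f (aug P x)" if "x \<in> carrier (term_at P 0)" for x
    using G.chain_liftD(3)[OF ft that] by (simp add: Ind_complex_def)
  have 1: "gmodule_hom G (term_at P n) (Ind G H \<Omega> (term_at Q n)) (\<lambda>x. Ind_map H \<Omega> (term_at Q n) (\<psi> n) (ft n x))" for n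
    by (rule gmodule_hom_comp[OF ft1 Ind_map_hom[OF r(1) q(1) l(1)]])
  have 2: "Ind_map H \<Omega> (term_at Q n) (\<psi> n) (ft n (bdry P n x)) =
      Ind_map H \<Omega> (term_at Q n) (bdry Q n) (Ind_map H \<Omega> (term_at Q (Suc n)) (\<psi> (Suc n)) (ft (Suc n) x))"
    if x: "x \<in> carrier (term_at P (Suc n))" for n x
    unfolding ft2[OF x]
    by (rule Ind_map_square[OF r(1,1) q(1,1) r(2) l(1,1) q(2) l(2) gmodule_hom_closed[OF ft1 x]])
  have 3: "Ind_map H \<Omega> N (aug Q) (Ind_map H \<Omega> (term_at Q 0) (\<psi> 0) (ft 0 x)) = f (aug P x)"
    if x: "x \<in> carrier (term_at P 0)" for x
  proof -
    have "Ind_map H \<Omega> N (aug Q) (Ind_map H \<Omega> (term_at Q 0) (\<psi> 0) (ft 0 x)) =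
        Ind_map H \<Omega> N (\<lambda>x. x) (Ind_map H \<Omega> N (aug R) (ft 0 x))"
      by (rule Ind_map_square[OF r(1) q(1) N N l(1) q(3) r(3) gmodule_hom_id l(3) gmodule_hom_closed[OF ft1 x]])
    also have "\<dots> = Ind_map H \<Omega> N (aug R) (ft 0 x)"
      unfolding Ind_map_eq
      using gmodule_hom_closed[OF Ind_map_hom[OF r(1) N r(3)] gmodule_hom_closed[OF ft1 x]]
      by (intro tensor_map_id[OF right_acted_corr N]) (simp_all add: Ind_simps Ind_map_eq)
    finally show ?thesis
      using ft3[OF x] by simp
  qed
  show ?thesis
    unfolding chain_lift_def by (simp add: Ind_complex_def 1 2 3)
qed

lemma chain_lift_precompose:
  assumes "chain_lift G R P (\<lambda>x. x) \<phi>" and "chain_lift G P Q f ft"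
  shows "chain_lift G R Q f (\<lambda>n x. ft n (\<phi> n x))"
  unfolding chain_lift_def
  using gmodule_hom_comp[OF G.chain_liftD(1)[OF assms(1)] G.chain_liftD(1)[OF assms(2)]]
    G.chain_liftD(2,3)[OF assms(1)] G.chain_liftD(2,3)[OF assms(2)] gmodule_hom_closed[OF G.chain_liftD(1)[OF assms(1)]]
  by simp

text \<open>The homotopy between a and b takes values in the induced complex, where exactness
  provides it. On a cycle the two maps differ by the boundary of some y there, and \<delta>
  \<otimes> id carries this to a boundary in the coinvariants of Q.\<close>

lemma chain_lifts_same_class:
  assumes P: "is_resolution G M P" "\<And>n. projective_module G (term_at P n)"
    and N: "left_module H N" and Q: "is_resolution H N Q" and f: "gmodule_hom G M (Ind G H \<Omega> N) f"
    and a: "chain_lift G P (Ind_complex G H \<Omega> N Q) f a" and b: "chain_lift G P (Ind_complex G H \<Omega> N Q) f b"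
    and z: "z \<in> cycles (coinvariants_complex G P) (coinvariants_bdry G P) n"
  shows "boundaries (coinvariants_complex H Q) (coinvariants_bdry H Q) n #>\<^bsub>coinvariants H (term_at Q n)\<^esub> corr_chain_map G H \<Omega> Q a n z =
    boundaries (coinvariants_complex H Q) (coinvariants_bdry H Q) n #>\<^bsub>coinvariants H (term_at Q n)\<^esub> corr_chain_map G H \<Omega> Q b n z"
proof -
  note p = G.resolutionD[OF P(1)] and q = H.resolutionD[OF Q]
  note zc = G.cycle_coinvD[OF z]
  note I = Ind_module[OF q(1)]
  have b1: "gmodule_hom G (term_at P n) (Ind G H \<Omega> (term_at Q n)) (b n)"
    using G.chain_liftD(1)[OF b] by (simp add: Ind_complex_def)
  have d: "gmodule_hom G (Ind G H \<Omega> (term_at Q (Suc n))) (Ind G H \<Omega> (term_at Q n)) (Ind_map H \<Omega> (term_at Q n) (bdry Q n))"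
    by (rule Ind_map_hom[OF q(1,1,2)])
  obtain y where y: "y \<in> carrier (coinvariants G (Ind G H \<Omega> (term_at Q (Suc n))))"
    and eq: "G.cm (Ind G H \<Omega> (term_at Q n)) (a n) z = G.cm (Ind G H \<Omega> (term_at Q n)) (b n) z
      \<otimes>\<^bsub>coinvariants G (Ind G H \<Omega> (term_at Q n))\<^esub> G.cm (Ind G H \<Omega> (term_at Q n)) (Ind_map H \<Omega> (term_at Q n) (bdry Q n)) y"
    using G.lifts_agree_on_cycles[OF P Ind_resolution[OF N Q] Ind_module[OF N] a b f zc] by (auto simp: Ind_complex_def)
  note \<delta> = delta_tensor_hom[OF q(1)]
  have "corr_chain_map G H \<Omega> Q a n z = corr_chain_map G H \<Omega> Q b n z \<otimes>\<^bsub>coinvariants H (term_at Q n)\<^esub>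
      coinvariants_bdry H Q n (delta_tensor G H \<Omega> (term_at Q (Suc n)) y)"
    unfolding corr_chain_map_def comp_apply eq
      hom_mult[OF \<delta> G.cm_closed[OF p(1) I b1 zc(1)] G.cm_closed[OF I I d y]]
      delta_tensor_natural[OF q(1,1,2) y] ..
  then show ?thesis
    by (rule cls_eqI[OF H.coinvariants_chain_complex[OF Q] hom_in_carrier[OF corr_chain_map(1)[OF P(1) N Q b] zc(1)]
          hom_in_carrier[OF \<delta> y]])
qed

end

text \<open>That a chain map induces H(\<Omega>, f) is understood through the comparison maps, whose
  bijectivity therefore belongs to the conclusion. The choice of a lift in
  \<open>homology_map\<close> does not affect the result, because any two lifts give the same class
  on cycles.\<close>

theorem theorem3p5:
  fixes G :: "'g groupoid" and H :: "'h groupoid" and \<Omega> :: "('g, 'h, 'w) correspondence"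
    and M :: "('g, 'm) gmodule" and N :: "('h, 'n) gmodule" and f :: "'m \<Rightarrow> ('w, 'n) ind"
  assumes "ample_groupoid G" and "ample_groupoid H" and "etale_correspondence G H \<Omega>"
    and "left_module G M" and "left_module H N" and "gmodule_hom G M (Ind G H \<Omega> N) f"
  shows "(\<forall>n. homology_map G H \<Omega> M N f n \<in> hom (homology G M n) (homology H N n)) \<and>
    (\<forall>(P :: ('g, 'p, 'm) gcomplex) (Q :: ('h, 'q, 'n) gcomplex) ft.
       is_acyclic_resolution G M P \<and> is_acyclic_resolution H N Q \<and>
       chain_lift G P (Ind_complex G H \<Omega> N Q) f ft \<longrightarrow>
       (\<forall>n. comparison G M P n \<in> iso (homology G M n) (coinvariants_homology G P n) \<and>
            comparison H N Q n \<in> iso (homology H N n) (coinvariants_homology H Q n) \<and>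
            (\<forall>x \<in> carrier (homology G M n).
               comparison H N Q n (homology_map G H \<Omega> M N f n x) =
               corr_induced G H \<Omega> Q ft n (comparison G M P n x))))"
proof -
  interpret ample_correspondence G H \<Omega>
    by (intro ample_correspondence.intro assms)
  note M = assms(4) and N = assms(5) and f = assms(6)
  define R where "R = projective_resolution G M"
  define S where "S = projective_resolution H N"
  have R: "is_resolution G M R" and Rp: "projective_module G (term_at R n)" for n
    unfolding R_def by (rule G.projective_resolution[OF M])+
  have S: "is_resolution H N S" and Sp: "projective_module H (term_at S n)" for n
    unfolding S_def by (rule H.projective_resolution[OF N])+
  define fR where "fR = (SOME ft. chain_lift G R (Ind_complex G H \<Omega> N S) f ft)"
  have fR: "chain_lift G R (Ind_complex G H \<Omega> N S) f fR"
    unfolding fR_def by (rule someI_ex[OF G.chain_lift_exists[OF R Rp Ind_resolution[OF N S] M Ind_module[OF N] f]])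
  note ccR = G.coinvariants_chain_complex[OF R] and ccS = H.coinvariants_chain_complex[OF S]
  note F = corr_chain_map[OF R N S fR]
  have Hmap: "homology_map G H \<Omega> M N f n =
      complex_homology_map (coinvariants_complex H S) (coinvariants_bdry H S) (corr_chain_map G H \<Omega> S fR) n" for n
    unfolding homology_map_def Let_def corr_induced_def coinvariants_homology_map_def fR_def R_def S_def ..
  have HR: "homology G M n = complex_homology (coinvariants_complex G R) (coinvariants_bdry G R) n"
    and HS: "homology H N n = complex_homology (coinvariants_complex H S) (coinvariants_bdry H S) n" for n
    unfolding homology_def coinvariants_homology_def R_def S_def by (rule refl)+
  have "homology_map G H \<Omega> M N f n \<in> hom (homology G M n) (homology H N n)" for n
    unfolding Hmap HR HS by (rule homology_map_hom[OF ccR ccS, of "corr_chain_map G H \<Omega> S fR", OF F])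
  moreover have "comparison H N Q n (homology_map G H \<Omega> M N f n x) = corr_induced G H \<Omega> Q ft n (comparison G M P n x)"
    if P: "is_acyclic_resolution G M P" and Q: "is_acyclic_resolution H N Q"
      and ft: "chain_lift G P (Ind_complex G H \<Omega> N Q) f ft" and x: "x \<in> carrier (homology G M n)"
    for P :: "('g, 'p, 'm) gcomplex" and Q :: "('h, 'q, 'n) gcomplex" and ft n x
  proof -
    have P': "is_resolution G M P" and Q': "is_resolution H N Q"
      using P Q by (simp_all add: is_acyclic_resolution_def)
    note r = G.resolutionD[OF R] and s = H.resolutionD[OF S] and p = G.resolutionD[OF P'] and q = H.resolutionD[OF Q']
    note ccP = G.coinvariants_chain_complex[OF P'] and ccQ = H.coinvariants_chain_complex[OF Q']
    define \<phi> where "\<phi> = (SOME \<phi>. chain_lift G R P (\<lambda>x. x) \<phi>)"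
    define \<psi> where "\<psi> = (SOME \<psi>. chain_lift H S Q (\<lambda>x. x) \<psi>)"
    have \<phi>: "chain_lift G R P (\<lambda>x. x) \<phi>"
      unfolding \<phi>_def by (rule someI_ex[OF G.chain_lift_exists[OF R Rp P' M M gmodule_hom_id]])
    have \<psi>: "chain_lift H S Q (\<lambda>x. x) \<psi>"
      unfolding \<psi>_def by (rule someI_ex[OF H.chain_lift_exists[OF S Sp Q' N N gmodule_hom_id]])
    note l = G.chain_liftD[OF \<phi>] and m = H.chain_liftD[OF \<psi>]
    \<comment> \<open>All maps are evaluated on the class of a cycle z, which reduces the square to
      a comparison of two chain maps at z.\<close>
    obtain z where z: "z \<in> cycles (coinvariants_complex G R) (coinvariants_bdry G R) n"
      and xz: "x = boundaries (coinvariants_complex G R) (coinvariants_bdry G R) n #>\<^bsub>coinvariants G (term_at R n)\<^esub> z"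
      using x unfolding HR carrier_homology[OF ccR] by (elim imageE)
    note zc = G.cycle_coinvD[OF z]
    note fz = hom_in_carrier[OF F(1) zc(1)] and \<phi>z = G.cm_closed[OF r(1) p(1) l(1) zc(1)]
    let ?cls = "\<lambda>y. boundaries (coinvariants_complex H Q) (coinvariants_bdry H Q) n #>\<^bsub>coinvariants H (term_at Q n)\<^esub> y"
    have fR1: "gmodule_hom G (term_at R n) (Ind G H \<Omega> (term_at S n)) (fR n)"
      using G.chain_liftD(1)[OF fR] by (simp add: Ind_complex_def)
    have ft1: "gmodule_hom G (term_at P n) (Ind G H \<Omega> (term_at Q n)) (ft n)"
      using G.chain_liftD(1)[OF ft] by (simp add: Ind_complex_def)
    let ?\<phi> = "\<lambda>k. G.cm (term_at P k) (\<phi> k)" and ?\<psi> = "\<lambda>k. H.cm (term_at Q k) (\<psi> k)"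
    have \<phi>1: "?\<phi> k \<in> hom (coinvariants G (term_at R k)) (coinvariants G (term_at P k))" for k
      by (rule G.cm_hom[OF r(1) p(1) l(1)])
    have \<psi>1: "?\<psi> k \<in> hom (coinvariants H (term_at S k)) (coinvariants H (term_at Q k))" for k
      by (rule H.cm_hom[OF s(1) q(1) m(1)])
    have \<phi>2: "?\<phi> k (coinvariants_bdry G R k X) = coinvariants_bdry G P k (?\<phi> (Suc k) X)"
      if "X \<in> carrier (coinvariants G (term_at R (Suc k)))" for k X
      by (rule G.cm_square[OF r(1,1) p(1,1) r(2) l(1,1) p(2) l(2) that])
    have \<psi>2: "?\<psi> k (coinvariants_bdry H S k X) = coinvariants_bdry H Q k (?\<psi> (Suc k) X)"
      if "X \<in> carrier (coinvariants H (term_at S (Suc k)))" for k X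
      by (rule H.cm_square[OF s(1,1) q(1,1) s(2) m(1,1) q(2) m(2) that])
    have h1: "homology_map G H \<Omega> M N f n x = boundaries (coinvariants_complex H S) (coinvariants_bdry H S) n
        #>\<^bsub>coinvariants H (term_at S n)\<^esub> corr_chain_map G H \<Omega> S fR n z"
      unfolding xz Hmap by (rule homology_map_class[OF ccR ccS, of "corr_chain_map G H \<Omega> S fR", OF F zc(1)])
    have h2: "comparison G M P n x = boundaries (coinvariants_complex G P) (coinvariants_bdry G P) n
        #>\<^bsub>coinvariants G (term_at P n)\<^esub> ?\<phi> n z"
      unfolding xz comparison_def Let_def coinvariants_homology_map_def R_def[symmetric] \<phi>_def[symmetric]
      by (rule homology_map_class[OF ccR ccP, of ?\<phi>, OF \<phi>1 \<phi>2 zc(1)])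
    have "comparison H N Q n (homology_map G H \<Omega> M N f n x) = ?cls (?\<psi> n (corr_chain_map G H \<Omega> S fR n z))"
      unfolding h1 comparison_def Let_def coinvariants_homology_map_def S_def[symmetric] \<psi>_def[symmetric]
      by (rule homology_map_class[OF ccS ccQ, of ?\<psi>, OF \<psi>1 \<psi>2 fz])
    \<comment> \<open>Naturality moves \<psi> through \<delta> \<otimes> id, so the left side is the
      chain map of the lift formed from fR and \<psi>; the next step exchanges this lift for the one
      formed from \<phi> and ft.\<close>
    also have "H.cm (term_at Q n) (\<psi> n) (corr_chain_map G H \<Omega> S fR n z) =
        corr_chain_map G H \<Omega> Q (\<lambda>n x. Ind_map H \<Omega> (term_at Q n) (\<psi> n) (fR n x)) n z"
      unfolding corr_chain_map_def comp_apply
        delta_tensor_natural[OF s(1) q(1) m(1) G.cm_closed[OF r(1) Ind_module[OF s(1)] fR1 zc(1)], symmetric]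
        G.cm_comp[OF r(1) Ind_module[OF s(1)] Ind_module[OF q(1)] fR1 Ind_map_hom[OF s(1) q(1) m(1)] refl zc(1)] ..
    also have "?cls \<dots> = ?cls (corr_chain_map G H \<Omega> Q (\<lambda>n x. ft n (\<phi> n x)) n z)"
      by (rule chain_lifts_same_class[OF R Rp N Q' f chain_lift_Ind_map[OF R N S Q' fR \<psi>] chain_lift_precompose[OF \<phi> ft] z])
    also have "corr_chain_map G H \<Omega> Q (\<lambda>n x. ft n (\<phi> n x)) n z = corr_chain_map G H \<Omega> Q ft n (G.cm (term_at P n) (\<phi> n) z)"
      unfolding corr_chain_map_def comp_apply G.cm_comp[OF r(1) p(1) Ind_module[OF q(1)] l(1) ft1 refl zc(1)] ..
    also have "?cls \<dots> = corr_induced G H \<Omega> Q ft n (comparison G M P n x)"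
      unfolding h2 corr_induced_def coinvariants_homology_map_def
      by (rule homology_map_class[OF ccP ccQ, of "corr_chain_map G H \<Omega> Q ft", OF corr_chain_map[OF P' N Q' ft] \<phi>z, symmetric])
    finally show ?thesis .
  qed
  ultimately show ?thesis
    using G.comparison_iso[OF M] H.comparison_iso[OF N] by blast
qed

end
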